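(* Let $r>0$ and $\mathbb{D}=\{z\in\mathbb{C}:|z|<1\}$. Then the zero point process $\mathcal{Z}_{X_{\mathbb{D}}^r}$ is a permanental-determinantal point process on $\mathbb{D}$ with correlation functions, with respect to $m/\pi$ ($m$ being Lebesgue measure on $\mathbb{C}$), $$\rho^n_{\mathbb{D}}(z_1,\dots,z_n;r)=\frac{1+r}{1+r\prod_{k=1}^n|z_k|^4}\ \mathrm{perdet}_{1\le i,j\le n}\Big[S_{\mathbb{D}}\Big(z_i,z_j;r\prod_{\ell=1}^n|z_\ell|^2\Big)\Big]$$ for every $n\in\mathbb{N}$ and $z_1,\dots,z_n\in\mathbb{D}$. In particular, the density of zeros on $\mathbb{D}$ is $$\rho^1_{\mathbb{D}}(z;r)=\frac{(1+r)(1+r|z|^4)}{(1+r|z|^2)^2(1-|z|^2)^2},\quad z\in\mathbb{D}.$$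
   Context: For an $n\times n$ matrix $M$, $\mathrm{perdet}\,M:=\mathrm{per}\,M\cdot\det M$ (permanent times determinant). For $s\ge0$, $S_{\mathbb{D}}(z,w;s)=\frac{1}{1+s}+\sum_{n=1}^\infty(z\overline{w})^n=\frac{1+sz\overline{w}}{(1+s)(1-z\overline{w})}$, $z,w\in\mathbb{D}$. With $\{\zeta_n\}_{n\ge0}$ i.i.d. standard complex Gaussian random variables with density $e^{-|z|^2}/\pi$, $X_{\mathbb{D}}^r(z)=\frac{\zeta_0}{\sqrt{1+r}}+\sum_{n=1}^\infty\zeta_nz^n$, $z\in\mathbb{D}$, is a Gaussian analytic function with covariance kernel $S_{\mathbb{D}}(z,w;r)$, and $\mathcal{Z}_{X_{\mathbb{D}}^r}=\sum_{z\in\mathbb{D}:X_{\mathbb{D}}^r(z)=0}\delta_z$. Correlation functions: a point process $\Xi$ on $S$ has $n$-point correlation function $\rho^n$ with respect to a reference measure $\lambda$ if for all disjoint bounded (relatively compact) sets $\Lambda_1,\dots,\Lambda_m\subset S$ and nonnegative integers $k_1,\dots,k_m$ with $\sum k_i=n$, $\mathbf{E}\big[\prod_{i=1}^m\frac{\Xi(\Lambda_i)!}{(\Xi(\Lambda_i)-k_i)!}\big]=\int_{\Lambda_1^{k_1}\times\cdots\times\Lambda_m^{k_m}}\rho^n\,d\lambda^{\otimes n}$, with the convention that the factor is $0$ if $\Xi(\Lambda_i)<k_i$. *)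

theory Defs
  imports "HOL-Probability.Probability" "Jordan_Normal_Form.Determinant"
begin

(* HOL-Analysis has its own, type-indexed determinant; here the size n varies,
   so matrices and determinants are those of Jordan_Normal_Form. *)
hide_const (open) Determinants.det

definition permanent :: "'a::comm_ring_1 mat \<Rightarrow> 'a" where
  "permanent A =
     (\<Sum>p\<in>{p. p permutes {0..<dim_row A}}. \<Prod>i = 0..<dim_row A. A $$ (i, p i))"

definition perdet :: "'a::comm_ring_1 mat \<Rightarrow> 'a" where
  "perdet A = permanent A * Determinant.det A"

definition unit_disk :: "complex set" where
  "unit_disk = {z. cmod z < 1}"

definition szego_disk :: "real \<Rightarrow> complex \<Rightarrow> complex \<Rightarrow> complex" where
  "szego_disk s z w = 1 / (1 + of_real s) + (\<Sum>n. (z * cnj w) ^ Suc n)"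

definition disk_ref_measure :: "complex measure" where
  "disk_ref_measure = scale_measure (ennreal (1 / pi)) (restrict_space lborel unit_disk)"

definition std_complex_gaussian :: "'a measure \<Rightarrow> ('a \<Rightarrow> complex) \<Rightarrow> bool" where
  "std_complex_gaussian M X \<longleftrightarrow>
     distributed M lborel X (\<lambda>z. ennreal (exp (- (cmod z)\<^sup>2) / pi))"

definition gaf_disk :: "(nat \<Rightarrow> 'a \<Rightarrow> complex) \<Rightarrow> real \<Rightarrow> 'a \<Rightarrow> complex \<Rightarrow> complex" where
  "gaf_disk \<zeta> r \<omega> z = \<zeta> 0 \<omega> / of_real (sqrt (1 + r)) + (\<Sum>n. \<zeta> (Suc n) \<omega> * z ^ Suc n)"

(* The sum of the unit masses at the zeros of f in S, obtained as the image on the Borel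
   sigma-algebra of S of the counting measure on the zero set; see emeasure_zero_measure. *)
definition zero_measure :: "'b::topological_space set \<Rightarrow> ('b \<Rightarrow> 'c::zero) \<Rightarrow> 'b measure" where
  "zero_measure S f = distr (count_space {z \<in> S. f z = 0}) (restrict_space borel S) (\<lambda>z. z)"

lemma emeasure_zero_measure:
  assumes "A \<in> sets (restrict_space borel S)"
  shows "emeasure (zero_measure S f) A =
         (\<integral>\<^sup>+ z. emeasure (return (restrict_space borel S) z) A \<partial>count_space {z \<in> S. f z = 0})"
proof -
  have meas: "(\<lambda>z. z) \<in> count_space {z \<in> S. f z = 0} \<rightarrow>\<^sub>M restrict_space borel S"
    by (auto simp: space_restrict_space)
  show ?thesis
    using assms nn_integral_distr[OF meas, of "indicator A"]
    by (simp add: zero_measure_def emeasure_return)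
qed

definition rel_compact_borel :: "'b::topological_space set \<Rightarrow> 'b set \<Rightarrow> bool" where
  "rel_compact_borel S \<Lambda> \<longleftrightarrow>
     \<Lambda> \<in> sets (restrict_space borel S) \<and> (\<exists>K. compact K \<and> K \<subseteq> S \<and> \<Lambda> \<subseteq> K)"

definition configurations :: "'b::topological_space set \<Rightarrow> 'b measure set" where
  "configurations S = {\<xi>. sets \<xi> = sets (restrict_space borel S) \<and>
     (\<forall>\<Lambda>. rel_compact_borel S \<Lambda> \<longrightarrow> (\<exists>k::nat. emeasure \<xi> \<Lambda> = of_nat k))}"

(* The realisations are required to be configurations only almost surely (a random power
   series need not converge on the exceptional null set).  For the same reason measurability
   of the counts is taken with respect to the completed probability space. *)
definition point_process ::
  "'a measure \<Rightarrow> 'b::topological_space set \<Rightarrow> ('a \<Rightarrow> 'b measure) \<Rightarrow> bool" where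
  "point_process M S \<Xi> \<longleftrightarrow>
     (AE \<omega> in M. \<Xi> \<omega> \<in> configurations S) \<and>
     (\<forall>\<Lambda>. rel_compact_borel S \<Lambda> \<longrightarrow>
        (\<lambda>\<omega>. emeasure (\<Xi> \<omega>) \<Lambda>) \<in> borel_measurable (completion M))"

(* On a configuration and a relatively compact set the measure is a natural number
   and the rounding has no effect. *)
definition point_count :: "'b measure \<Rightarrow> 'b set \<Rightarrow> nat" where
  "point_count \<xi> \<Lambda> = nat \<lfloor>measure \<xi> \<Lambda>\<rfloor>"

definition falling_factorial :: "nat \<Rightarrow> nat \<Rightarrow> nat" where
  "falling_factorial N k = (if k \<le> N then fact N div fact (N - k) else 0)"

(* The list concat (map2 replicate ks Ls) repeats Ls ! i exactly ks ! i times, so the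
   domain of integration is the product of the sets (Ls ! i) ^ (ks ! i). *)
definition has_correlation_function ::
  "'a measure \<Rightarrow> 'b::topological_space set \<Rightarrow> 'b measure \<Rightarrow> ('a \<Rightarrow> 'b measure) \<Rightarrow>
   nat \<Rightarrow> ((nat \<Rightarrow> 'b) \<Rightarrow> real) \<Rightarrow> bool" where
  "has_correlation_function M S lam \<Xi> n \<rho> \<longleftrightarrow>
     \<rho> \<in> borel_measurable (PiM {..<n} (\<lambda>_. lam)) \<and>
     (\<forall>z \<in> space (PiM {..<n} (\<lambda>_. lam)). 0 \<le> \<rho> z) \<and>
     (\<forall>Ls ks. length ks = length Ls \<longrightarrow> sum_list ks = n \<longrightarrow>
        (\<forall>i < length Ls. rel_compact_borel S (Ls ! i)) \<longrightarrow>
        (\<forall>i < length Ls. \<forall>j < length Ls. i \<noteq> j \<longrightarrow> Ls ! i \<inter> Ls ! j = {}) \<longrightarrow>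
        (\<integral>\<^sup>+ \<omega>. of_nat (\<Prod>i<length Ls. falling_factorial (point_count (\<Xi> \<omega>) (Ls ! i)) (ks ! i)) \<partial>M)
        = (\<integral>\<^sup>+ z \<in> (PiE {..<n} (\<lambda>j. concat (map2 replicate ks Ls) ! j)).
             ennreal (\<rho> z) \<partial>PiM {..<n} (\<lambda>_. lam)))"

(* A point process whose correlation functions are given by permanents times determinants.
   Both the prefactor C and the kernel K may depend on n and on the whole n-tuple z. *)
definition permanental_determinantal_process ::
  "'a measure \<Rightarrow> 'b::topological_space set \<Rightarrow> 'b measure \<Rightarrow> ('a \<Rightarrow> 'b measure) \<Rightarrow>
   (nat \<Rightarrow> (nat \<Rightarrow> 'b) \<Rightarrow> real) \<Rightarrow>
   (nat \<Rightarrow> (nat \<Rightarrow> 'b) \<Rightarrow> real) \<Rightarrow>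
   (nat \<Rightarrow> (nat \<Rightarrow> 'b) \<Rightarrow> 'b \<Rightarrow> 'b \<Rightarrow> complex) \<Rightarrow> bool" where
  "permanental_determinantal_process M S lam \<Xi> \<rho> C K \<longleftrightarrow>
     point_process M S \<Xi> \<and>
     (\<forall>n\<ge>1. has_correlation_function M S lam \<Xi> n (\<rho> n) \<and>
        (\<forall>z. (\<forall>i<n. z i \<in> S) \<longrightarrow>
           complex_of_real (\<rho> n z) =
             complex_of_real (C n z) * perdet (mat n n (\<lambda>(i, j). K n z (z i) (z j)))))"

end

theory Submission
  imports Defs "HOL-Complex_Analysis.Complex_Analysis"
begin

text \<open>The coefficients \<open>x\<^sub>0, x\<^sub>1, \<dots>\<close> of the random power series are independent complex Gaussians with inverse
  variances \<open>1 + r, 1, 1, \<dots>\<close>.  If the series vanishes at \<open>z\<^sub>1, \<dots>, z\<^sub>n\<close>, it is \<open>\<Prod>(w - z\<^sub>i)\<close> times a quotient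
  \<open>Q\<close>, and \<open>Q\<close> is determined by the coefficients of index at least \<open>n\<close>.  Replacing \<open>x\<^sub>0, \<dots>, x\<^sub>n\<^sub>-\<^sub>1\<close> one after
  the other by the position of a zero (area formula in one complex variable) gives a Kac--Rice formula:
  the factorial moments of the zero counts are integrals over \<open>z\<close> of the expectation of \<open>\<Prod>\<bar>Q(z\<^sub>i)\<bar>\<^sup>2\<close> times
  \<open>\<Prod>\<bar>z\<^sub>i - z\<^sub>j\<bar>\<^sup>2\<close> times the Gaussian density of the first \<open>n\<close> coefficients.  Under this Gaussian weight
  \<open>Q\<close> is again a Gaussian analytic function.  Because Blaschke factors are isometries of the Hardy space and
  only affect the weight of the constant term, its covariance is the Szego kernel with parameter
  \<open>r \<Prod>\<bar>z\<^sub>i\<bar>\<^sup>2\<close>, divided by the products \<open>\<Prod>(1 - z\<^sub>i cnj w)\<close>.  Wick's formula, obtained from integration by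
  parts, produces the permanent, and the Cauchy-type evaluation of the determinant of the Szego kernel
  absorbs the Vandermonde factor.\<close>

section \<open>Power series and divided differences\<close>


text \<open>Conditioning on zeros at given points is conditioning on a null event. Eliminating
  coefficients one at a time replaces it by a change of variables, and the conditional law of
  \<open>Q\<close> becomes an explicit Gaussian weight (\<open>ztilt\<close>) on the coefficients of
  index at least n. That weight is never diagonalised: its covariance is found by integration by
  parts alone, in a direction whose gradient is evaluation at a point, and its total mass by a
  recursion in n. Apart from normalising constants the mass is (1 + r) / (1 + s) times \<Prod>(1 -
  z_i conj z_j), where s = r \<Prod>|z_i|^2. The determinant of the Szego kernel with parameter s is
  (1 + s \<Prod>|z_i|^2) / (1 + s) times the squared Vandermonde product over \<Prod>(1 - z_i conj
  z_j). Since s \<Prod>|z_i|^2 = r \<Prod>|z_i|^4, expressing the Vandermonde quotient by this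
  determinant leaves the prefactor (1 + r) / (1 + r \<Prod>|z_i|^4). Sequences are measured in l1
  norms with weights \<rho>^k, \<rho> < 1: evaluation and division are bounded there, and a Gaussian
  sequence has finite norm almost surely, with all moments.\<close>

definition wsummable :: "real \<Rightarrow> (nat \<Rightarrow> complex) \<Rightarrow> bool" where
  "wsummable \<rho> x \<longleftrightarrow> summable (\<lambda>k. cmod (x k) * \<rho> ^ k)"

definition wnorm :: "real \<Rightarrow> (nat \<Rightarrow> complex) \<Rightarrow> real" where
  "wnorm \<rho> x = (\<Sum>k. cmod (x k) * \<rho> ^ k)"

definition pseries :: "(nat \<Rightarrow> complex) \<Rightarrow> complex \<Rightarrow> complex" where
  "pseries x a = (\<Sum>k. x k * a ^ k)"

definition useq :: "nat \<Rightarrow> nat \<Rightarrow> complex" where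
  "useq n k = (if k = n then 1 else 0)"

text \<open>Coefficients of \<open>(x(w) - x(a)) / (w - a)\<close>, of \<open>(w - a) x(w)\<close> and of \<open>(1 - cnj a w) x(w)\<close>.\<close>
definition divdiff :: "complex \<Rightarrow> (nat \<Rightarrow> complex) \<Rightarrow> nat \<Rightarrow> complex" where
  "divdiff a x k = (\<Sum>j. x (Suc (k + j)) * a ^ j)"

definition lin :: "complex \<Rightarrow> (nat \<Rightarrow> complex) \<Rightarrow> nat \<Rightarrow> complex" where
  "lin a x k = (case k of 0 \<Rightarrow> 0 | Suc m \<Rightarrow> x m) - a * x k"

definition colin :: "complex \<Rightarrow> (nat \<Rightarrow> complex) \<Rightarrow> nat \<Rightarrow> complex" where
  "colin a x k = x k - cnj a * (case k of 0 \<Rightarrow> 0 | Suc m \<Rightarrow> x m)"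

lemma wnorm_nonneg: "wsummable \<rho> x \<Longrightarrow> \<rho> > 0 \<Longrightarrow> 0 \<le> wnorm \<rho> x"
  unfolding wnorm_def wsummable_def by (rule suminf_nonneg) auto

lemma wsummable_useq: "wsummable \<rho> (useq n)"
  unfolding wsummable_def
  by (rule summable_finite[of "{n}"]) (auto simp: useq_def)

lemma wsummable_lincomb:
  assumes "wsummable \<rho> x" "wsummable \<rho> y" "\<rho> > 0"
  shows "wsummable \<rho> (\<lambda>k. x k + c * y k)"
proof -
  have "summable (\<lambda>k. cmod (x k) * \<rho> ^ k + cmod c * (cmod (y k) * \<rho> ^ k))"
    using assms unfolding wsummable_def by (intro summable_add summable_mult) auto
  then show ?thesis
    unfolding wsummable_def
  proof (rule summable_comparison_test'[where N = 0])
    fix k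
    have "cmod (x k + c * y k) \<le> cmod (x k) + cmod c * cmod (y k)"
      by (metis norm_mult norm_triangle_ineq)
    then have "cmod (x k + c * y k) * \<rho> ^ k \<le> (cmod (x k) + cmod c * cmod (y k)) * \<rho> ^ k"
      using assms by (intro mult_right_mono) auto
    then show "norm (cmod (x k + c * y k) * \<rho> ^ k) \<le> cmod (x k) * \<rho> ^ k + cmod c * (cmod (y k) * \<rho> ^ k)"
      using assms by (simp add: algebra_simps)
  qed
qed

lemma wsummable_scale: "wsummable \<rho> y \<Longrightarrow> wsummable \<rho> (\<lambda>k. c * y k)"
  unfolding wsummable_def
  using summable_mult[of "\<lambda>k. cmod (y k) * \<rho> ^ k" "cmod c"] by (simp add: norm_mult mult.assoc)

lemma wsummable_upd:
  assumes "wsummable \<rho> x" "\<rho> > 0"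
  shows "wsummable \<rho> (x(n := w))"
proof -
  have "x(n := w) = (\<lambda>k. x k + (w - x n) * useq n k)"
    by (auto simp: useq_def)
  then show ?thesis
    using wsummable_lincomb[OF assms(1) wsummable_useq assms(2)] by metis
qed

lemma pseries_norm_summable:
  assumes "wsummable \<rho> x" "cmod a \<le> \<rho>"
  shows "summable (\<lambda>k. norm (x k * a ^ k))"
  using assms(1) unfolding wsummable_def
  by (rule summable_comparison_test'[where N = 0])
     (use assms(2) in \<open>auto simp: norm_mult norm_power intro!: mult_left_mono power_mono\<close>)

lemma pseries_summable:
  assumes "wsummable \<rho> x" "cmod a \<le> \<rho>"
  shows "summable (\<lambda>k. x k * a ^ k)"
  using pseries_norm_summable[OF assms] by (rule summable_norm_cancel)

lemma norm_pseries_le: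
  assumes "wsummable \<rho> x" "cmod a \<le> \<rho>"
  shows "cmod (pseries x a) \<le> wnorm \<rho> x"
proof -
  have "cmod (pseries x a) \<le> (\<Sum>k. norm (x k * a ^ k))"
    unfolding pseries_def by (rule summable_norm[OF pseries_norm_summable[OF assms]])
  also have "\<dots> \<le> wnorm \<rho> x"
    unfolding wnorm_def
    using assms(2) pseries_norm_summable[OF assms] assms(1)[unfolded wsummable_def]
    by (intro suminf_le) (auto simp: norm_mult norm_power intro!: mult_left_mono power_mono)
  finally show ?thesis .
qed

lemma pseries_lincomb:
  assumes "wsummable \<rho> x" "wsummable \<rho> y" "cmod a \<le> \<rho>"
  shows "pseries (\<lambda>k. x k + c * y k) a = pseries x a + c * pseries y a"
proof -
  have "(\<Sum>k. x k * a ^ k + c * (y k * a ^ k)) = pseries x a + c * pseries y a"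
    unfolding pseries_def
    using pseries_summable[OF assms(1,3)] pseries_summable[OF assms(2,3)]
    by (subst suminf_add[symmetric]) (auto intro: summable_mult simp: suminf_mult)
  then show ?thesis
    by (simp add: pseries_def algebra_simps)
qed

lemma pseries_useq: "pseries (useq n) a = a ^ n"
proof -
  have "pseries (useq n) a = (\<Sum>k\<in>{n}. useq n k * a ^ k)"
    unfolding pseries_def by (rule suminf_finite) (auto simp: useq_def)
  then show ?thesis by (simp add: useq_def)
qed

lemma wsummable_shift_summable:
  assumes "wsummable \<rho> x" "\<rho> > 0"
  shows "summable (\<lambda>m. cmod (x (Suc m)) * \<rho> ^ m)"
proof -
  have "summable (\<lambda>m. cmod (x (Suc m)) * \<rho> ^ Suc m)"
    using assms(1) unfolding wsummable_def by (subst summable_Suc_iff)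
  then have "summable (\<lambda>m. (1 / \<rho>) * (cmod (x (Suc m)) * \<rho> ^ Suc m))"
    by (rule summable_mult)
  then show ?thesis using assms by simp
qed

lemma divdiff_norm_summable:
  assumes "wsummable \<rho> x" "cmod a \<le> \<rho>" "\<rho> > 0"
  shows "summable (\<lambda>j. norm (x (Suc (k + j)) * a ^ j))"
proof -
  have "summable (\<lambda>j. cmod (x (Suc (j + k))) * \<rho> ^ (j + k))"
    using wsummable_shift_summable[OF assms(1,3)] 
    by (subst summable_iff_shift[of "\<lambda>m. cmod (x (Suc m)) * \<rho> ^ m"])
  then have "summable (\<lambda>j. (1 / \<rho> ^ k) * (cmod (x (Suc (j + k))) * \<rho> ^ (j + k)))"
    by (rule summable_mult)
  then show ?thesis
    by (rule summable_comparison_test'[where N = 0])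
       (use assms in \<open>auto simp: norm_mult norm_power power_add add.commute intro!: mult_left_mono power_mono\<close>)
qed

lemma divdiff_summable:
  assumes "wsummable \<rho> x" "cmod a \<le> \<rho>" "\<rho> > 0"
  shows "summable (\<lambda>j. x (Suc (k + j)) * a ^ j)"
  using divdiff_norm_summable[OF assms] by (rule summable_norm_cancel)

lemma divdiff_lincomb:
  assumes "wsummable \<rho> x" "wsummable \<rho> y" "cmod a \<le> \<rho>" "\<rho> > 0"
  shows "divdiff a (\<lambda>k. x k + c * y k) = (\<lambda>k. divdiff a x k + c * divdiff a y k)"
proof
  fix k
  have "(\<Sum>j. x (Suc (k + j)) * a ^ j + c * (y (Suc (k + j)) * a ^ j)) = divdiff a x k + c * divdiff a y k"
    unfolding divdiff_def
    using divdiff_summable[OF assms(1,3,4)] divdiff_summable[OF assms(2,3,4)]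
    by (subst suminf_add[symmetric]) (auto intro: summable_mult simp: suminf_mult)
  then show "divdiff a (\<lambda>k. x k + c * y k) k = divdiff a x k + c * divdiff a y k"
    by (simp add: divdiff_def algebra_simps)
qed

text \<open>With \<theta> = |a| / \<rho> and b_m = |x_(m+1)| \<rho>^m the weighted double series is
  dominated by the terms \<theta>^j b_(k+j). Summing over k costs at most the sum of b, and what
  remains is geometric in j. The constant 1 / (\<rho> - |a|) is 1 / (1 - \<theta>) times the 1 /
  \<rho> lost through the index shift in b.\<close>

lemma divdiff_bound:
  assumes x: "wsummable \<rho> x" and a: "cmod a < \<rho>"
  shows "wsummable \<rho> (divdiff a x)"
    and "wnorm \<rho> (divdiff a x) \<le> wnorm \<rho> x / (\<rho> - cmod a)"
proof -
  have \<rho>: "\<rho> > 0" using a norm_ge_zero[of a] by linarith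
  define \<theta> where "\<theta> = cmod a / \<rho>"
  have \<theta>: "0 \<le> \<theta>" "\<theta> < 1" using a \<rho> by (auto simp: \<theta>_def)
  define b where "b m = cmod (x (Suc m)) * \<rho> ^ m" for m
  have b: "summable b" "\<And>m. 0 \<le> b m"
    using wsummable_shift_summable[OF x \<rho>] \<rho> by (auto simp: b_def[abs_def])
  have tm: "norm (x (Suc (k + j)) * a ^ j) * \<rho> ^ k = \<theta> ^ j * b (k + j)" for k j
    using \<rho> by (simp add: b_def \<theta>_def norm_mult norm_power power_divide power_add)
  have sj: "summable (\<lambda>j. \<theta> ^ j * b (k + j))" for k
    using summable_mult2[OF divdiff_norm_summable[OF x less_imp_le[OF a] \<rho>, of k], of "\<rho> ^ k"] by (simp add: tm)
  have le1: "cmod (divdiff a x k) * \<rho> ^ k \<le> (\<Sum>j. \<theta> ^ j * b (k + j))" for k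
  proof -
    have "cmod (divdiff a x k) * \<rho> ^ k \<le> (\<Sum>j. norm (x (Suc (k + j)) * a ^ j)) * \<rho> ^ k"
      unfolding divdiff_def using \<rho>
      by (intro mult_right_mono summable_norm divdiff_norm_summable[OF x less_imp_le[OF a]]) auto
    also have "\<dots> = (\<Sum>j. norm (x (Suc (k + j)) * a ^ j) * \<rho> ^ k)"
      by (rule suminf_mult2[OF divdiff_norm_summable[OF x less_imp_le[OF a] \<rho>]])
    finally show ?thesis by (simp add: tm)
  qed
  \<comment> \<open>Only finite sums over k are exchanged with the series over j, so that
    summability in k comes out as a result.\<close>
  have partial: "(\<Sum>k<K. cmod (divdiff a x k) * \<rho> ^ k) \<le> suminf b / (1 - \<theta>)" for K
  proof -
    have "(\<Sum>k<K. cmod (divdiff a x k) * \<rho> ^ k) \<le> (\<Sum>k<K. \<Sum>j. \<theta> ^ j * b (k + j))"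
      by (intro sum_mono le1)
    also have "\<dots> = (\<Sum>j. \<Sum>k<K. \<theta> ^ j * b (k + j))"
      by (rule suminf_sum[symmetric]) (rule sj)
    also have "\<dots> \<le> (\<Sum>j. \<theta> ^ j * suminf b)"
    proof (rule suminf_le)
      fix j
      have "(\<Sum>k<K. b (k + j)) = sum b {j..<K + j}"
        using sum.shift_bounds_nat_ivl[of b 0 j K] by (simp add: lessThan_atLeast0)
      also have "\<dots> \<le> suminf b"
        using b by (intro sum_le_suminf) auto
      finally show "(\<Sum>k<K. \<theta> ^ j * b (k + j)) \<le> \<theta> ^ j * suminf b"
        using \<theta> by (simp add: sum_distrib_left[symmetric] mult_left_mono)
      show "summable (\<lambda>j. \<Sum>k<K. \<theta> ^ j * b (k + j))"
        by (rule summable_sum) (rule sj)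
      show "summable (\<lambda>j. \<theta> ^ j * suminf b)"
        using \<theta> by (intro summable_mult2 summable_geometric) auto
    qed
    also have "\<dots> = suminf b / (1 - \<theta>)"
      using \<theta> by (subst suminf_mult2[symmetric]) (auto simp: suminf_geometric summable_geometric)
    finally show ?thesis .
  qed
  show sm: "wsummable \<rho> (divdiff a x)"
    unfolding wsummable_def using \<rho>
    by (intro summableI_nonneg_bounded[where x = "suminf b / (1 - \<theta>)"] partial) auto
  have "wnorm \<rho> (divdiff a x) \<le> suminf b / (1 - \<theta>)"
    unfolding wnorm_def by (rule suminf_le_const[OF sm[unfolded wsummable_def] partial])
  also have "suminf b \<le> wnorm \<rho> x / \<rho>"
  proof -
    have "suminf b * \<rho> = (\<Sum>m. cmod (x (Suc m)) * \<rho> ^ Suc m)"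
      using suminf_mult2[OF b(1), of \<rho>] by (simp add: b_def mult_ac)
    also have "\<dots> = wnorm \<rho> x - cmod (x 0)"
      using suminf_split_initial_segment[OF x[unfolded wsummable_def], of 1]
      by (simp add: wnorm_def)
    finally have "suminf b * \<rho> \<le> wnorm \<rho> x" by simp
    then show ?thesis using \<rho> by (simp add: field_simps)
  qed
  then have "suminf b / (1 - \<theta>) \<le> wnorm \<rho> x / \<rho> / (1 - \<theta>)"
    using \<theta> by (intro divide_right_mono) auto
  also have "wnorm \<rho> x / \<rho> / (1 - \<theta>) = wnorm \<rho> x / (\<rho> - cmod a)"
    using \<rho> by (simp add: \<theta>_def field_simps)
  finally show "wnorm \<rho> (divdiff a x) \<le> wnorm \<rho> x / (\<rho> - cmod a)"
    by this
qed

lemma wsummable_shift: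
  assumes "wsummable \<rho> x" "\<rho> > 0"
  shows "wsummable \<rho> (\<lambda>k. case k of 0 \<Rightarrow> 0 | Suc m \<Rightarrow> x m)"
    and "wnorm \<rho> (\<lambda>k. case k of 0 \<Rightarrow> 0 | Suc m \<Rightarrow> x m) = \<rho> * wnorm \<rho> x"
proof -
  let ?y = "\<lambda>k. case k of 0 \<Rightarrow> 0 | Suc m \<Rightarrow> x m"
  have "(\<lambda>m. cmod (x m) * \<rho> ^ m * \<rho>) sums (wnorm \<rho> x * \<rho>)"
    using assms unfolding wsummable_def wnorm_def by (intro sums_mult2 summable_sums)
  then have "(\<lambda>m. cmod (?y (Suc m)) * \<rho> ^ Suc m) sums (wnorm \<rho> x * \<rho>)"
    by (simp add: mult_ac)
  then have "(\<lambda>k. cmod (?y k) * \<rho> ^ k) sums (wnorm \<rho> x * \<rho>)"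
    by (subst (asm) sums_Suc_iff) simp
  then show "wsummable \<rho> ?y" "wnorm \<rho> ?y = \<rho> * wnorm \<rho> x"
    unfolding wsummable_def wnorm_def by (auto simp: sums_iff)
qed

lemma wsummable_lin: "wsummable \<rho> x \<Longrightarrow> \<rho> > 0 \<Longrightarrow> wsummable \<rho> (lin a x)"
  using wsummable_lincomb[OF wsummable_shift(1)[of \<rho> x], of x "-a"]
  by (auto simp: lin_def[abs_def])

lemma pseries_lin:
  assumes "wsummable \<rho> x" "\<rho> > 0" "cmod w \<le> \<rho>"
  shows "pseries (lin a x) w = (w - a) * pseries x w"
proof -
  let ?y = "\<lambda>k. case k of 0 \<Rightarrow> 0 | Suc m \<Rightarrow> x m"
  have "(\<lambda>m. x m * w ^ m * w) sums (pseries x w * w)"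
    using pseries_summable[OF assms(1,3)] unfolding pseries_def by (intro sums_mult2 summable_sums)
  then have "(\<lambda>m. ?y (Suc m) * w ^ Suc m) sums (pseries x w * w)"
    by (simp add: mult_ac)
  then have "(\<lambda>k. ?y k * w ^ k) sums (pseries x w * w)"
    by (subst (asm) sums_Suc_iff) simp
  then have "pseries ?y w = pseries x w * w"
    by (simp add: pseries_def sums_iff)
  then show ?thesis
    using pseries_lincomb[OF wsummable_shift(1)[OF assms(1,2)] assms(1,3), of "-a"]
    by (simp add: lin_def[abs_def] algebra_simps)
qed

text \<open>Splitting the first term off the series for \<open>divdiff a x m\<close> gives the
  Horner recursion: x_(m+1) plus a times the next coefficient. At index 0 the same split of
  \<open>pseries x a\<close> leaves the remainder -x(a).\<close>

lemma lin_divdiff: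
  assumes "wsummable \<rho> x" "cmod a \<le> \<rho>" "\<rho> > 0"
  shows "lin a (divdiff a x) = (\<lambda>k. x k + (- pseries x a) * useq 0 k)"
proof
  fix k
  show "lin a (divdiff a x) k = x k + (- pseries x a) * useq 0 k"
  proof (cases k)
    case 0
    have "pseries x a = x 0 + (\<Sum>j. x (Suc j) * a ^ Suc j)"
      using suminf_split_initial_segment[OF pseries_summable[OF assms(1,2)], of 1]
      by (simp add: pseries_def)
    also have "(\<Sum>j. x (Suc j) * a ^ Suc j) = a * divdiff a x 0"
      unfolding divdiff_def
      by (subst suminf_mult[symmetric]) (use divdiff_summable[OF assms, of 0] in \<open>auto simp: mult_ac\<close>)
    finally show ?thesis by (simp add: 0 lin_def useq_def)
  next
    case (Suc m)
    have "divdiff a x m = x (Suc m) + (\<Sum>j. x (Suc (m + Suc j)) * a ^ Suc j)"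
      using suminf_split_initial_segment[OF divdiff_summable[OF assms, of m], of 1]
      by (simp add: divdiff_def)
    also have "(\<Sum>j. x (Suc (m + Suc j)) * a ^ Suc j) = a * divdiff a x k"
      unfolding divdiff_def
      by (subst suminf_mult[symmetric]) (use divdiff_summable[OF assms, of k] in \<open>auto simp: mult_ac Suc\<close>)
    finally show ?thesis by (simp add: Suc lin_def useq_def)
  qed
qed

text \<open>The series telescopes: its terms are g_j - g_(j+1) with g_j = y_(k+j) a^j, and
  summability on the closed disc makes g_j tend to 0.\<close>

lemma divdiff_lin:
  assumes "wsummable \<rho> y" "cmod a \<le> \<rho>" "\<rho> > 0"
  shows "divdiff a (lin a y) = y"
proof
  fix k
  let ?g = "\<lambda>j. y (k + j) * a ^ j"
  have s: "summable (\<lambda>j. y (j + Suc k) * a ^ j)"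
    using divdiff_summable[OF assms, of k] by (simp add: add.commute)
  have "summable ?g"
    using divdiff_summable[OF wsummable_shift(1)[OF assms(1,3)] assms(2,3), of k] by simp
  then have "?g \<longlonglongrightarrow> 0" by (rule summable_LIMSEQ_zero)
  then have "(\<lambda>j. ?g j - ?g (Suc j)) sums (?g 0 - 0)"
    by (rule telescope_sums')
  moreover have "lin a y (Suc (k + j)) * a ^ j = ?g j - ?g (Suc j)" for j
    by (simp add: lin_def algebra_simps)
  ultimately show "divdiff a (lin a y) k = y k"
    unfolding divdiff_def by (simp add: sums_iff)
qed

lemma pseries_divdiff:
  assumes "wsummable \<rho> x" "cmod a < \<rho>" "cmod w \<le> \<rho>"
  shows "pseries x w = pseries x a + (w - a) * pseries (divdiff a x) w"
proof -
  have \<rho>: "\<rho> > 0" using assms(2) norm_ge_zero[of a] by linarith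
  have "(w - a) * pseries (divdiff a x) w = pseries (\<lambda>k. x k + (- pseries x a) * useq 0 k) w"
    using pseries_lin[OF divdiff_bound(1)[OF assms(1,2)] \<rho> assms(3), of a]
      lin_divdiff[OF assms(1) _ \<rho>, of a] assms(2) by simp
  also have "\<dots> = pseries x w - pseries x a"
    by (subst pseries_lincomb[OF assms(1) wsummable_useq assms(3)]) (simp add: pseries_useq)
  finally show ?thesis by simp
qed


section \<open>Iterated quotients and Newton interpolation\<close>

primrec divdiffs :: "nat \<Rightarrow> (nat \<Rightarrow> complex) \<Rightarrow> (nat \<Rightarrow> complex) \<Rightarrow> nat \<Rightarrow> complex" where
  "divdiffs 0 z x = x"
| "divdiffs (Suc n) z x = divdiff (z n) (divdiffs n z x)"

text \<open>The new factor is applied innermost, opposite to \<open>divdiffs\<close>, so that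
  \<open>lins n z (divdiffs n z x)\<close> undoes the divisions one by one, the last point
  first.\<close>

primrec lins :: "nat \<Rightarrow> (nat \<Rightarrow> complex) \<Rightarrow> (nat \<Rightarrow> complex) \<Rightarrow> nat \<Rightarrow> complex" where
  "lins 0 z y = y"
| "lins (Suc n) z y = lins n z (lin (z n) y)"

primrec colins :: "nat \<Rightarrow> (nat \<Rightarrow> complex) \<Rightarrow> (nat \<Rightarrow> complex) \<Rightarrow> nat \<Rightarrow> complex" where
  "colins 0 z y = y"
| "colins (Suc n) z y = colin (z n) (colins n z y)"

text \<open>For a power series \<open>x\<close>, this is \<open>x\<close> minus its interpolation polynomial at the points of \<open>z\<close>.\<close>
definition interp :: "nat \<Rightarrow> (nat \<Rightarrow> complex) \<Rightarrow> (nat \<Rightarrow> complex) \<Rightarrow> nat \<Rightarrow> complex" where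
  "interp n z x = lins n z (divdiffs n z x)"

lemma divdiffs_wsummable:
  assumes "wsummable \<rho> x" "\<And>i. i < n \<Longrightarrow> cmod (z i) < \<rho>"
  shows "wsummable \<rho> (divdiffs n z x)"
  using assms(2) by (induction n) (auto simp: assms(1) divdiff_bound(1))

lemma divdiffs_bound:
  assumes "\<And>i. i < n \<Longrightarrow> cmod (z i) < \<rho>"
  shows "\<exists>C\<ge>0. \<forall>x. wsummable \<rho> x \<longrightarrow> wnorm \<rho> (divdiffs n z x) \<le> C * wnorm \<rho> x"
  using assms
proof (induction n)
  case 0
  show ?case by (intro exI[of _ 1]) auto
next
  case (Suc n)
  then obtain C where C: "C \<ge> 0" "\<And>x. wsummable \<rho> x \<Longrightarrow> wnorm \<rho> (divdiffs n z x) \<le> C * wnorm \<rho> x"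
    by (auto simp: less_Suc_eq)
  let ?d = "\<rho> - cmod (z n)"
  have d: "?d > 0" using Suc.prems[of n] by simp
  show ?case
  proof (intro exI[of _ "C / ?d"] conjI allI impI)
    show "C / ?d \<ge> 0" using C d by simp
    fix x assume x: "wsummable \<rho> x"
    have "wnorm \<rho> (divdiffs (Suc n) z x) \<le> wnorm \<rho> (divdiffs n z x) / ?d"
      using divdiff_bound(2)[OF divdiffs_wsummable[OF x], of n z "z n"] Suc.prems by auto
    also have "\<dots> \<le> C * wnorm \<rho> x / ?d"
      using C(2)[OF x] d by (intro divide_right_mono) auto
    finally show "wnorm \<rho> (divdiffs (Suc n) z x) \<le> C / ?d * wnorm \<rho> x" by simp
  qed
qed

lemma divdiffs_lincomb:
  assumes "wsummable \<rho> x" "wsummable \<rho> y" "\<And>i. i < n \<Longrightarrow> cmod (z i) < \<rho>" "\<rho> > 0"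
  shows "divdiffs n z (\<lambda>k. x k + c * y k) = (\<lambda>k. divdiffs n z x k + c * divdiffs n z y k)"
  using assms(3)
proof (induction n)
  case (Suc n)
  then show ?case
    using divdiff_lincomb[OF divdiffs_wsummable[OF assms(1)] divdiffs_wsummable[OF assms(2)], of n z n z "z n" c] assms(4)
    by (auto simp: less_imp_le)
qed auto

lemma lin_lincomb: "lin a (\<lambda>k. x k + c * y k) = (\<lambda>k. lin a x k + c * lin a y k)"
  by (auto simp: lin_def fun_eq_iff algebra_simps split: nat.split)

lemma lins_lincomb: "lins n z (\<lambda>k. x k + c * y k) = (\<lambda>k. lins n z x k + c * lins n z y k)"
  by (induction n arbitrary: x y) (auto simp: lin_lincomb)

lemma lins_wsummable: "wsummable \<rho> y \<Longrightarrow> \<rho> > 0 \<Longrightarrow> wsummable \<rho> (lins n z y)"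
  by (induction n arbitrary: y) (auto simp: wsummable_lin)

lemma wnorm_component:
  assumes "wsummable \<rho> x" "\<rho> > 0"
  shows "cmod (x k) \<le> wnorm \<rho> x / \<rho> ^ k"
proof -
  have "sum (\<lambda>k. cmod (x k) * \<rho> ^ k) {k} \<le> wnorm \<rho> x"
    using assms unfolding wnorm_def wsummable_def by (intro sum_le_suminf) auto
  then show ?thesis using assms by (simp add: field_simps)
qed

text \<open>Makes each coordinate of \<open>interp\<close> a bounded functional, which integration
  by parts against the Gaussian weight requires.\<close>

lemma lins_component_bound:
  assumes "\<rho> > 0"
  shows "\<exists>C\<ge>0. \<forall>y. wsummable \<rho> y \<longrightarrow> cmod (lins n z y j) \<le> C * wnorm \<rho> y"
proof (induction n arbitrary: j)
  case 0
  show ?case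
    using wnorm_component[OF _ assms] assms by (intro exI[of _ "1 / \<rho> ^ j"]) auto
next
  case (Suc n)
  obtain C where C: "C \<ge> 0" "\<And>y. wsummable \<rho> y \<Longrightarrow> cmod (lins n z y j) \<le> C * wnorm \<rho> y"
    using Suc by blast
  show ?case
  proof (intro exI[of _ "C * (\<rho> + cmod (z n))"] conjI allI impI)
    show "C * (\<rho> + cmod (z n)) \<ge> 0" using C assms by simp
    fix y assume y: "wsummable \<rho> y"
    let ?s = "\<lambda>k. case k of 0 \<Rightarrow> 0 | Suc m \<Rightarrow> y m"
    have s: "wsummable \<rho> ?s" "wnorm \<rho> ?s = \<rho> * wnorm \<rho> y"
      using wsummable_shift[OF y assms] by auto
    have sm: "summable (\<lambda>k. cmod (?s k) * \<rho> ^ k)" "summable (\<lambda>k. cmod (y k) * \<rho> ^ k)"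
      using s(1) y by (auto simp: wsummable_def)
    have "wnorm \<rho> (lin (z n) y) \<le> (\<Sum>k. cmod (?s k) * \<rho> ^ k + cmod (z n) * (cmod (y k) * \<rho> ^ k))"
      unfolding wnorm_def
    proof (rule suminf_le)
      fix k
      have "cmod (lin (z n) y k) \<le> cmod (?s k) + cmod (z n) * cmod (y k)"
        unfolding lin_def by (metis norm_mult norm_triangle_ineq4)
      then have "cmod (lin (z n) y k) * \<rho> ^ k \<le> (cmod (?s k) + cmod (z n) * cmod (y k)) * \<rho> ^ k"
        using assms by (intro mult_right_mono) auto
      then show "cmod (lin (z n) y k) * \<rho> ^ k \<le> cmod (?s k) * \<rho> ^ k + cmod (z n) * (cmod (y k) * \<rho> ^ k)"
        by (simp add: algebra_simps)
    qed (use sm wsummable_lin[OF y assms] in \<open>auto simp: wsummable_def intro!: summable_add summable_mult\<close>)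
    also have "\<dots> = wnorm \<rho> ?s + cmod (z n) * wnorm \<rho> y"
      unfolding wnorm_def using sm by (subst suminf_add[symmetric]) (auto simp: suminf_mult intro: summable_mult)
    finally have "wnorm \<rho> (lin (z n) y) \<le> (\<rho> + cmod (z n)) * wnorm \<rho> y"
      by (simp add: s algebra_simps)
    then show "cmod (lins (Suc n) z y j) \<le> C * (\<rho> + cmod (z n)) * wnorm \<rho> y"
      using C(2)[OF wsummable_lin[OF y assms], of "z n"] C(1)
      by (simp add: mult.assoc) (meson mult_left_mono order_trans)
  qed
qed

text \<open>Newton's interpolation formula: the interpolation polynomial gains the value at z_n of
  the n-th quotient times the nodal polynomial \<Prod>(w - z_i), whose coefficients are
  \<open>lins n z (useq 0)\<close>.\<close>

lemma interp_Suc: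
  assumes "wsummable \<rho> x" "\<And>i. i \<le> n \<Longrightarrow> cmod (z i) < \<rho>" "\<rho> > 0"
  shows "interp (Suc n) z x =
    (\<lambda>k. interp n z x k + (- pseries (divdiffs n z x) (z n)) * lins n z (useq 0) k)"
proof -
  have "lin (z n) (divdiff (z n) (divdiffs n z x)) =
      (\<lambda>k. divdiffs n z x k + (- pseries (divdiffs n z x) (z n)) * useq 0 k)"
    using assms by (intro lin_divdiff[of \<rho>] divdiffs_wsummable) (auto intro: less_imp_le)
  then have "interp (Suc n) z x = lins n z (\<lambda>k. divdiffs n z x k + (- pseries (divdiffs n z x) (z n)) * useq 0 k)"
    by (simp only: interp_def lins.simps divdiffs.simps)
  then show ?thesis
    by (simp only: lins_lincomb interp_def)
qed

lemma divdiffs_lins: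
  assumes "wsummable \<rho> y" "\<And>i. i < n \<Longrightarrow> cmod (z i) < \<rho>" "\<rho> > 0"
  shows "divdiffs n z (lins n z y) = y"
  using assms(1,2)
proof (induction n arbitrary: y)
  case (Suc n)
  then show ?case
    using divdiff_lin[of \<rho> y "z n"] assms(3) by (auto simp: wsummable_lin less_imp_le)
qed auto

lemma lins_support:
  assumes "\<And>k. k > m \<Longrightarrow> y k = 0"
  shows "(\<forall>k > m + n. lins n z y k = 0) \<and> lins n z y (m + n) = y m"
  using assms
proof (induction n arbitrary: y m)
  case (Suc n)
  have 0: "lin (z n) y k = 0" if "k > Suc m" for k
    using that Suc.prems by (cases k) (auto simp: lin_def)
  have "lin (z n) y (Suc m) = y m" using Suc.prems by (auto simp: lin_def)
  then show ?case
    using Suc.IH[of "Suc m" "lin (z n) y"] 0 by simp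
qed auto

lemma lins_useq0: "k > n \<Longrightarrow> lins n z (useq 0) k = 0" "lins n z (useq 0) n = 1"
  using lins_support[of 0 "useq 0" n z] by (auto simp: useq_def)

text \<open>The interpolation polynomial has degree below n and touches only the first n
  coefficients. Hence \<open>interp n z x j\<close> for j < n are the values that those coefficients
  must take, given the others, for the series to vanish at all z_i.\<close>

lemma interp_ge:
  assumes "wsummable \<rho> x" "\<And>i. i < n \<Longrightarrow> cmod (z i) < \<rho>" "\<rho> > 0" "k \<ge> n"
  shows "interp n z x k = x k"
  using assms(2,4)
proof (induction n)
  case (Suc n)
  then show ?case
    using interp_Suc[OF assms(1) _ assms(3), of n z] lins_useq0(1)[of _ k z] by (auto simp: less_Suc_eq_le)
qed (auto simp: interp_def)

text \<open>Each division moves indices up by at least one, so the n-th quotient reads only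
  coefficients of index at least n. This allows the first n coefficients to be integrated out or
  replaced.\<close>

lemma divdiffs_cong:
  assumes "\<And>k. k \<ge> n + m \<Longrightarrow> x k = y k" "k \<ge> m"
  shows "divdiffs n z x k = divdiffs n z y k"
  using assms
proof (induction n arbitrary: m k)
  case (Suc n)
  have "divdiffs n z x i = divdiffs n z y i" if "i \<ge> Suc m" for i
    using Suc.IH[of "Suc m" i] Suc.prems that by auto
  then show ?case using Suc.prems(2) by (simp add: divdiff_def)
qed auto

lemma divdiffs_cong_seq: "(\<And>k. k \<ge> n \<Longrightarrow> x k = y k) \<Longrightarrow> divdiffs n z x = divdiffs n z y"
  using divdiffs_cong[of n 0 x y _ z] by auto

lemma interp_cong: "(\<And>k. k \<ge> n \<Longrightarrow> x k = y k) \<Longrightarrow> interp n z x = interp n z y"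
  unfolding interp_def using divdiffs_cong_seq by metis

lemma divdiffs_cong_points: "(\<And>i. i < n \<Longrightarrow> z i = z' i) \<Longrightarrow> divdiffs n z x = divdiffs n z' x"
  by (induction n) auto

lemma lins_cong_points: "(\<And>i. i < n \<Longrightarrow> z i = z' i) \<Longrightarrow> lins n z x = lins n z' x"
  by (induction n arbitrary: x) auto

lemma divdiffs_support:
  assumes "\<And>k. k > n + m \<Longrightarrow> v k = 0"
  shows "(\<forall>k > m. divdiffs n z v k = 0) \<and> divdiffs n z v m = v (n + m)"
  using assms
proof (induction n arbitrary: m)
  case (Suc n)
  have z: "divdiffs n z v i = 0" if "i > Suc m" for i
    using Suc.IH[of "Suc m"] Suc.prems that by auto
  have t: "divdiffs n z v (Suc m) = v (n + Suc m)"
    using Suc.IH[of "Suc m"] Suc.prems by auto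
  have "divdiffs (Suc n) z v k = 0" if "k > m" for k
    using that z by (simp add: divdiff_def)
  moreover have "divdiffs (Suc n) z v m = (\<Sum>j\<in>{0}. divdiffs n z v (Suc (m + j)) * z n ^ j)"
    unfolding divdiffs.simps divdiff_def by (rule suminf_finite) (auto simp: z)
  ultimately show ?case by (simp add: t)
qed auto

lemma divdiffs_useq: "divdiffs n z (useq n) = useq 0"
proof
  fix k
  show "divdiffs n z (useq n) k = useq 0 k"
    using divdiffs_support[of n 0 "useq n" z] by (cases k) (auto simp: useq_def)
qed

text \<open>The monomial w^n has n-th quotient 1, so coefficient n enters the quotient only as an
  additive constant. The equation Q(v) = 0 can therefore be solved for that coefficient.\<close>

lemma divdiffs_upd:
  assumes "wsummable \<rho> x" "\<And>i. i < n \<Longrightarrow> cmod (z i) < \<rho>" "\<rho> > 0"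
  shows "divdiffs n z (x(n := w)) = (\<lambda>k. divdiffs n z (x(n := 0)) k + w * useq 0 k)"
proof -
  have "x(n := w) = (\<lambda>k. (x(n := 0)) k + w * useq n k)"
    by (auto simp: useq_def)
  then show ?thesis
    using divdiffs_lincomb[OF wsummable_upd[OF assms(1,3), of n 0] wsummable_useq[of \<rho> n] assms(2,3), where n = n and c = w]
    by (simp add: divdiffs_useq)
qed

text \<open>The constant coefficient picks up \<Prod>(-z_i) here but stays the same in
  \<open>colins_0\<close>; this discrepancy turns r into \<open>defl_param r n z\<close>.\<close>

lemma lins_0: "lins n z y 0 = (\<Prod>i<n. - z i) * y 0"
  by (induction n arbitrary: y) (auto simp: lin_def)

lemma colins_0: "colins n z y 0 = y 0"
  by (induction n) (auto simp: colin_def)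

section \<open>The kernel of the deflated series\<close>

text \<open>The dual side of \<open>wsummable\<close>: geometric decay at rate \<rho> makes the
  pairing with every \<rho>-summable sequence converge absolutely. The kernels live in this
  class.\<close>

definition geo_bounded :: "real \<Rightarrow> (nat \<Rightarrow> complex) \<Rightarrow> bool" where
  "geo_bounded \<rho> h \<longleftrightarrow> (\<exists>C\<ge>0. \<forall>k. cmod (h k) \<le> C * \<rho> ^ k)"

lemma geo_bounded_scale: "geo_bounded \<rho> h \<Longrightarrow> geo_bounded \<rho> (\<lambda>k. c * h k)"
  unfolding geo_bounded_def
proof (elim exE conjE)
  fix C assume "C \<ge> 0" "\<forall>k. cmod (h k) \<le> C * \<rho> ^ k"
  then show "\<exists>C\<ge>0. \<forall>k. cmod (c * h k) \<le> C * \<rho> ^ k"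
    by (intro exI[of _ "cmod c * C"]) (auto simp: norm_mult mult.assoc mult_left_mono)
qed

lemma geo_bounded_add:
  assumes "geo_bounded \<rho> g" "geo_bounded \<rho> h" "\<rho> > 0"
  shows "geo_bounded \<rho> (\<lambda>k. g k + h k)"
proof -
  obtain C D where "C \<ge> 0" "\<And>k. cmod (g k) \<le> C * \<rho> ^ k" "D \<ge> 0" "\<And>k. cmod (h k) \<le> D * \<rho> ^ k"
    using assms unfolding geo_bounded_def by blast
  then show ?thesis
    unfolding geo_bounded_def
    by (intro exI[of _ "C + D"]) (auto simp: algebra_simps intro: order_trans[OF norm_triangle_ineq] add_mono)
qed

lemma geo_bounded_shift:
  assumes "geo_bounded \<rho> h" "\<rho> > 0"
  shows "geo_bounded \<rho> (\<lambda>k. case k of 0 \<Rightarrow> 0 | Suc m \<Rightarrow> h m)"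
proof -
  obtain C where C: "C \<ge> 0" "\<And>k. cmod (h k) \<le> C * \<rho> ^ k"
    using assms unfolding geo_bounded_def by blast
  show ?thesis
    unfolding geo_bounded_def
    using C assms(2) by (intro exI[of _ "C / \<rho>"]) (auto split: nat.split)
qed

lemma geo_bounded_lin: "geo_bounded \<rho> h \<Longrightarrow> \<rho> > 0 \<Longrightarrow> geo_bounded \<rho> (lin a h)"
  using geo_bounded_add[OF geo_bounded_shift[of \<rho> h] geo_bounded_scale[of \<rho> h "-a"]]
  by (auto simp: lin_def[abs_def])

lemma geo_bounded_colin: "geo_bounded \<rho> h \<Longrightarrow> \<rho> > 0 \<Longrightarrow> geo_bounded \<rho> (colin a h)"
  using geo_bounded_add[OF _ geo_bounded_scale[OF geo_bounded_shift[of \<rho> h], of "- cnj a"], of h]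
  by (auto simp: colin_def[abs_def])

lemma geo_bounded_lins: "geo_bounded \<rho> h \<Longrightarrow> \<rho> > 0 \<Longrightarrow> geo_bounded \<rho> (lins n z h)"
  by (induction n arbitrary: h) (auto simp: geo_bounded_lin)

lemma geo_bounded_colins: "geo_bounded \<rho> h \<Longrightarrow> \<rho> > 0 \<Longrightarrow> geo_bounded \<rho> (colins n z h)"
  by (induction n) (auto simp: geo_bounded_colin)

lemma geo_bounded_wsummable:
  assumes "geo_bounded \<rho> h" "0 < \<rho>" "\<rho> < 1"
  shows "wsummable \<rho> h"
proof -
  obtain C where C: "C \<ge> 0" "\<And>k. cmod (h k) \<le> C * \<rho> ^ k"
    using assms unfolding geo_bounded_def by blast
  have "\<rho> * \<rho> < 1 * 1" using assms by (intro mult_strict_mono) auto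
  then have "summable (\<lambda>k. C * (\<rho> * \<rho>) ^ k)"
    using assms(2) by (intro summable_mult summable_geometric) auto
  then show ?thesis
    unfolding wsummable_def
  proof (rule summable_comparison_test'[where N = 0])
    fix k
    have "cmod (h k) * \<rho> ^ k \<le> C * \<rho> ^ k * \<rho> ^ k"
      using C assms by (intro mult_right_mono) auto
    then show "norm (cmod (h k) * \<rho> ^ k) \<le> C * (\<rho> * \<rho>) ^ k"
      using assms by (simp add: power_mult_distrib mult.assoc)
  qed
qed

lemma pairing_norm_summable:
  assumes "wsummable \<rho> y" "geo_bounded \<rho> h" "\<rho> > 0"
  shows "summable (\<lambda>k. norm (y k * cnj (h k)))"
proof -
  obtain C where C: "C \<ge> 0" "\<And>k. cmod (h k) \<le> C * \<rho> ^ k"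
    using assms unfolding geo_bounded_def by blast
  have "summable (\<lambda>k. C * (cmod (y k) * \<rho> ^ k))"
    using assms(1) unfolding wsummable_def by (rule summable_mult)
  then show ?thesis
  proof (rule summable_comparison_test'[where N = 0])
    fix k
    have "cmod (y k) * cmod (h k) \<le> cmod (y k) * (C * \<rho> ^ k)"
      using C by (intro mult_left_mono) auto
    then show "norm (norm (y k * cnj (h k))) \<le> C * (cmod (y k) * \<rho> ^ k)"
      by (simp add: norm_mult mult_ac)
  qed
qed

lemma pairing_summable:
  assumes "wsummable \<rho> y" "geo_bounded \<rho> h" "\<rho> > 0"
  shows "summable (\<lambda>k. y k * cnj (h k))"
  using pairing_norm_summable[OF assms] by (rule summable_norm_cancel)

text \<open>Multiplication by a Blaschke factor is isometric; clearing the denominator turns this into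
  an identity between pairings that is visible on coefficients.\<close>
lemma pairing_lin:
  assumes "wsummable \<rho> q" "geo_bounded \<rho> h" "\<rho> > 0"
  shows "(\<Sum>k. lin a q k * cnj (lin a h k)) = (\<Sum>k. colin a q k * cnj (colin a h k))"
proof -
  let ?q = "\<lambda>k. case k of 0 \<Rightarrow> 0 | Suc m \<Rightarrow> q m" and ?h = "\<lambda>k. case k of 0 \<Rightarrow> 0 | Suc m \<Rightarrow> h m"
  note q' = wsummable_shift(1)[OF assms(1,3)] and h' = geo_bounded_shift[OF assms(2,3)]
  define A where "A = (\<Sum>k. q k * cnj (h k))"
  define B where "B = (\<Sum>k. ?q k * cnj (h k))"
  define C where "C = (\<Sum>k. q k * cnj (?h k))"
  have A: "(\<lambda>k. q k * cnj (h k)) sums A" unfolding A_def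
    using pairing_summable[OF assms] by (rule summable_sums)
  have B: "(\<lambda>k. ?q k * cnj (h k)) sums B" unfolding B_def
    using pairing_summable[OF q' assms(2,3)] by (rule summable_sums)
  have C: "(\<lambda>k. q k * cnj (?h k)) sums C" unfolding C_def
    using pairing_summable[OF assms(1) h' assms(3)] by (rule summable_sums)
  \<comment> \<open>Shifting both sequences leaves their pairing unchanged. Everything else is a
    sesquilinear expansion in which the same four terms appear on both sides.\<close>
  have "(\<lambda>k. ?q (Suc k) * cnj (?h (Suc k))) sums A" using A by simp
  then have A': "(\<lambda>k. ?q k * cnj (?h k)) sums A" by (subst (asm) sums_Suc_iff) simp
  have "(\<lambda>k. ?q k * cnj (?h k) - cnj a * (?q k * cnj (h k)) - a * (q k * cnj (?h k)) + a * cnj a * (q k * cnj (h k)))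
      sums (A - cnj a * B - a * C + a * cnj a * A)"
    by (intro sums_add sums_diff sums_mult A A' B C)
  moreover have "(\<lambda>k. q k * cnj (h k) - a * (q k * cnj (?h k)) - cnj a * (?q k * cnj (h k)) + a * cnj a * (?q k * cnj (?h k)))
      sums (A - a * C - cnj a * B + a * cnj a * A)"
    by (intro sums_add sums_diff sums_mult A A' B C)
  moreover have "lin a q k * cnj (lin a h k) =
      ?q k * cnj (?h k) - cnj a * (?q k * cnj (h k)) - a * (q k * cnj (?h k)) + a * cnj a * (q k * cnj (h k))" for k
    unfolding lin_def by (simp add: algebra_simps split: nat.split)
  moreover have "colin a q k * cnj (colin a h k) =
      q k * cnj (h k) - a * (q k * cnj (?h k)) - cnj a * (?q k * cnj (h k)) + a * cnj a * (?q k * cnj (?h k))" for k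
    unfolding colin_def by (simp add: algebra_simps split: nat.split)
  ultimately have "(\<Sum>k. lin a q k * cnj (lin a h k)) = A - cnj a * B - a * C + a * cnj a * A"
    and "(\<Sum>k. colin a q k * cnj (colin a h k)) = A - a * C - cnj a * B + a * cnj a * A"
    by (simp_all only: sums_iff)
  then show ?thesis by simp
qed

lemma colin_lin: "colin a (lin b y) = lin b (colin a y)"
  by (auto simp: colin_def lin_def fun_eq_iff algebra_simps split: nat.split)

lemma colins_lin: "colins n z (lin b y) = lin b (colins n z y)"
  by (induction n) (auto simp: colin_lin)

lemma colin_wsummable: "wsummable \<rho> x \<Longrightarrow> \<rho> > 0 \<Longrightarrow> wsummable \<rho> (colin a x)"
  using wsummable_lincomb[OF _ wsummable_shift(1)[of \<rho> x], of x "- cnj a"]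
  by (auto simp: colin_def[abs_def])

lemma colins_wsummable: "wsummable \<rho> x \<Longrightarrow> \<rho> > 0 \<Longrightarrow> wsummable \<rho> (colins n z x)"
  by (induction n) (auto simp: colin_wsummable)

text \<open>The induction hypothesis converts the first n factors for \<open>lin (z n) q\<close> and
  \<open>lin (z n) h\<close>; then \<open>colins n z\<close> is moved past \<open>lin (z n)\<close>,
  so that the one-factor identity handles the last point.\<close>

lemma pairing_lins:
  assumes "wsummable \<rho> q" "geo_bounded \<rho> h" "\<rho> > 0"
  shows "(\<Sum>k. lins n z q k * cnj (lins n z h k)) = (\<Sum>k. colins n z q k * cnj (colins n z h k))"
  using assms(1,2)
proof (induction n arbitrary: q h)
  case (Suc n)
  then show ?case
    using pairing_lin[OF colins_wsummable[OF Suc.prems(1) assms(3)] geo_bounded_colins[OF Suc.prems(2) assms(3)] assms(3),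
        where a = "z n"] assms(3)
    by (simp add: wsummable_lin geo_bounded_lin colins_lin)
qed auto

lemma pseries_colin:
  assumes "wsummable \<rho> x" "\<rho> > 0" "cmod w \<le> \<rho>"
  shows "pseries (colin a x) w = (1 - cnj a * w) * pseries x w"
proof -
  let ?y = "\<lambda>k. case k of 0 \<Rightarrow> 0 | Suc m \<Rightarrow> x m"
  have "lin 0 x = ?y" by (auto simp: lin_def)
  then have "pseries ?y w = w * pseries x w"
    using pseries_lin[OF assms, of 0] by simp
  then show ?thesis
    using pseries_lincomb[OF assms(1) wsummable_shift(1)[OF assms(1,2)] assms(3), of "- cnj a"]
    by (simp add: colin_def[abs_def] algebra_simps)
qed

lemma pseries_colins:
  assumes "wsummable \<rho> x" "\<rho> > 0" "cmod w \<le> \<rho>"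
  shows "pseries (colins n z x) w = (\<Prod>i<n. 1 - cnj (z i) * w) * pseries x w"
  by (induction n) (auto simp: pseries_colin[OF colins_wsummable[OF assms(1,2)] assms(2,3)])

text \<open>Cauchy product with the geometric series of 1 / (1 - conj a w), hence the inverse of
  multiplication by 1 - conj a w.\<close>

definition icolin :: "complex \<Rightarrow> (nat \<Rightarrow> complex) \<Rightarrow> nat \<Rightarrow> complex" where
  "icolin a h k = (\<Sum>j\<le>k. cnj a ^ (k - j) * h j)"

lemma colin_icolin: "colin a (icolin a h) = h"
proof
  fix k
  show "colin a (icolin a h) k = h k"
  proof (cases k)
    case (Suc m)
    have "(\<Sum>j\<le>m. cnj a ^ (Suc m - j) * h j) = cnj a * (\<Sum>j\<le>m. cnj a ^ (m - j) * h j)"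
      unfolding sum_distrib_left by (intro sum.cong) (auto simp: Suc_diff_le)
    then show ?thesis by (simp add: colin_def icolin_def Suc)
  qed (simp add: colin_def icolin_def)
qed

text \<open>Strictness of |a| < \<rho> keeps the convolution geometric at the same rate: once
  \<rho>^k is extracted only powers of \<theta> = |a| / \<rho> are summed. At |a| = \<rho> a factor
  k + 1 would appear.\<close>

lemma geo_bounded_icolin:
  assumes "geo_bounded \<rho> h" "cmod a < \<rho>"
  shows "geo_bounded \<rho> (icolin a h)"
proof -
  have \<rho>: "\<rho> > 0" using assms(2) norm_ge_zero[of a] by linarith
  obtain C where C: "C \<ge> 0" "\<And>k. cmod (h k) \<le> C * \<rho> ^ k"
    using assms unfolding geo_bounded_def by blast
  define \<theta> where "\<theta> = cmod a / \<rho>"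
  have \<theta>: "0 \<le> \<theta>" "\<theta> < 1" "cmod a = \<theta> * \<rho>" using assms \<rho> by (auto simp: \<theta>_def)
  have "cmod (icolin a h k) \<le> (C / (1 - \<theta>)) * \<rho> ^ k" for k
  proof -
    have "cmod (icolin a h k) \<le> (\<Sum>j\<le>k. cmod (cnj a ^ (k - j) * h j))"
      unfolding icolin_def by (rule norm_sum)
    also have "\<dots> \<le> (\<Sum>j\<le>k. \<theta> ^ (k - j) * (C * \<rho> ^ k))"
    proof (rule sum_mono)
      fix j assume j: "j \<in> {..k}"
      have "cmod (cnj a ^ (k - j) * h j) \<le> cmod a ^ (k - j) * (C * \<rho> ^ j)"
        using C by (simp add: norm_mult norm_power mult_left_mono)
      also have "\<dots> = \<theta> ^ (k - j) * (C * (\<rho> ^ (k - j) * \<rho> ^ j))"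
        by (simp add: \<theta>(3) power_mult_distrib mult_ac)
      also have "\<rho> ^ (k - j) * \<rho> ^ j = \<rho> ^ k"
        using j by (simp flip: power_add)
      finally show "cmod (cnj a ^ (k - j) * h j) \<le> \<theta> ^ (k - j) * (C * \<rho> ^ k)" .
    qed
    also have "\<dots> = (\<Sum>j\<le>k. \<theta> ^ j) * (C * \<rho> ^ k)"
      unfolding sum_distrib_right[symmetric]
      using sum.nat_diff_reindex[of "\<lambda>j. \<theta> ^ j" "Suc k"] by (simp add: lessThan_Suc_atMost)
    also have "(\<Sum>j\<le>k. \<theta> ^ j) \<le> (\<Sum>j. \<theta> ^ j)"
      using \<theta> by (intro sum_le_suminf summable_geometric) auto
    also have "(\<Sum>j. \<theta> ^ j) = 1 / (1 - \<theta>)"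
      using \<theta> by (intro suminf_geometric) auto
    finally show ?thesis
      using C \<rho> by (simp add: mult_right_mono)
  qed
  then show ?thesis
    unfolding geo_bounded_def using C \<theta> by (intro exI[of _ "C / (1 - \<theta>)"]) auto
qed

primrec icolins :: "nat \<Rightarrow> (nat \<Rightarrow> complex) \<Rightarrow> (nat \<Rightarrow> complex) \<Rightarrow> nat \<Rightarrow> complex" where
  "icolins 0 z h = h"
| "icolins (Suc n) z h = icolins n z (icolin (z n) h)"

lemma colins_icolins: "colins n z (icolins n z h) = h"
  by (induction n arbitrary: h) (auto simp: colin_icolin)

lemma geo_bounded_icolins:
  "geo_bounded \<rho> h \<Longrightarrow> (\<And>i. i < n \<Longrightarrow> cmod (z i) < \<rho>) \<Longrightarrow> geo_bounded \<rho> (icolins n z h)"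
  by (induction n arbitrary: h) (auto simp: geo_bounded_icolin)

lemma colins_scale: "colins n z (\<lambda>k. c * y k) = (\<lambda>k. c * colins n z y k)"
proof (induction n)
  case (Suc n)
  then show ?case by (auto simp: colin_def fun_eq_iff algebra_simps split: nat.split)
qed auto

section \<open>The weighted pairing and its reproducing kernels\<close>

definition \<tau> :: "real \<Rightarrow> nat \<Rightarrow> real" where
  "\<tau> r k = (if k = 0 then 1 + r else 1)"

text \<open>The Cameron-Martin inner product of the Gaussian sequence, in which coefficient k has
  variance 1 / \<open>\<tau> r k\<close>. Integration by parts produces exactly this pairing, so its
  reproducing kernels are covariances.\<close>

definition wpair :: "real \<Rightarrow> (nat \<Rightarrow> complex) \<Rightarrow> (nat \<Rightarrow> complex) \<Rightarrow> complex" where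
  "wpair r y h = (\<Sum>k. of_real (\<tau> r k) * y k * cnj (h k))"

text \<open>Coefficients of the Szego kernel v \<mapsto> S(v, w; s), the reproducing kernel of
  \<open>wpair s\<close> at w.\<close>

definition szego_seq :: "real \<Rightarrow> complex \<Rightarrow> nat \<Rightarrow> complex" where
  "szego_seq s w k = (if k = 0 then of_real (1 / (1 + s)) else cnj w ^ k)"

text \<open>The second form splits off the extra weight of the constant term and leaves the plain
  Hardy pairing, to which \<open>pairing_lins\<close> applies.\<close>

lemma wpair_sums:
  assumes "wsummable \<rho> y" "geo_bounded \<rho> h" "\<rho> > 0"
  shows "(\<lambda>k. of_real (\<tau> r k) * y k * cnj (h k)) sums wpair r y h"
    and "wpair r y h = (\<Sum>k. y k * cnj (h k)) + of_real r * y 0 * cnj (h 0)"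
proof -
  have 1: "(\<lambda>k. y k * cnj (h k)) sums (\<Sum>k. y k * cnj (h k))"
    using pairing_summable[OF assms] by (rule summable_sums)
  have "(\<lambda>k. if k = 0 then of_real r * y 0 * cnj (h 0) else 0) sums (of_real r * y 0 * cnj (h 0))"
    using sums_single[of 0 "\<lambda>_. of_real r * y 0 * cnj (h 0)"] by simp
  from sums_add[OF 1 this]
  have *: "(\<lambda>k. of_real (\<tau> r k) * y k * cnj (h k)) sums ((\<Sum>k. y k * cnj (h k)) + of_real r * y 0 * cnj (h 0))"
    by (rule sums_cong[THEN iffD1, rotated]) (auto simp: \<tau>_def algebra_simps)
  then show "wpair r y h = (\<Sum>k. y k * cnj (h k)) + of_real r * y 0 * cnj (h 0)"
    unfolding wpair_def by (rule sums_unique[symmetric])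
  with * show "(\<lambda>k. of_real (\<tau> r k) * y k * cnj (h k)) sums wpair r y h" by simp
qed

lemma geo_bounded_szego_seq:
  assumes "cmod w \<le> \<rho>" "s \<ge> 0" "\<rho> > 0"
  shows "geo_bounded \<rho> (szego_seq s w)"
  unfolding geo_bounded_def
proof (intro exI[of _ 1] conjI allI)
  fix k
  show "cmod (szego_seq s w k) \<le> 1 * \<rho> ^ k"
    using assms by (auto simp: szego_seq_def norm_power norm_divide power_mono simp del: of_real_add of_real_divide)
qed simp

lemma wpair_szego_seq:
  assumes "wsummable \<rho> y" "cmod w \<le> \<rho>" "s \<ge> 0" "\<rho> > 0"
  shows "wpair s y (szego_seq s w) = pseries y w"
proof -
  have "of_real (\<tau> s k) * y k * cnj (szego_seq s w k) = y k * w ^ k" for k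
  proof (cases "k = 0")
    case True
    have "complex_of_real (1 + s) * complex_of_real (1 / (1 + s)) = 1"
      using assms(3) by (subst of_real_mult[symmetric]) simp
    then show ?thesis using True by (simp add: \<tau>_def szego_seq_def del: of_real_add of_real_divide)
  qed (simp add: \<tau>_def szego_seq_def)
  then show ?thesis unfolding wpair_def pseries_def by (simp only:)
qed

lemma pseries_szego_seq:
  assumes "cmod w < 1" "cmod v < 1" "s \<ge> 0"
  shows "pseries (szego_seq s w) v = (1 + of_real s * v * cnj w) / ((1 + of_real s) * (1 - v * cnj w))"
proof -
  have n: "cmod (cnj w * v) < 1"
    using mult_strict_mono'[OF assms(1,2)] by (simp add: norm_mult)
  then have ne: "1 - v * cnj w \<noteq> 0" by (auto simp: mult.commute)
  have "(\<lambda>k. (cnj w * v) ^ k) sums (1 / (1 - cnj w * v))"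
    by (rule geometric_sums[OF n])
  moreover have "(\<lambda>k. if k = 0 then of_real (1 / (1 + s)) - 1 else 0) sums (of_real (1 / (1 + s)) - 1 :: complex)"
    using sums_single[of 0 "\<lambda>_. of_real (1 / (1 + s)) - 1 :: complex"] by simp
  ultimately have "(\<lambda>k. (cnj w * v) ^ k + (if k = 0 then of_real (1 / (1 + s)) - 1 else 0))
      sums (1 / (1 - cnj w * v) + (of_real (1 / (1 + s)) - 1))"
    by (rule sums_add)
  then have "(\<lambda>k. szego_seq s w k * v ^ k) sums (1 / (1 - cnj w * v) + (of_real (1 / (1 + s)) - 1))"
    by (rule sums_cong[THEN iffD1, rotated]) (auto simp: szego_seq_def power_mult_distrib)
  then have "pseries (szego_seq s w) v = 1 / (1 - cnj w * v) + (of_real (1 / (1 + s)) - 1)"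
    by (simp add: pseries_def sums_iff)
  also have "\<dots> = (1 + of_real s * v * cnj w) / ((1 + of_real s) * (1 - v * cnj w))"
  proof -
    have "complex_of_real (1 + s) \<noteq> 0" using assms(3) by (subst of_real_eq_0_iff) auto
    then show ?thesis using ne by (simp add: divide_simps) (simp add: algebra_simps)
  qed
  finally show ?thesis .
qed

definition defl_param :: "real \<Rightarrow> nat \<Rightarrow> (nat \<Rightarrow> complex) \<Rightarrow> real" where
  "defl_param r n z = r * (\<Prod>i<n. (cmod (z i))\<^sup>2)"

text \<open>The covariance of the quotient \<open>Q\<close>.  Replacing the factors \<open>w - z\<^sub>i\<close> by \<open>1 - cnj z\<^sub>i w\<close> preserves
  the Hardy norm and divides the constant coefficient by \<open>\<Prod>(- z\<^sub>i)\<close>, so the weight \<open>1 + r\<close> of that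
  coefficient becomes \<open>1 + r \<Prod>\<bar>z\<^sub>i\<bar>\<^sup>2\<close>.\<close>
definition defl_kernel :: "real \<Rightarrow> nat \<Rightarrow> (nat \<Rightarrow> complex) \<Rightarrow> complex \<Rightarrow> nat \<Rightarrow> complex" where
  "defl_kernel r n z w =
     (\<lambda>k. (1 / (\<Prod>i<n. 1 - z i * cnj w)) * icolins n z (szego_seq (defl_param r n z) w) k)"

lemma one_minus_mult_ne_0: "cmod a < 1 \<Longrightarrow> cmod b < 1 \<Longrightarrow> 1 - a * b \<noteq> 0"
proof -
  assume "cmod a < 1" "cmod b < 1"
  then have "cmod (a * b) < 1"
    using mult_strict_mono'[of "cmod a" 1 "cmod b" 1] by (simp add: norm_mult)
  then show ?thesis by auto
qed

lemma prod_one_minus_ne_0: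
  "(\<And>i. i < n \<Longrightarrow> cmod (f i) < 1) \<Longrightarrow> cmod w < 1 \<Longrightarrow> (\<Prod>i<n::nat. 1 - f i * w) \<noteq> 0"
  using one_minus_mult_ne_0[of "f _" w] by (simp only: prod_zero_iff finite_lessThan) blast

lemma wpair_scale:
  assumes "wsummable \<rho> y" "geo_bounded \<rho> h" "\<rho> > 0"
  shows "wpair r y (\<lambda>k. c * h k) = cnj c * wpair r y h"
proof -
  have "(\<lambda>k. cnj c * (of_real (\<tau> r k) * y k * cnj (h k))) sums (cnj c * wpair r y h)"
    by (intro sums_mult wpair_sums(1)[OF assms])
  moreover have "of_real (\<tau> r k) * y k * cnj (c * h k) = cnj c * (of_real (\<tau> r k) * y k * cnj (h k))" for k
    by simp
  ultimately show ?thesis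
    unfolding wpair_def by (simp only: sums_iff)
qed

lemma defl_param_nonneg: "r \<ge> 0 \<Longrightarrow> defl_param r n z \<ge> 0"
  unfolding defl_param_def by (intro mult_nonneg_nonneg prod_nonneg) auto

lemma geo_bounded_defl_kernel:
  assumes "r \<ge> 0" "\<And>i. i < n \<Longrightarrow> cmod (z i) < \<rho>" "cmod w \<le> \<rho>" "\<rho> > 0"
  shows "geo_bounded \<rho> (defl_kernel r n z w)"
  unfolding defl_kernel_def
  by (intro geo_bounded_scale geo_bounded_icolins geo_bounded_szego_seq assms defl_param_nonneg)

text \<open>\<open>colins n z\<close> maps the kernel to a multiple of \<open>szego_seq\<close>;
  after evaluation at v it remains to divide by \<Prod>(1 - conj z_i v).\<close>

lemma pseries_defl_kernel:
  assumes "r \<ge> 0" "\<And>i. i < n \<Longrightarrow> cmod (z i) < \<rho>" "cmod w \<le> \<rho>" "cmod v \<le> \<rho>" "0 < \<rho>" "\<rho> < 1"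
  shows "pseries (defl_kernel r n z w) v =
    1 / (\<Prod>i<n. 1 - z i * cnj w) * (1 / (\<Prod>i<n. 1 - cnj (z i) * v)) *
    ((1 + of_real (defl_param r n z) * v * cnj w) / ((1 + of_real (defl_param r n z)) * (1 - v * cnj w)))"
proof -
  let ?s = "defl_param r n z" and ?h = "defl_kernel r n z w"
  have h: "wsummable \<rho> ?h"
    using assms by (intro geo_bounded_wsummable geo_bounded_defl_kernel) auto
  have c: "colins n z ?h = (\<lambda>k. 1 / (\<Prod>i<n. 1 - z i * cnj w) * szego_seq ?s w k)"
    unfolding defl_kernel_def colins_scale colins_icolins ..
  have sz: "wsummable \<rho> (szego_seq ?s w)"
    using assms by (intro geo_bounded_wsummable geo_bounded_szego_seq defl_param_nonneg) auto
  have "(\<Prod>i<n. 1 - cnj (z i) * v) * pseries ?h v = pseries (colins n z ?h) v"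
    by (rule pseries_colins[OF h assms(5,4), symmetric])
  also have "\<dots> = 1 / (\<Prod>i<n. 1 - z i * cnj w) * pseries (szego_seq ?s w) v"
    unfolding c using pseries_lincomb[OF _ sz assms(4), of "\<lambda>_. 0" "1 / (\<Prod>i<n. 1 - z i * cnj w)"]
    by (simp add: wsummable_def pseries_def)
  also have "pseries (szego_seq ?s w) v = (1 + of_real ?s * v * cnj w) / ((1 + of_real ?s) * (1 - v * cnj w))"
    using assms by (intro pseries_szego_seq defl_param_nonneg) auto
  finally have *: "(\<Prod>i<n. 1 - cnj (z i) * v) * pseries ?h v = 1 / (\<Prod>i<n. 1 - z i * cnj w) *
      ((1 + of_real ?s * v * cnj w) / ((1 + of_real ?s) * (1 - v * cnj w)))" .
  have "cmod (z i) < 1" if "i < n" for i using assms(2)[OF that] assms(6) by simp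
  then have "(\<Prod>i<n. 1 - cnj (z i) * v) \<noteq> 0"
    using assms by (intro prod_one_minus_ne_0) auto
  then have "pseries ?h v = (1 / (\<Prod>i<n. 1 - cnj (z i) * v)) * ((\<Prod>i<n. 1 - cnj (z i) * v) * pseries ?h v)"
    by simp
  then show ?thesis unfolding * by simp
qed

text \<open>Reproducing property on the series divisible by \<Prod>(w - z_i), with the quotient q
  evaluated in place of the series itself. The scalar in \<open>defl_kernel\<close> is chosen to
  cancel the factor \<Prod>(1 - conj z_i w) created by \<open>pseries_colins\<close>.\<close>

lemma wpair_defl_kernel:
  assumes "r \<ge> 0" "wsummable \<rho> q" "\<And>i. i < n \<Longrightarrow> cmod (z i) < \<rho>" "cmod w \<le> \<rho>" "0 < \<rho>" "\<rho> < 1"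
  shows "wpair r (lins n z q) (lins n z (defl_kernel r n z w)) = pseries q w"
proof -
  let ?s = "defl_param r n z" and ?h = "defl_kernel r n z w"
  let ?c = "1 / (\<Prod>i<n. 1 - z i * cnj w)"
  have h: "geo_bounded \<rho> ?h"
    using assms by (intro geo_bounded_defl_kernel) auto
  have c: "colins n z ?h = (\<lambda>k. ?c * szego_seq ?s w k)"
    unfolding defl_kernel_def colins_scale colins_icolins ..
  have sz: "geo_bounded \<rho> (szego_seq ?s w)"
    using assms by (intro geo_bounded_szego_seq defl_param_nonneg) auto
  have cq: "wsummable \<rho> (colins n z q)"
    using assms by (intro colins_wsummable) auto
  \<comment> \<open>The extra weight r of the constant term meets |\<Prod> z_i|^2 and so becomes
    \<open>defl_param r n z\<close> on the \<open>colins\<close> side.\<close>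
  have "of_real r * (lins n z q 0) * cnj (lins n z ?h 0) = of_real r * ((\<Prod>i<n. - z i) * cnj (\<Prod>i<n. - z i)) * q 0 * cnj (?h 0)"
    by (simp add: lins_0)
  also have "(\<Prod>i<n. - z i) * cnj (\<Prod>i<n. - z i) = of_real (\<Prod>i<n. (cmod (z i))\<^sup>2)"
    by (simp add: prod.distrib[symmetric] complex_norm_square[symmetric])
  finally have r0: "of_real r * (lins n z q 0) * cnj (lins n z ?h 0) =
      of_real ?s * colins n z q 0 * cnj (colins n z ?h 0)"
    by (simp add: defl_param_def colins_0)
  have "wpair r (lins n z q) (lins n z ?h) =
      (\<Sum>k. lins n z q k * cnj (lins n z ?h k)) + of_real r * lins n z q 0 * cnj (lins n z ?h 0)"
    using assms h by (intro wpair_sums(2)[of \<rho>] lins_wsummable geo_bounded_lins)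
  also have "\<dots> = (\<Sum>k. colins n z q k * cnj (colins n z ?h k)) + of_real ?s * colins n z q 0 * cnj (colins n z ?h 0)"
    unfolding r0 pairing_lins[OF assms(2) h assms(5)] ..
  also have "\<dots> = wpair ?s (colins n z q) (colins n z ?h)"
    using cq h assms(5) by (intro wpair_sums(2)[symmetric, of \<rho>] geo_bounded_colins)
  also have "\<dots> = cnj ?c * wpair ?s (colins n z q) (szego_seq ?s w)"
    unfolding c by (rule wpair_scale[OF cq sz assms(5)])
  also have "\<dots> = cnj ?c * ((\<Prod>i<n. 1 - cnj (z i) * w) * pseries q w)"
    using wpair_szego_seq[OF cq assms(4) defl_param_nonneg[OF assms(1)] assms(5)]
      pseries_colins[OF assms(2,5,4)] by simp
  also have "\<dots> = pseries q w"
  proof -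
    have "cmod (z i) < 1" if "i < n" for i using assms(3)[OF that] assms(6) by simp
    then have "(\<Prod>i<n. 1 - cnj (z i) * w) \<noteq> 0"
      using assms by (intro prod_one_minus_ne_0) auto
    moreover have "cnj ?c = 1 / (\<Prod>i<n. 1 - cnj (z i) * w)" by simp
    ultimately show ?thesis by (simp only:) simp
  qed
  finally show ?thesis .
qed


section \<open>Area formula for holomorphic functions\<close>

text \<open>Identifies the complex plane with \<open>real ^ 2\<close>, where the change of variables
  theorem is phrased with matrix determinants.\<close>

definition vec_complex :: "real ^ 2 \<Rightarrow> complex" where
  "vec_complex v = Complex (vec_nth v 1) (vec_nth v 2)"

definition complex_vec :: "complex \<Rightarrow> real ^ 2" where
  "complex_vec z = (\<chi> i. if i = 1 then Re z else Im z)"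

lemma vec_complex_inverse [simp]: "complex_vec (vec_complex v) = v" "vec_complex (complex_vec z) = z"
proof -
  have "vec_nth (complex_vec (vec_complex v)) i = vec_nth v i" for i
    using exhaust_2[of i] by (auto simp: complex_vec_def vec_complex_def)
  then show "complex_vec (vec_complex v) = v" by (simp add: Finite_Cartesian_Product.vec_eq_iff)
qed (simp add: complex_vec_def vec_complex_def complex_eq_iff)

lemma linear_vec_complex: "bounded_linear vec_complex"
  by (intro linear_conv_bounded_linear[THEN iffD1] linearI) (auto simp: vec_complex_def complex_eq_iff)

lemma linear_complex_vec: "bounded_linear complex_vec"
  by (intro linear_conv_bounded_linear[THEN iffD1] linearI) (auto simp: complex_vec_def Finite_Cartesian_Product.vec_eq_iff)

lemma measurable_vec_complex [measurable]: "vec_complex \<in> borel_measurable borel"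
  using linear_vec_complex by (intro borel_measurable_continuous_onI linear_continuous_on)

lemma measurable_complex_vec [measurable]: "complex_vec \<in> borel_measurable borel"
  using linear_complex_vec by (intro borel_measurable_continuous_onI linear_continuous_on)

lemma Basis_vec2: "(Basis :: (real ^ 2) set) = {axis 1 1, axis 2 1}"
  by (auto simp: Basis_vec_def UNIV_2)

lemma lborel_vec_complex: "distr lborel borel vec_complex = lborel"
proof (rule lborel_eqI[symmetric])
  fix l u :: complex
  assume lu: "\<And>b. b \<in> Basis \<Longrightarrow> inner l b \<le> inner u b"
  have lu': "Re l \<le> Re u" "Im l \<le> Im u"
    using lu[of 1] lu[of \<i>] by (auto simp: Basis_complex_def inner_complex_def)
  have ne: "axis 1 1 \<noteq> (axis 2 1 :: real ^ 2)" by (simp add: axis_eq_axis)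
  have "vec_complex -` box l u = box (complex_vec l) (complex_vec u)"
    by (auto simp: box_def Basis_vec2 Basis_complex_def vec_complex_def complex_vec_def inner_axis)
  moreover have "emeasure lborel (box (complex_vec l) (complex_vec u)) =
      (\<Prod>b\<in>Basis. inner (complex_vec u - complex_vec l) b)"
    using lu' by (intro emeasure_lborel_box) (auto simp: Basis_vec2 Basis_complex_def complex_vec_def inner_axis)
  moreover have "(\<Prod>b\<in>Basis. inner (complex_vec u - complex_vec l) b) = (\<Prod>b\<in>Basis. inner (u - l) b)"
    using ne by (simp add: Basis_vec2 Basis_complex_def complex_vec_def inner_axis)
  ultimately show "emeasure (distr lborel borel vec_complex) (box l u) = ennreal (\<Prod>b\<in>Basis. inner (u - l) b)"
    by (simp add: emeasure_distr)
qed simp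

lemma det_complex_mult: "Determinants.det (matrix (\<lambda>h. complex_vec (c * vec_complex h))) = (cmod c)\<^sup>2"
  by (simp add: det_2 matrix_def complex_vec_def vec_complex_def axis_def cmod_power2) (simp add: power2_eq_square)

text \<open>The Jacobian is |g'|^2 by the Cauchy-Riemann equations
  (\<open>det_complex_mult\<close>). Boundedness makes the image a set of finite measure, so that
  its measure can be read as the real value of an integral.\<close>

lemma emeasure_holomorphic_image:
  assumes hol: "g holomorphic_on U" and U: "open U" and S: "S \<subseteq> U" "S \<in> sets borel"
    and inj: "inj_on g S" and im: "g ` S \<in> sets borel" "bounded (g ` S)"
  shows "emeasure lborel (g ` S) = (\<integral>\<^sup>+z. ennreal ((cmod (deriv g z))\<^sup>2) * indicator S z \<partial>lborel)"
proof -
  let ?S = "vec_complex -` S" and ?G = "\<lambda>v. complex_vec (g (vec_complex v))"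
  let ?G' = "\<lambda>v h. complex_vec (deriv g (vec_complex v) * vec_complex h)"
  have S': "?S \<in> sets borel" using measurable_sets[OF measurable_vec_complex S(2)] by simp
  have "vec_complex ` ?S = S"
    by (auto simp: image_iff) (metis vec_complex_inverse(2))
  then have GS': "?G ` ?S = complex_vec ` (g ` S)"
    by (metis image_image)
  have GS: "?G ` ?S = vec_complex -` (g ` S)"
    unfolding GS' by (auto simp: image_iff) (metis vec_complex_inverse(1))
  have bim: "?G ` ?S \<in> sets borel"
    unfolding GS using measurable_sets[OF measurable_vec_complex im(1)] by simp
  have bd: "bounded (?G ` ?S)"
    unfolding GS' by (rule bounded_linear_image[OF im(2) linear_complex_vec])
  have lm: "?G ` ?S \<in> lmeasurable"
    using bim bd by (intro bounded_set_imp_lmeasurable) auto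
  have "((\<lambda>v. \<bar>Determinants.det (matrix (?G' v))\<bar>) has_integral measure lebesgue (?G ` ?S)) ?S"
  proof (rule has_measure_differentiable_image[THEN iffD1])
    show "?S \<in> sets lebesgue" using S' by simp
    show "inj_on ?G ?S"
      using inj by (auto simp: inj_on_def) (metis vec_complex_inverse)
    show "(?G has_derivative ?G' v) (at v within ?S)" if v: "v \<in> ?S" for v
    proof -
      have "(g has_field_derivative deriv g (vec_complex v)) (at (vec_complex v))"
        using hol U S v by (intro holomorphic_derivI[of g U]) auto
      then have "(g has_derivative (*) (deriv g (vec_complex v))) (at (vec_complex v))"
        by (rule has_field_derivative_imp_has_derivative)
      then have "(g \<circ> vec_complex has_derivative (*) (deriv g (vec_complex v)) \<circ> vec_complex) (at v within ?S)"
        by (rule diff_chain_within[OF bounded_linear_imp_has_derivative[OF linear_vec_complex] has_derivative_at_withinI])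
      then have "(complex_vec \<circ> (g \<circ> vec_complex) has_derivative
          complex_vec \<circ> ((*) (deriv g (vec_complex v)) \<circ> vec_complex)) (at v within ?S)"
        by (rule diff_chain_within[OF _ bounded_linear_imp_has_derivative[OF linear_complex_vec]])
      then show ?thesis by (simp add: o_def)
    qed
  qed (use lm in auto)
  then have I: "((\<lambda>v. (cmod (deriv g (vec_complex v)))\<^sup>2) has_integral measure lebesgue (?G ` ?S)) ?S"
    by (simp add: det_complex_mult)
  have dm: "(\<lambda>z. if z \<in> U then deriv g z else 0) \<in> borel_measurable borel"
    using hol U by (intro borel_measurable_continuous_on_if holomorphic_on_imp_continuous_on holomorphic_deriv) auto
  have m: "(\<lambda>z. ennreal ((cmod (deriv g z))\<^sup>2) * indicator S z) \<in> borel_measurable borel"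
  proof -
    have "(\<lambda>z. ennreal ((cmod (deriv g z))\<^sup>2) * indicator S z) =
        (\<lambda>z. ennreal ((cmod (if z \<in> U then deriv g z else 0))\<^sup>2) * indicator S z)"
      using S by (auto simp: indicator_def fun_eq_iff)
    then show ?thesis using dm S(2) by simp
  qed
  have "emeasure lborel (g ` S) = emeasure (distr lborel borel vec_complex) (g ` S)"
    by (simp add: lborel_vec_complex)
  also have "\<dots> = emeasure lborel (?G ` ?S)"
    using im(1) unfolding GS by (subst emeasure_distr) auto
  also have "\<dots> = ennreal (measure lebesgue (?G ` ?S))"
    using fmeasurableD2[OF lm] bim by (simp add: emeasure_eq_ennreal_measure)
  also have "\<dots> = (\<integral>\<^sup>+v. ennreal ((cmod (deriv g (vec_complex v)))\<^sup>2) * indicator ?S v \<partial>lborel)"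
    by (rule nn_integral_has_integral_lebesgue'[OF _ I, symmetric]) simp
  also have "\<dots> = (\<integral>\<^sup>+z. ennreal ((cmod (deriv g z))\<^sup>2) * indicator S z \<partial>distr lborel borel vec_complex)"
    using m by (subst nn_integral_distr) (auto simp: indicator_def intro!: nn_integral_cong)
  finally show ?thesis by (simp add: lborel_vec_complex)
qed

lemma nn_integral_count_space_subsingleton:
  assumes "\<And>v. v \<in> X \<longleftrightarrow> P \<and> v = a"
  shows "(\<integral>\<^sup>+v. H v \<partial>count_space X) = (if P then H a else 0)"
proof (cases P)
  case True
  then have X: "X = {a}" using assms by auto
  show ?thesis unfolding X using True by (simp add: nn_integral_count_space_finite)
next
  case False
  then have "X = {}" using assms by auto
  then show ?thesis using False by (simp add: nn_integral_count_space_finite)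
qed

text \<open>For injective g each fibre has at most one point, so the inner integral is the value of
  H at the inverse image. The outer integral is a transport of measure: g pushes |g'|^2 dv on A
  forward to Lebesgue measure on g(A).\<close>

lemma area_formula_injective:
  assumes hol: "g holomorphic_on U" and U: "open U" and inj: "inj_on g U" and bd: "bounded (g ` U)"
    and A: "A \<in> sets borel" "A \<subseteq> U" and H [measurable]: "H \<in> borel_measurable borel"
  shows "(\<lambda>w. \<integral>\<^sup>+v. H v \<partial>count_space {v \<in> A. g v = w}) \<in> borel_measurable borel" (is ?M)
    and "(\<integral>\<^sup>+w. (\<integral>\<^sup>+v. H v \<partial>count_space {v \<in> A. g v = w}) \<partial>lborel) =
      (\<integral>\<^sup>+v. H v * ennreal ((cmod (deriv g v))\<^sup>2) * indicator A v \<partial>lborel)"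
proof -
  obtain h where h: "h holomorphic_on (g ` U)" "\<And>z. z \<in> U \<Longrightarrow> h (g z) = z"
    using holomorphic_has_inverse[OF hol U inj] by metis
  have oU: "open (g ` U)" by (rule open_mapping_thm3[OF hol U inj])
  \<comment> \<open>Extension by 0 turns the inverse of g, and g itself, into total Borel
    functions.\<close>
  define k where "k w = (if w \<in> g ` U then h w else 0)" for w
  define f where "f v = (if v \<in> U then g v else 0)" for v
  have km [measurable]: "k \<in> borel_measurable borel" unfolding k_def[abs_def]
    using oU h(1) by (intro borel_measurable_continuous_on_if holomorphic_on_imp_continuous_on) auto
  have fm [measurable]: "f \<in> borel_measurable borel" unfolding f_def[abs_def]
    using U hol by (intro borel_measurable_continuous_on_if holomorphic_on_imp_continuous_on) auto
  have im: "g ` B \<in> sets borel" if B: "B \<in> sets borel" "B \<subseteq> U" for B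
  proof -
    have "g ` B = g ` U \<inter> k -` B"
      using B(2) h(2) by (auto simp: k_def)
    then show ?thesis using measurable_sets[OF km B(1)] oU by auto
  qed
  note gA [measurable] = im[OF A]
  have eq: "(\<integral>\<^sup>+v. H v \<partial>count_space {v \<in> A. g v = w}) = H (k w) * indicator (g ` A) w" for w
  proof -
    have kg: "k (g v) = v" if "v \<in> A" for v
      using that A(2) h(2) by (auto simp: k_def)
    have "v \<in> {v \<in> A. g v = w} \<longleftrightarrow> w \<in> g ` A \<and> v = k w" for v
      using kg by auto
    then have "(\<integral>\<^sup>+v. H v \<partial>count_space {v \<in> A. g v = w}) = (if w \<in> g ` A then H (k w) else 0)"
      by (rule nn_integral_count_space_subsingleton)
    then show ?thesis by simp
  qed
  show ?M unfolding eq by measurable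
  define \<nu> where "\<nu> = density lborel (\<lambda>v. ennreal ((cmod (deriv g v))\<^sup>2) * indicator A v)"
  have dm: "(\<lambda>z. if z \<in> U then deriv g z else 0) \<in> borel_measurable borel"
    using hol U by (intro borel_measurable_continuous_on_if holomorphic_on_imp_continuous_on holomorphic_deriv) auto
  have m [measurable]: "(\<lambda>z. ennreal ((cmod (deriv g z))\<^sup>2) * indicator A z) \<in> borel_measurable borel"
  proof -
    have "(\<lambda>z. ennreal ((cmod (deriv g z))\<^sup>2) * indicator A z) =
        (\<lambda>z. ennreal ((cmod (if z \<in> U then deriv g z else 0))\<^sup>2) * indicator A z)"
      using A by (auto simp: indicator_def fun_eq_iff)
    then show ?thesis using dm A(1) by simp
  qed
  have distr: "distr \<nu> borel f = density lborel (indicator (g ` A))"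
  proof (rule measure_eqI)
    fix E assume "E \<in> sets (distr \<nu> borel f)"
    then have E [measurable]: "E \<in> sets borel" by simp
    have fE: "f -` E \<in> sets borel" using measurable_sets[OF fm E] by simp
    let ?B = "A \<inter> f -` E"
    have B: "?B \<in> sets borel" "?B \<subseteq> U" using A fE by auto
    have "emeasure (distr \<nu> borel f) E = emeasure \<nu> (f -` E)"
      by (subst emeasure_distr) (auto simp: \<nu>_def)
    also have "\<dots> = (\<integral>\<^sup>+z. ennreal ((cmod (deriv g z))\<^sup>2) * indicator A z * indicator (f -` E) z \<partial>lborel)"
      unfolding \<nu>_def using fE by (subst emeasure_density) auto
    also have "\<dots> = (\<integral>\<^sup>+z. ennreal ((cmod (deriv g z))\<^sup>2) * indicator ?B z \<partial>lborel)"
      by (intro nn_integral_cong) (auto simp: indicator_def)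
    also have "\<dots> = emeasure lborel (g ` ?B)"
      using B bd inj by (intro emeasure_holomorphic_image[OF hol U, symmetric] im)
        (auto intro: inj_on_subset bounded_subset)
    also have "g ` ?B = g ` A \<inter> E"
      using A(2) by (auto simp: f_def)
    also have "emeasure lborel (g ` A \<inter> E) = emeasure (density lborel (indicator (g ` A))) E"
      by (subst emeasure_density) (auto simp: indicator_inter_arith[symmetric])
    finally show "emeasure (distr \<nu> borel f) E = emeasure (density lborel (indicator (g ` A))) E" .
  qed simp
  have "(\<integral>\<^sup>+w. (\<integral>\<^sup>+v. H v \<partial>count_space {v \<in> A. g v = w}) \<partial>lborel) =
      (\<integral>\<^sup>+w. indicator (g ` A) w * H (k w) \<partial>lborel)"
    unfolding eq by (simp add: mult.commute)
  also have "\<dots> = (\<integral>\<^sup>+w. H (k w) \<partial>distr \<nu> borel f)"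
    unfolding distr by (subst nn_integral_density) auto
  also have "\<dots> = (\<integral>\<^sup>+v. H (k (f v)) \<partial>\<nu>)"
    by (subst nn_integral_distr) (auto simp: \<nu>_def)
  also have "\<dots> = (\<integral>\<^sup>+v. ennreal ((cmod (deriv g v))\<^sup>2) * indicator A v * H (k (f v)) \<partial>lborel)"
    unfolding \<nu>_def by (subst nn_integral_density) auto
  also have "\<dots> = (\<integral>\<^sup>+v. H v * ennreal ((cmod (deriv g v))\<^sup>2) * indicator A v \<partial>lborel)"
    using A(2) h(2) by (intro nn_integral_cong) (auto simp: indicator_def k_def f_def mult.commute)
  finally show "(\<integral>\<^sup>+w. (\<integral>\<^sup>+v. H v \<partial>count_space {v \<in> A. g v = w}) \<partial>lborel) =
      (\<integral>\<^sup>+v. H v * ennreal ((cmod (deriv g v))\<^sup>2) * indicator A v \<partial>lborel)" .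
qed

text \<open>A Sard statement by counting: unless g' is constant its zeros are countable, hence so
  are the critical values. If g' vanishes identically then g takes a single value.\<close>

lemma critical_values_null:
  assumes hol: "g holomorphic_on S" and S: "open S" "connected S"
  shows "g ` {v \<in> S. deriv g v = 0} \<in> null_sets lborel"
proof -
  have "countable (g ` {v \<in> S. deriv g v = 0})"
  proof (cases "deriv g constant_on S")
    case False
    obtain C :: "nat \<Rightarrow> complex set" where C: "\<And>n. compact (C n)" "\<Union>(range C) = S"
      using open_Union_compact_subsets[OF S(1)] by metis
    then have "fsigma S" using fsigma.intros[of C] compact_imp_closed by metis
    then show ?thesis
      using holomorphic_countable_zeros[OF holomorphic_deriv[OF hol S(1)] S _ False] by simp
  next
    case True
    then obtain c where c: "\<And>v. v \<in> S \<Longrightarrow> deriv g v = c" by (auto simp: constant_on_def)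
    show ?thesis
    proof (cases "c = 0")
      case True
      then have "g constant_on S"
        using has_field_derivative_0_imp_constant_on[of S g] c hol S holomorphic_derivI by metis
      then obtain d where "\<And>v. v \<in> S \<Longrightarrow> g v = d" by (auto simp: constant_on_def)
      then have "g ` {v \<in> S. deriv g v = 0} \<subseteq> {d}" by auto
      then show ?thesis by (rule countable_subset) auto
    next
      case False
      with c have e: "{v \<in> S. deriv g v = 0} = {}" by auto
      show ?thesis unfolding e by simp
    qed
  qed
  then show ?thesis by (rule countable_imp_null_set_lborel)
qed

text \<open>The noncritical points are covered by countably many open sets on which g is injective;
  these are made disjoint and the pieces are summed. Critical points drop out on both sides: their
  images form a null set, and on the right |g'| is 0 there.\<close>

lemma holomorphic_area_formula:
  assumes hol: "g holomorphic_on S" and S: "open S" "connected S"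
    and A: "A \<in> sets borel" "A \<subseteq> S" and H [measurable]: "H \<in> borel_measurable borel"
  shows "(\<integral>\<^sup>+w. (\<integral>\<^sup>+v. H v \<partial>count_space {v \<in> A. g v = w}) \<partial>lborel) =
      (\<integral>\<^sup>+v. H v * ennreal ((cmod (deriv g v))\<^sup>2) * indicator A v \<partial>lborel)"
proof -
  define R where "R = {v \<in> S. deriv g v \<noteq> 0}"
  define \<F> where "\<F> = {B. open B \<and> B \<subseteq> S \<and> inj_on g B \<and> bounded (g ` B)}"
  have "R \<subseteq> \<Union>\<F>"
  proof
    fix \<xi> assume "\<xi> \<in> R"
    then have \<xi>: "\<xi> \<in> S" "deriv g \<xi> \<noteq> 0" by (auto simp: R_def)
    obtain r where r: "r > 0" "ball \<xi> r \<subseteq> S" "inj_on g (ball \<xi> r)"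
      using has_complex_derivative_locally_injective[OF hol \<xi>(1) S(1) \<xi>(2)] by metis
    \<comment> \<open>Halving the radius puts the ball into a compact subset of S, which bounds its
      image.\<close>
    have "cball \<xi> (r / 2) \<subseteq> ball \<xi> r" using r(1) by auto
    then have "cball \<xi> (r / 2) \<subseteq> S" using r(2) by blast
    then have "compact (g ` cball \<xi> (r / 2))"
      using hol by (intro compact_continuous_image) (auto intro: holomorphic_on_imp_continuous_on holomorphic_on_subset)
    then have "bounded (g ` ball \<xi> (r / 2))"
      by (rule bounded_subset[OF compact_imp_bounded]) (auto simp: less_imp_le)
    moreover have "ball \<xi> (r / 2) \<subseteq> ball \<xi> r" using r(1) by auto
    ultimately have "ball \<xi> (r / 2) \<in> \<F>"
      using r by (auto simp: \<F>_def intro: inj_on_subset)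
    then show "\<xi> \<in> \<Union>\<F>" using r(1) by (intro UnionI[of "ball \<xi> (r / 2)"]) auto
  qed
  moreover obtain \<F>' where F': "\<F>' \<subseteq> \<F>" "countable \<F>'" "\<Union>\<F>' = \<Union>\<F>"
    using Lindelof[of \<F>] by (auto simp: \<F>_def)
  \<comment> \<open>The empty set is added so that the countable cover is nonempty and can be
    enumerated by the naturals.\<close>
  moreover have "{} \<in> \<F>" by (auto simp: \<F>_def)
  ultimately obtain B :: "nat \<Rightarrow> complex set" where B: "range B = insert {} \<F>'" "R \<subseteq> (\<Union>i. B i)"
    using uncountable_def[of "insert {} \<F>'"] by (metis Union_insert countable_insert insert_not_empty sup_bot.left_neutral)
  have BF: "B i \<in> \<F>" for i using B(1) F'(1) \<open>{} \<in> \<F>\<close> by (metis insert_subset rangeI subset_iff)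
  define D where "D i = A \<inter> R \<inter> disjointed B i" for i
  have Rb [measurable]: "R \<in> sets borel"
  proof -
    have "open (S \<inter> deriv g -` (- {0}))"
      using holomorphic_deriv[OF hol S(1)] S(1)
      by (intro continuous_open_preimage holomorphic_on_imp_continuous_on) auto
    moreover have "S \<inter> deriv g -` (- {0}) = R" by (auto simp: R_def)
    ultimately show ?thesis by auto
  qed
  have Db: "D i \<in> sets borel" for i
  proof -
    have "range B \<subseteq> sets borel" using BF by (auto simp: \<F>_def)
    then have "disjointed B i \<in> sets borel" using sets.range_disjointed_sets[of B borel] by auto
    then show ?thesis using A(1) by (simp add: D_def)
  qed
  have DB: "D i \<subseteq> B i" for i using disjointed_subset[of B i] by (auto simp: D_def)
  have Ddisj: "disjoint_family D"
    using disjoint_family_disjointed[of B] by (auto simp: disjoint_family_on_def D_def)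
  have DU: "(\<Union>i. D i) = A \<inter> R"
    using B(2) UN_disjointed_eq[of B] by (auto simp: D_def)
  have piece: "(\<lambda>w. \<integral>\<^sup>+v. H v \<partial>count_space {v \<in> D i. g v = w}) \<in> borel_measurable borel"
    "(\<integral>\<^sup>+w. (\<integral>\<^sup>+v. H v \<partial>count_space {v \<in> D i. g v = w}) \<partial>lborel) =
      (\<integral>\<^sup>+v. H v * ennreal ((cmod (deriv g v))\<^sup>2) * indicator (D i) v \<partial>lborel)" for i
    using BF[of i] holomorphic_on_subset[OF hol] Db DB
    by (auto intro!: area_formula_injective[where U = "B i"] simp: \<F>_def)
  \<comment> \<open>Away from critical values the whole fibre in A consists of noncritical points,
    so it splits over the pieces \<open>D i\<close>.\<close>
  have split: "(\<integral>\<^sup>+v. H v \<partial>count_space {v \<in> A. g v = w}) = (\<Sum>i. \<integral>\<^sup>+v. H v \<partial>count_space {v \<in> D i. g v = w})"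
    if w: "w \<notin> g ` {v \<in> S. deriv g v = 0}" for w
  proof -
    have "v \<in> A \<and> g v = w \<longleftrightarrow> v \<in> (\<Union>i. D i) \<and> g v = w" for v
      unfolding DU using w A(2) by (auto simp: R_def)
    then have "{v \<in> A. g v = w} = (\<Union>i. {v \<in> D i. g v = w})"
      by blast
    moreover have "disjoint_family (\<lambda>i. {v \<in> D i. g v = w})"
      using Ddisj by (auto simp: disjoint_family_on_def)
    ultimately have ind: "indicator {v \<in> A. g v = w} v = (\<Sum>i. indicator {v \<in> D i. g v = w} v :: ennreal)" for v
      by (simp add: suminf_indicator)
    have "(\<integral>\<^sup>+v. H v \<partial>count_space {v \<in> A. g v = w}) = (\<integral>\<^sup>+v. (\<Sum>i. H v * indicator {v \<in> D i. g v = w} v) \<partial>count_space UNIV)"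
      by (subst nn_integral_count_space_indicator) (auto simp: ind)
    also have "\<dots> = (\<Sum>i. \<integral>\<^sup>+v. H v * indicator {v \<in> D i. g v = w} v \<partial>count_space UNIV)"
      by (rule nn_integral_suminf) auto
    also have "\<dots> = (\<Sum>i. \<integral>\<^sup>+v. H v \<partial>count_space {v \<in> D i. g v = w})"
      by (subst (2) nn_integral_count_space_indicator) auto
    finally show ?thesis .
  qed
  have "AE w in lborel. w \<notin> g ` {v \<in> S. deriv g v = 0}"
    by (rule AE_not_in[OF critical_values_null[OF hol S]])
  then have "(\<integral>\<^sup>+w. (\<integral>\<^sup>+v. H v \<partial>count_space {v \<in> A. g v = w}) \<partial>lborel) =
      (\<integral>\<^sup>+w. (\<Sum>i. \<integral>\<^sup>+v. H v \<partial>count_space {v \<in> D i. g v = w}) \<partial>lborel)"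
    by (intro nn_integral_cong_AE) (auto simp: split)
  also have "\<dots> = (\<Sum>i. \<integral>\<^sup>+w. (\<integral>\<^sup>+v. H v \<partial>count_space {v \<in> D i. g v = w}) \<partial>lborel)"
    using piece(1) by (intro nn_integral_suminf) auto
  also have "\<dots> = (\<Sum>i. \<integral>\<^sup>+v. H v * ennreal ((cmod (deriv g v))\<^sup>2) * indicator (D i) v \<partial>lborel)"
    by (simp only: piece(2))
  also have "\<dots> = (\<integral>\<^sup>+v. (\<Sum>i. H v * ennreal ((cmod (deriv g v))\<^sup>2) * indicator (D i) v) \<partial>lborel)"
  proof (rule nn_integral_suminf[symmetric])
    fix i
    have "(\<lambda>z. if z \<in> S then deriv g z else 0) \<in> borel_measurable borel"
      using hol S by (intro borel_measurable_continuous_on_if holomorphic_on_imp_continuous_on holomorphic_deriv) auto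
    then have "(\<lambda>v. H v * ennreal ((cmod (if v \<in> S then deriv g v else 0))\<^sup>2) * indicator (D i) v) \<in> borel_measurable lborel"
      using Db[of i] by measurable
    moreover have "(\<lambda>v. H v * ennreal ((cmod (if v \<in> S then deriv g v else 0))\<^sup>2) * indicator (D i) v) =
        (\<lambda>v. H v * ennreal ((cmod (deriv g v))\<^sup>2) * indicator (D i) v)"
      using A(2) by (auto simp: fun_eq_iff indicator_def D_def)
    ultimately show "(\<lambda>v. H v * ennreal ((cmod (deriv g v))\<^sup>2) * indicator (D i) v) \<in> borel_measurable lborel"
      by simp
  qed
  also have "\<dots> = (\<integral>\<^sup>+v. H v * ennreal ((cmod (deriv g v))\<^sup>2) * indicator (A \<inter> R) v \<partial>lborel)"
    using suminf_indicator[OF Ddisj] by (simp add: DU)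
  also have "\<dots> = (\<integral>\<^sup>+v. H v * ennreal ((cmod (deriv g v))\<^sup>2) * indicator A v \<partial>lborel)"
    using A(2) by (intro nn_integral_cong) (auto simp: R_def indicator_def)
  finally show ?thesis .
qed


section \<open>Gaussian sequences\<close>

text \<open>The parameter \<open>t\<close> is the inverse of the variance.\<close>
definition gauss_density :: "real \<Rightarrow> complex \<Rightarrow> real" where
  "gauss_density t w = t / pi * exp (- t * (cmod w)\<^sup>2)"

definition gauss_measure :: "real \<Rightarrow> complex measure" where
  "gauss_measure t = density lborel (\<lambda>w. ennreal (gauss_density t w))"

lemma gauss_density_nonneg: "t > 0 \<Longrightarrow> 0 \<le> gauss_density t w"
  by (simp add: gauss_density_def)

lemma measurable_gauss_density [measurable]: "gauss_density t \<in> borel_measurable borel"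
  unfolding gauss_density_def[abs_def] by measurable

lemma sets_gauss_measure [measurable_cong, simp]: "sets (gauss_measure t) = sets borel"
  by (simp add: gauss_measure_def)

lemma space_gauss_measure [simp]: "space (gauss_measure t) = UNIV"
  by (simp add: gauss_measure_def)

lemma lborel_pair_complex: "distr lborel borel (\<lambda>(x, y). Complex x y) = lborel"
proof (rule lborel_eqI[symmetric])
  have m: "(\<lambda>(x, y). Complex x y) \<in> borel_measurable borel"
    by (intro borel_measurable_continuous_onI) (auto simp: case_prod_beta Complex_eq intro!: continuous_intros)
  fix l u :: complex
  assume lu: "\<And>b. b \<in> Basis \<Longrightarrow> inner l b \<le> inner u b"
  have lu': "Re l \<le> Re u" "Im l \<le> Im u"
    using lu[of 1] lu[of \<i>] by (auto simp: Basis_complex_def inner_complex_def)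
  have B: "(Basis :: (real \<times> real) set) = {(1, 0), (0, 1)}"
    by (auto simp: Basis_prod_def)
  have "(\<lambda>(x, y). Complex x y) -` box l u = box (Re l, Im l) (Re u, Im u)"
    by (auto simp: box_def B Basis_complex_def)
  moreover have "emeasure lborel (box (Re l, Im l) (Re u, Im u)) =
      (\<Prod>b\<in>Basis. inner ((Re u, Im u) - (Re l, Im l)) b)"
    using lu' by (intro emeasure_lborel_box) (auto simp: B)
  moreover have "(\<Prod>b\<in>Basis. inner ((Re u, Im u) - (Re l, Im l)) b) = (\<Prod>b\<in>Basis. inner (u - l) b)"
    by (simp add: B Basis_complex_def)
  ultimately show "emeasure (distr lborel borel (\<lambda>(x, y). Complex x y)) (box l u) = ennreal (\<Prod>b\<in>Basis. inner (u - l) b)"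
    using m by (simp add: emeasure_distr)
qed simp

lemma nn_integral_gauss_density:
  assumes t: "t > 0"
  shows "(\<integral>\<^sup>+w. ennreal (gauss_density t w) \<partial>lborel) = 1"
proof -
  \<comment> \<open>A complex Gaussian of variance 1 / t has independent real and imaginary parts of
    variance 1 / (2 t) each.\<close>
  let ?n = "normal_density 0 (1 / sqrt (2 * t))"
  have n: "?n x = sqrt (t / pi) * exp (- t * x\<^sup>2)" for x
    using t by (simp add: normal_density_def power_divide real_sqrt_divide)
  interpret prob_space "density lborel ?n"
    using t by (intro prob_space_normal_density) auto
  have n1: "(\<integral>\<^sup>+x. ennreal (?n x) \<partial>lborel) = 1"
    using emeasure_space_1 by (simp add: emeasure_density)
  have eq: "gauss_density t (Complex x y) = ?n x * ?n y" for x y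
  proof -
    have "?n x * ?n y = (sqrt (t / pi) * sqrt (t / pi)) * exp (- t * x\<^sup>2 - t * y\<^sup>2)"
      unfolding n by (simp add: exp_diff exp_minus field_simps)
    then show ?thesis
      using t by (simp add: gauss_density_def cmod_power2 algebra_simps del: normal_density_def)
  qed
  have m: "(\<lambda>(x, y). Complex x y) \<in> borel_measurable borel"
    by (intro borel_measurable_continuous_onI) (auto simp: case_prod_beta Complex_eq intro!: continuous_intros)
  have "(\<integral>\<^sup>+w. ennreal (gauss_density t w) \<partial>lborel) =
      (\<integral>\<^sup>+w. ennreal (gauss_density t w) \<partial>distr lborel borel (\<lambda>(x, y). Complex x y))"
    by (simp add: lborel_pair_complex)
  also have "\<dots> = (\<integral>\<^sup>+p. ennreal (?n (fst p) * ?n (snd p)) \<partial>(lborel \<Otimes>\<^sub>M lborel))"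
    using m by (subst nn_integral_distr) (auto simp: case_prod_beta eq lborel_prod)
  also have "\<dots> = (\<integral>\<^sup>+x. \<integral>\<^sup>+y. ennreal (?n x * ?n y) \<partial>lborel \<partial>lborel)"
    by (subst lborel.nn_integral_fst[symmetric]) auto
  also have "\<dots> = (\<integral>\<^sup>+x. ennreal (?n x) * (\<integral>\<^sup>+y. ennreal (?n y) \<partial>lborel) \<partial>lborel)"
    by (simp add: ennreal_mult nn_integral_cmult)
  finally show ?thesis by (simp add: n1)
qed

lemma prob_space_gauss_measure: "t > 0 \<Longrightarrow> prob_space (gauss_measure t)"
  by (rule prob_spaceI) (simp add: gauss_measure_def emeasure_density nn_integral_gauss_density)

lemma nn_integral_gauss_measure:
  assumes "f \<in> borel_measurable borel" "t > 0"
  shows "(\<integral>\<^sup>+w. f w \<partial>gauss_measure t) = (\<integral>\<^sup>+w. ennreal (gauss_density t w) * f w \<partial>lborel)"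
  unfolding gauss_measure_def using assms by (subst nn_integral_density) auto

lemma integrable_exp_norm2: "t > 0 \<Longrightarrow> integrable lborel (\<lambda>w::complex. exp (- t * (cmod w)\<^sup>2))"
proof -
  assume t: "t > 0"
  have "integrable lborel (gauss_density t)"
    using t by (intro integrableI_nn_integral_finite[where x = 1])
      (auto simp: nn_integral_gauss_density gauss_density_nonneg)
  then have "integrable lborel (\<lambda>w. pi / t * gauss_density t w)" by simp
  then show ?thesis using t by (simp add: gauss_density_def)
qed

lemma integral_exp_norm2:
  assumes t: "t > 0"
  shows "(\<integral>w. exp (- t * (cmod w)\<^sup>2) \<partial>lborel) = pi / t"
proof -
  have "(\<integral>w. gauss_density t w \<partial>lborel) = 1"
    using t by (intro integral_eq_nn_integral[THEN trans])
      (auto simp: nn_integral_gauss_density gauss_density_nonneg)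
  moreover have "(\<integral>w. gauss_density t w \<partial>lborel) = t / pi * (\<integral>w. exp (- t * (cmod w)\<^sup>2) \<partial>lborel)"
    unfolding gauss_density_def[abs_def] by simp
  ultimately show ?thesis using t by (simp add: field_simps)
qed

lemma power_le_fact_exp: "x \<ge> 0 \<Longrightarrow> x ^ m \<le> fact m * exp (x::real)"
proof -
  assume x: "x \<ge> 0"
  have "sum (\<lambda>n. x ^ n /\<^sub>R fact n) {m} \<le> (\<Sum>n. x ^ n /\<^sub>R fact n)"
    using x by (intro sum_le_suminf summable_exp_generic) auto
  then show ?thesis by (simp add: exp_def field_simps)
qed

lemma poly_le_exp_norm2:
  assumes "t > 0"
  shows "\<exists>C\<ge>0. \<forall>w. (1 + cmod w) ^ m \<le> C * exp (t * (cmod w)\<^sup>2)"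
proof -
  \<comment> \<open>From 2|w| \<le> t|w|^2 + 1 / t and (1 + |w|)^m \<le> m! exp(1 + |w|).\<close>
  define C where "C = fact m * exp (1 + 1 / t)"
  have "(1 + cmod w) ^ m \<le> C * exp (t * (cmod w)\<^sup>2)" for w
  proof -
    have "2 * cmod w \<le> t * (cmod w)\<^sup>2 + 1 / t"
    proof -
      have "0 \<le> (sqrt t * cmod w - 1 / sqrt t)\<^sup>2" by simp
      also have "\<dots> = t * (cmod w)\<^sup>2 + 1 / t - 2 * cmod w"
        using assms by (simp add: power2_diff power_mult_distrib power_divide)
      finally show ?thesis by simp
    qed
    then have "cmod w \<le> t * (cmod w)\<^sup>2 + 1 / t" using norm_ge_zero[of w] by linarith
    then have "exp (1 + cmod w) \<le> exp (1 + 1 / t) * exp (t * (cmod w)\<^sup>2)"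
      by (simp flip: exp_add)
    then have "fact m * exp (1 + cmod w) \<le> C * exp (t * (cmod w)\<^sup>2)"
      by (simp add: C_def mult.assoc)
    moreover have "(1 + cmod w) ^ m \<le> fact m * exp (1 + cmod w)"
      by (intro power_le_fact_exp) auto
    ultimately show ?thesis by linarith
  qed
  then show ?thesis by (intro exI[of _ C]) (auto simp: C_def)
qed

lemma integrable_poly_exp_norm2:
  assumes "t > 0"
  shows "integrable lborel (\<lambda>w. (1 + cmod w) ^ m * exp (- t * (cmod w)\<^sup>2))"
proof -
  obtain C where C: "C \<ge> 0" "\<And>w. (1 + cmod w) ^ m \<le> C * exp (t / 2 * (cmod w)\<^sup>2)"
    using poly_le_exp_norm2[of "t / 2" m] assms by auto
  have "integrable lborel (\<lambda>w::complex. C * exp (- (t / 2) * (cmod w)\<^sup>2))"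
    using integrable_exp_norm2[of "t / 2"] assms by auto
  then show ?thesis
  proof (rule Bochner_Integration.integrable_bound)
    show "AE w in lborel. norm ((1 + cmod w) ^ m * exp (- t * (cmod w)\<^sup>2)) \<le> norm (C * exp (- (t / 2) * (cmod w)\<^sup>2))"
    proof (rule AE_I2)
      fix w :: complex
      have "(1 + cmod w) ^ m * exp (- t * (cmod w)\<^sup>2) \<le> C * exp (t / 2 * (cmod w)\<^sup>2) * exp (- t * (cmod w)\<^sup>2)"
        by (intro mult_right_mono C) auto
      also have "\<dots> = C * exp (- (t / 2) * (cmod w)\<^sup>2)"
        by (simp add: mult.assoc flip: exp_add)
      finally show "norm ((1 + cmod w) ^ m * exp (- t * (cmod w)\<^sup>2)) \<le> norm (C * exp (- (t / 2) * (cmod w)\<^sup>2))"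
        using C by (simp add: abs_mult)
    qed
  qed auto
qed

lemma nn_integral_gauss_moment:
  assumes "t > 0"
  shows "(\<integral>\<^sup>+w. ennreal (cmod w ^ m) \<partial>gauss_measure t) < \<infinity>"
proof -
  have "integrable lborel (\<lambda>w. t / pi * ((1 + cmod w) ^ m * exp (- t * (cmod w)\<^sup>2)))"
    by (intro integrable_mult_right integrable_poly_exp_norm2 assms)
  then have fin: "(\<integral>\<^sup>+w. ennreal (t / pi * ((1 + cmod w) ^ m * exp (- t * (cmod w)\<^sup>2))) \<partial>lborel) < \<infinity>"
    using assms by (simp add: integrable_iff_bounded abs_mult)
  have "(\<integral>\<^sup>+w. ennreal (cmod w ^ m) \<partial>gauss_measure t) = (\<integral>\<^sup>+w. ennreal (gauss_density t w) * ennreal (cmod w ^ m) \<partial>lborel)"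
    using assms by (subst nn_integral_gauss_measure) auto
  also have "\<dots> \<le> (\<integral>\<^sup>+w. ennreal (t / pi * ((1 + cmod w) ^ m * exp (- t * (cmod w)\<^sup>2))) \<partial>lborel)"
  proof (intro nn_integral_mono)
    fix w :: complex
    have "cmod w ^ m \<le> (1 + cmod w) ^ m" by (intro power_mono) auto
    then have "gauss_density t w * cmod w ^ m \<le> gauss_density t w * (1 + cmod w) ^ m"
      using assms by (intro mult_left_mono gauss_density_nonneg)
    then show "ennreal (gauss_density t w) * ennreal (cmod w ^ m) \<le> ennreal (t / pi * ((1 + cmod w) ^ m * exp (- t * (cmod w)\<^sup>2)))"
      using assms by (simp add: ennreal_mult[symmetric] gauss_density_nonneg) (simp add: gauss_density_def mult_ac)
  qed
  also note fin
  finally show ?thesis .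
qed

section \<open>The product measure, resampling of one coordinate, and moments\<close>

abbreviation "seq_borel \<equiv> (PiM UNIV (\<lambda>_. borel) :: (nat \<Rightarrow> complex) measure)"

definition gauss_seq :: "real \<Rightarrow> (nat \<Rightarrow> complex) measure" where
  "gauss_seq r = PiM UNIV (\<lambda>k. gauss_measure (\<tau> r k))"

lemma \<tau>_pos: "r \<ge> 0 \<Longrightarrow> \<tau> r k > 0"
  by (simp add: \<tau>_def)

lemma sets_gauss_seq [measurable_cong, simp]: "sets (gauss_seq r) = sets seq_borel"
  unfolding gauss_seq_def by (rule sets_PiM_cong) auto

lemma space_gauss_seq [simp]: "space (gauss_seq r) = UNIV"
  by (simp add: gauss_seq_def space_PiM)

lemma prob_space_gauss_seq: "r \<ge> 0 \<Longrightarrow> prob_space (gauss_seq r)"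
  unfolding gauss_seq_def by (intro prob_space_PiM prob_space_gauss_measure \<tau>_pos)

lemma measurable_cnj [measurable]: "cnj \<in> borel_measurable borel"
  by (intro borel_measurable_continuous_onI continuous_intros)

lemma measurable_wnorm [measurable]: "wnorm \<rho> \<in> borel_measurable seq_borel"
  unfolding wnorm_def[abs_def] by measurable

lemma gauss_seq_distr_upd:
  assumes "r \<ge> 0"
  shows "distr (gauss_measure (\<tau> r k) \<Otimes>\<^sub>M gauss_seq r) (gauss_seq r) (\<lambda>(w, x). x(k := w)) = gauss_seq r"
  using distr_pair_PiM_eq_PiM[of UNIV "\<lambda>k. gauss_measure (\<tau> r k)" k] assms
  by (simp add: gauss_seq_def prob_space_gauss_measure \<tau>_pos)

lemma measurable_seq_upd [measurable]: "(\<lambda>(w, x). x(k := w)) \<in> borel \<Otimes>\<^sub>M seq_borel \<rightarrow>\<^sub>M seq_borel"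
proof (rule measurable_PiM_single')
  fix i :: nat
  show "(\<lambda>p. (case p of (w, x) \<Rightarrow> x(k := w)) i) \<in> borel_measurable (borel \<Otimes>\<^sub>M seq_borel)"
    by (cases "i = k") (auto simp: case_prod_beta)
qed (auto simp: PiE_iff)

text \<open>An independent redraw of coordinate k does not change the law. The outer integral keeps
  the whole sequence, so one coordinate is treated by Fubini while the index set stays the
  same.\<close>

lemma gauss_seq_resample:
  assumes "r \<ge> 0" and [measurable]: "f \<in> borel_measurable seq_borel"
  shows "(\<integral>\<^sup>+x. f x \<partial>gauss_seq r) = (\<integral>\<^sup>+x. \<integral>\<^sup>+w. f (x(k := w)) \<partial>gauss_measure (\<tau> r k) \<partial>gauss_seq r)"
proof -
  interpret G: prob_space "gauss_measure (\<tau> r k)" using assms(1) by (intro prob_space_gauss_measure \<tau>_pos)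
  interpret S: prob_space "gauss_seq r" using assms(1) by (rule prob_space_gauss_seq)
  interpret P: pair_prob_space "gauss_measure (\<tau> r k)" "gauss_seq r" ..
  have sets: "sets (gauss_measure (\<tau> r k) \<Otimes>\<^sub>M gauss_seq r) = sets (borel \<Otimes>\<^sub>M seq_borel)"
    by (rule sets_pair_measure_cong) auto
  have m: "(\<lambda>(w, x). x(k := w)) \<in> gauss_measure (\<tau> r k) \<Otimes>\<^sub>M gauss_seq r \<rightarrow>\<^sub>M gauss_seq r"
    using measurable_seq_upd by (simp cong: measurable_cong_sets add: sets)
  have "(\<integral>\<^sup>+x. f x \<partial>gauss_seq r) = (\<integral>\<^sup>+x. f x \<partial>distr (gauss_measure (\<tau> r k) \<Otimes>\<^sub>M gauss_seq r) (gauss_seq r) (\<lambda>(w, x). x(k := w)))"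
    by (simp add: gauss_seq_distr_upd[OF assms(1)])
  also have "\<dots> = (\<integral>\<^sup>+p. f ((snd p)(k := fst p)) \<partial>(gauss_measure (\<tau> r k) \<Otimes>\<^sub>M gauss_seq r))"
    using m by (subst nn_integral_distr) (auto simp: case_prod_beta)
  also have "\<dots> = (\<integral>\<^sup>+x. \<integral>\<^sup>+w. f (x(k := w)) \<partial>gauss_measure (\<tau> r k) \<partial>gauss_seq r)"
  proof -
    have "(\<lambda>p. f ((snd p)(k := fst p))) \<in> borel_measurable (gauss_measure (\<tau> r k) \<Otimes>\<^sub>M gauss_seq r)"
      using measurable_compose[OF m, of f borel] by (simp add: case_prod_beta)
    from P.nn_integral_snd[OF this] show ?thesis by simp
  qed
  finally show ?thesis .
qed

lemma integral_gauss_seq_resample_zero: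
  fixes f :: "(nat \<Rightarrow> complex) \<Rightarrow> complex"
  assumes r: "r \<ge> 0" and f: "integrable (gauss_seq r) f"
    and z: "AE x in gauss_seq r. (\<integral>w. f (x(k := w)) \<partial>gauss_measure (\<tau> r k)) = 0"
  shows "(\<integral>x. f x \<partial>gauss_seq r) = 0"
proof -
  interpret G: prob_space "gauss_measure (\<tau> r k)" using r by (intro prob_space_gauss_measure \<tau>_pos)
  interpret S: prob_space "gauss_seq r" using r by (rule prob_space_gauss_seq)
  interpret P: pair_prob_space "gauss_measure (\<tau> r k)" "gauss_seq r" ..
  have sets: "sets (gauss_measure (\<tau> r k) \<Otimes>\<^sub>M gauss_seq r) = sets (borel \<Otimes>\<^sub>M seq_borel)"
    by (rule sets_pair_measure_cong) auto
  have m: "(\<lambda>(w, x). x(k := w)) \<in> gauss_measure (\<tau> r k) \<Otimes>\<^sub>M gauss_seq r \<rightarrow>\<^sub>M gauss_seq r"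
    using measurable_seq_upd by (simp cong: measurable_cong_sets add: sets)
  note D = gauss_seq_distr_upd[OF r, of k]
  have fm: "f \<in> borel_measurable (gauss_seq r)" using f by auto
  have "integrable (distr (gauss_measure (\<tau> r k) \<Otimes>\<^sub>M gauss_seq r) (gauss_seq r) (\<lambda>(w, x). x(k := w))) f"
    using f by (simp add: D)
  from integrable_distr[OF m this]
  have i: "integrable (gauss_measure (\<tau> r k) \<Otimes>\<^sub>M gauss_seq r) (\<lambda>(w, x). f (x(k := w)))"
    by (simp add: case_prod_beta')
  have "(\<integral>x. f x \<partial>gauss_seq r) = (\<integral>x. f x \<partial>distr (gauss_measure (\<tau> r k) \<Otimes>\<^sub>M gauss_seq r) (gauss_seq r) (\<lambda>(w, x). x(k := w)))"
    by (simp add: D)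
  also have "\<dots> = (\<integral>p. (case p of (w, x) \<Rightarrow> f (x(k := w))) \<partial>(gauss_measure (\<tau> r k) \<Otimes>\<^sub>M gauss_seq r))"
    using integral_distr[OF m fm] by (simp add: case_prod_beta')
  also have "\<dots> = (\<integral>x. \<integral>w. f (x(k := w)) \<partial>gauss_measure (\<tau> r k) \<partial>gauss_seq r)"
    using P.integral_snd[OF i] by simp
  also have "\<dots> = (\<integral>x. 0 \<partial>gauss_seq r)"
    using z P.borel_measurable_lebesgue_integral by (intro integral_cong_AE) (use i in \<open>auto intro!: P.integrable_snd[THEN borel_measurable_integrable]\<close>)
  finally show ?thesis by simp
qed

lemma gauss_seq_component:
  assumes "r \<ge> 0" "f \<in> borel_measurable borel"
  shows "(\<integral>\<^sup>+x. f (x k) \<partial>gauss_seq r) = (\<integral>\<^sup>+w. f w \<partial>gauss_measure (\<tau> r k))"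
proof -
  have D: "distr (gauss_seq r) (gauss_measure (\<tau> r k)) (\<lambda>x. x k) = gauss_measure (\<tau> r k)"
    unfolding gauss_seq_def using assms by (intro distr_PiM_component prob_space_gauss_measure \<tau>_pos) auto
  have "(\<integral>\<^sup>+w. f w \<partial>gauss_measure (\<tau> r k)) = (\<integral>\<^sup>+w. f w \<partial>distr (gauss_seq r) (gauss_measure (\<tau> r k)) (\<lambda>x. x k))"
    by (simp add: D)
  also have "\<dots> = (\<integral>\<^sup>+x. f (x k) \<partial>gauss_seq r)"
    using assms(2) by (subst nn_integral_distr) auto
  finally show ?thesis by simp
qed

text \<open>Used to exclude identically vanishing quotients, see
  \<open>divdiffs_regular\<close>.\<close>

lemma gauss_seq_AE_nonzero: "r \<ge> 0 \<Longrightarrow> AE x in gauss_seq r. \<forall>k. x k \<noteq> 0"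
proof (subst AE_all_countable, rule allI)
  fix k :: nat assume r: "r \<ge> 0"
  have "AE w in lborel. w \<noteq> (0::complex)" by (rule AE_lborel_singleton)
  then have "AE w in gauss_measure (\<tau> r k). w \<noteq> 0"
    unfolding gauss_measure_def by (subst AE_density) auto
  then show "AE x in gauss_seq r. x k \<noteq> 0"
    unfolding gauss_seq_def using r by (intro AE_PiM_component prob_space_gauss_measure \<tau>_pos) auto
qed

lemma gauss_seq_moment_bound:
  assumes "r \<ge> 0"
  shows "\<exists>C\<ge>0. \<forall>k. (\<integral>\<^sup>+x. ennreal (cmod (x k) ^ m) \<partial>gauss_seq r) \<le> ennreal C"
proof -
  define M where "M t = enn2real (\<integral>\<^sup>+w. ennreal (cmod w ^ m) \<partial>gauss_measure t)" for t
  have M: "(\<integral>\<^sup>+x. ennreal (cmod (x k) ^ m) \<partial>gauss_seq r) = ennreal (M (\<tau> r k))" for k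
    using nn_integral_gauss_moment[of "\<tau> r k" m] assms
    by (subst gauss_seq_component) (auto simp: M_def \<tau>_pos)
  \<comment> \<open>Only the variances 1 / (1 + r) and 1 occur, so the sum of their two moments
    bounds all of them.\<close>
  show ?thesis
    by (intro exI[of _ "M (1 + r) + M 1"]) (auto simp: M intro!: ennreal_leI simp: \<tau>_def M_def)
qed

lemma gauss_seq_weighted_moment:
  assumes "r \<ge> 0" "0 < \<rho>" "\<rho> < 1"
  shows "(\<integral>\<^sup>+x. (\<Sum>k. ennreal (cmod (x k) ^ m * \<rho> ^ k)) \<partial>gauss_seq r) < \<infinity>"
proof -
  obtain C where C: "C \<ge> 0" "\<And>k. (\<integral>\<^sup>+x. ennreal (cmod (x k) ^ m) \<partial>gauss_seq r) \<le> ennreal C"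
    using gauss_seq_moment_bound[OF assms(1)] by blast
  have "(\<integral>\<^sup>+x. (\<Sum>k. ennreal (cmod (x k) ^ m * \<rho> ^ k)) \<partial>gauss_seq r) =
      (\<Sum>k. \<integral>\<^sup>+x. ennreal (cmod (x k) ^ m * \<rho> ^ k) \<partial>gauss_seq r)"
    by (rule nn_integral_suminf) measurable
  also have "\<dots> = (\<Sum>k. (\<integral>\<^sup>+x. ennreal (cmod (x k) ^ m) \<partial>gauss_seq r) * ennreal (\<rho> ^ k))"
    using assms by (simp add: ennreal_mult nn_integral_multc)
  also have "\<dots> \<le> (\<Sum>k. ennreal C * ennreal (\<rho> ^ k))"
    by (intro suminf_le mult_right_mono C) auto
  also have "\<dots> = (\<Sum>k. ennreal (C * \<rho> ^ k))"
    using C assms by (simp add: ennreal_mult)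
  also have "\<dots> < \<infinity>"
    using C assms by (subst suminf_ennreal2) (auto intro!: summable_mult summable_geometric)
  finally show ?thesis .
qed

lemma gauss_seq_AE_summable_power:
  assumes "r \<ge> 0" "0 < \<rho>" "\<rho> < 1"
  shows "AE x in gauss_seq r. summable (\<lambda>k. cmod (x k) ^ m * \<rho> ^ k)"
proof -
  have "AE x in gauss_seq r. (\<Sum>k. ennreal (cmod (x k) ^ m * \<rho> ^ k)) \<noteq> \<infinity>"
    using gauss_seq_weighted_moment[OF assms, of m] by (intro nn_integral_noteq_infinite) auto
  then show ?thesis
  proof eventually_elim
    fix x :: "nat \<Rightarrow> complex"
    assume "(\<Sum>k. ennreal (cmod (x k) ^ m * \<rho> ^ k)) \<noteq> \<infinity>"
    then show "summable (\<lambda>k. cmod (x k) ^ m * \<rho> ^ k)"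
      using assms by (intro summable_suminf_not_top) auto
  qed
qed

lemma gauss_seq_AE_wsummable:
  assumes "r \<ge> 0" "0 < \<rho>" "\<rho> < 1"
  shows "AE x in gauss_seq r. wsummable \<rho> x"
  using gauss_seq_AE_summable_power[OF assms, of 1] by (simp add: wsummable_def)

text \<open>Write \<rho>^k as the square of sqrt(\<rho>)^k. One factor gives |x_k| sqrt(\<rho>)^k
  \<le> S^(1/m), where S is the sum of m-th powers; the other sums to 1 / (1 - sqrt \<rho>). Moments
  of the norm are thereby reduced to moments of single coordinates.\<close>

lemma wnorm_power_le:
  assumes "0 < \<rho>" "\<rho> < 1" "summable (\<lambda>k. cmod (x k) ^ m * (sqrt \<rho> ^ m) ^ k)" "wsummable \<rho> x" "m > 0"
  shows "wnorm \<rho> x ^ m \<le> (1 / (1 - sqrt \<rho>)) ^ m * (\<Sum>k. cmod (x k) ^ m * (sqrt \<rho> ^ m) ^ k)"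
proof -
  define S where "S = (\<Sum>k. cmod (x k) ^ m * (sqrt \<rho> ^ m) ^ k)"
  have sq: "0 < sqrt \<rho>" "sqrt \<rho> < 1" using assms by auto
  have S0: "S \<ge> 0" unfolding S_def using assms by (intro suminf_nonneg) auto
  have le: "cmod (x k) * sqrt \<rho> ^ k \<le> root m S" for k
  proof -
    have "sum (\<lambda>k. cmod (x k) ^ m * (sqrt \<rho> ^ m) ^ k) {k} \<le> S"
      unfolding S_def using assms by (intro sum_le_suminf) auto
    moreover have "(cmod (x k) * sqrt \<rho> ^ k) ^ m = cmod (x k) ^ m * (sqrt \<rho> ^ m) ^ k"
      by (simp only: power_mult_distrib power_mult[symmetric] mult.commute[of k m])
    moreover have "root m S ^ m = S"
      using assms(5) S0 by simp
    ultimately have "(cmod (x k) * sqrt \<rho> ^ k) ^ m \<le> root m S ^ m"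
      by simp
    moreover have "0 \<le> cmod (x k) * sqrt \<rho> ^ k" "0 \<le> root m S"
      using sq S0 assms(5) by auto
    ultimately show ?thesis
      using power_mono_iff assms(5) by blast
  qed
  have "wnorm \<rho> x \<le> (\<Sum>k. root m S * sqrt \<rho> ^ k)"
    unfolding wnorm_def
  proof (rule suminf_le)
    fix k
    have "cmod (x k) * \<rho> ^ k = cmod (x k) * sqrt \<rho> ^ k * sqrt \<rho> ^ k"
      using assms(1) by (simp add: mult.assoc power_mult_distrib[symmetric])
    also have "\<dots> \<le> root m S * sqrt \<rho> ^ k"
      using sq by (intro mult_right_mono le) auto
    finally show "cmod (x k) * \<rho> ^ k \<le> root m S * sqrt \<rho> ^ k" .
  qed (use assms sq in \<open>auto simp: wsummable_def intro!: summable_mult summable_geometric\<close>)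
  also have "\<dots> = root m S * (1 / (1 - sqrt \<rho>))"
    using sq by (subst suminf_mult) (auto simp: suminf_geometric intro!: summable_geometric)
  finally have "wnorm \<rho> x ^ m \<le> (root m S * (1 / (1 - sqrt \<rho>))) ^ m"
    using assms by (intro power_mono wnorm_nonneg) auto
  also have "\<dots> = (1 / (1 - sqrt \<rho>)) ^ m * S"
    using assms(5) S0 by (simp add: power_mult_distrib power_divide)
  finally show ?thesis by (simp add: S_def)
qed

lemma integrable_wnorm_power:
  assumes "r \<ge> 0" "0 < \<rho>" "\<rho> < 1"
  shows "integrable (gauss_seq r) (\<lambda>x. wnorm \<rho> x ^ m)"
proof (cases "m = 0")
  case True
  then show ?thesis
    using prob_space.finite_measure[OF prob_space_gauss_seq[OF assms(1)]]
    by (simp add: finite_measure.integrable_const)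
next
  case False
  let ?\<sigma> = "sqrt \<rho> ^ m" and ?K = "(1 / (1 - sqrt \<rho>)) ^ m"
  have sg: "0 < ?\<sigma>" "?\<sigma> < 1" using assms False by (auto simp: power_less_one_iff)
  have K: "?K \<ge> 0" using assms by auto
  have "AE x in gauss_seq r. wsummable \<rho> x" "AE x in gauss_seq r. summable (\<lambda>k. cmod (x k) ^ m * ?\<sigma> ^ k)"
    by (intro gauss_seq_AE_wsummable gauss_seq_AE_summable_power assms sg)+
  then have "AE x in gauss_seq r. ennreal (norm (wnorm \<rho> x ^ m)) \<le> ennreal ?K * (\<Sum>k. ennreal (cmod (x k) ^ m * ?\<sigma> ^ k))"
  proof eventually_elim
    case (elim x)
    have "(\<Sum>k. ennreal (cmod (x k) ^ m * ?\<sigma> ^ k)) = ennreal (\<Sum>k. cmod (x k) ^ m * ?\<sigma> ^ k)"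
      using elim(2) sg by (intro suminf_ennreal2) auto
    moreover have "0 \<le> wnorm \<rho> x" using wnorm_nonneg elim(1) assms by blast
    ultimately show ?case
      using wnorm_power_le[OF assms(2,3) elim(2,1)] False K
      by (auto simp: ennreal_mult'[symmetric] intro!: ennreal_leI)
  qed
  then have "(\<integral>\<^sup>+x. ennreal (norm (wnorm \<rho> x ^ m)) \<partial>gauss_seq r) \<le>
      (\<integral>\<^sup>+x. ennreal ?K * (\<Sum>k. ennreal (cmod (x k) ^ m * ?\<sigma> ^ k)) \<partial>gauss_seq r)"
    by (rule nn_integral_mono_AE)
  also have "\<dots> = ennreal ?K * (\<integral>\<^sup>+x. (\<Sum>k. ennreal (cmod (x k) ^ m * ?\<sigma> ^ k)) \<partial>gauss_seq r)"
    by (rule nn_integral_cmult) measurable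
  also have "\<dots> < \<infinity>"
    using gauss_seq_weighted_moment[OF assms(1) sg, of m] by (simp add: ennreal_mult_less_top)
  finally show ?thesis by (intro integrableI_bounded) auto
qed

text \<open>Integrands of polynomial growth in the norm: closed under sums and products, and
  integrable because all moments of the norm are finite. The bound is asked on \<rho>-summable
  sequences, a set of full measure when \<rho> < 1, since \<open>suminf\<close> has no meaningful
  value elsewhere.\<close>

definition poly_bounded :: "real \<Rightarrow> ((nat \<Rightarrow> complex) \<Rightarrow> complex) \<Rightarrow> bool" where
  "poly_bounded \<rho> f \<longleftrightarrow> f \<in> borel_measurable seq_borel \<and>
     (\<exists>C\<ge>0. \<exists>m. \<forall>x. wsummable \<rho> x \<longrightarrow> cmod (f x) \<le> C * (1 + wnorm \<rho> x) ^ m)"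

lemma poly_boundedI:
  assumes "f \<in> borel_measurable seq_borel" "C \<ge> 0"
    "\<And>x. wsummable \<rho> x \<Longrightarrow> cmod (f x) \<le> C * (1 + wnorm \<rho> x) ^ m"
  shows "poly_bounded \<rho> f"
  using assms unfolding poly_bounded_def by blast

lemma poly_bounded_const: "poly_bounded \<rho> (\<lambda>_. c)"
  by (rule poly_boundedI[where C = "cmod c" and m = 0]) auto

lemma poly_bounded_mult:
  assumes "poly_bounded \<rho> f" "poly_bounded \<rho> g" "\<rho> > 0"
  shows "poly_bounded \<rho> (\<lambda>x. f x * g x)"
proof -
  obtain C m D n where f: "f \<in> borel_measurable seq_borel" "C \<ge> 0" "\<And>x. wsummable \<rho> x \<Longrightarrow> cmod (f x) \<le> C * (1 + wnorm \<rho> x) ^ m"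
    and g: "g \<in> borel_measurable seq_borel" "D \<ge> 0" "\<And>x. wsummable \<rho> x \<Longrightarrow> cmod (g x) \<le> D * (1 + wnorm \<rho> x) ^ n"
    using assms unfolding poly_bounded_def by metis
  show ?thesis
  proof (rule poly_boundedI[where C = "C * D" and m = "m + n"])
    fix x assume x: "wsummable \<rho> x"
    have "cmod (f x) * cmod (g x) \<le> (C * (1 + wnorm \<rho> x) ^ m) * (D * (1 + wnorm \<rho> x) ^ n)"
      using x f g wnorm_nonneg[OF x assms(3)] by (intro mult_mono) auto
    then show "cmod (f x * g x) \<le> C * D * (1 + wnorm \<rho> x) ^ (m + n)"
      by (simp add: norm_mult power_add mult_ac)
  qed (use f g in auto)
qed

lemma poly_bounded_add:
  assumes "poly_bounded \<rho> f" "poly_bounded \<rho> g" "\<rho> > 0"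
  shows "poly_bounded \<rho> (\<lambda>x. f x + g x)"
proof -
  obtain C m D n where f: "f \<in> borel_measurable seq_borel" "C \<ge> 0" "\<And>x. wsummable \<rho> x \<Longrightarrow> cmod (f x) \<le> C * (1 + wnorm \<rho> x) ^ m"
    and g: "g \<in> borel_measurable seq_borel" "D \<ge> 0" "\<And>x. wsummable \<rho> x \<Longrightarrow> cmod (g x) \<le> D * (1 + wnorm \<rho> x) ^ n"
    using assms unfolding poly_bounded_def by metis
  show ?thesis
  proof (rule poly_boundedI[where C = "C + D" and m = "m + n"])
    fix x assume x: "wsummable \<rho> x"
    have 1: "1 \<le> 1 + wnorm \<rho> x" using wnorm_nonneg[OF x assms(3)] by simp
    have "cmod (f x + g x) \<le> C * (1 + wnorm \<rho> x) ^ m + D * (1 + wnorm \<rho> x) ^ n"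
      using f(3)[OF x] g(3)[OF x] norm_triangle_ineq[of "f x" "g x"] by linarith
    also have "\<dots> \<le> C * (1 + wnorm \<rho> x) ^ (m + n) + D * (1 + wnorm \<rho> x) ^ (m + n)"
      using f g 1 by (intro add_mono mult_left_mono power_increasing) auto
    finally show "cmod (f x + g x) \<le> (C + D) * (1 + wnorm \<rho> x) ^ (m + n)"
      by (simp add: algebra_simps)
  qed (use f g in auto)
qed

lemma poly_bounded_cnj: "poly_bounded \<rho> f \<Longrightarrow> poly_bounded \<rho> (\<lambda>x. cnj (f x))"
  unfolding poly_bounded_def using measurable_compose[OF _ measurable_cnj] by auto

lemma poly_bounded_sum:
  assumes "\<And>i. i \<in> I \<Longrightarrow> poly_bounded \<rho> (f i)" "\<rho> > 0"
  shows "poly_bounded \<rho> (\<lambda>x. \<Sum>i\<in>I. f i x)"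
proof (cases "finite I")
  case True
  then show ?thesis using assms(1)
    by (induction I) (auto simp: poly_bounded_const intro!: poly_bounded_add assms(2))
qed (simp add: poly_bounded_const)

lemma poly_bounded_prod:
  assumes "\<And>i. i \<in> I \<Longrightarrow> poly_bounded \<rho> (f i)" "\<rho> > 0"
  shows "poly_bounded \<rho> (\<lambda>x. \<Prod>i\<in>I. f i x)"
proof (cases "finite I")
  case True
  then show ?thesis using assms(1)
    by (induction I) (auto simp: poly_bounded_const intro!: poly_bounded_mult assms(2))
qed (simp add: poly_bounded_const)

lemma poly_bounded_integrable:
  assumes "poly_bounded \<rho> f" "r \<ge> 0" "0 < \<rho>" "\<rho> < 1"
  shows "integrable (gauss_seq r) f"
proof -
  obtain C m where f: "f \<in> borel_measurable seq_borel" "C \<ge> 0"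
    "\<And>x. wsummable \<rho> x \<Longrightarrow> cmod (f x) \<le> C * (1 + wnorm \<rho> x) ^ m"
    using assms(1) unfolding poly_bounded_def by metis
  have "integrable (gauss_seq r) (\<lambda>x. C * (\<Sum>j\<le>m. of_nat (m choose j) * wnorm \<rho> x ^ j))"
    by (intro integrable_mult_right Bochner_Integration.integrable_sum integrable_wnorm_power assms)
  moreover have "(1 + wnorm \<rho> x) ^ m = (\<Sum>j\<le>m. of_nat (m choose j) * wnorm \<rho> x ^ j)" for x
    using binomial_ring[of "wnorm \<rho> x" 1 m] by (simp add: add.commute)
  ultimately have "integrable (gauss_seq r) (\<lambda>x. C * (1 + wnorm \<rho> x) ^ m)"
    by (simp only:)
  then show ?thesis
  proof (rule Bochner_Integration.integrable_bound)
    show "f \<in> borel_measurable (gauss_seq r)" using f(1) by simp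
    show "AE x in gauss_seq r. norm (f x) \<le> norm (C * (1 + wnorm \<rho> x) ^ m)"
      using gauss_seq_AE_wsummable[OF assms(2-4)]
    proof eventually_elim
      case (elim x)
      show ?case
        by (rule order_trans[OF f(3)[OF elim]]) (simp only: real_norm_def abs_ge_self)
    qed
  qed
qed


section \<open>Zeros of random power series\<close>

text \<open>The radii 1 - 1 / (n + 2) start at 1 / 2 and increase to 1. A countable family stands in
  for all \<rho> < 1, so that measurability and almost sure statements follow by countable
  intersection.\<close>

definition wsummable_all :: "(nat \<Rightarrow> complex) \<Rightarrow> bool" where
  "wsummable_all x \<longleftrightarrow> (\<forall>n::nat. wsummable (1 - 1 / (real n + 2)) x)"

lemma wsummable_mono:
  assumes "wsummable \<sigma> x" "0 < \<rho>" "\<rho> \<le> \<sigma>"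
  shows "wsummable \<rho> x"
  using assms(1) unfolding wsummable_def
  by (rule summable_comparison_test'[where N = 0]) (use assms in \<open>auto intro!: mult_left_mono power_mono\<close>)

lemma wsummable_all_iff: "wsummable_all x \<longleftrightarrow> (\<forall>\<rho>. 0 < \<rho> \<and> \<rho> < 1 \<longrightarrow> wsummable \<rho> x)"
proof
  assume x: "wsummable_all x"
  show "\<forall>\<rho>. 0 < \<rho> \<and> \<rho> < 1 \<longrightarrow> wsummable \<rho> x"
  proof (intro allI impI)
    fix \<rho> :: real assume \<rho>: "0 < \<rho> \<and> \<rho> < 1"
    obtain n :: nat where n: "1 / (1 - \<rho>) < real n" using reals_Archimedean2 by blast
    have "1 / (real n + 2) \<le> 1 - \<rho>"
    proof -
      have "1 < real n * (1 - \<rho>)" using n \<rho> by (simp add: field_simps)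
      also have "\<dots> \<le> (real n + 2) * (1 - \<rho>)" using \<rho> by (intro mult_right_mono) auto
      finally show ?thesis by (simp add: field_simps)
    qed
    then have "\<rho> \<le> 1 - 1 / (real n + 2)" by linarith
    moreover have "wsummable (1 - 1 / (real n + 2)) x"
      using x unfolding wsummable_all_def by (rule spec)
    ultimately show "wsummable \<rho> x"
      using \<rho> wsummable_mono by blast
  qed
next
  assume "\<forall>\<rho>. 0 < \<rho> \<and> \<rho> < 1 \<longrightarrow> wsummable \<rho> x"
  moreover have "0 < 1 - 1 / (real n + 2)" "1 - 1 / (real n + 2) < 1" for n :: nat
    by (simp_all add: field_simps)
  ultimately show "wsummable_all x"
    unfolding wsummable_all_def by blast
qed

lemma wsummable_all_D: "wsummable_all x \<Longrightarrow> 0 < \<rho> \<Longrightarrow> \<rho> < 1 \<Longrightarrow> wsummable \<rho> x"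
  by (simp add: wsummable_all_iff)

lemma gauss_seq_AE_wsummable_all: "r \<ge> 0 \<Longrightarrow> AE x in gauss_seq r. wsummable_all x"
  unfolding wsummable_all_def
  by (subst AE_all_countable, rule allI, rule gauss_seq_AE_wsummable) (auto simp: field_simps)

lemma measurable_wsummable [measurable]:
  assumes "\<rho> > 0"
  shows "Measurable.pred seq_borel (wsummable \<rho>)"
proof -
  have "wsummable \<rho> x \<longleftrightarrow> (\<Sum>k. ennreal (cmod (x k) * \<rho> ^ k)) \<noteq> \<infinity>" for x
  proof
    assume "wsummable \<rho> x"
    then show "(\<Sum>k. ennreal (cmod (x k) * \<rho> ^ k)) \<noteq> \<infinity>"
      unfolding wsummable_def using assms by (subst suminf_ennreal2) auto
  next
    assume "(\<Sum>k. ennreal (cmod (x k) * \<rho> ^ k)) \<noteq> \<infinity>"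
    then show "wsummable \<rho> x"
      unfolding wsummable_def using assms by (intro summable_suminf_not_top) auto
  qed
  moreover have "Measurable.pred seq_borel (\<lambda>x. (\<Sum>k. ennreal (cmod (x k) * \<rho> ^ k)) \<noteq> \<infinity>)"
    by measurable
  ultimately show ?thesis by presburger
qed

lemma measurable_wsummable_all [measurable]: "Measurable.pred seq_borel wsummable_all"
proof -
  have "Measurable.pred seq_borel (\<lambda>x. wsummable (1 - 1 / (real n + 2)) x)" for n :: nat
    by (rule measurable_wsummable) (simp add: field_simps)
  then have "Measurable.pred seq_borel (\<lambda>x. \<forall>n. wsummable (1 - 1 / (real n + 2)) x)"
    by (rule pred_intros_countable)
  then show ?thesis by (simp add: wsummable_all_def[abs_def])
qed

lemma wsummable_all_upd: "wsummable_all x \<Longrightarrow> wsummable_all (x(n := w))"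
  by (auto simp: wsummable_all_iff intro: wsummable_upd)

lemma obtain_radius:
  assumes "cmod a < 1"
  obtains \<rho> where "cmod a < \<rho>" "0 < \<rho>" "\<rho> < 1"
  using assms dense[of "cmod a" 1] norm_ge_zero[of a] by (meson le_less_trans)

lemma wsummable_all_divdiff:
  assumes "wsummable_all x" "cmod a < 1"
  shows "wsummable_all (divdiff a x)"
  unfolding wsummable_all_iff
proof (intro allI impI)
  fix \<rho> :: real assume \<rho>: "0 < \<rho> \<and> \<rho> < 1"
  obtain \<sigma> where \<sigma>: "max \<rho> (cmod a) < \<sigma>" "\<sigma> < 1" using dense[of "max \<rho> (cmod a)" 1] \<rho> assms(2) by auto
  have "wsummable \<sigma> (divdiff a x)"
    using \<sigma> \<rho> assms by (intro divdiff_bound(1) wsummable_all_D) auto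
  then show "wsummable \<rho> (divdiff a x)" using \<sigma> \<rho> wsummable_mono[of \<sigma> "divdiff a x" \<rho>] by simp
qed

lemma wsummable_all_divdiffs:
  "wsummable_all x \<Longrightarrow> (\<And>i. i < n \<Longrightarrow> cmod (z i) < 1) \<Longrightarrow> wsummable_all (divdiffs n z x)"
  by (induction n) (auto simp: wsummable_all_divdiff)

lemma pseries_holomorphic:
  assumes "wsummable_all x"
  shows "pseries x holomorphic_on ball 0 1"
proof (rule power_series_holomorphic)
  fix w :: complex assume "w \<in> ball 0 1"
  then have "cmod w < 1" by simp
  then obtain \<rho> where "cmod w < \<rho>" "0 < \<rho>" "\<rho> < 1" by (rule obtain_radius)
  then have "summable (\<lambda>n. x n * w ^ n)"
    using assms by (intro pseries_summable[of \<rho>] wsummable_all_D) auto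
  then show "(\<lambda>n. x n * (w - 0) ^ n) sums pseries x w"
    unfolding pseries_def by (simp add: summable_sums)
qed

lemma pseries_divdiff':
  assumes "wsummable_all x" "cmod a < 1" "cmod w < 1"
  shows "pseries x w = pseries x a + (w - a) * pseries (divdiff a x) w"
proof -
  obtain \<sigma> where \<sigma>: "max (cmod w) (cmod a) < \<sigma>" "\<sigma> < 1" using dense[of "max (cmod w) (cmod a)" 1] assms by auto
  moreover have "0 < \<sigma>" using \<sigma> norm_ge_zero[of a] by linarith
  ultimately show ?thesis using assms by (intro pseries_divdiff[of \<sigma>] wsummable_all_D) auto
qed

text \<open>In the factorisation x(w) = x(a) + (w - a) q(w) the product rule at a leaves only
  q(a).\<close>

lemma deriv_pseries:
  assumes "wsummable_all x" "cmod a < 1"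
  shows "deriv (pseries x) a = pseries (divdiff a x) a"
proof -
  let ?q = "pseries (divdiff a x)"
  have q: "?q holomorphic_on ball 0 1"
    using assms by (intro pseries_holomorphic wsummable_all_divdiff)
  have "((\<lambda>w. pseries x a + (w - a) * ?q w) has_field_derivative (1 - 0) * ?q a + deriv ?q a * (a - a)) (at a)"
    using holomorphic_derivI[OF q, of a] assms(2)
    by (auto intro!: derivative_eq_intros)
  then have "((\<lambda>w. pseries x a + (w - a) * ?q w) has_field_derivative ?q a) (at a)" by simp
  then have "(pseries x has_field_derivative ?q a) (at a)"
  proof (rule has_field_derivative_transform_within_open[of _ _ _ "ball 0 1"])
    fix w :: complex assume "w \<in> ball 0 1"
    then show "pseries x a + (w - a) * ?q w = pseries x w"
      using pseries_divdiff'[OF assms, of w] by simp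
  qed (use assms in auto)
  then show ?thesis by (rule DERIV_imp_deriv)
qed

section \<open>Isolated zeros and measurability of their number\<close>

definition regular_seqs :: "(nat \<Rightarrow> complex) set" where
  "regular_seqs = {y. wsummable_all y \<and> y \<noteq> (\<lambda>_. 0)}"

lemma measurable_regular_seqs [measurable]: "regular_seqs \<in> sets seq_borel"
proof -
  have "{y \<in> space seq_borel. wsummable_all y \<and> (\<exists>k. y k \<noteq> 0)} \<in> sets seq_borel"
    by measurable
  moreover have "{y \<in> space seq_borel. wsummable_all y \<and> (\<exists>k. y k \<noteq> 0)} = regular_seqs"
    by (auto simp: regular_seqs_def fun_eq_iff space_PiM)
  ultimately show ?thesis by metis
qed

lemma finite_zeros:
  assumes y: "y \<in> regular_seqs" and \<rho>: "\<rho> < 1" and L: "L \<subseteq> cball 0 \<rho>"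
  shows "finite {v \<in> L. pseries y v = 0}"
proof -
  have hol: "pseries y holomorphic_on ball 0 1"
    using y by (auto simp: regular_seqs_def intro: pseries_holomorphic)
  have "finite {v \<in> cball 0 \<rho>. pseries y v = 0}"
  proof (cases "pseries y constant_on ball 0 1")
    case False
    then show ?thesis
      using \<rho> by (intro holomorphic_compact_finite_zeros[OF hol]) auto
  next
    case True
    then obtain c where c: "\<And>v. v \<in> ball 0 1 \<Longrightarrow> pseries y v = c" by (auto simp: constant_on_def)
    \<comment> \<open>The constant 0 is excluded because some coefficient is nonzero, and a
      nontrivial power series does not vanish in a punctured disc around the origin.\<close>
    have "c \<noteq> 0"
    proof
      assume c0: "c = 0"
      have "pseries y 0 = y 0"
        unfolding pseries_def by (subst suminf_finite[of "{0}"]) auto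
      with c[of 0] c0 have "y 0 = 0" by simp
      moreover obtain m where "y m \<noteq> 0" using y by (auto simp: regular_seqs_def)
      ultimately have m: "y m \<noteq> 0" "m > 0" by (auto intro: gr0I)
      have "(\<lambda>n. y n * (x - 0) ^ n) sums pseries y x" if "norm (x - 0) < 1" for x
      proof -
        have "cmod x < 1" using that by simp
        then obtain \<rho> where "cmod x < \<rho>" "0 < \<rho>" "\<rho> < 1" by (rule obtain_radius)
        then have "summable (\<lambda>n. y n * x ^ n)"
          using y by (intro pseries_summable[of \<rho>] wsummable_all_D) (auto simp: regular_seqs_def)
        then show ?thesis unfolding pseries_def by (simp add: summable_sums)
      qed
      then obtain s where s: "s > 0" "\<And>v. v \<in> cball 0 s - {0} \<Longrightarrow> pseries y v \<noteq> 0"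
        using powser_0_nonzero[of 1 0 y "pseries y" m] c[of 0] c0 m by auto
      define v where "v = complex_of_real (min s (1 / 2))"
      have "cmod v = min s (1 / 2)" using s(1) by (simp add: v_def)
      then have "v \<in> cball 0 s - {0}" "v \<in> ball 0 1" using s(1) by auto
      then show False using s(2) c c0 by blast
    qed
    then have e: "{v \<in> cball 0 \<rho>. pseries y v = 0} = {}" using c \<rho> by auto
    show ?thesis unfolding e by simp
  qed
  then show ?thesis by (rule finite_subset[rotated]) (use L in auto)
qed

lemma measurable_pseries [measurable (raw)]:
  assumes "\<And>k. (\<lambda>u. x u k) \<in> borel_measurable M" "a \<in> borel_measurable M"
  shows "(\<lambda>u. pseries (x u) (a u)) \<in> borel_measurable M"
  unfolding pseries_def using assms by measurable

text \<open>On a compact set a continuous function has a zero exactly when its modulus takes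
  arbitrarily small values, and these can be sought on a countable dense subset. This turns an
  uncountable union into countable operations.\<close>

lemma measurable_exists_zero:
  assumes "compact C" "C \<subseteq> ball 0 1"
  shows "{y \<in> regular_seqs. \<exists>v\<in>C. pseries y v = 0} \<in> sets seq_borel"
proof -
  obtain T where T: "countable T" "T \<subseteq> C" "C \<subseteq> closure T" by (rule separable)
  have "(\<exists>v\<in>C. pseries y v = 0) \<longleftrightarrow> (\<forall>n::nat. \<exists>v\<in>T. cmod (pseries y v) < 1 / (real n + 1))"
    if y: "y \<in> regular_seqs" for y
  proof
    have cont: "continuous_on C (pseries y)"
      using y pseries_holomorphic assms(2)
      by (auto simp: regular_seqs_def intro!: holomorphic_on_imp_continuous_on intro: holomorphic_on_subset)
    {
      assume "\<exists>v\<in>C. pseries y v = 0"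
      then obtain v where v: "v \<in> C" "pseries y v = 0" by auto
      show "\<forall>n::nat. \<exists>v\<in>T. cmod (pseries y v) < 1 / (real n + 1)"
      proof
        fix n :: nat
        have "0 < 1 / (real n + 1)" by simp
        then obtain d where d: "d > 0" "\<And>u. u \<in> C \<Longrightarrow> dist u v < d \<Longrightarrow> dist (pseries y u) (pseries y v) < 1 / (real n + 1)"
          using cont v(1) unfolding continuous_on_iff by metis
        obtain u where "u \<in> T" "dist u v < d"
          using T(3) v(1) d(1) closure_approachable by blast
        then show "\<exists>v\<in>T. cmod (pseries y v) < 1 / (real n + 1)"
          using d(2)[of u] T(2) v(2) by (auto simp: dist_norm)
      qed
    next
      assume *: "\<forall>n::nat. \<exists>v\<in>T. cmod (pseries y v) < 1 / (real n + 1)"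
      then have "C \<noteq> {}" using T(2) by auto
      then obtain v where v: "v \<in> C" "\<And>u. u \<in> C \<Longrightarrow> cmod (pseries y v) \<le> cmod (pseries y u)"
        using continuous_attains_inf[OF assms(1), of "\<lambda>v. cmod (pseries y v)"] cont by (auto intro: continuous_intros)
      have "cmod (pseries y v) < 1 / (real n + 1)" for n :: nat
        using * v(2) T(2) by (meson le_less_trans subset_iff)
      then have "\<not> cmod (pseries y v) > 0"
        using nat_approx_posE[of "cmod (pseries y v)"] by (metis add.commute less_irrefl less_trans of_nat_Suc)
      then show "\<exists>v\<in>C. pseries y v = 0" using v(1) by auto
    }
  qed
  then have eq: "{y \<in> regular_seqs. \<exists>v\<in>C. pseries y v = 0} =
      regular_seqs \<inter> (\<Inter>n::nat. \<Union>v\<in>T. {y \<in> space seq_borel. cmod (pseries y v) < 1 / (real n + 1)})"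
    by (auto simp: space_PiM)
  have "{y \<in> space seq_borel. cmod (pseries y v) < 1 / (real n + 1)} \<in> sets seq_borel" for v and n :: nat
    by measurable
  then have "(\<Union>v\<in>T. {y \<in> space seq_borel. cmod (pseries y v) < 1 / (real n + 1)}) \<in> sets seq_borel" for n :: nat
    using T(1) by (intro sets.countable_UN'')
  then have "(\<Inter>n::nat. \<Union>v\<in>T. {y \<in> space seq_borel. cmod (pseries y v) < 1 / (real n + 1)}) \<in> sets seq_borel"
    by (intro sets.countable_INT image_subsetI) auto
  then show ?thesis unfolding eq by measurable
qed

text \<open>There are at least k zeros in C exactly when k pairwise disjoint balls from a fixed
  countable family each contain a zero in C, because finitely many zeros can be separated by small
  balls of the family.\<close>

lemma measurable_zeros_ge:
  assumes C: "compact C" "C \<subseteq> ball 0 1"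
  shows "{y \<in> regular_seqs. k \<le> card {v \<in> C. pseries y v = 0}} \<in> sets seq_borel"
proof -
  obtain T :: "complex set" where T: "countable T" "UNIV \<subseteq> closure T" using separable[of "UNIV :: complex set"] by auto
  have "T \<noteq> {}" using T(2) by auto
  \<comment> \<open>The index j codes a centre from the dense set T and a radius 1 / (n +
    1).\<close>
  define B where "B j = cball (from_nat_into T (fst (prod_decode j))) (1 / (real (snd (prod_decode j)) + 1))" for j :: nat
  let ?J = "{I. finite I \<and> card I = k \<and> disjoint_family_on B I}"
  have "k \<le> card {v \<in> C. pseries y v = 0} \<longleftrightarrow> (\<exists>I\<in>?J. \<forall>i\<in>I. \<exists>v \<in> C \<inter> B i. pseries y v = 0)"
    if y: "y \<in> regular_seqs" for y
  proof
    let ?Z = "{v \<in> C. pseries y v = 0}"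
    obtain \<rho> where \<rho>: "\<rho> < 1" "C \<subseteq> cball 0 \<rho>"
    proof (cases "C = {}")
      case False
      obtain u where "u \<in> C" "\<And>v. v \<in> C \<Longrightarrow> cmod v \<le> cmod u"
        using continuous_attains_sup[OF C(1) False, of cmod] by (auto intro: continuous_intros)
      then have "C \<subseteq> cball 0 (cmod u)" "cmod u < 1" using C(2) by auto
      then show ?thesis using that by blast
    qed (use that[of 0] in auto)
    have fin: "finite ?Z" using y \<rho> by (rule finite_zeros)
    {
      assume "\<exists>I\<in>?J. \<forall>i\<in>I. \<exists>v \<in> C \<inter> B i. pseries y v = 0"
      then obtain I where I: "finite I" "card I = k" "disjoint_family_on B I"
        and "\<forall>i\<in>I. \<exists>v \<in> C \<inter> B i. pseries y v = 0"
        by auto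
      then obtain f where f: "\<And>i. i \<in> I \<Longrightarrow> f i \<in> C \<inter> B i \<and> pseries y (f i) = 0"
        by metis
      have "inj_on f I"
        using I(3) f unfolding inj_on_def disjoint_family_on_def by (metis IntD2 IntI empty_iff)
      moreover have "f ` I \<subseteq> ?Z" using f by auto
      ultimately show "k \<le> card ?Z" using card_inj_on_le[of f I ?Z] fin I(2) by simp
    next
      assume "k \<le> card ?Z"
      then obtain S where S: "S \<subseteq> ?Z" "card S = k" "finite S" by (rule obtain_subset_with_card_n)
      define D where "D = {dist p q |p q. p \<in> S \<and> q \<in> S \<and> p \<noteq> q}"
      have "D \<subseteq> (\<lambda>(p, q). dist p q) ` (S \<times> S)" by (auto simp: D_def)
      then have finD: "finite D" using S(3) finite_subset by blast
      \<comment> \<open>The least distance between chosen zeros; the inserted 1 keeps the set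
        nonempty when S has fewer than two points. Balls of radius below e / 4 around centres that
        close to the zeros stay within e / 2 of them and are therefore disjoint.\<close>
      define e where "e = Min (insert 1 D)"
      have "\<forall>d\<in>insert 1 D. d > 0" by (auto simp: D_def)
      then have e0: "e > 0" unfolding e_def using finD by (subst Min_gr_iff) auto
      have e: "e \<le> dist p q" if "p \<in> S" "q \<in> S" "p \<noteq> q" for p q
        unfolding e_def using that finD by (intro Min_le) (auto simp: D_def)
      obtain n :: nat where n: "1 / (real n + 1) < e / 4"
        using nat_approx_posE[of "e / 4"] e0 by (metis zero_less_divide_iff zero_less_numeral add.commute of_nat_Suc)
      have "\<exists>j. p \<in> B j \<and> (\<forall>u\<in>B j. dist u p < e / 2)" for p
      proof -
        have "p \<in> closure T" using T(2) by auto
        moreover have "0 < 1 / (real n + 1)" by simp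
        ultimately obtain t where t: "t \<in> T" "dist t p < 1 / (real n + 1)"
          using closure_approachable by blast
        obtain m where m: "from_nat_into T m = t" using from_nat_into_surj[OF T(1) t(1)] by auto
        have Bj: "B (prod_encode (m, n)) = cball t (1 / (real n + 1))" by (simp add: B_def m)
        have "dist u p < e / 2" if "u \<in> cball t (1 / (real n + 1))" for u
        proof -
          have "dist u p \<le> dist t u + dist t p" by (rule dist_triangle3)
          also have "\<dots> < e / 2" using that t(2) n by simp
          finally show ?thesis .
        qed
        then show ?thesis using t(2) Bj by (intro exI[of _ "prod_encode (m, n)"]) auto
      qed
      then obtain j where j: "\<And>p. p \<in> B (j p)" "\<And>p u. u \<in> B (j p) \<Longrightarrow> dist u p < e / 2" by metis
      have disj: "B (j p) \<inter> B (j q) = {}" if "p \<in> S" "q \<in> S" "p \<noteq> q" for p q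
      proof -
        have False if u: "u \<in> B (j p)" "u \<in> B (j q)" for u
          using j(2)[OF u(1)] j(2)[OF u(2)] dist_triangle3[of p q u] e[OF \<open>p \<in> S\<close> \<open>q \<in> S\<close> \<open>p \<noteq> q\<close>] by simp
        then show ?thesis by auto
      qed
      have inj: "p = q" if "p \<in> S" "q \<in> S" "j p = j q" for p q
        using disj[OF that(1,2)] j(1)[of p] that(3) by fastforce
      show "\<exists>I\<in>?J. \<forall>i\<in>I. \<exists>v \<in> C \<inter> B i. pseries y v = 0"
      proof (intro bexI[of _ "j ` S"] ballI)
        have "disjoint_family_on B (j ` S)"
          unfolding disjoint_family_on_def
        proof (intro ballI impI)
          fix a b assume "a \<in> j ` S" "b \<in> j ` S" "a \<noteq> b"
          then obtain p q where "p \<in> S" "q \<in> S" "a = j p" "b = j q" by auto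
          then show "B a \<inter> B b = {}" using disj \<open>a \<noteq> b\<close> by blast
        qed
        moreover have "inj_on j S" using inj by (rule inj_onI)
        ultimately show "j ` S \<in> ?J"
          using S(2,3) by (simp add: card_image)
        fix i assume "i \<in> j ` S"
        then show "\<exists>v \<in> C \<inter> B i. pseries y v = 0" using S(1) j(1) by auto
      qed
    }
  qed
  then have eq: "{y \<in> regular_seqs. k \<le> card {v \<in> C. pseries y v = 0}} =
      regular_seqs \<inter> (\<Union>I\<in>?J. regular_seqs \<inter> (\<Inter>i\<in>I. {y \<in> regular_seqs. \<exists>v \<in> C \<inter> B i. pseries y v = 0}))"
    by auto
  have cB: "closed (B i)" for i by (simp add: B_def)
  have "{y \<in> regular_seqs. \<exists>v \<in> C \<inter> B i. pseries y v = 0} \<in> sets seq_borel" for i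
    using C by (intro measurable_exists_zero compact_Int_closed cB) auto
  then have "regular_seqs \<inter> (\<Inter>i\<in>I. {y \<in> regular_seqs. \<exists>v \<in> C \<inter> B i. pseries y v = 0}) \<in> sets seq_borel" if "finite I" for I
    using that by (cases "I = {}") auto
  moreover have "countable ?J"
    by (rule countable_subset[OF _ countable_Collect_finite]) auto
  ultimately have "(\<Union>I\<in>?J. regular_seqs \<inter> (\<Inter>i\<in>I. {y \<in> regular_seqs. \<exists>v \<in> C \<inter> B i. pseries y v = 0})) \<in> sets seq_borel"
    by (intro sets.countable_UN'') auto
  then show ?thesis unfolding eq by measurable
qed

text \<open>Zeros are counted without multiplicity, as in \<open>zero_measure\<close>; multiple
  zeros are later discarded as critical values. The value 0 off \<open>regular_seqs\<close> is a
  convention on a null set.\<close>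

definition zero_count :: "complex set \<Rightarrow> (nat \<Rightarrow> complex) \<Rightarrow> nat" where
  "zero_count L y = (if y \<in> regular_seqs then card {v \<in> L. pseries y v = 0} else 0)"

lemma measurable_zero_count_compact:
  assumes "compact C" "C \<subseteq> ball 0 1"
  shows "zero_count C \<in> measurable seq_borel (count_space UNIV)"
proof (rule measurable_count_space_eq2_countable[THEN iffD2])
  have "zero_count C -` {n} \<inter> space seq_borel =
      ({y \<in> regular_seqs. n \<le> card {v \<in> C. pseries y v = 0}} - {y \<in> regular_seqs. Suc n \<le> card {v \<in> C. pseries y v = 0}})
      \<union> (if n = 0 then space seq_borel - regular_seqs else {})" for n
    by (auto simp: zero_count_def space_PiM split: if_splits)
  then have "zero_count C -` {n} \<inter> space seq_borel \<in> sets seq_borel" for n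
    using measurable_zeros_ge[OF assms] by auto
  then show "zero_count C \<in> space seq_borel \<rightarrow> UNIV \<and> (\<forall>n\<in>UNIV. zero_count C -` {n} \<inter> space seq_borel \<in> sets seq_borel)"
    by auto
qed

text \<open>A Dynkin argument starting from closed sets, where
  \<open>measurable_zero_count_compact\<close> applies. Intersecting with one disc of radius below 1
  keeps all counts finite, so complements become differences and disjoint unions become
  series.\<close>

lemma measurable_zero_count:
  assumes L: "L \<in> sets borel" "L \<subseteq> cball 0 \<rho>" and \<rho>: "\<rho> < 1"
  shows "zero_count L \<in> measurable seq_borel (count_space UNIV)"
proof -
  let ?K = "cball (0::complex) \<rho>"
  have sub: "A \<inter> ?K \<subseteq> ?K" for A :: "complex set" by auto
  have fin: "finite {v \<in> A \<inter> ?K. pseries y v = 0}" if "y \<in> regular_seqs" for y A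
    using finite_zeros[OF that \<rho> sub] .
  have "(\<lambda>y. real (zero_count (A \<inter> ?K) y)) \<in> borel_measurable seq_borel" if "A \<in> sets borel" for A
  proof -
    have "Int_stable (Collect closed :: complex set set)" "Collect closed \<subseteq> Pow (UNIV :: complex set)"
      by (auto simp: Int_stable_def)
    moreover have "A \<in> sigma_sets UNIV (Collect closed)" using that by (simp add: borel_eq_closed)
    ultimately show ?thesis
    proof (induction rule: sigma_sets_induct_disjoint)
      case (basic A)
      have "zero_count (A \<inter> ?K) \<in> measurable seq_borel (count_space UNIV)"
        using basic \<rho> by (intro measurable_zero_count_compact closed_Int_compact) auto
      then show ?case by measurable
    next
      case empty
      have "real (zero_count ({} \<inter> ?K) y) = 0" for y by (simp add: zero_count_def)
      then show ?case by simp
    next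
      case (compl A)
      have "real (zero_count ((UNIV - A) \<inter> ?K) y) = real (zero_count ?K y) - real (zero_count (A \<inter> ?K) y)" for y
      proof (cases "y \<in> regular_seqs")
        case True
        have "{v \<in> (UNIV - A) \<inter> ?K. pseries y v = 0} = {v \<in> UNIV \<inter> ?K. pseries y v = 0} - {v \<in> A \<inter> ?K. pseries y v = 0}"
          by auto
        then have "card {v \<in> (UNIV - A) \<inter> ?K. pseries y v = 0} = card {v \<in> UNIV \<inter> ?K. pseries y v = 0} - card {v \<in> A \<inter> ?K. pseries y v = 0}"
          using fin[OF True, of A] by (simp only:) (intro card_Diff_subset, auto)
        moreover have "card {v \<in> A \<inter> ?K. pseries y v = 0} \<le> card {v \<in> UNIV \<inter> ?K. pseries y v = 0}"
          using fin[OF True, of UNIV] by (intro card_mono) auto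
        ultimately show ?thesis using True by (simp add: zero_count_def of_nat_diff)
      qed (simp add: zero_count_def)
      moreover have "zero_count ?K \<in> measurable seq_borel (count_space UNIV)"
        using \<rho> by (intro measurable_zero_count_compact) auto
      ultimately show ?case using compl by simp
    next
      case (union F)
      have "(\<lambda>i. real (zero_count (F i \<inter> ?K) y)) sums real (zero_count ((\<Union>i. F i) \<inter> ?K) y)" for y
      proof (cases "y \<in> regular_seqs")
        case True
        let ?Z = "\<lambda>A. {v \<in> A \<inter> ?K. pseries y v = 0}"
        have disj: "disjoint_family (\<lambda>i. ?Z (F i))"
          using union(1) by (auto simp: disjoint_family_on_def)
        have e: "(\<Union>i. ?Z (F i)) = ?Z (\<Union>i. F i)" by auto
        have "(\<lambda>i. measure (count_space UNIV) (?Z (F i))) sums measure (count_space UNIV) (\<Union>i. ?Z (F i))"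
          using disj e fin[OF True, of "\<Union>i. F i"]
          by (intro measure_UNION) (auto simp: emeasure_count_space)
        moreover note e
        moreover have "measure (count_space UNIV) X = real (card X)" for X :: "complex set"
          by (cases "finite X") (auto simp: measure_def emeasure_count_space_finite emeasure_count_space_infinite)
        ultimately show ?thesis
          using True by (simp add: zero_count_def)
      qed (simp add: zero_count_def)
      then have "real (zero_count ((\<Union>i. F i) \<inter> ?K) y) = (\<Sum>i. real (zero_count (F i \<inter> ?K) y))" for y
        by (simp add: sums_iff)
      then show ?case using union(3) by simp
    qed
  qed
  from this[OF L(1)] have "(\<lambda>y. real (zero_count L y)) \<in> borel_measurable seq_borel"
    using L(2) by (simp add: Int_absorb2)
  then have "(\<lambda>y. real (zero_count L y)) -` {real n} \<inter> space seq_borel \<in> sets seq_borel" for n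
    by (rule measurable_sets) auto
  then have "zero_count L -` {n} \<inter> space seq_borel \<in> sets seq_borel" for n
    by (auto simp: vimage_def)
  then show ?thesis
    by (subst measurable_count_space_eq2_countable) auto
qed

lemma falling_factorial_Suc: "falling_factorial N (Suc k) = N * falling_factorial (N - 1) k"
proof (cases N)
  case (Suc M)
  show ?thesis
  proof (cases "k \<le> M")
    case True
    have "fact (M - k) dvd (fact M :: nat)" by (intro fact_dvd) simp
    then show ?thesis using True by (simp add: falling_factorial_def Suc div_mult_swap)
  qed (simp add: falling_factorial_def Suc)
qed (simp add: falling_factorial_def)

text \<open>The list \<open>js\<close> names, for each of \<open>length js\<close> distinct zeros, the index of the set containing it.\<close>
definition fact_moment :: "nat \<Rightarrow> (nat \<Rightarrow> complex set) \<Rightarrow> nat list \<Rightarrow> (nat \<Rightarrow> complex) \<Rightarrow> nat" where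
  "fact_moment m L js y = (\<Prod>i<m. falling_factorial (zero_count (L i) y) (count_list js i))"

lemma fact_moment_Nil: "fact_moment m L [] y = 1"
  by (simp add: fact_moment_def falling_factorial_def)

lemma measurable_fact_moment:
  assumes "\<And>i. i < m \<Longrightarrow> L i \<in> sets borel" "\<And>i. i < m \<Longrightarrow> L i \<subseteq> cball 0 \<rho>" "\<rho> < 1"
  shows "(\<lambda>y. ennreal (real (fact_moment m L js y))) \<in> borel_measurable seq_borel"
proof -
  have [measurable]: "zero_count (L i) \<in> measurable seq_borel (count_space UNIV)" if "i < m" for i
    using that assms by (intro measurable_zero_count) auto
  have "(\<lambda>y. \<Prod>i<m. real (falling_factorial (zero_count (L i) y) (count_list js i))) \<in> borel_measurable seq_borel"
  proof (rule borel_measurable_prod)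
    fix i assume "i \<in> {..<m}"
    then have [measurable]: "zero_count (L i) \<in> measurable seq_borel (count_space UNIV)" using assms by (intro measurable_zero_count) auto
    show "(\<lambda>y. real (falling_factorial (zero_count (L i) y) (count_list js i))) \<in> borel_measurable seq_borel"
      by measurable
  qed
  then show ?thesis by (simp add: fact_moment_def)
qed

lemma divdiff_regular:
  assumes "y \<in> regular_seqs" "cmod v < 1" "pseries (divdiff v y) v \<noteq> 0"
  shows "divdiff v y \<in> regular_seqs"
proof -
  have "divdiff v y \<noteq> (\<lambda>_. 0)"
    using assms(3) by (auto simp: pseries_def)
  then show ?thesis using assms by (auto simp: regular_seqs_def wsummable_all_divdiff)
qed

text \<open>Away from v the series and its quotient vanish together, and simplicity of the zero
  keeps v from being a zero of the quotient.\<close>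

lemma zero_count_divdiff:
  assumes y: "y \<in> regular_seqs" and v: "cmod v < 1" "pseries y v = 0" "pseries (divdiff v y) v \<noteq> 0"
    and L: "L \<subseteq> cball 0 \<rho>" "\<rho> < 1"
  shows "zero_count L (divdiff v y) = zero_count L y - (if v \<in> L then 1 else 0)"
proof -
  have "pseries (divdiff v y) w = 0 \<longleftrightarrow> pseries y w = 0 \<and> w \<noteq> v" if "w \<in> L" for w
  proof -
    have "cmod w < 1" using that L by (auto simp: subset_iff)
    then show ?thesis
      using pseries_divdiff'[of y v w] y v by (auto simp: regular_seqs_def)
  qed
  then have "{w \<in> L. pseries (divdiff v y) w = 0} = {w \<in> L. pseries y w = 0} - {v}" by auto
  moreover have "finite {w \<in> L. pseries y w = 0}" by (rule finite_zeros[OF y L(2,1)])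
  ultimately show ?thesis
    using divdiff_regular[OF y v(1,3)] y v(2) by (simp add: zero_count_def card_Diff_singleton_if)
qed

text \<open>Removing a zero in \<open>L i\<close> lowers the count of \<open>L i\<close> by one and
  leaves the other, disjoint sets alone. The summand is thus the same for every zero v, and the
  number of terms supplies the leading factor of the next falling factorial.\<close>

lemma sum_fact_moment_divdiff:
  assumes y: "y \<in> regular_seqs" and i: "i < m"
    and L: "\<And>i. i < m \<Longrightarrow> L i \<subseteq> cball 0 \<rho>" "\<rho> < 1" "disjoint_family_on L {..<m}"
    and simple: "\<And>v. v \<in> L i \<Longrightarrow> pseries y v = 0 \<Longrightarrow> pseries (divdiff v y) v \<noteq> 0"
  shows "(\<integral>\<^sup>+v. of_nat (fact_moment m L js (divdiff v y)) \<partial>count_space {v \<in> L i. pseries y v = 0}) =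
    of_nat (fact_moment m L (i # js) y)"
proof -
  let ?Z = "{v \<in> L i. pseries y v = 0}"
  have fin: "finite ?Z" by (rule finite_zeros[OF y L(2) L(1)[OF i]])
  let ?c = "falling_factorial (zero_count (L i) y - 1) (count_list js i) *
    (\<Prod>l\<in>{..<m} - {i}. falling_factorial (zero_count (L l) y) (count_list js l))"
  have 1: "fact_moment m L js (divdiff v y) = ?c" if v: "v \<in> ?Z" for v
  proof -
    have v1: "cmod v < 1" using v L(1)[OF i] L(2) by (auto simp: subset_iff)
    have ns: "pseries (divdiff v y) v \<noteq> 0" using simple v by auto
    have zc: "zero_count (L l) (divdiff v y) = zero_count (L l) y - (if l = i then 1 else 0)" if "l < m" for l
    proof -
      have "v \<in> L l \<longleftrightarrow> l = i"
        using L(3) v i that by (auto simp: disjoint_family_on_def)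
      then show ?thesis
        using zero_count_divdiff[OF y v1 _ ns L(1)[OF that] L(2)] v by auto
    qed
    have "fact_moment m L js (divdiff v y) =
        falling_factorial (zero_count (L i) (divdiff v y)) (count_list js i) *
        (\<Prod>l\<in>{..<m} - {i}. falling_factorial (zero_count (L l) (divdiff v y)) (count_list js l))"
      unfolding fact_moment_def using i by (subst prod.remove[of _ i]) auto
    also have "\<dots> = ?c"
      using i by (auto simp: zc intro!: arg_cong2[where f = "(*)"] prod.cong)
    finally show ?thesis .
  qed
  have "fact_moment m L (i # js) y = falling_factorial (zero_count (L i) y) (Suc (count_list js i)) *
      (\<Prod>l\<in>{..<m} - {i}. falling_factorial (zero_count (L l) y) (count_list (i # js) l))"
    unfolding fact_moment_def using i by (subst prod.remove[of _ i]) auto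
  also have "\<dots> = card ?Z * ?c"
    using y by (auto simp: falling_factorial_Suc zero_count_def mult.assoc intro!: prod.cong)
  finally have 2: "fact_moment m L (i # js) y = card ?Z * ?c" .
  have "(\<integral>\<^sup>+v. of_nat (fact_moment m L js (divdiff v y)) \<partial>count_space ?Z) = (\<Sum>v\<in>?Z. of_nat ?c)"
    using fin 1 by (subst nn_integral_count_space_finite) (auto simp del: of_nat_mult intro!: sum.cong)
  also have "\<dots> = of_nat (card ?Z * ?c)" by simp
  finally show ?thesis unfolding 2 .
qed


section \<open>The Kac--Rice formula\<close>

lemma measurable_seqI:
  assumes "\<And>k. (\<lambda>u. x u k) \<in> borel_measurable M"
  shows "x \<in> M \<rightarrow>\<^sub>M seq_borel"
  by (rule measurable_PiM_single') (use assms in \<open>auto simp: PiE_iff\<close>)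

lemma measurable_seqD: "x \<in> M \<rightarrow>\<^sub>M seq_borel \<Longrightarrow> (\<lambda>u. x u k) \<in> borel_measurable M"
  by (rule measurable_compose[OF _ measurable_component_singleton]) auto

lemma measurable_divdiff:
  assumes "\<And>k. (\<lambda>u. x u k) \<in> borel_measurable M" "a \<in> borel_measurable M"
  shows "(\<lambda>u. divdiff (a u) (x u) k) \<in> borel_measurable M"
  unfolding divdiff_def using assms by measurable

lemma measurable_divdiffs:
  assumes "\<And>k. (\<lambda>u. x u k) \<in> borel_measurable M" "\<And>i. i < n \<Longrightarrow> (\<lambda>u. z u i) \<in> borel_measurable M"
  shows "(\<lambda>u. divdiffs n (z u) (x u) k) \<in> borel_measurable M"
  using assms(2)
proof (induction n arbitrary: k)
  case (Suc n)
  then show ?case by (simp add: measurable_divdiff)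
qed (simp add: assms(1))

lemma measurable_lins:
  assumes "\<And>k. (\<lambda>u. y u k) \<in> borel_measurable M" "\<And>i. i < n \<Longrightarrow> (\<lambda>u. z u i) \<in> borel_measurable M"
  shows "(\<lambda>u. lins n (z u) (y u) k) \<in> borel_measurable M"
  using assms
proof (induction n arbitrary: k y)
  case (Suc n)
  have "(\<lambda>u. lin (z u n) (y u) k) \<in> borel_measurable M" for k
    unfolding lin_def using Suc.prems by (cases k) auto
  then show ?case using Suc.IH[of "\<lambda>u. lin (z u n) (y u)" k] Suc.prems(2) by simp
qed simp

lemma measurable_interp:
  assumes "\<And>k. (\<lambda>u. x u k) \<in> borel_measurable M" "\<And>i. i < n \<Longrightarrow> (\<lambda>u. z u i) \<in> borel_measurable M"
  shows "(\<lambda>u. interp n (z u) (x u) k) \<in> borel_measurable M"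
  unfolding interp_def using assms by (intro measurable_lins measurable_divdiffs)

definition vandermonde2 :: "nat \<Rightarrow> (nat \<Rightarrow> complex) \<Rightarrow> real" where
  "vandermonde2 n z = (\<Prod>j<n. \<Prod>i<j. (cmod (z i - z j))\<^sup>2)"

text \<open>The Jacobian of the first n coefficients as functions of the zeros z, the other
  coefficients being fixed, times the Gaussian density of these coefficients. If f is the full
  series, f'(z_j) = Q(z_j) \<Prod>(z_j - z_i) over i \<noteq> j, and the Jacobian |\<Prod>
  f'(z_j)|^2 / |Vandermonde|^2 is the product of the first two factors.\<close>

definition kac_rice :: "real \<Rightarrow> nat \<Rightarrow> (nat \<Rightarrow> complex) \<Rightarrow> (nat \<Rightarrow> complex) \<Rightarrow> real" where
  "kac_rice r n z x = vandermonde2 n z * (\<Prod>i<n. (cmod (pseries (divdiffs n z x) (z i)))\<^sup>2) *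
     (\<Prod>j<n. gauss_density (\<tau> r j) (interp n z x j))"

lemma kac_rice_nonneg: "r \<ge> 0 \<Longrightarrow> kac_rice r n z x \<ge> 0"
  unfolding kac_rice_def vandermonde2_def
  by (intro mult_nonneg_nonneg prod_nonneg gauss_density_nonneg \<tau>_pos ballI) auto

lemma measurable_kac_rice:
  assumes "\<And>k. (\<lambda>u. x u k) \<in> borel_measurable M" "\<And>i. i < n \<Longrightarrow> (\<lambda>u. z u i) \<in> borel_measurable M"
  shows "(\<lambda>u. kac_rice r n (z u) (x u)) \<in> borel_measurable M"
proof -
  have 1: "(\<lambda>u. \<Prod>j<n. \<Prod>i<j. (cmod (z u i - z u j))\<^sup>2) \<in> borel_measurable M"
    using assms(2) by (intro borel_measurable_prod) (auto intro!: borel_measurable_power borel_measurable_norm borel_measurable_diff)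
  have 2: "(\<lambda>u. \<Prod>i<n. (cmod (pseries (divdiffs n (z u) (x u)) (z u i)))\<^sup>2) \<in> borel_measurable M"
  proof (rule borel_measurable_prod)
    fix i assume i: "i \<in> {..<n}"
    have "(\<lambda>u. pseries (divdiffs n (z u) (x u)) (z u i)) \<in> borel_measurable M"
      by (rule measurable_pseries, rule measurable_divdiffs) (use assms i in auto)
    then show "(\<lambda>u. (cmod (pseries (divdiffs n (z u) (x u)) (z u i)))\<^sup>2) \<in> borel_measurable M"
      by simp
  qed
  have 3: "(\<lambda>u. \<Prod>j<n. gauss_density (\<tau> r j) (interp n (z u) (x u) j)) \<in> borel_measurable M"
    using assms by (intro borel_measurable_prod measurable_compose[OF _ measurable_gauss_density] measurable_interp) auto
  show ?thesis unfolding kac_rice_def vandermonde2_def using 1 2 3 by simp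
qed

lemma lins_zero: "lins n z (\<lambda>_. 0) = (\<lambda>_. 0)"
proof (induction n)
  case (Suc n)
  have "lin (z n) (\<lambda>_. 0) = (\<lambda>_. 0)" by (auto simp: lin_def split: nat.split)
  then show ?case using Suc by simp
qed simp

text \<open>A vanishing quotient would make \<open>interp\<close> vanish, which agrees with x at
  index n + 1. The condition starts above n because coefficient n is about to be replaced by an
  arbitrary w.\<close>

lemma divdiffs_regular:
  assumes "wsummable_all x" "\<And>k. x (Suc (n + k)) \<noteq> 0" "\<And>i. i < n \<Longrightarrow> cmod (z i) < 1"
  shows "divdiffs n z x \<in> regular_seqs"
proof -
  have "divdiffs n z x \<noteq> (\<lambda>_. 0)"
  proof
    assume "divdiffs n z x = (\<lambda>_. 0)"
    then have 0: "interp n z x (Suc n) = 0" by (simp add: interp_def lins_zero)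
    define \<sigma> where "\<sigma> = Max (insert (1/2) ((\<lambda>i. cmod (z i)) ` {..<n}))"
    have "\<sigma> < 1" using assms(3) by (auto simp: \<sigma>_def)
    moreover have "1/2 \<le> \<sigma>" "\<And>i. i < n \<Longrightarrow> cmod (z i) \<le> \<sigma>"
      unfolding \<sigma>_def by (rule Max_ge; simp)+
    moreover obtain \<rho> where "\<sigma> < \<rho>" "\<rho> < 1" using \<open>\<sigma> < 1\<close> dense by blast
    ultimately have "interp n z x (Suc n) = x (Suc n)"
      using assms(1) by (intro interp_ge[of \<rho>] wsummable_all_D) (force intro: le_less_trans)+
    then show False using 0 assms(2)[of 0] by simp
  qed
  then show ?thesis using assms by (auto simp: regular_seqs_def wsummable_all_divdiffs)
qed

lemma pseries_add_useq0:
  assumes "wsummable_all y" "cmod v < 1"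
  shows "pseries (\<lambda>k. y k + w * useq 0 k) v = w + pseries y v"
proof -
  obtain \<sigma> where "cmod v < \<sigma>" "0 < \<sigma>" "\<sigma> < 1" using obtain_radius[OF assms(2)] .
  then show ?thesis
    using pseries_lincomb[OF wsummable_all_D[OF assms(1)] wsummable_useq, of \<sigma> v] by (simp add: pseries_useq)
qed

lemma divdiff_add_useq0: "divdiff v (\<lambda>k. y k + w * useq 0 k) = divdiff v y"
  by (simp add: divdiff_def[abs_def] useq_def)

text \<open>As v is a zero of the n-th quotient Q, Q(z_i) = (z_i - v) q(z_i), which absorbs the new
  Vandermonde factors |z_i - v|^2. The interpolation remainder does not change, and its coefficient
  n is x_n; this yields the additional density.\<close>

lemma kac_rice_Suc:
  assumes r: "r \<ge> 0" and x: "wsummable \<rho> x" and \<rho>: "0 < \<rho>" "\<rho> < 1" and z: "\<And>i. i < n \<Longrightarrow> cmod (z i) < \<rho>" and v: "cmod v < \<rho>"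
    and zero: "pseries (divdiffs n z x) v = 0"
  shows "kac_rice r (Suc n) (z(n := v)) x =
    kac_rice r n z x * gauss_density (\<tau> r n) (x n) * (cmod (pseries (divdiff v (divdiffs n z x)) v))\<^sup>2"
proof -
  let ?z = "z(n := v)" and ?q = "divdiff v (divdiffs n z x)"
  have dd: "divdiffs n ?z x = divdiffs n z x" by (rule divdiffs_cong_points) auto
  have li: "lins n ?z u = lins n z u" for u by (rule lins_cong_points) auto
  have D: "divdiffs (Suc n) ?z x = ?q" by (simp add: dd)
  have "interp (Suc n) ?z x = (\<lambda>k. interp n ?z x k + - pseries (divdiffs n ?z x) (?z n) * lins n ?z (useq 0) k)"
    using x z v \<rho> by (intro interp_Suc[of \<rho>]) (auto simp: le_less)
  then have I: "interp (Suc n) ?z x = interp n z x"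
    using zero by (simp add: dd li interp_def)
  have In: "interp n z x n = x n" using x z \<rho> by (intro interp_ge[of \<rho>]) auto
  have V: "vandermonde2 (Suc n) ?z = vandermonde2 n z * (\<Prod>i<n. (cmod (z i - v))\<^sup>2)"
  proof -
    have "(\<Prod>j<n. \<Prod>i<j. (cmod (?z i - ?z j))\<^sup>2) = (\<Prod>j<n. \<Prod>i<j. (cmod (z i - z j))\<^sup>2)"
      by (intro prod.cong) auto
    moreover have "(\<Prod>i<n. (cmod (?z i - v))\<^sup>2) = (\<Prod>i<n. (cmod (z i - v))\<^sup>2)"
      by (intro prod.cong) auto
    ultimately show ?thesis by (simp add: vandermonde2_def)
  qed
  have P: "(cmod (pseries (divdiffs n z x) (z i)))\<^sup>2 = (cmod (z i - v))\<^sup>2 * (cmod (pseries ?q (z i)))\<^sup>2" if "i < n" for i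
    using pseries_divdiff[OF divdiffs_wsummable[OF x z] v less_imp_le[OF z[OF that]]] zero
    by (simp add: norm_mult power_mult_distrib)
  have "(\<Prod>i<Suc n. (cmod (pseries (divdiffs (Suc n) ?z x) (?z i)))\<^sup>2) =
      (\<Prod>i<n. (cmod (pseries ?q (z i)))\<^sup>2) * (cmod (pseries ?q v))\<^sup>2"
    unfolding D by (auto intro!: arg_cong2[where f = "(*)"] prod.cong)
  then show ?thesis
    unfolding kac_rice_def V I by (simp add: In P prod.distrib)
qed

text \<open>For fixed remaining coefficients, \<open>Q(v) = 0\<close> means \<open>w = g v\<close> with \<open>g\<close> holomorphic, and \<open>g'\<close> at a zero \<open>v\<close>
  is minus the value at \<open>v\<close> of the next quotient, which is the Jacobian appearing in \<open>kac_rice\<close>.\<close>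
lemma elimination_step_fibre:
  assumes r: "r \<ge> 0" and i: "i < m"
    and L: "\<And>i. i < m \<Longrightarrow> L i \<in> sets borel" "\<And>i. i < m \<Longrightarrow> L i \<subseteq> cball 0 \<rho>" "\<rho> < 1" "disjoint_family_on L {..<m}"
    and z: "\<And>i. i < n \<Longrightarrow> cmod (z i) \<le> \<rho>" and x: "wsummable_all x" "\<And>k. x k \<noteq> 0"
  shows "(\<integral>\<^sup>+w. ennreal (real (fact_moment m L (i # js) (divdiffs n z (x(n := w))))) * ennreal (kac_rice r n z (x(n := w)))
      \<partial>gauss_measure (\<tau> r n)) =
    (\<integral>\<^sup>+v. ennreal (real (fact_moment m L js (divdiffs (Suc n) (z(n := v)) x))) * ennreal (kac_rice r (Suc n) (z(n := v)) x) *
      indicator (L i) v \<partial>lborel)"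
proof -
  have z1: "\<And>i. i < n \<Longrightarrow> cmod (z i) < 1" using z L(3) by (meson le_less_trans)
  have L1: "cmod v < 1" if "v \<in> L i" for v using that L(2)[OF i] L(3) by (auto simp: subset_iff)
  obtain \<sigma> where \<sigma>: "max \<rho> 0 < \<sigma>" "\<sigma> < 1" using dense[of "max \<rho> 0" 1] L(3) by auto
  have z\<sigma>: "\<And>i. i < n \<Longrightarrow> cmod (z i) < \<sigma>" using z \<sigma> by (meson le_less_trans max.strict_boundedE)
  have L\<sigma>: "cmod v < \<sigma>" if "v \<in> L i" for v using that L(2)[OF i] \<sigma> by (auto simp: subset_iff)
  have \<sigma>0: "0 < \<sigma>" using \<sigma> by simp
  define y0 where "y0 = divdiffs n z (x(n := 0))"
  define G where "G v = - pseries y0 v" for v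
  have y0: "wsummable_all y0" unfolding y0_def using x z1 by (intro wsummable_all_divdiffs wsummable_all_upd)
  have yw: "divdiffs n z (x(n := w)) = (\<lambda>k. y0 k + w * useq 0 k)" for w
    unfolding y0_def using x z\<sigma> \<sigma> \<sigma>0 by (intro divdiffs_upd[of \<sigma>] wsummable_all_D) auto
  have py: "pseries (divdiffs n z (x(n := w))) v = w - G v" if "cmod v < 1" for w v
    unfolding yw using y0 that by (simp add: pseries_add_useq0 G_def)
  have dy: "divdiff v (divdiffs n z (x(n := w))) = divdiff v y0" for v w
    unfolding yw by (rule divdiff_add_useq0)
  have reg: "divdiffs n z (x(n := w)) \<in> regular_seqs" for w
    using x z1 by (intro divdiffs_regular wsummable_all_upd) auto
  have dS: "divdiffs (Suc n) (z(n := v)) x' = divdiff v (divdiffs n z x')" for v x'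
    using divdiffs_cong_points[of n "z(n := v)" z x'] by simp
  have dc: "divdiffs (Suc n) (z(n := v)) x = divdiff v y0" for v
  proof -
    have "divdiffs (Suc n) (z(n := v)) x = divdiffs (Suc n) (z(n := v)) (x(n := 0))"
      by (rule divdiffs_cong_seq) auto
    then show ?thesis by (simp only: dS y0_def)
  qed
  have holG: "G holomorphic_on ball 0 1"
    unfolding G_def[abs_def] by (intro holomorphic_on_minus pseries_holomorphic y0)
  have dG: "deriv G v = - pseries (divdiff v y0) v" if "cmod v < 1" for v
  proof -
    have "pseries y0 field_differentiable (at v)"
      using pseries_holomorphic[OF y0] that by (auto intro: holomorphic_on_imp_differentiable_at)
    then show ?thesis unfolding G_def[abs_def] using deriv_pseries[OF y0 that] by (simp add: deriv_minus)
  qed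
  have mfm: "(\<lambda>y. ennreal (real (fact_moment m L js y))) \<in> borel_measurable seq_borel" for js
    using L by (intro measurable_fact_moment) auto
  define H where "H v = ennreal (real (fact_moment m L js (divdiff v y0))) *
    (ennreal (gauss_density (\<tau> r n) (G v)) * ennreal (kac_rice r n z (x(n := G v))))" for v
  have mG [measurable]: "G \<in> borel_measurable borel"
    unfolding G_def[abs_def] by measurable
  have mk: "(\<lambda>w. kac_rice r n z (x(n := w))) \<in> borel_measurable borel"
  proof (intro measurable_kac_rice)
    fix k show "(\<lambda>w. (x(n := w)) k) \<in> borel_measurable borel" by (cases "k = n") auto
  qed auto
  have md: "(\<lambda>v. ennreal (real (fact_moment m L js (divdiff v y0)))) \<in> borel_measurable borel"
    by (rule measurable_compose[OF _ mfm], rule measurable_seqI, rule measurable_divdiff) auto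
  have mH: "H \<in> borel_measurable borel"
    unfolding H_def[abs_def] using md measurable_compose[OF mG mk] by measurable
  have mf1: "(\<lambda>w. ennreal (real (fact_moment m L (i # js) (divdiffs n z (x(n := w)))))) \<in> borel_measurable borel"
  proof (rule measurable_compose[OF _ mfm], rule measurable_seqI, rule measurable_divdiffs)
    fix k show "(\<lambda>w. (x(n := w)) k) \<in> borel_measurable borel" by (cases "k = n") auto
  qed auto
  \<comment> \<open>A multiple zero v of the quotient has G'(v) = 0, so w = G(v) is a critical
    value. For almost every w all zeros to be counted are simple.\<close>
  have null: "AE w in lborel. w \<notin> G ` {v \<in> ball 0 1. deriv G v = 0}"
    by (rule AE_not_in[OF critical_values_null[OF holG]]) auto
  have "(\<integral>\<^sup>+w. ennreal (real (fact_moment m L (i # js) (divdiffs n z (x(n := w))))) * ennreal (kac_rice r n z (x(n := w)))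
      \<partial>gauss_measure (\<tau> r n)) =
    (\<integral>\<^sup>+w. ennreal (gauss_density (\<tau> r n) w) * (ennreal (real (fact_moment m L (i # js) (divdiffs n z (x(n := w))))) *
       ennreal (kac_rice r n z (x(n := w)))) \<partial>lborel)"
    using mf1 mk r by (intro nn_integral_gauss_measure) (auto simp: \<tau>_pos)
  also have "\<dots> = (\<integral>\<^sup>+w. (\<integral>\<^sup>+v. H v \<partial>count_space {v \<in> L i. G v = w}) \<partial>lborel)"
  proof (rule nn_integral_cong_AE, use null in eventually_elim)
    case (elim w)
    let ?y = "divdiffs n z (x(n := w))"
    have Z: "{v \<in> L i. pseries ?y v = 0} = {v \<in> L i. G v = w}"
      using py[of _ w] L1 by auto
    have "ennreal (real (fact_moment m L (i # js) ?y)) =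
        (\<integral>\<^sup>+v. of_nat (fact_moment m L js (divdiff v ?y)) \<partial>count_space {v \<in> L i. pseries ?y v = 0})"
    proof (subst sum_fact_moment_divdiff[OF reg i L(2,3,4)])
      fix v assume v: "v \<in> L i" "pseries ?y v = 0"
      then have "G v = w" "v \<in> ball 0 1" using py[of v w] L1 by auto
      then have "deriv G v \<noteq> 0" using elim by auto
      then show "pseries (divdiff v ?y) v \<noteq> 0" using dG[OF L1[OF v(1)]] by (simp add: dy)
    qed (auto simp: ennreal_of_nat_eq_real_of_nat)
    then have e: "ennreal (real (fact_moment m L (i # js) ?y)) =
        (\<integral>\<^sup>+v. ennreal (real (fact_moment m L js (divdiff v y0))) \<partial>count_space {v \<in> L i. G v = w})"
      by (simp only: Z dy ennreal_of_nat_eq_real_of_nat)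
    let ?c = "ennreal (gauss_density (\<tau> r n) w) * ennreal (kac_rice r n z (x(n := w)))"
    have "(\<integral>\<^sup>+v. H v \<partial>count_space {v \<in> L i. G v = w}) =
        (\<integral>\<^sup>+v. ennreal (real (fact_moment m L js (divdiff v y0))) * ?c \<partial>count_space {v \<in> L i. G v = w})"
      by (intro nn_integral_cong) (simp add: H_def)
    also have "\<dots> = ennreal (real (fact_moment m L (i # js) ?y)) * ?c"
      unfolding e by (rule nn_integral_multc) simp
    finally show ?case by (simp add: mult_ac)
  qed
  also have "\<dots> = (\<integral>\<^sup>+v. H v * ennreal ((cmod (deriv G v))\<^sup>2) * indicator (L i) v \<partial>lborel)"
    using L1 by (intro holomorphic_area_formula[OF holG] L i mH) auto
  also have "\<dots> = (\<integral>\<^sup>+v. ennreal (real (fact_moment m L js (divdiffs (Suc n) (z(n := v)) x))) * ennreal (kac_rice r (Suc n) (z(n := v)) x) *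
      indicator (L i) v \<partial>lborel)"
  proof (rule nn_integral_cong)
    fix v
    show "H v * ennreal ((cmod (deriv G v))\<^sup>2) * indicator (L i) v =
      ennreal (real (fact_moment m L js (divdiffs (Suc n) (z(n := v)) x))) * ennreal (kac_rice r (Suc n) (z(n := v)) x) * indicator (L i) v"
    proof (cases "v \<in> L i")
      case True
      let ?x = "x(n := G v)"
      have ws: "wsummable \<sigma> ?x" using x \<sigma> \<sigma>0 by (intro wsummable_all_D wsummable_all_upd)
      have zero: "pseries (divdiffs n z ?x) v = 0" using py[OF L1[OF True]] by simp
      \<comment> \<open>Stage n + 1 does not read coefficient n, so this coefficient may be given
        the value G(v), which makes v a zero and brings \<open>kac_rice_Suc\<close> into
        play.\<close>
      have "kac_rice r (Suc n) (z(n := v)) x = kac_rice r (Suc n) (z(n := v)) ?x"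
        unfolding kac_rice_def using divdiffs_cong_seq[of "Suc n" x ?x "z(n := v)"] interp_cong[of "Suc n" x ?x "z(n := v)"] by simp
      also have "\<dots> = kac_rice r n z ?x * gauss_density (\<tau> r n) (?x n) * (cmod (pseries (divdiff v (divdiffs n z ?x)) v))\<^sup>2"
        by (rule kac_rice_Suc[OF r ws \<sigma>0 \<sigma>(2) z\<sigma> L\<sigma>[OF True] zero])
      also have "\<dots> = gauss_density (\<tau> r n) (G v) * kac_rice r n z ?x * (cmod (deriv G v))\<^sup>2"
        by (simp add: dy dG[OF L1[OF True]])
      finally have "ennreal (kac_rice r (Suc n) (z(n := v)) x) =
          ennreal (gauss_density (\<tau> r n) (G v)) * ennreal (kac_rice r n z ?x) * ennreal ((cmod (deriv G v))\<^sup>2)"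
        using r by (simp add: ennreal_mult gauss_density_nonneg kac_rice_nonneg \<tau>_pos)
      then show ?thesis unfolding dc H_def by (simp add: mult_ac)
    qed simp
  qed
  finally show ?thesis .
qed

text \<open>Interpolates between the factorial moment (n = 0) and the Kac-Rice integral (n the
  length of \<open>js\<close>): the first n listed zeros have become integration variables, and the
  remaining ones are counted as zeros of the n-th quotient.\<close>

definition elimination_stage ::
  "real \<Rightarrow> nat \<Rightarrow> (nat \<Rightarrow> complex set) \<Rightarrow> nat list \<Rightarrow> nat \<Rightarrow> ennreal" where
  "elimination_stage r m L js n =
    (\<integral>\<^sup>+z. (\<integral>\<^sup>+x. ennreal (real (fact_moment m L (drop n js) (divdiffs n z x))) * ennreal (kac_rice r n z x) \<partial>gauss_seq r) *
       indicator (PiE {..<n} (\<lambda>i. L (js ! i))) z \<partial>PiM {..<n} (\<lambda>_. lborel))"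

text \<open>Coefficient n is redrawn, exchanged for a zero v by
  \<open>elimination_step_fibre\<close>, and after Fubini v joins z as a further coordinate of the
  product integral.\<close>

lemma elimination_stage_Suc:
  assumes r: "r \<ge> 0" and js: "n < length js" "\<And>i. i < length js \<Longrightarrow> js ! i < m"
    and L: "\<And>i. i < m \<Longrightarrow> L i \<in> sets borel" "\<And>i. i < m \<Longrightarrow> L i \<subseteq> cball 0 \<rho>" "\<rho> < 1" "disjoint_family_on L {..<m}"
  shows "elimination_stage r m L js n = elimination_stage r m L js (Suc n)"
proof -
  interpret P: product_sigma_finite "\<lambda>_::nat. lborel :: complex measure" ..
  interpret S: prob_space "gauss_seq r" using r by (rule prob_space_gauss_seq)
  interpret Q: pair_sigma_finite "gauss_seq r" "lborel :: complex measure" ..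
  let ?E = "\<lambda>n. PiE {..<n} (\<lambda>i. L (js ! i))"
  let ?F = "\<lambda>n z x. ennreal (real (fact_moment m L (drop n js) (divdiffs n z x))) * ennreal (kac_rice r n z x)"
  have mfm: "(\<lambda>y. ennreal (real (fact_moment m L js y))) \<in> borel_measurable seq_borel" for js
    using L by (intro measurable_fact_moment) auto
  have mF: "(\<lambda>u. ?F k (z u) (x u)) \<in> borel_measurable M"
    if "\<And>j. (\<lambda>u. x u j) \<in> borel_measurable M" "\<And>i. i < k \<Longrightarrow> (\<lambda>u. z u i) \<in> borel_measurable M"
    for k z x and M :: "'b measure"
  proof -
    have "(\<lambda>u. ennreal (real (fact_moment m L (drop k js) (divdiffs k (z u) (x u))))) \<in> borel_measurable M"
      by (rule measurable_compose[OF _ mfm], rule measurable_seqI, rule measurable_divdiffs) (use that in auto)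
    moreover have "(\<lambda>u. kac_rice r k (z u) (x u)) \<in> borel_measurable M"
      by (rule measurable_kac_rice) (use that in auto)
    ultimately show ?thesis by simp
  qed
  have mE: "?E k \<in> sets (PiM {..<k} (\<lambda>_. lborel))" if "k \<le> length js" for k
    using that js L by (intro sets_PiM_I_finite) auto
  have comp: "(\<lambda>x. x j) \<in> borel_measurable (gauss_seq r)" for j
    by (rule measurable_seqD[of "\<lambda>x. x"]) simp
  have good: "AE x in gauss_seq r. wsummable_all x \<and> (\<forall>k. x k \<noteq> 0)"
    using gauss_seq_AE_wsummable_all[OF r] gauss_seq_AE_nonzero[OF r] by eventually_elim simp
  have inner: "(\<integral>\<^sup>+x. ?F n z x \<partial>gauss_seq r) * indicator (?E n) z =
      (\<integral>\<^sup>+v. (\<integral>\<^sup>+x. ?F (Suc n) (z(n := v)) x \<partial>gauss_seq r) * indicator (?E (Suc n)) (z(n := v)) \<partial>lborel)"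
    if z: "z \<in> space (PiM {..<n} (\<lambda>_. lborel))" for z
  proof (cases "z \<in> ?E n")
    case True
    have zL: "z i \<in> L (js ! i)" if "i < n" for i using True that by auto
    have z\<rho>: "cmod (z i) \<le> \<rho>" if "i < n" for i
    proof -
      have "js ! i < m" using js that by simp
      then show ?thesis using zL[OF that] L(2)[of "js ! i"] by (auto simp: subset_iff)
    qed
    have jn: "js ! n < m" using js by simp
    have dr: "drop n js = js ! n # drop (Suc n) js" using js(1) by (simp add: Cons_nth_drop_Suc)
    have zc: "z(n := v) \<in> ?E (Suc n) \<longleftrightarrow> v \<in> L (js ! n)" for v
      using True by (auto simp: PiE_iff extensional_def less_Suc_eq)
    have ind: "indicator (?E (Suc n)) (z(n := v)) = (indicator (L (js ! n)) v :: ennreal)" for v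
      using zc by (simp add: indicator_def)
    have "(\<integral>\<^sup>+x. ?F n z x \<partial>gauss_seq r) = (\<integral>\<^sup>+x. \<integral>\<^sup>+w. ?F n z (x(n := w)) \<partial>gauss_measure (\<tau> r n) \<partial>gauss_seq r)"
    proof (rule gauss_seq_resample[OF r])
      show "?F n z \<in> borel_measurable seq_borel"
        by (rule mF[of "\<lambda>x. x" _ n "\<lambda>_. z"]) auto
    qed
    also have "\<dots> = (\<integral>\<^sup>+x. \<integral>\<^sup>+v. ?F (Suc n) (z(n := v)) x * indicator (L (js ! n)) v \<partial>lborel \<partial>gauss_seq r)"
      using good
    proof (intro nn_integral_cong_AE, eventually_elim)
      case (elim x)
      show ?case
        unfolding dr using elim r jn L z\<rho> by (intro elimination_step_fibre[where \<rho> = \<rho>]) auto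
    qed
    also have "\<dots> = (\<integral>\<^sup>+v. \<integral>\<^sup>+x. ?F (Suc n) (z(n := v)) x * indicator (L (js ! n)) v \<partial>gauss_seq r \<partial>lborel)"
    proof (rule Q.Fubini'[symmetric])
      have "(\<lambda>p. ?F (Suc n) (z(n := snd p)) (fst p)) \<in> borel_measurable (gauss_seq r \<Otimes>\<^sub>M lborel)"
      proof (rule mF)
        fix j show "(\<lambda>p. fst p j) \<in> borel_measurable (gauss_seq r \<Otimes>\<^sub>M lborel)"
          by (rule measurable_compose[OF measurable_fst comp])
      next
        fix i assume "i < Suc n"
        show "(\<lambda>p. (z(n := snd p)) i) \<in> borel_measurable (gauss_seq r \<Otimes>\<^sub>M lborel)"
          by (cases "i = n") auto
      qed
      moreover have "(\<lambda>p. indicator (L (js ! n)) (snd p) :: ennreal) \<in> borel_measurable (gauss_seq r \<Otimes>\<^sub>M lborel)"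
        using L(1)[OF jn] by measurable
      ultimately have "(\<lambda>p. ?F (Suc n) (z(n := snd p)) (fst p) * indicator (L (js ! n)) (snd p)) \<in> borel_measurable (gauss_seq r \<Otimes>\<^sub>M lborel)"
        by simp
      then show "(\<lambda>(x, v). ?F (Suc n) (z(n := v)) x * indicator (L (js ! n)) v) \<in> borel_measurable (gauss_seq r \<Otimes>\<^sub>M lborel)"
        by (simp add: case_prod_beta')
    qed
    also have "\<dots> = (\<integral>\<^sup>+v. (\<integral>\<^sup>+x. ?F (Suc n) (z(n := v)) x \<partial>gauss_seq r) * indicator (L (js ! n)) v \<partial>lborel)"
    proof (intro nn_integral_cong nn_integral_multc)
      fix v
      have "?F (Suc n) (z(n := v)) \<in> borel_measurable (gauss_seq r)"
        by (rule mF[of "\<lambda>x. x" _ "Suc n" "\<lambda>_. z(n := v)"]) (auto intro: comp)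
      then show "?F (Suc n) (z(n := v)) \<in> borel_measurable (gauss_seq r)" .
    qed
    finally show ?thesis using True by (simp add: ind)
  next
    case False
    have "z(n := v) \<notin> ?E (Suc n)" for v
    proof
      assume a: "z(n := v) \<in> ?E (Suc n)"
      have "z i \<in> L (js ! i)" if "i < n" for i
        using PiE_mem[OF a, of i] that by simp
      moreover have "z \<in> extensional {..<n}" using z by (simp add: space_PiM PiE_iff)
      ultimately show False using False by (auto simp: PiE_iff)
    qed
    then show ?thesis using False by simp
  qed
  have "elimination_stage r m L js n =
      (\<integral>\<^sup>+z. \<integral>\<^sup>+v. (\<integral>\<^sup>+x. ?F (Suc n) (z(n := v)) x \<partial>gauss_seq r) * indicator (?E (Suc n)) (z(n := v)) \<partial>lborel \<partial>PiM {..<n} (\<lambda>_. lborel))"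
    unfolding elimination_stage_def by (rule nn_integral_cong) (rule inner)
  also have "\<dots> = (\<integral>\<^sup>+z. (\<integral>\<^sup>+x. ?F (Suc n) z x \<partial>gauss_seq r) * indicator (?E (Suc n)) z \<partial>PiM (insert n {..<n}) (\<lambda>_. lborel))"
  proof (rule P.product_nn_integral_insert[symmetric])
    have "(\<lambda>z. \<integral>\<^sup>+x. ?F (Suc n) z x \<partial>gauss_seq r) \<in> borel_measurable (PiM {..<Suc n} (\<lambda>_. lborel))"
    proof (rule S.borel_measurable_nn_integral)
      have "(\<lambda>p. ?F (Suc n) (fst p) (snd p)) \<in> borel_measurable (PiM {..<Suc n} (\<lambda>_. lborel) \<Otimes>\<^sub>M gauss_seq r)"
      proof (rule mF)
        fix j show "(\<lambda>p. snd p j) \<in> borel_measurable (PiM {..<Suc n} (\<lambda>_. lborel :: complex measure) \<Otimes>\<^sub>M gauss_seq r)"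
          by (rule measurable_compose[OF measurable_snd comp])
      next
        fix i assume "i < Suc n"
        then have "(\<lambda>z. z i) \<in> borel_measurable (PiM {..<Suc n} (\<lambda>_. lborel :: complex measure))"
          using measurable_component_singleton[of i "{..<Suc n}" "\<lambda>_. lborel :: complex measure"] by simp
        then show "(\<lambda>p. fst p i) \<in> borel_measurable (PiM {..<Suc n} (\<lambda>_. lborel :: complex measure) \<Otimes>\<^sub>M gauss_seq r)"
          by (rule measurable_compose[OF measurable_fst])
      qed
      then show "(\<lambda>(z, x). ?F (Suc n) z x) \<in> borel_measurable (PiM {..<Suc n} (\<lambda>_. lborel) \<Otimes>\<^sub>M gauss_seq r)"
        by (simp add: case_prod_beta')
    qed
    then show "(\<lambda>z. (\<integral>\<^sup>+x. ?F (Suc n) z x \<partial>gauss_seq r) * indicator (?E (Suc n)) z) \<in> borel_measurable (PiM (insert n {..<n}) (\<lambda>_. lborel))"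
      using mE[of "Suc n"] js(1) by (simp add: lessThan_Suc[symmetric])
  qed auto
  also have "\<dots> = elimination_stage r m L js (Suc n)"
    unfolding elimination_stage_def by (simp add: lessThan_Suc)
  finally show ?thesis .
qed

theorem factorial_moment_formula:
  assumes r: "r \<ge> 0" and js: "\<And>i. i < length js \<Longrightarrow> js ! i < m"
    and L: "\<And>i. i < m \<Longrightarrow> L i \<in> sets borel" "\<And>i. i < m \<Longrightarrow> L i \<subseteq> cball 0 \<rho>" "\<rho> < 1" "disjoint_family_on L {..<m}"
  shows "(\<integral>\<^sup>+x. ennreal (real (fact_moment m L js x)) \<partial>gauss_seq r) =
    (\<integral>\<^sup>+z. (\<integral>\<^sup>+x. ennreal (kac_rice r (length js) z x) \<partial>gauss_seq r) *
       indicator (PiE {..<length js} (\<lambda>i. L (js ! i))) z \<partial>PiM {..<length js} (\<lambda>_. lborel))"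
proof -
  interpret P: product_sigma_finite "\<lambda>_::nat. lborel :: complex measure" ..
  have "elimination_stage r m L js 0 = elimination_stage r m L js n" if "n \<le> length js" for n
    using that
  proof (induction n)
    case (Suc n)
    then show ?case using elimination_stage_Suc[OF r _ js L, of n] by simp
  qed simp
  from this[of "length js"]
  have "elimination_stage r m L js 0 = elimination_stage r m L js (length js)" by simp
  moreover have "elimination_stage r m L js 0 = (\<integral>\<^sup>+x. ennreal (real (fact_moment m L js x)) \<partial>gauss_seq r)"
    unfolding elimination_stage_def by (simp add: P.nn_integral_empty del: prod.lessThan_Suc add: kac_rice_def vandermonde2_def)
  moreover have "elimination_stage r m L js (length js) =
    (\<integral>\<^sup>+z. (\<integral>\<^sup>+x. ennreal (kac_rice r (length js) z x) \<partial>gauss_seq r) *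
       indicator (PiE {..<length js} (\<lambda>i. L (js ! i))) z \<partial>PiM {..<length js} (\<lambda>_. lborel))"
    unfolding elimination_stage_def by (simp add: fact_moment_Nil)
  ultimately show ?thesis by simp
qed


section \<open>Integration by parts\<close>

lemma integrable_lborel_translate:
  fixes f :: "complex \<Rightarrow> complex"
  assumes "integrable lborel f"
  shows "integrable lborel (\<lambda>w. f (h + w))" "(\<integral>w. f (h + w) \<partial>lborel) = (\<integral>w. f w \<partial>lborel)"
proof -
  have m: "(+) h \<in> borel_measurable lborel" by simp
  have "integrable (distr lborel borel ((+) h)) f" using assms by (simp add: lborel_distr_plus)
  from integrable_distr[OF m this] show "integrable lborel (\<lambda>w. f (h + w))" .
  have "(\<integral>w. f (h + w) \<partial>lborel) = (\<integral>w. f w \<partial>distr lborel borel ((+) h))"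
    using assms by (intro integral_distr[OF m, symmetric]) auto
  then show "(\<integral>w. f (h + w) \<partial>lborel) = (\<integral>w. f w \<partial>lborel)" by (simp add: lborel_distr_plus)
qed

text \<open>The integral of a derivative vanishes by translation invariance: integrate
  \<open>F (w + h) - F w\<close>, written as an integral over the segment, and exchange the two integrals.\<close>
lemma integral_cnj_derivative_zero:
  fixes F A B :: "complex \<Rightarrow> complex"
  assumes der: "\<And>w. (F has_derivative (\<lambda>h. A w * h + B w * cnj h)) (at w)"
    and cont: "continuous_on UNIV A" "continuous_on UNIV B"
    and int: "integrable lborel F" "integrable lborel A" "integrable lborel B"
  shows "(\<integral>w. B w \<partial>lborel) = 0"
proof -
  have key: "(\<integral>w. A w * h + B w * cnj h \<partial>lborel) = 0" for h
  proof -
    define D where "D w = A w * h + B w * cnj h" for w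
    have cD: "continuous_on UNIV D" unfolding D_def[abs_def] using cont by (intro continuous_intros)
    have mD: "D \<in> borel_measurable borel" by (rule borel_measurable_continuous_onI[OF cD])
    have iD: "integrable lborel D" unfolding D_def[abs_def] using int by simp
    have F_diff: "(\<integral>s. indicator {0..1::real} s *\<^sub>R D (of_real s * h + w) \<partial>lborel) = F (h + w) - F w" for w
    proof -
      have v: "((\<lambda>s. F (of_real s * h + w)) has_vector_derivative D (of_real s * h + w)) (at s within {0..1})" for s :: real
      proof -
        have "((\<lambda>s::real. of_real s * h + w) has_derivative (\<lambda>u. of_real u * h)) (at s within {0..1})"
          by (auto intro!: derivative_eq_intros)
        then have "((\<lambda>s. F (of_real s * h + w)) has_derivative
            (\<lambda>u. A (of_real s * h + w) * (of_real u * h) + B (of_real s * h + w) * cnj (of_real u * h))) (at s within {0..1})"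
          by (rule has_derivative_compose) (rule der)
        then show ?thesis
          unfolding has_vector_derivative_def
          by (rule has_derivative_eq_rhs) (auto simp: D_def fun_eq_iff scaleR_conv_of_real algebra_simps)
      qed
      have "(\<integral>s. indicator {0..1::real} s *\<^sub>R D (of_real s * h + w) \<partial>lborel) = F (of_real 1 * h + w) - F (of_real 0 * h + w)"
        using v by (intro integral_FTC_atLeastAtMost continuous_on_compose2[OF cD]) (auto intro!: continuous_intros)
      then show ?thesis by simp
    qed
    let ?f = "\<lambda>s w. indicator {0..1::real} s *\<^sub>R D (of_real s * h + w)"
    have "integrable (lborel \<Otimes>\<^sub>M lborel) (\<lambda>(s, w). ?f s w)"
    proof (rule lborel_pair.Fubini_integrable)
      show "(\<lambda>(s, w). ?f s w) \<in> borel_measurable (lborel \<Otimes>\<^sub>M lborel)"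
        using mD by measurable
      \<comment> \<open>By translation invariance the inner norm integral does not depend on s,
        which gives joint integrability over the bounded range of s.\<close>
      have n: "(\<integral>w. norm (D (c + w)) \<partial>lborel) = (\<integral>w. norm (D w) \<partial>lborel)" for c
      proof -
        have "(\<integral>w. norm (D w) \<partial>lborel) = (\<integral>w. norm (D w) \<partial>distr lborel borel ((+) c))"
          by (simp add: lborel_distr_plus)
        also have "\<dots> = (\<integral>w. norm (D (c + w)) \<partial>lborel)"
          using mD by (intro integral_distr) auto
        finally show ?thesis by simp
      qed
      have "integrable lborel (\<lambda>s. indicator {0..1::real} s *\<^sub>R (\<integral>w. norm (D w) \<partial>lborel))"
        by (intro integrable_scaleR_left) (auto simp: emeasure_lborel_Icc_eq)
      then show "integrable lborel (\<lambda>s. \<integral>w. norm (case (s, w) of (s, w) \<Rightarrow> ?f s w) \<partial>lborel)"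
        by (simp add: n)
      show "AE s in lborel. integrable lborel (\<lambda>w. case (s, w) of (s, w) \<Rightarrow> ?f s w)"
        using integrable_lborel_translate(1)[OF iD] by (intro AE_I2) simp
    qed
    then have "(\<integral>w. (\<integral>s. ?f s w \<partial>lborel) \<partial>lborel) = (\<integral>s. (\<integral>w. ?f s w \<partial>lborel) \<partial>lborel)"
      by (rule lborel_pair.Fubini_integral)
    moreover have "(\<integral>w. (\<integral>s. ?f s w \<partial>lborel) \<partial>lborel) = 0"
      unfolding F_diff using integrable_lborel_translate[OF int(1), of h] int(1) by simp
    moreover have "(\<integral>s. (\<integral>w. ?f s w \<partial>lborel) \<partial>lborel) = (\<integral>w. D w \<partial>lborel)"
      using integrable_lborel_translate(2)[OF iD] by (simp add: emeasure_lborel_Icc_eq)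
    ultimately show ?thesis by (simp add: D_def)
  qed
  \<comment> \<open>The directions h = 1 and h = i separate the two complex integrals.\<close>
  have "(\<integral>w. A w \<partial>lborel) + (\<integral>w. B w \<partial>lborel) = 0"
    using key[of 1] int by simp
  moreover have "\<i> * (\<integral>w. A w \<partial>lborel) - \<i> * (\<integral>w. B w \<partial>lborel) = 0"
    using key[of \<i>] int by (simp add: mult.commute)
  then have "(\<integral>w. A w \<partial>lborel) = (\<integral>w. B w \<partial>lborel)"
    by (simp flip: right_diff_distrib)
  ultimately show ?thesis by simp
qed

section \<open>Gaussian integration by parts, in one coordinate and in a direction\<close>

definition poly_growth :: "(complex \<Rightarrow> complex) \<Rightarrow> bool" where
  "poly_growth f \<longleftrightarrow> (\<exists>C\<ge>0. \<exists>m. \<forall>w. cmod (f w) \<le> C * (1 + cmod w) ^ m)"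

lemma poly_growth_affine: "poly_growth (\<lambda>w. a + b * w)"
  unfolding poly_growth_def
proof (intro exI[of _ "cmod a + cmod b"] conjI exI[of _ 1] allI)
  fix w
  have "cmod (a + b * w) \<le> cmod a + cmod b * cmod w"
    by (metis norm_mult norm_triangle_ineq)
  also have "\<dots> \<le> (cmod a + cmod b) * (1 + cmod w) ^ 1"
    by (simp add: algebra_simps)
  finally show "cmod (a + b * w) \<le> (cmod a + cmod b) * (1 + cmod w) ^ 1" .
qed simp

lemma poly_growth_const: "poly_growth (\<lambda>_. c)"
  using poly_growth_affine[of c 0] by simp

lemma poly_growth_mult:
  assumes "poly_growth f" "poly_growth g"
  shows "poly_growth (\<lambda>w. f w * g w)"
proof -
  obtain C m D n where f: "C \<ge> 0" "\<And>w. cmod (f w) \<le> C * (1 + cmod w) ^ m"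
    and g: "D \<ge> 0" "\<And>w. cmod (g w) \<le> D * (1 + cmod w) ^ n"
    using assms unfolding poly_growth_def by metis
  show ?thesis
    unfolding poly_growth_def
  proof (intro exI[of _ "C * D"] conjI exI[of _ "m + n"] allI)
    fix w
    have "cmod (f w) * cmod (g w) \<le> (C * (1 + cmod w) ^ m) * (D * (1 + cmod w) ^ n)"
      using f g by (intro mult_mono) auto
    then show "cmod (f w * g w) \<le> C * D * (1 + cmod w) ^ (m + n)"
      by (simp add: norm_mult power_add mult_ac)
  qed (use f g in auto)
qed

lemma poly_growth_add:
  assumes "poly_growth f" "poly_growth g"
  shows "poly_growth (\<lambda>w. f w + g w)"
proof -
  obtain C m D n where f: "C \<ge> 0" "\<And>w. cmod (f w) \<le> C * (1 + cmod w) ^ m"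
    and g: "D \<ge> 0" "\<And>w. cmod (g w) \<le> D * (1 + cmod w) ^ n"
    using assms unfolding poly_growth_def by metis
  show ?thesis
    unfolding poly_growth_def
  proof (intro exI[of _ "C + D"] conjI exI[of _ "m + n"] allI)
    fix w
    have "cmod (f w + g w) \<le> C * (1 + cmod w) ^ m + D * (1 + cmod w) ^ n"
      using f(2)[of w] g(2)[of w] norm_triangle_ineq[of "f w" "g w"] by linarith
    also have "\<dots> \<le> C * (1 + cmod w) ^ (m + n) + D * (1 + cmod w) ^ (m + n)"
      using f g by (intro add_mono mult_left_mono power_increasing) auto
    finally show "cmod (f w + g w) \<le> (C + D) * (1 + cmod w) ^ (m + n)"
      by (simp add: algebra_simps)
  qed (use f g in auto)
qed

lemma poly_growth_cnj: "poly_growth f \<Longrightarrow> poly_growth (\<lambda>w. cnj (f w))"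
  unfolding poly_growth_def by simp

lemma poly_growth_uminus: "poly_growth f \<Longrightarrow> poly_growth (\<lambda>w. - f w)"
  unfolding poly_growth_def by simp

lemma poly_growth_sum: "(\<And>i. i \<in> I \<Longrightarrow> poly_growth (f i)) \<Longrightarrow> poly_growth (\<lambda>w. \<Sum>i\<in>I. f i w)"
  by (induction I rule: infinite_finite_induct) (auto simp: poly_growth_const poly_growth_add)

lemma poly_growth_prod: "(\<And>i. i \<in> I \<Longrightarrow> poly_growth (f i)) \<Longrightarrow> poly_growth (\<lambda>w. \<Prod>i\<in>I. f i w)"
  by (induction I rule: infinite_finite_induct) (auto simp: poly_growth_const poly_growth_mult)

lemmas poly_growth_intros = poly_growth_affine poly_growth_const poly_growth_mult poly_growth_add
  poly_growth_cnj poly_growth_uminus poly_growth_sum poly_growth_prod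

lemma poly_growth_integrable:
  assumes "continuous_on UNIV E" "\<And>w. cmod (E w) \<le> exp (- t * (cmod w)\<^sup>2)" "t > 0"
    and "continuous_on UNIV f" "poly_growth f"
  shows "integrable lborel (\<lambda>w. E w * f w)"
proof -
  obtain C m where f: "C \<ge> 0" "\<And>w. cmod (f w) \<le> C * (1 + cmod w) ^ m"
    using assms(5) unfolding poly_growth_def by metis
  have "integrable lborel (\<lambda>w. C * ((1 + cmod w) ^ m * exp (- t * (cmod w)\<^sup>2)))"
    by (intro integrable_mult_right integrable_poly_exp_norm2 assms)
  then show ?thesis
  proof (rule Bochner_Integration.integrable_bound)
    show "(\<lambda>w. E w * f w) \<in> borel_measurable lborel"
      using assms by (simp add: borel_measurable_continuous_onI continuous_on_mult)
    show "AE w in lborel. norm (E w * f w) \<le> norm (C * ((1 + cmod w) ^ m * exp (- t * (cmod w)\<^sup>2)))"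
    proof (rule AE_I2)
      fix w
      have "cmod (E w) * cmod (f w) \<le> exp (- t * (cmod w)\<^sup>2) * (C * (1 + cmod w) ^ m)"
        by (intro mult_mono assms f) auto
      then show "norm (E w * f w) \<le> norm (C * ((1 + cmod w) ^ m * exp (- t * (cmod w)\<^sup>2)))"
        using f(1) by (simp add: norm_mult abs_mult mult_ac)
    qed
  qed
qed

lemma has_derivative_cnj_comp: "(f has_derivative f') F \<Longrightarrow> ((\<lambda>x. cnj (f x)) has_derivative (\<lambda>h. cnj (f' h))) F"
  by (rule bounded_linear.has_derivative[OF bounded_linear_cnj])

text \<open>Up to the constant -t / pi the integrand is the derivative with respect to conj w of
  E(w) H(w) conj(G(w)), where E = exp(-Q) collects the Gaussian density and the weight. For
  holomorphic H and G this derivative meets only E and conj G, and \<open>c\<close> is the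
  derivative of Q with respect to conj w.\<close>

lemma stein_one_coordinate:
  fixes \<sigma> :: "nat \<Rightarrow> real" and \<alpha> \<beta> :: "nat \<Rightarrow> complex"
  assumes t: "t > 0" and \<sigma>: "\<And>j. j < N \<Longrightarrow> \<sigma> j \<ge> 0"
    and H: "\<And>w. (H has_field_derivative H' w) (at w)" and G: "\<And>w. (G has_field_derivative G' w) (at w)"
    and cont: "continuous_on UNIV H'" "continuous_on UNIV G'"
    and gr: "poly_growth H" "poly_growth G" "poly_growth H'" "poly_growth G'"
  shows "(\<integral>w. of_real (exp (- (\<Sum>j<N. \<sigma> j * (cmod (\<alpha> j + \<beta> j * w))\<^sup>2))) *
      ((of_real t * w + (\<Sum>j<N. of_real (\<sigma> j) * (\<alpha> j + \<beta> j * w) * cnj (\<beta> j))) * H w * cnj (G w) - H w * cnj (G' w))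
      \<partial>gauss_measure t) = 0"
proof -
  define Y where "Y j w = \<alpha> j + \<beta> j * w" for j w
  define W where "W w = exp (- (\<Sum>j<N. \<sigma> j * (cmod (Y j w))\<^sup>2))" for w
  define Q where "Q w = of_real t * (w * cnj w) + (\<Sum>j<N. of_real (\<sigma> j) * (Y j w * cnj (Y j w)))" for w
  define E where "E w = exp (- Q w)" for w
  define c where "c w = of_real t * w + (\<Sum>j<N. of_real (\<sigma> j) * Y j w * cnj (\<beta> j))" for w
  have Q: "Q w = of_real (t * (cmod w)\<^sup>2 + (\<Sum>j<N. \<sigma> j * (cmod (Y j w))\<^sup>2))" for w
    by (simp add: Q_def complex_norm_square[symmetric])
  have E: "E w = of_real (exp (- t * (cmod w)\<^sup>2) * W w)" for w
  proof -
    have "E w = of_real (exp (- (t * (cmod w)\<^sup>2 + (\<Sum>j<N. \<sigma> j * (cmod (Y j w))\<^sup>2))))"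
      by (simp only: E_def Q of_real_minus[symmetric] exp_of_real)
    then show ?thesis by (simp add: W_def exp_diff exp_minus field_simps)
  qed
  have W1: "W w \<le> 1" for w
  proof -
    have "0 \<le> (\<Sum>j<N. \<sigma> j * (cmod (Y j w))\<^sup>2)"
      by (intro sum_nonneg mult_nonneg_nonneg) (use \<sigma> in auto)
    then show ?thesis by (simp add: W_def)
  qed
  have Eb: "cmod (E w) \<le> exp (- t * (cmod w)\<^sup>2)" for w
  proof -
    have "cmod (E w) = exp (- t * (cmod w)\<^sup>2) * W w"
      unfolding E by (simp only: norm_of_real) (simp add: W_def)
    also have "\<dots> \<le> exp (- t * (cmod w)\<^sup>2)" using W1 by simp
    finally show ?thesis .
  qed
  have cY: "continuous_on UNIV (Y j)" for j unfolding Y_def by (intro continuous_intros)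
  have cE: "continuous_on UNIV E" unfolding E_def[abs_def] Q_def by (intro continuous_intros cY)
  have cH: "continuous_on UNIV H" "continuous_on UNIV G"
    using H G by (auto intro: DERIV_continuous_on[of UNIV])
  have cc: "continuous_on UNIV c" unfolding c_def by (intro continuous_intros cY)
  have gY: "poly_growth (Y j)" for j unfolding Y_def by (rule poly_growth_affine)
  have gid: "poly_growth (\<lambda>w. w)" using poly_growth_affine[of 0 1] by simp
  have gc: "poly_growth c" unfolding c_def by (intro poly_growth_intros gY gid)
  define A where "A w = E w * (- cnj (c w) * H w * cnj (G w) + H' w * cnj (G w))" for w
  define B where "B w = E w * (- c w * H w * cnj (G w) + H w * cnj (G' w))" for w
  have dY: "(Y j has_derivative (\<lambda>h. \<beta> j * h)) (at w)" for j w
    unfolding Y_def by (auto intro!: derivative_eq_intros)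
  have dQ: "(Q has_derivative (\<lambda>h. cnj (c w) * h + c w * cnj h)) (at w)" for w
  proof -
    have 1: "((\<lambda>w. f w * cnj (f w)) has_derivative (\<lambda>h. f w * cnj (f' h) + f' h * cnj (f w))) (at w)"
      if "(f has_derivative f') (at w)" for f f'
      by (rule has_derivative_mult[OF that has_derivative_cnj_comp[OF that]])
    have "(Q has_derivative (\<lambda>h. of_real t * (w * cnj h + h * cnj w) +
        (\<Sum>j<N. of_real (\<sigma> j) * (Y j w * cnj (\<beta> j * h) + \<beta> j * h * cnj (Y j w))))) (at w)"
      unfolding Q_def[abs_def]
      by (intro has_derivative_add has_derivative_sum has_derivative_mult_right 1 dY has_derivative_ident)
    then show ?thesis
      by (rule has_derivative_eq_rhs)
         (auto simp: c_def fun_eq_iff sum_distrib_left sum_distrib_right sum.distrib algebra_simps)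
  qed
  have "((\<lambda>w. E w * (H w * cnj (G w))) has_derivative (\<lambda>h. A w * h + B w * cnj h)) (at w)" for w
  proof -
    have "(exp has_derivative (*) (E w)) (at (- Q w))"
      using DERIV_exp[of "- Q w"] by (simp add: has_field_derivative_def E_def)
    from has_derivative_compose[OF has_derivative_minus[OF dQ] this]
    have dE: "(E has_derivative (\<lambda>h. E w * - (cnj (c w) * h + c w * cnj h))) (at w)"
      unfolding E_def[abs_def] .
    have dH: "(H has_derivative (\<lambda>h. H' w * h)) (at w)" "(G has_derivative (\<lambda>h. G' w * h)) (at w)"
      using H G by (auto simp: has_field_derivative_def)
    show ?thesis
      by (rule has_derivative_eq_rhs[OF has_derivative_mult[OF dE has_derivative_mult[OF dH(1) has_derivative_cnj_comp[OF dH(2)]]]])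
         (simp add: A_def B_def fun_eq_iff algebra_simps)
  qed
  then have "(\<integral>w. B w \<partial>lborel) = 0"
  proof (rule integral_cnj_derivative_zero)
    show "continuous_on UNIV A" "continuous_on UNIV B"
      unfolding A_def[abs_def] B_def[abs_def] by (intro continuous_intros cE cH cc cont)+
    show "integrable lborel (\<lambda>w. E w * (H w * cnj (G w)))"
      by (rule poly_growth_integrable[OF cE Eb t]) (intro continuous_intros cH poly_growth_intros gr)+
    show "integrable lborel A" unfolding A_def[abs_def]
      by (rule poly_growth_integrable[OF cE Eb t]) (intro continuous_intros cH cc cont poly_growth_intros gr gc)+
    show "integrable lborel B" unfolding B_def[abs_def]
      by (rule poly_growth_integrable[OF cE Eb t]) (intro continuous_intros cH cc cont poly_growth_intros gr gc)+
  qed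
  moreover have "(\<integral>w. of_real (W w) * (c w * H w * cnj (G w) - H w * cnj (G' w)) \<partial>gauss_measure t) =
      (\<integral>w. - of_real (t / pi) * B w \<partial>lborel)"
  proof -
    have cW: "continuous_on UNIV W" unfolding W_def[abs_def] by (intro continuous_intros cY)
    have "(\<lambda>w. of_real (W w) * (c w * H w * cnj (G w) - H w * cnj (G' w))) \<in> borel_measurable lborel"
      using borel_measurable_continuous_onI[of "\<lambda>w. of_real (W w) * (c w * H w * cnj (G w) - H w * cnj (G' w))"]
      by (simp add: continuous_intros cW cH cc cont)
    then have "(\<integral>w. of_real (W w) * (c w * H w * cnj (G w) - H w * cnj (G' w)) \<partial>gauss_measure t) =
      (\<integral>w. gauss_density t w *\<^sub>R (of_real (W w) * (c w * H w * cnj (G w) - H w * cnj (G' w))) \<partial>lborel)"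
      unfolding gauss_measure_def using t by (intro integral_density) (auto simp: gauss_density_nonneg)
    also have "\<dots> = (\<integral>w. - of_real (t / pi) * B w \<partial>lborel)"
      by (intro Bochner_Integration.integral_cong)
         (auto simp: B_def E gauss_density_def scaleR_conv_of_real algebra_simps)
    finally show ?thesis .
  qed
  ultimately show ?thesis by (simp add: W_def Y_def c_def)
qed

text \<open>Linearity is asked between \<rho>-summable sequences, since functionals such as
  evaluation are defined through \<open>suminf\<close>.\<close>

definition bounded_functional :: "real \<Rightarrow> ((nat \<Rightarrow> complex) \<Rightarrow> complex) \<Rightarrow> bool" where
  "bounded_functional \<rho> l \<longleftrightarrow> l \<in> borel_measurable seq_borel \<and>
    (\<forall>x y c. wsummable \<rho> x \<longrightarrow> wsummable \<rho> y \<longrightarrow> l (\<lambda>k. x k + c * y k) = l x + c * l y) \<and>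
    (\<exists>C\<ge>0. \<forall>x. wsummable \<rho> x \<longrightarrow> cmod (l x) \<le> C * wnorm \<rho> x)"

lemma bounded_functional_measurable: "bounded_functional \<rho> l \<Longrightarrow> l \<in> borel_measurable seq_borel"
  by (simp add: bounded_functional_def)

lemma bounded_functional_lincomb:
  "bounded_functional \<rho> l \<Longrightarrow> wsummable \<rho> x \<Longrightarrow> wsummable \<rho> y \<Longrightarrow> l (\<lambda>k. x k + c * y k) = l x + c * l y"
  by (simp add: bounded_functional_def)

lemma bounded_functional_bound:
  assumes "bounded_functional \<rho> l"
  obtains C where "C \<ge> 0" "\<And>x. wsummable \<rho> x \<Longrightarrow> cmod (l x) \<le> C * wnorm \<rho> x"
  using assms unfolding bounded_functional_def by blast

lemma bounded_functional_upd:
  assumes "bounded_functional \<rho> l" "wsummable \<rho> x"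
  shows "l (x(k := w)) = (l x - x k * l (useq k)) + l (useq k) * w"
proof -
  have "x(k := w) = (\<lambda>j. x j + (w - x k) * useq k j)" by (auto simp: useq_def)
  then show ?thesis
    using bounded_functional_lincomb[OF assms wsummable_useq, of "w - x k" k] by (simp add: algebra_simps)
qed

lemma bounded_functional_poly_bounded:
  assumes "bounded_functional \<rho> l" "\<rho> > 0"
  shows "poly_bounded \<rho> l"
proof -
  obtain C where C: "C \<ge> 0" "\<And>x. wsummable \<rho> x \<Longrightarrow> cmod (l x) \<le> C * wnorm \<rho> x"
    using bounded_functional_bound[OF assms(1)] by metis
  show ?thesis
  proof (rule poly_boundedI[where C = C and m = 1])
    fix x assume x: "wsummable \<rho> x"
    have "C * wnorm \<rho> x \<le> C * (1 + wnorm \<rho> x) ^ 1" using C(1) by (simp add: mult_left_mono)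
    then show "cmod (l x) \<le> C * (1 + wnorm \<rho> x) ^ 1" using C(2)[OF x] by linarith
  qed (use C assms in \<open>auto simp: bounded_functional_def\<close>)
qed

lemma bounded_functional_zero: "bounded_functional \<rho> l \<Longrightarrow> l (\<lambda>_. 0) = 0"
  using bounded_functional_lincomb[of \<rho> l "\<lambda>_. 0" "\<lambda>_. 0" 1] by (simp add: wsummable_def)

text \<open>Truncations of v converge to v in the weighted norm, so a bounded functional is
  determined by its values on the monomials.\<close>

lemma bounded_functional_sums:
  assumes l: "bounded_functional \<rho> l" and v: "wsummable \<rho> v" and \<rho>: "\<rho> > 0"
  shows "(\<lambda>k. v k * l (useq k)) sums l v"
proof -
  obtain C where C: "C \<ge> 0" "\<And>x. wsummable \<rho> x \<Longrightarrow> cmod (l x) \<le> C * wnorm \<rho> x"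
    using bounded_functional_bound[OF l] by metis
  define tr where "tr n k = (if k < n then v k else 0)" for n k :: nat
  have wtr: "wsummable \<rho> (tr n)" for n
    unfolding wsummable_def by (rule summable_finite[of "{..<n}"]) (auto simp: tr_def)
  have ltr: "l (tr n) = (\<Sum>k<n. v k * l (useq k))" for n
  proof (induction n)
    case 0
    have "tr 0 = (\<lambda>_. 0)" by (simp add: tr_def fun_eq_iff)
    then show ?case using bounded_functional_zero[OF l] by simp
  next
    case (Suc n)
    have "tr (Suc n) = (\<lambda>k. tr n k + v n * useq n k)" by (auto simp: tr_def useq_def fun_eq_iff less_Suc_eq)
    then show ?case using bounded_functional_lincomb[OF l wtr wsummable_useq, where c = "v n"] Suc by simp
  qed
  define u where "u n k = v k + (- 1) * tr n k" for n k
  have wu: "wsummable \<rho> (u n)" for n unfolding u_def[abs_def] by (rule wsummable_lincomb[OF v wtr \<rho>])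
  have lu: "l (u n) = l v - l (tr n)" for n
    unfolding u_def[abs_def] using bounded_functional_lincomb[OF l v wtr, of "-1" n] by simp
  have "wnorm \<rho> (u n) = (\<Sum>k. cmod (v (k + n)) * \<rho> ^ (k + n))" for n
  proof -
    have "wnorm \<rho> (u n) = (\<Sum>k. cmod (u n (k + n)) * \<rho> ^ (k + n)) + (\<Sum>k<n. cmod (u n k) * \<rho> ^ k)"
      using wu[of n] unfolding wnorm_def wsummable_def by (rule suminf_split_initial_segment)
    then show ?thesis by (simp add: u_def tr_def)
  qed
  moreover have "(\<lambda>n. \<Sum>k. cmod (v (k + n)) * \<rho> ^ (k + n)) \<longlonglongrightarrow> 0"
    using v unfolding wsummable_def by (rule suminf_exist_split2)
  ultimately have "(\<lambda>n. C * wnorm \<rho> (u n)) \<longlonglongrightarrow> 0"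
    using tendsto_mult_left[of "\<lambda>n. wnorm \<rho> (u n)" 0 sequentially C] by simp
  moreover have "\<forall>\<^sub>F n in sequentially. norm (l (u n)) \<le> C * wnorm \<rho> (u n)"
    by (intro always_eventually allI C(2) wu)
  ultimately have "(\<lambda>n. l (u n)) \<longlonglongrightarrow> 0"
    by (rule Lim_null_comparison[rotated])
  then have "(\<lambda>n. l v - l (u n)) \<longlonglongrightarrow> l v - 0" by (intro tendsto_diff tendsto_const)
  then show ?thesis by (simp add: sums_def lu ltr)
qed


text \<open>An unnormalised Gaussian weight. The shift s is 0 for the Kac-Rice weight; nonzero
  shifts enter when the mass of that weight is computed.\<close>

definition tilt ::
  "nat \<Rightarrow> (nat \<Rightarrow> real) \<Rightarrow> (nat \<Rightarrow> (nat \<Rightarrow> complex) \<Rightarrow> complex) \<Rightarrow> (nat \<Rightarrow> complex) \<Rightarrow> (nat \<Rightarrow> complex) \<Rightarrow> real" where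
  "tilt N \<sigma> B s x = exp (- (\<Sum>j<N. \<sigma> j * (cmod (B j x + s j))\<^sup>2))"

lemma tilt_bounds:
  assumes "\<And>j. j < N \<Longrightarrow> \<sigma> j \<ge> 0"
  shows "0 < tilt N \<sigma> B s x" "tilt N \<sigma> B s x \<le> 1"
proof -
  have "0 \<le> (\<Sum>j<N. \<sigma> j * (cmod (B j x + s j))\<^sup>2)"
    by (intro sum_nonneg mult_nonneg_nonneg) (use assms in auto)
  then show "0 < tilt N \<sigma> B s x" "tilt N \<sigma> B s x \<le> 1" by (auto simp: tilt_def)
qed

lemma measurable_tilt:
  assumes "\<And>j. j < N \<Longrightarrow> B j \<in> borel_measurable seq_borel"
  shows "tilt N \<sigma> B s \<in> borel_measurable seq_borel"
proof -
  have "(\<lambda>x. \<Sum>j<N. \<sigma> j * (cmod (B j x + s j))\<^sup>2) \<in> borel_measurable seq_borel"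
    using assms by (intro borel_measurable_sum) auto
  then show ?thesis unfolding tilt_def[abs_def] by simp
qed

lemma poly_bounded_tilt:
  assumes "\<And>j. j < N \<Longrightarrow> \<sigma> j \<ge> 0" "\<And>j. j < N \<Longrightarrow> B j \<in> borel_measurable seq_borel"
  shows "poly_bounded \<rho> (\<lambda>x. of_real (tilt N \<sigma> B s x))"
proof (rule poly_boundedI[where C = 1 and m = 0])
  show "(\<lambda>x. complex_of_real (tilt N \<sigma> B s x)) \<in> borel_measurable seq_borel"
    using measurable_tilt[OF assms(2)] by simp
  show "cmod (complex_of_real (tilt N \<sigma> B s x)) \<le> 1 * (1 + wnorm \<rho> x) ^ 0" for x
    using tilt_bounds[where N = N and \<sigma> = \<sigma> and B = B and s = s and x = x] assms(1) by simp
qed simp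

lemma poly_bounded_measurable:
  assumes "poly_bounded \<rho> f"
  shows "f \<in> borel_measurable (gauss_seq r)"
proof -
  have "f \<in> borel_measurable seq_borel" using assms by (simp add: poly_bounded_def)
  then show ?thesis by simp
qed

lemma poly_bounded_component: "\<rho> > 0 \<Longrightarrow> poly_bounded \<rho> (\<lambda>x. x k)"
proof (rule poly_boundedI[where C = "1 / \<rho> ^ k" and m = 1])
  fix x assume "\<rho> > 0" "wsummable \<rho> x"
  then have "cmod (x k) \<le> wnorm \<rho> x / \<rho> ^ k" by (intro wnorm_component)
  also have "\<dots> \<le> 1 / \<rho> ^ k * (1 + wnorm \<rho> x) ^ 1" using \<open>\<rho> > 0\<close> by (simp add: divide_right_mono)
  finally show "cmod (x k) \<le> 1 / \<rho> ^ k * (1 + wnorm \<rho> x) ^ 1" .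
qed auto

lemma poly_bounded_affine: "bounded_functional \<rho> l \<Longrightarrow> \<rho> > 0 \<Longrightarrow> poly_bounded \<rho> (\<lambda>x. l x + c)"
  by (intro poly_bounded_add bounded_functional_poly_bounded poly_bounded_const)

lemma poly_bounded_monomial:
  assumes "\<rho> > 0" "\<And>j. j < N \<Longrightarrow> \<sigma> j \<ge> 0" "\<And>j. j < N \<Longrightarrow> bounded_functional \<rho> (B j)"
    "\<And>i. i \<in> I \<Longrightarrow> bounded_functional \<rho> (l i)" "\<And>j. j \<in> J \<Longrightarrow> bounded_functional \<rho> (l' j)"
  shows "poly_bounded \<rho> (\<lambda>x. of_real (tilt N \<sigma> B s x) * (\<Prod>i\<in>I. l i x) * cnj (\<Prod>j\<in>J. l' j x))"
  using assms
  by (intro poly_bounded_mult poly_bounded_tilt poly_bounded_cnj poly_bounded_prod bounded_functional_poly_bounded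
      bounded_functional_measurable) auto

text \<open>The derivative with respect to the conjugate of x_k meets three places: the Gaussian
  density, the tilt, and the conjugated factors over J. The holomorphic factors over I are carried
  along.\<close>

lemma stein_coordinate:
  fixes s :: "nat \<Rightarrow> complex"
  assumes r: "r \<ge> 0" and \<rho>: "0 < \<rho>" "\<rho> < 1"
    and \<sigma>: "\<And>j. j < N \<Longrightarrow> \<sigma> j \<ge> 0" and B: "\<And>j. j < N \<Longrightarrow> bounded_functional \<rho> (B j)"
    and l: "\<And>i. i \<in> I \<Longrightarrow> bounded_functional \<rho> (l i)" and l': "\<And>j. j \<in> J \<Longrightarrow> bounded_functional \<rho> (l' j)"
  defines "P \<equiv> \<lambda>J x. of_real (tilt N \<sigma> B s x) * (\<Prod>i\<in>I. l i x) * cnj (\<Prod>j\<in>J. l' j x)"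
  shows "of_real (\<tau> r k) * (\<integral>x. x k * P J x \<partial>gauss_seq r) +
      (\<Sum>j<N. of_real (\<sigma> j) * cnj (B j (useq k)) * (\<integral>x. (B j x + s j) * P J x \<partial>gauss_seq r)) =
    (\<Sum>j\<in>J. cnj (l' j (useq k)) * (\<integral>x. P (J - {j}) x \<partial>gauss_seq r))"
proof -
  have pP: "poly_bounded \<rho> (P K)" if "K \<subseteq> J" for K
    unfolding P_def using that by (intro poly_bounded_monomial \<rho> \<sigma> B l l') auto
  have pY: "poly_bounded \<rho> (\<lambda>x. (B j x + s j) * P J x)" if "j < N" for j
    using that by (intro poly_bounded_mult poly_bounded_affine B \<rho> pP) auto
  have px: "poly_bounded \<rho> (\<lambda>x. x k * P J x)"
    by (intro poly_bounded_mult poly_bounded_component \<rho> pP) auto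
  note int = poly_bounded_integrable[OF _ r \<rho>]
  \<comment> \<open>The difference of the two sides before integration; it integrates to 0 already
    in coordinate k alone.\<close>
  define F where "F x = of_real (\<tau> r k) * (x k * P J x) +
      (\<Sum>j<N. of_real (\<sigma> j) * cnj (B j (useq k)) * ((B j x + s j) * P J x)) -
    (\<Sum>j\<in>J. cnj (l' j (useq k)) * P (J - {j}) x)" for x
  have iF: "integrable (gauss_seq r) F"
    unfolding F_def[abs_def]
    by (intro Bochner_Integration.integrable_add Bochner_Integration.integrable_diff Bochner_Integration.integrable_sum
        integrable_mult_right int px pY pP) auto
  have "(\<integral>x. F x \<partial>gauss_seq r) = 0"
  proof (rule integral_gauss_seq_resample_zero[OF r iF, of k])
    show "AE x in gauss_seq r. (\<integral>w. F (x(k := w)) \<partial>gauss_measure (\<tau> r k)) = 0"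
      using gauss_seq_AE_wsummable[OF r \<rho>]
    proof eventually_elim
      fix x assume x: "wsummable \<rho> x"
      define \<alpha> where "\<alpha> j = (B j x - x k * B j (useq k)) + s j" for j
      define \<beta> where "\<beta> j = B j (useq k)" for j
      define H where "H w = (\<Prod>i\<in>I. (l i x - x k * l i (useq k)) + l i (useq k) * w)" for w
      define H' where "H' w = (\<Sum>i\<in>I. l i (useq k) * (\<Prod>y\<in>I-{i}. (l y x - x k * l y (useq k)) + l y (useq k) * w))" for w
      define GK where "GK K w = (\<Prod>i\<in>K. (l' i x - x k * l' i (useq k)) + l' i (useq k) * w)" for K w
      define G' where "G' w = (\<Sum>i\<in>J. l' i (useq k) * GK (J - {i}) w)" for w
      have Y: "B j (x(k := w)) + s j = \<alpha> j + \<beta> j * w" if "j < N" for j w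
        using bounded_functional_upd[OF B[OF that] x] by (simp add: \<alpha>_def \<beta>_def)
      have t: "tilt N \<sigma> B s (x(k := w)) = exp (- (\<Sum>j<N. \<sigma> j * (cmod (\<alpha> j + \<beta> j * w))\<^sup>2))" for w
        by (simp add: tilt_def Y)
      have lH: "(\<Prod>i\<in>I. l i (x(k := w))) = H w" for w
        unfolding H_def by (intro prod.cong refl bounded_functional_upd[OF _ x] l)
      have lG: "(\<Prod>j\<in>K. l' j (x(k := w))) = GK K w" if "K \<subseteq> J" for K w
        unfolding GK_def using that by (intro prod.cong refl bounded_functional_upd[OF _ x] l') auto
      define E where "E w = complex_of_real (exp (- (\<Sum>j<N. \<sigma> j * (cmod (\<alpha> j + \<beta> j * w))\<^sup>2)))" for w
      have PK: "P K (x(k := w)) = E w * H w * cnj (GK K w)" if "K \<subseteq> J" for K w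
        unfolding P_def lH lG[OF that] t E_def ..
      have FE: "F (x(k := w)) = E w * ((of_real (\<tau> r k) * w + (\<Sum>j<N. of_real (\<sigma> j) * (\<alpha> j + \<beta> j * w) * cnj (\<beta> j))) * H w * cnj (GK J w)
          - H w * cnj (G' w))" for w
      proof -
        have "(\<Sum>j<N. of_real (\<sigma> j) * cnj (B j (useq k)) * ((B j (x(k := w)) + s j) * P J (x(k := w)))) =
            (\<Sum>j<N. of_real (\<sigma> j) * (\<alpha> j + \<beta> j * w) * cnj (\<beta> j)) * (E w * H w * cnj (GK J w))"
          unfolding sum_distrib_right by (intro sum.cong refl) (simp add: Y PK \<beta>_def mult_ac)
        moreover have "(\<Sum>j\<in>J. cnj (l' j (useq k)) * P (J - {j}) (x(k := w))) = E w * H w * cnj (G' w)"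
          unfolding G'_def cnj_sum sum_distrib_left by (intro sum.cong refl) (auto simp: PK mult_ac)
        ultimately show ?thesis
          unfolding F_def by (simp add: PK algebra_simps)
      qed
      have "(\<integral>w. E w * ((of_real (\<tau> r k) * w + (\<Sum>j<N. of_real (\<sigma> j) * (\<alpha> j + \<beta> j * w) * cnj (\<beta> j))) * H w * cnj (GK J w)
          - H w * cnj (G' w)) \<partial>gauss_measure (\<tau> r k)) = 0"
        unfolding E_def
      proof (rule stein_one_coordinate)
        show "(H has_field_derivative H' w) (at w)" for w
          unfolding H_def[abs_def] H'_def
          by (rule has_field_derivative_prod) (auto intro!: derivative_eq_intros)
        show "(GK J has_field_derivative G' w) (at w)" for w
          unfolding GK_def[abs_def] G'_def
          by (rule has_field_derivative_prod) (auto intro!: derivative_eq_intros)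
        show "continuous_on UNIV H'" "continuous_on UNIV G'"
          unfolding H'_def[abs_def] G'_def[abs_def] GK_def by (intro continuous_intros)+
        show "poly_growth H" "poly_growth (GK J)" "poly_growth H'" "poly_growth G'"
          unfolding H_def[abs_def] H'_def[abs_def] G'_def[abs_def] GK_def[abs_def] by (intro poly_growth_intros)+
      qed (use r \<sigma> in \<open>auto simp: \<tau>_pos\<close>)
      then show "(\<integral>w. F (x(k := w)) \<partial>gauss_measure (\<tau> r k)) = 0"
        unfolding FE .
    qed
  qed
  moreover have "(\<integral>x. F x \<partial>gauss_seq r) = of_real (\<tau> r k) * (\<integral>x. x k * P J x \<partial>gauss_seq r) +
      (\<Sum>j<N. of_real (\<sigma> j) * cnj (B j (useq k)) * (\<integral>x. (B j x + s j) * P J x \<partial>gauss_seq r)) -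
    (\<Sum>j\<in>J. cnj (l' j (useq k)) * (\<integral>x. P (J - {j}) x \<partial>gauss_seq r))"
  proof -
    have 1: "integrable (gauss_seq r) (\<lambda>x. of_real (\<tau> r k) * (x k * P J x))"
      by (intro integrable_mult_right int px)
    have 2: "integrable (gauss_seq r) (\<lambda>x. of_real (\<sigma> j) * cnj (B j (useq k)) * ((B j x + s j) * P J x))" if "j < N" for j
      using that by (intro integrable_mult_right int pY)
    have 3: "integrable (gauss_seq r) (\<lambda>x. cnj (l' j (useq k)) * P (J - {j}) x)" for j
      by (intro integrable_mult_right int pP) auto
    have "(\<integral>x. F x \<partial>gauss_seq r) = (\<integral>x. of_real (\<tau> r k) * (x k * P J x) \<partial>gauss_seq r) +
        (\<Sum>j<N. \<integral>x. of_real (\<sigma> j) * cnj (B j (useq k)) * ((B j x + s j) * P J x) \<partial>gauss_seq r) -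
        (\<Sum>j\<in>J. \<integral>x. cnj (l' j (useq k)) * P (J - {j}) x \<partial>gauss_seq r)"
      unfolding F_def using 1 2 3
      by (subst Bochner_Integration.integral_diff Bochner_Integration.integral_add Bochner_Integration.integral_sum;
          (intro Bochner_Integration.integrable_add Bochner_Integration.integrable_sum)?; simp)+
    then show ?thesis by simp
  qed
  ultimately show ?thesis by simp
qed

text \<open>Two radii make the exchange of sum and expectation possible: v_k decays like \<rho>'^k
  while |x_k| is at most \<open>wnorm \<rho> x\<close> / \<rho>^k, so the terms are dominated by a
  geometric series of ratio \<rho>' / \<rho>.\<close>

lemma integral_wpair:
  assumes r: "r \<ge> 0" and \<rho>: "0 < \<rho>'" "\<rho>' < \<rho>" "\<rho> < 1"
    and v: "geo_bounded \<rho>' v" and P: "poly_bounded \<rho> P"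
  shows "(\<lambda>k. cnj (v k) * of_real (\<tau> r k) * (\<integral>x. x k * P x \<partial>gauss_seq r)) sums (\<integral>x. wpair r x v * P x \<partial>gauss_seq r)"
    and "integrable (gauss_seq r) (\<lambda>x. wpair r x v * P x)"
proof -
  have \<rho>0: "0 < \<rho>" using \<rho> by simp
  obtain C where C: "C \<ge> 0" "\<And>k. cmod (v k) \<le> C * \<rho>' ^ k"
    using v unfolding geo_bounded_def by blast
  define \<theta> where "\<theta> = \<rho>' / \<rho>"
  have \<theta>: "0 < \<theta>" "\<theta> < 1" using \<rho> \<rho>0 by (auto simp: \<theta>_def)
  define f where "f k x = of_real (\<tau> r k) * x k * cnj (v k) * P x" for k x
  have pf: "poly_bounded \<rho> (f k)" for k
    unfolding f_def[abs_def] by (intro poly_bounded_mult poly_bounded_const poly_bounded_component \<rho>0 P)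
  note int = poly_bounded_integrable[OF _ r \<rho>0 \<rho>(3)]
  have iwP: "integrable (gauss_seq r) (\<lambda>x. wnorm \<rho> x * cmod (P x))"
  proof -
    have "poly_bounded \<rho> (\<lambda>x. of_real (wnorm \<rho> x) * P x)"
    proof (intro poly_bounded_mult P \<rho>0 poly_boundedI[where C = 1 and m = 1])
      fix x assume "wsummable \<rho> x"
      then show "cmod (complex_of_real (wnorm \<rho> x)) \<le> 1 * (1 + wnorm \<rho> x) ^ 1"
        using wnorm_nonneg[OF _ \<rho>0] by simp
    qed auto
    from integrable_norm[OF int[OF this]]
    have "integrable (gauss_seq r) (\<lambda>x. \<bar>wnorm \<rho> x\<bar> * cmod (P x))" by (simp add: norm_mult)
    then show ?thesis
    proof (rule Bochner_Integration.integrable_cong_AE_imp)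
      show "(\<lambda>x. wnorm \<rho> x * cmod (P x)) \<in> borel_measurable (gauss_seq r)"
      proof -
        have "wnorm \<rho> \<in> borel_measurable (gauss_seq r)" "P \<in> borel_measurable (gauss_seq r)"
          using measurable_wnorm poly_bounded_measurable[OF P] by simp_all
        then show ?thesis by simp
      qed
      show "AE x in gauss_seq r. \<bar>wnorm \<rho> x\<bar> * cmod (P x) = wnorm \<rho> x * cmod (P x)"
        using gauss_seq_AE_wsummable[OF r \<rho>0 \<rho>(3)] by eventually_elim (simp add: wnorm_nonneg[OF _ \<rho>0])
    qed
  qed
  have fb: "AE x in gauss_seq r. cmod (f k x) \<le> (1 + r) * C * \<theta> ^ k * (wnorm \<rho> x * cmod (P x))" for k
    using gauss_seq_AE_wsummable[OF r \<rho>0 \<rho>(3)]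
  proof eventually_elim
    case (elim x)
    have "cmod (f k x) = \<tau> r k * cmod (x k) * cmod (v k) * cmod (P x)"
      using \<tau>_pos[OF r, of k] by (simp add: f_def norm_mult)
    also have "\<dots> \<le> (1 + r) * (wnorm \<rho> x / \<rho> ^ k) * (C * \<rho>' ^ k) * cmod (P x)"
      using C \<rho>0 \<rho>(1) r wnorm_component[OF elim \<rho>0, of k] wnorm_nonneg[OF elim \<rho>0]
      by (intro mult_mono mult_nonneg_nonneg) (auto simp: \<tau>_def)
    also have "\<dots> = (1 + r) * C * \<theta> ^ k * (wnorm \<rho> x * cmod (P x))"
      by (simp add: \<theta>_def power_divide)
    finally show ?case .
  qed
  have int_f: "(\<integral>x. cmod (f k x) \<partial>gauss_seq r) \<le> (1 + r) * C * \<theta> ^ k * (\<integral>x. wnorm \<rho> x * cmod (P x) \<partial>gauss_seq r)" for k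
  proof -
    have "(\<integral>x. cmod (f k x) \<partial>gauss_seq r) \<le> (\<integral>x. (1 + r) * C * \<theta> ^ k * (wnorm \<rho> x * cmod (P x)) \<partial>gauss_seq r)"
      by (intro integral_mono_AE integrable_norm int pf integrable_mult_right iwP fb)
    then show ?thesis by simp
  qed
  have sums1: "summable (\<lambda>k. \<integral>x. cmod (f k x) \<partial>gauss_seq r)"
  proof (rule summable_comparison_test'[where N = 0])
    show "summable (\<lambda>k. (1 + r) * C * \<theta> ^ k * (\<integral>x. wnorm \<rho> x * cmod (P x) \<partial>gauss_seq r))"
      using \<theta> by (intro summable_mult2 summable_mult summable_geometric) auto
    show "norm (\<integral>x. cmod (f k x) \<partial>gauss_seq r) \<le> (1 + r) * C * \<theta> ^ k * (\<integral>x. wnorm \<rho> x * cmod (P x) \<partial>gauss_seq r)" for k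
      using int_f[of k] by simp
  qed
  have sums2: "AE x in gauss_seq r. summable (\<lambda>k. norm (f k x))"
  proof -
    have "AE x in gauss_seq r. \<forall>k. cmod (f k x) \<le> (1 + r) * C * \<theta> ^ k * (wnorm \<rho> x * cmod (P x))"
      using fb by (simp add: AE_all_countable)
    then show ?thesis
    proof eventually_elim
      case (elim x)
      have "summable (\<lambda>k. (1 + r) * C * \<theta> ^ k * (wnorm \<rho> x * cmod (P x)))"
        using \<theta> by (intro summable_mult2 summable_mult summable_geometric) auto
      then show ?case by (rule summable_comparison_test'[where N = 0]) (use elim in auto)
    qed
  qed
  have iS: "integrable (gauss_seq r) (\<lambda>x. \<Sum>k. f k x)"
    by (rule integrable_suminf) (use sums1 sums2 in \<open>auto intro: int pf\<close>)
  have "(\<lambda>k. \<integral>x. f k x \<partial>gauss_seq r) sums (\<integral>x. (\<Sum>k. f k x) \<partial>gauss_seq r)"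
    by (rule sums_integral) (use sums1 sums2 in \<open>auto intro: int pf\<close>)
  moreover have ae: "AE x in gauss_seq r. (\<Sum>k. f k x) = wpair r x v * P x"
    using gauss_seq_AE_wsummable[OF r \<rho>0 \<rho>(3)]
  proof eventually_elim
    case (elim x)
    have "geo_bounded \<rho> v"
      unfolding geo_bounded_def
    proof (intro exI[of _ C] conjI allI)
      fix k
      have "C * \<rho>' ^ k \<le> C * \<rho> ^ k" using C \<rho> by (intro mult_left_mono power_mono) auto
      then show "cmod (v k) \<le> C * \<rho> ^ k" using C(2)[of k] by linarith
    qed (rule C)
    from sums_mult2[OF wpair_sums(1)[OF elim this \<rho>0], of r "P x"]
    show ?case by (simp add: f_def sums_iff)
  qed
  have mw: "(\<lambda>x. wpair r x v * P x) \<in> borel_measurable (gauss_seq r)"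
  proof -
    have "(\<lambda>x. x k) \<in> borel_measurable (gauss_seq r)" for k
      by (rule measurable_seqD[of "\<lambda>x. x"]) simp
    then have "(\<lambda>x. wpair r x v) \<in> borel_measurable (gauss_seq r)"
      unfolding wpair_def by (intro borel_measurable_suminf) simp
    then show ?thesis using poly_bounded_measurable[OF P] by simp
  qed
  ultimately have "(\<lambda>k. \<integral>x. f k x \<partial>gauss_seq r) sums (\<integral>x. wpair r x v * P x \<partial>gauss_seq r)"
    using integral_cong_AE[OF borel_measurable_integrable[OF iS] mw ae] by simp
  moreover have "(\<integral>x. f k x \<partial>gauss_seq r) = cnj (v k) * of_real (\<tau> r k) * (\<integral>x. x k * P x \<partial>gauss_seq r)" for k
  proof -
    have "(\<integral>x. f k x \<partial>gauss_seq r) = (\<integral>x. (cnj (v k) * of_real (\<tau> r k)) * (x k * P x) \<partial>gauss_seq r)"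
      unfolding f_def by (intro Bochner_Integration.integral_cong) (auto simp: mult_ac)
    then show ?thesis by simp
  qed
  ultimately show "(\<lambda>k. cnj (v k) * of_real (\<tau> r k) * (\<integral>x. x k * P x \<partial>gauss_seq r)) sums (\<integral>x. wpair r x v * P x \<partial>gauss_seq r)"
    by simp
  show "integrable (gauss_seq r) (\<lambda>x. wpair r x v * P x)"
    by (rule Bochner_Integration.integrable_cong_AE_imp[OF iS mw ae])
qed

text \<open>Integration by parts in the direction v: the coordinate identities are weighted with
  conj v_k and summed, and each functional recovers its value at v through
  \<open>bounded_functional_sums\<close>.\<close>

lemma stein_identity:
  fixes s :: "nat \<Rightarrow> complex"
  assumes r: "r \<ge> 0" and \<rho>: "0 < \<rho>'" "\<rho>' < \<rho>" "\<rho> < 1" and v: "geo_bounded \<rho>' v" and J: "finite J"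
    and \<sigma>: "\<And>j. j < N \<Longrightarrow> \<sigma> j \<ge> 0" and B: "\<And>j. j < N \<Longrightarrow> bounded_functional \<rho> (B j)"
    and l: "\<And>i. i \<in> I \<Longrightarrow> bounded_functional \<rho> (l i)" and l': "\<And>j. j \<in> J \<Longrightarrow> bounded_functional \<rho> (l' j)"
  defines "P \<equiv> \<lambda>J x. of_real (tilt N \<sigma> B s x) * (\<Prod>i\<in>I. l i x) * cnj (\<Prod>j\<in>J. l' j x)"
  shows "(\<integral>x. (wpair r x v + (\<Sum>j<N. of_real (\<sigma> j) * (B j x + s j) * cnj (B j v))) * P J x \<partial>gauss_seq r) =
    (\<Sum>j\<in>J. cnj (l' j v) * (\<integral>x. P (J - {j}) x \<partial>gauss_seq r))"
proof -
  have \<rho>0: "0 < \<rho>" using \<rho> by simp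
  have pP: "poly_bounded \<rho> (P J)"
    unfolding P_def by (intro poly_bounded_monomial \<rho>0 \<sigma> B l l') auto
  have pY: "poly_bounded \<rho> (\<lambda>x. (B j x + s j) * P J x)" if "j < N" for j
    using that by (intro poly_bounded_mult poly_bounded_affine B \<rho>0 pP) auto
  note int = poly_bounded_integrable[OF _ r \<rho>0 \<rho>(3)]
  have vS: "wsummable \<rho> v"
  proof -
    have "geo_bounded \<rho> v"
      using v \<rho> unfolding geo_bounded_def
      by (meson mult_left_mono order_trans power_mono less_imp_le)
    then show ?thesis using geo_bounded_wsummable \<rho>0 \<rho>(3) by blast
  qed
  have bs: "(\<lambda>k. cnj (v k) * cnj (l (useq k))) sums cnj (l v)" if "bounded_functional \<rho> l" for l
    using sums_cnj[THEN iffD2, OF bounded_functional_sums[OF that vS \<rho>0]] by simp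
  let ?e = "\<lambda>j. \<integral>x. (B j x + s j) * P J x \<partial>gauss_seq r"
  let ?R = "\<lambda>j. \<integral>x. P (J - {j}) x \<partial>gauss_seq r"
  have "(\<lambda>k. cnj (v k) * of_real (\<tau> r k) * (\<integral>x. x k * P J x \<partial>gauss_seq r) +
      (\<Sum>j<N. of_real (\<sigma> j) * (cnj (v k) * cnj (B j (useq k))) * ?e j)) sums
    ((\<integral>x. wpair r x v * P J x \<partial>gauss_seq r) + (\<Sum>j<N. of_real (\<sigma> j) * cnj (B j v) * ?e j))"
    by (intro sums_add sums_sum sums_mult2 sums_mult integral_wpair[OF r \<rho> v pP] bs B) auto
  moreover have "cnj (v k) * of_real (\<tau> r k) * (\<integral>x. x k * P J x \<partial>gauss_seq r) +
      (\<Sum>j<N. of_real (\<sigma> j) * (cnj (v k) * cnj (B j (useq k))) * ?e j) =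
      (\<Sum>j\<in>J. (cnj (v k) * cnj (l' j (useq k))) * ?R j)" for k
  proof -
    have "cnj (v k) * (of_real (\<tau> r k) * (\<integral>x. x k * P J x \<partial>gauss_seq r) +
      (\<Sum>j<N. of_real (\<sigma> j) * cnj (B j (useq k)) * ?e j)) = cnj (v k) * (\<Sum>j\<in>J. cnj (l' j (useq k)) * ?R j)"
      unfolding P_def by (intro arg_cong2[where f = "(*)"] refl stein_coordinate[where \<rho> = \<rho>] r \<rho>0 \<rho>(3) \<sigma> B l l')
    then show ?thesis by (simp add: sum_distrib_left distrib_left mult_ac)
  qed
  moreover have "(\<lambda>k. \<Sum>j\<in>J. (cnj (v k) * cnj (l' j (useq k))) * ?R j) sums (\<Sum>j\<in>J. cnj (l' j v) * ?R j)"
    by (intro sums_sum sums_mult2 bs l')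
  ultimately have "(\<integral>x. wpair r x v * P J x \<partial>gauss_seq r) + (\<Sum>j<N. of_real (\<sigma> j) * cnj (B j v) * ?e j) =
      (\<Sum>j\<in>J. cnj (l' j v) * ?R j)"
    by (simp add: sums_iff)
  moreover have "(\<integral>x. (wpair r x v + (\<Sum>j<N. of_real (\<sigma> j) * (B j x + s j) * cnj (B j v))) * P J x \<partial>gauss_seq r) =
      (\<integral>x. wpair r x v * P J x + (\<Sum>j<N. of_real (\<sigma> j) * cnj (B j v) * ((B j x + s j) * P J x)) \<partial>gauss_seq r)"
    by (intro Bochner_Integration.integral_cong) (auto simp: algebra_simps sum_distrib_left)
  moreover have "\<dots> = (\<integral>x. wpair r x v * P J x \<partial>gauss_seq r) + (\<Sum>j<N. of_real (\<sigma> j) * cnj (B j v) * ?e j)"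
  proof -
    have i2: "integrable (gauss_seq r) (\<lambda>x. of_real (\<sigma> j) * cnj (B j v) * ((B j x + s j) * P J x))" if "j < N" for j
      using that by (intro integrable_mult_right int pY)
    then have "(\<integral>x. wpair r x v * P J x + (\<Sum>j<N. of_real (\<sigma> j) * cnj (B j v) * ((B j x + s j) * P J x)) \<partial>gauss_seq r) =
       (\<integral>x. wpair r x v * P J x \<partial>gauss_seq r) + (\<integral>x. (\<Sum>j<N. of_real (\<sigma> j) * cnj (B j v) * ((B j x + s j) * P J x)) \<partial>gauss_seq r)"
      by (intro Bochner_Integration.integral_add integral_wpair(2)[OF r \<rho> v pP] Bochner_Integration.integrable_sum) auto
    also have "(\<integral>x. (\<Sum>j<N. of_real (\<sigma> j) * cnj (B j v) * ((B j x + s j) * P J x)) \<partial>gauss_seq r) =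
        (\<Sum>j<N. of_real (\<sigma> j) * cnj (B j v) * ?e j)"
      using i2 by (subst Bochner_Integration.integral_sum) auto
    finally show ?thesis .
  qed
  ultimately show ?thesis by simp
qed


section \<open>Wick's formula for the deflated series\<close>

lemma bounded_functional_divdiffs:
  assumes \<rho>: "\<rho> > 0" and z: "\<And>i. i < n \<Longrightarrow> cmod (z i) < \<rho>"
    and F: "(\<lambda>x. F (divdiffs n z x)) \<in> borel_measurable seq_borel"
      "\<And>x y c. wsummable \<rho> x \<Longrightarrow> wsummable \<rho> y \<Longrightarrow> F (\<lambda>k. x k + c * y k) = F x + c * F y"
      "C \<ge> 0" "\<And>x. wsummable \<rho> x \<Longrightarrow> cmod (F x) \<le> C * wnorm \<rho> x"
  shows "bounded_functional \<rho> (\<lambda>x. F (divdiffs n z x))"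
proof -
  obtain D where D: "D \<ge> 0" "\<And>x. wsummable \<rho> x \<Longrightarrow> wnorm \<rho> (divdiffs n z x) \<le> D * wnorm \<rho> x"
    using divdiffs_bound[of n z \<rho>] z by auto
  have "cmod (F (divdiffs n z x)) \<le> (C * D) * wnorm \<rho> x" if x: "wsummable \<rho> x" for x
  proof -
    have "cmod (F (divdiffs n z x)) \<le> C * wnorm \<rho> (divdiffs n z x)"
      by (intro F divdiffs_wsummable x z)
    also have "\<dots> \<le> C * (D * wnorm \<rho> x)" using F(3) D(2)[OF x] by (intro mult_left_mono)
    finally show ?thesis by (simp add: mult.assoc)
  qed
  moreover have "0 \<le> C * D" using F(3) D(1) by simp
  moreover have "F (divdiffs n z (\<lambda>k. x k + c * y k)) = F (divdiffs n z x) + c * F (divdiffs n z y)"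
    if "wsummable \<rho> x" "wsummable \<rho> y" for x y c
    using divdiffs_lincomb[OF that z \<rho>] F(2)[OF divdiffs_wsummable[OF that(1) z] divdiffs_wsummable[OF that(2) z]] by simp
  ultimately show ?thesis unfolding bounded_functional_def using F(1) by blast
qed

lemma measurable_seq_component: "(\<lambda>x. x k) \<in> borel_measurable seq_borel"
  by simp

lemma bounded_functional_interp:
  assumes "\<rho> > 0" "\<And>i. i < n \<Longrightarrow> cmod (z i) < \<rho>"
  shows "bounded_functional \<rho> (\<lambda>x. interp n z x j)"
proof -
  obtain C where C: "C \<ge> 0" "\<And>y. wsummable \<rho> y \<Longrightarrow> cmod (lins n z y j) \<le> C * wnorm \<rho> y"
    using lins_component_bound[OF assms(1)] by blast
  show ?thesis unfolding interp_def
  proof (rule bounded_functional_divdiffs[where F = "\<lambda>y. lins n z y j", OF assms _ _ C])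
    show "(\<lambda>x. lins n z (divdiffs n z x) j) \<in> borel_measurable seq_borel"
      by (intro measurable_lins measurable_divdiffs measurable_seq_component) auto
  qed (simp_all add: lins_lincomb)
qed

lemma bounded_functional_eval:
  assumes "\<rho> > 0" "\<And>i. i < n \<Longrightarrow> cmod (z i) < \<rho>" "cmod a \<le> \<rho>"
  shows "bounded_functional \<rho> (\<lambda>x. pseries (divdiffs n z x) a)"
proof (rule bounded_functional_divdiffs[where F = "\<lambda>y. pseries y a" and C = 1, OF assms(1,2)])
  show "(\<lambda>x. pseries (divdiffs n z x) a) \<in> borel_measurable seq_borel"
    by (rule measurable_pseries, rule measurable_divdiffs) auto
qed (use assms(3) in \<open>simp_all add: pseries_lincomb norm_pseries_le\<close>)

lemma measurable_wpair:
  assumes "\<And>k. (\<lambda>u. Y u k) \<in> borel_measurable M"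
  shows "(\<lambda>u. wpair r (Y u) v) \<in> borel_measurable M"
  unfolding wpair_def using assms by (intro borel_measurable_suminf) auto

text \<open>With s = 0 this is the product of the Gaussian densities in \<open>kac_rice\<close>
  without the constants \<open>\<tau> r j\<close> / pi.\<close>

abbreviation ztilt :: "real \<Rightarrow> nat \<Rightarrow> (nat \<Rightarrow> complex) \<Rightarrow> (nat \<Rightarrow> complex) \<Rightarrow> (nat \<Rightarrow> complex) \<Rightarrow> real" where
  "ztilt r n z \<equiv> tilt n (\<tau> r) (\<lambda>j x. interp n z x j)"

lemma geo_bounded_mono:
  assumes "geo_bounded \<rho>' h" "0 \<le> \<rho>'" "\<rho>' \<le> \<rho>"
  shows "geo_bounded \<rho> h"
  using assms unfolding geo_bounded_def by (meson mult_left_mono order_trans power_mono)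

text \<open>The direction is \<open>lins n z h\<close> with its first n entries cleared. Its
  quotient is still h, so evaluations see h; its interpolation remainder is all of
  \<open>lins n z h\<close>, so the gradient of the weight supplies exactly the n terms that
  clearing removed from the pairing.\<close>

lemma kernel_stein:
  assumes r: "r \<ge> 0" and \<rho>: "0 < \<rho>'" "\<rho>' < \<rho>" "\<rho> < 1" and z: "\<And>i. i < n \<Longrightarrow> cmod (z i) < \<rho>'"
    and h: "geo_bounded \<rho>' h" and J: "finite J"
    and a: "\<And>i. i \<in> I \<Longrightarrow> cmod (a i) \<le> \<rho>" and b: "\<And>j. j \<in> J \<Longrightarrow> cmod (b j) \<le> \<rho>"
  shows "(\<integral>x. wpair r (\<lambda>k. interp n z x k + (if k < n then s k else 0)) (lins n z h) *
        (of_real (ztilt r n z s x) * (\<Prod>i\<in>I. pseries (divdiffs n z x) (a i)) * cnj (\<Prod>j\<in>J. pseries (divdiffs n z x) (b j)))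
        \<partial>gauss_seq r) =
    (\<Sum>j\<in>J. cnj (pseries h (b j)) *
      (\<integral>x. of_real (ztilt r n z s x) * (\<Prod>i\<in>I. pseries (divdiffs n z x) (a i)) * cnj (\<Prod>j\<in>J-{j}. pseries (divdiffs n z x) (b j))
        \<partial>gauss_seq r))"
proof -
  have \<rho>0: "0 < \<rho>" using \<rho> by simp
  have z\<rho>: "\<And>i. i < n \<Longrightarrow> cmod (z i) < \<rho>" using z \<rho>(2) by (meson less_trans)
  let ?\<kappa> = "lins n z h"
  let ?P = "\<lambda>x. of_real (ztilt r n z s x) * (\<Prod>i\<in>I. pseries (divdiffs n z x) (a i)) * cnj (\<Prod>j\<in>J. pseries (divdiffs n z x) (b j))"
  define v where "v k = (if k < n then 0 else ?\<kappa> k)" for k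
  have \<kappa>: "geo_bounded \<rho>' ?\<kappa>" by (rule geo_bounded_lins[OF h \<rho>(1)])
  have v: "geo_bounded \<rho>' v"
    using \<kappa> \<rho>(1) unfolding geo_bounded_def v_def by (metis less_imp_le mult_nonneg_nonneg norm_zero zero_le_power)
  have \<kappa>\<rho>: "geo_bounded \<rho> ?\<kappa>" using geo_bounded_mono[OF \<kappa>] \<rho> by simp
  have hS: "wsummable \<rho> h"
    using geo_bounded_wsummable[OF geo_bounded_mono[OF h]] \<rho> by simp
  have dv: "divdiffs n z v = h"
  proof -
    have "divdiffs n z v = divdiffs n z ?\<kappa>" by (rule divdiffs_cong_seq) (simp add: v_def)
    also have "\<dots> = h" by (rule divdiffs_lins[OF hS z\<rho> \<rho>0])
    finally show ?thesis .
  qed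
  have iv: "interp n z v j = ?\<kappa> j" for j unfolding interp_def dv ..
  have "(\<integral>x. (wpair r x v + (\<Sum>j<n. of_real (\<tau> r j) * (interp n z x j + s j) * cnj (interp n z v j))) * ?P x \<partial>gauss_seq r) =
    (\<Sum>j\<in>J. cnj (pseries (divdiffs n z v) (b j)) *
      (\<integral>x. of_real (ztilt r n z s x) * (\<Prod>i\<in>I. pseries (divdiffs n z x) (a i)) * cnj (\<Prod>j\<in>J-{j}. pseries (divdiffs n z x) (b j))
        \<partial>gauss_seq r))"
    using less_imp_le[OF \<tau>_pos[OF r]]
    by (intro stein_identity[OF r \<rho> v J] bounded_functional_interp bounded_functional_eval \<rho>0 z\<rho> a b)
  moreover have "(\<integral>x. wpair r (\<lambda>k. interp n z x k + (if k < n then s k else 0)) ?\<kappa> * ?P x \<partial>gauss_seq r) =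
     (\<integral>x. (wpair r x v + (\<Sum>j<n. of_real (\<tau> r j) * (interp n z x j + s j) * cnj (interp n z v j))) * ?P x \<partial>gauss_seq r)"
  proof (rule integral_cong_AE)
    have P: "?P \<in> borel_measurable (gauss_seq r)"
      using less_imp_le[OF \<tau>_pos[OF r]]
      by (intro poly_bounded_measurable[of \<rho>] poly_bounded_monomial bounded_functional_interp bounded_functional_eval \<rho>0 z\<rho> a b)
    have c: "(\<lambda>x. x k) \<in> borel_measurable (gauss_seq r)" for k by simp
    have i: "(\<lambda>x. interp n z x k) \<in> borel_measurable (gauss_seq r)" for k
      by (intro measurable_interp c) auto
    have w1: "(\<lambda>x. wpair r (\<lambda>k. interp n z x k + (if k < n then s k else 0)) ?\<kappa>) \<in> borel_measurable (gauss_seq r)"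
      using i by (intro measurable_wpair) auto
    show "(\<lambda>x. wpair r (\<lambda>k. interp n z x k + (if k < n then s k else 0)) ?\<kappa> * ?P x) \<in> borel_measurable (gauss_seq r)"
      by (rule borel_measurable_times[OF w1 P])
    have w2: "(\<lambda>x. wpair r x v + (\<Sum>j<n. of_real (\<tau> r j) * (interp n z x j + s j) * cnj (interp n z v j))) \<in> borel_measurable (gauss_seq r)"
      by (intro borel_measurable_add borel_measurable_sum borel_measurable_times measurable_wpair c i) auto
    show "(\<lambda>x. (wpair r x v + (\<Sum>j<n. of_real (\<tau> r j) * (interp n z x j + s j) * cnj (interp n z v j))) * ?P x) \<in> borel_measurable (gauss_seq r)"
      by (rule borel_measurable_times[OF w2 P])
    show "AE x in gauss_seq r. wpair r (\<lambda>k. interp n z x k + (if k < n then s k else 0)) ?\<kappa> * ?P x =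
      (wpair r x v + (\<Sum>j<n. of_real (\<tau> r j) * (interp n z x j + s j) * cnj (interp n z v j))) * ?P x"
      using gauss_seq_AE_wsummable[OF r \<rho>0 \<rho>(3)]
    proof eventually_elim
      case (elim x)
      let ?g = "\<lambda>k. if k < n then of_real (\<tau> r k) * (interp n z x k + s k) * cnj (?\<kappa> k) else 0"
      have "(\<lambda>k. of_real (\<tau> r k) * x k * cnj (v k)) sums wpair r x v"
        using geo_bounded_mono[OF v] \<rho> by (intro wpair_sums(1)[OF elim _ \<rho>0]) simp
      moreover have "?g sums (\<Sum>k<n. ?g k)" by (rule sums_finite) auto
      ultimately have "(\<lambda>k. of_real (\<tau> r k) * x k * cnj (v k) + ?g k) sums (wpair r x v + (\<Sum>k<n. ?g k))"
        by (rule sums_add)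
      moreover have "of_real (\<tau> r k) * x k * cnj (v k) + ?g k =
          of_real (\<tau> r k) * (interp n z x k + (if k < n then s k else 0)) * cnj (?\<kappa> k)" for k
        using interp_ge[OF elim z\<rho> \<rho>0, where k = k] by (auto simp: v_def)
      ultimately have "wpair r (\<lambda>k. interp n z x k + (if k < n then s k else 0)) ?\<kappa> = wpair r x v + (\<Sum>k<n. ?g k)"
        by (simp add: wpair_def sums_iff)
      then show ?case by (simp add: iv)
    qed
  qed
  ultimately show ?thesis by (simp only: dv)
qed

text \<open>Induction on the number of factors. Q(a_m) is rewritten as the pairing with its kernel;
  integration by parts then contracts it with each conj Q(b_j) in turn, and what is left has one
  factor less on both sides.\<close>

lemma wick_tilted:
  fixes m :: nat
  assumes r: "r \<ge> 0" and \<rho>: "0 < \<rho>'" "\<rho>' < 1" and z: "\<And>i. i < n \<Longrightarrow> cmod (z i) < \<rho>'"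
    and a: "\<And>i. i < m \<Longrightarrow> cmod (a i) \<le> \<rho>'" and b: "\<And>j. j < m \<Longrightarrow> cmod (b j) \<le> \<rho>'"
  shows "(\<integral>x. of_real (ztilt r n z (\<lambda>_. 0) x) * (\<Prod>i<m. pseries (divdiffs n z x) (a i)) * cnj (\<Prod>j<m. pseries (divdiffs n z x) (b j)) \<partial>gauss_seq r) =
    (\<integral>x. of_real (ztilt r n z (\<lambda>_. 0) x) \<partial>gauss_seq r) *
    (\<Sum>p | p permutes {..<m}. \<Prod>i<m. cnj (pseries (defl_kernel r n z (a i)) (b (p i))))"
  using a b
proof (induction m arbitrary: b)
  case 0
  then show ?case by simp
next
  case (Suc m)
  \<comment> \<open>Integration by parts needs a radius strictly above the one that bounds the
    points and kernels.\<close>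
  obtain \<rho> where \<rho>2: "\<rho>' < \<rho>" "\<rho> < 1" using dense[OF \<rho>(2)] by auto
  have \<rho>0: "0 < \<rho>" using \<rho> \<rho>2 by simp
  let ?Q = "\<lambda>x. pseries (divdiffs n z x)" and ?t = "\<lambda>x. complex_of_real (ztilt r n z (\<lambda>_. 0) x)"
  let ?K = "\<lambda>i w. cnj (pseries (defl_kernel r n z (a i)) w)"
  let ?h = "defl_kernel r n z (a m)"
  let ?T = "\<integral>x. ?t x \<partial>gauss_seq r"
  have h: "geo_bounded \<rho>' ?h"
    using Suc.prems(1)[of m] r z \<rho> by (intro geo_bounded_defl_kernel) auto
  have ar: "cmod (a i) \<le> \<rho>" if "i < Suc m" for i using Suc.prems(1)[OF that] \<rho>2(1) by simp
  have br: "cmod (b i) \<le> \<rho>" if "i < Suc m" for i using Suc.prems(2)[OF that] \<rho>2(1) by simp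
  \<comment> \<open>Transposing m and j carries the first m indices onto all indices but j, which
    puts the remaining factors into the form of the induction hypothesis.\<close>
  have bi: "bij_betw (Transposition.transpose m j) {..<m} ({..<Suc m} - {j})" if "j < Suc m" for j
  proof -
    have "inj_on (Transposition.transpose m j) {..<m}" by (rule inj_on_subset[OF inj_transpose]) simp
    moreover have "Transposition.transpose m j ` {..<m} = {..<Suc m} - {j}"
      using that by (auto simp: Transposition.transpose_def image_iff less_Suc_eq split: if_splits)
    ultimately show ?thesis by (simp add: bij_betw_def)
  qed
  have rem: "(\<Prod>i\<in>{..<Suc m}-{j}. ?Q x (b i)) = (\<Prod>i<m. ?Q x (b (Transposition.transpose m j i)))" if "j < Suc m" for j x
    by (rule prod.reindex_bij_betw[OF bi[OF that], symmetric])
  have tr: "Transposition.transpose m j i < Suc m" if "j < Suc m" "i < m" for i j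
    using bi[OF that(1)] that(2) by (auto simp: bij_betw_def)
  have "(\<integral>x. ?t x * (\<Prod>i<Suc m. ?Q x (a i)) * cnj (\<Prod>j<Suc m. ?Q x (b j)) \<partial>gauss_seq r) =
    (\<integral>x. wpair r (\<lambda>k. interp n z x k + (if k < n then 0 else 0)) (lins n z ?h) *
        (?t x * (\<Prod>i\<in>{..<m}. ?Q x (a i)) * cnj (\<Prod>j\<in>{..<Suc m}. ?Q x (b j))) \<partial>gauss_seq r)"
  proof (rule integral_cong_AE)
    have zr: "\<And>i. i < n \<Longrightarrow> cmod (z i) < \<rho>" using z \<rho>2(1) by (meson less_trans)
    have P: "(\<lambda>x. ?t x * (\<Prod>i\<in>{..<k}. ?Q x (a i)) * cnj (\<Prod>j\<in>{..<Suc m}. ?Q x (b j))) \<in> borel_measurable (gauss_seq r)"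
      if "k \<le> Suc m" for k
      using that
      by (intro poly_bounded_measurable[of \<rho>] poly_bounded_monomial bounded_functional_interp bounded_functional_eval \<rho>0 zr
          ar br less_imp_le[OF \<tau>_pos[OF r]]) auto
    show "(\<lambda>x. ?t x * (\<Prod>i<Suc m. ?Q x (a i)) * cnj (\<Prod>j<Suc m. ?Q x (b j))) \<in> borel_measurable (gauss_seq r)"
      by (rule P) simp
    have "(\<lambda>x. interp n z x k + (if k < n then 0 else 0)) \<in> borel_measurable (gauss_seq r)" for k
    proof -
      have "(\<lambda>x. interp n z x k) \<in> borel_measurable (gauss_seq r)"
        by (intro measurable_interp) auto
      then show ?thesis by simp
    qed
    then have w: "(\<lambda>x. wpair r (\<lambda>k. interp n z x k + (if k < n then 0 else 0)) (lins n z ?h)) \<in> borel_measurable (gauss_seq r)"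
      by (rule measurable_wpair)
    show "(\<lambda>x. wpair r (\<lambda>k. interp n z x k + (if k < n then 0 else 0)) (lins n z ?h) *
        (?t x * (\<Prod>i\<in>{..<m}. ?Q x (a i)) * cnj (\<Prod>j\<in>{..<Suc m}. ?Q x (b j)))) \<in> borel_measurable (gauss_seq r)"
      by (rule borel_measurable_times[OF w P]) simp
    show "AE x in gauss_seq r. ?t x * (\<Prod>i<Suc m. ?Q x (a i)) * cnj (\<Prod>j<Suc m. ?Q x (b j)) =
      wpair r (\<lambda>k. interp n z x k + (if k < n then 0 else 0)) (lins n z ?h) *
        (?t x * (\<Prod>i\<in>{..<m}. ?Q x (a i)) * cnj (\<Prod>j\<in>{..<Suc m}. ?Q x (b j)))"
      using gauss_seq_AE_wsummable[OF r \<rho>0 \<rho>2(2)]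
    proof eventually_elim
      case (elim x)
      have "cmod (a m) \<le> \<rho>" using Suc.prems(1)[of m] \<rho>2 by simp
      then have "wpair r (interp n z x) (lins n z ?h) = ?Q x (a m)"
        unfolding interp_def by (intro wpair_defl_kernel[OF r divdiffs_wsummable[OF elim zr] zr _ \<rho>0 \<rho>2(2)]) auto
      then show ?case by (simp add: mult_ac)
    qed
  qed
  also have "\<dots> = (\<Sum>j\<in>{..<Suc m}. cnj (pseries ?h (b j)) *
      (\<integral>x. ?t x * (\<Prod>i\<in>{..<m}. ?Q x (a i)) * cnj (\<Prod>j\<in>{..<Suc m}-{j}. ?Q x (b j)) \<partial>gauss_seq r))"
    by (intro kernel_stein[OF r \<rho>(1) \<rho>2 z h] ar br) auto
  also have "\<dots> = (\<Sum>j\<in>{..<Suc m}. ?K m (b j) * (?T * (\<Sum>p | p permutes {..<m}. \<Prod>i<m. ?K i (b (Transposition.transpose m j (p i))))))"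
  proof (intro sum.cong refl arg_cong2[where f = "(*)"])
    fix j assume j: "j \<in> {..<Suc m}"
    have "(\<integral>x. ?t x * (\<Prod>i\<in>{..<m}. ?Q x (a i)) * cnj (\<Prod>j\<in>{..<Suc m}-{j}. ?Q x (b j)) \<partial>gauss_seq r) =
        (\<integral>x. ?t x * (\<Prod>i<m. ?Q x (a i)) * cnj (\<Prod>i<m. ?Q x ((b \<circ> Transposition.transpose m j) i)) \<partial>gauss_seq r)"
      using j by (simp only: rem lessThan_iff o_def)
    also have "\<dots> = ?T * (\<Sum>p | p permutes {..<m}. \<Prod>i<m. ?K i ((b \<circ> Transposition.transpose m j) (p i)))"
      using Suc.prems tr j by (intro Suc.IH) auto
    finally show "(\<integral>x. ?t x * (\<Prod>i\<in>{..<m}. ?Q x (a i)) * cnj (\<Prod>j\<in>{..<Suc m}-{j}. ?Q x (b j)) \<partial>gauss_seq r) =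
      ?T * (\<Sum>p | p permutes {..<m}. \<Prod>i<m. ?K i (b (Transposition.transpose m j (p i))))" by simp
  qed
  also have "\<dots> = ?T * (\<Sum>j\<in>insert m {..<m}. \<Sum>q | q permutes {..<m}. (\<Prod>i<Suc m. ?K i (b ((Transposition.transpose m j \<circ> q) i))))"
  proof -
    have "(\<Prod>i<Suc m. ?K i (b ((Transposition.transpose m j \<circ> q) i))) = ?K m (b j) * (\<Prod>i<m. ?K i (b (Transposition.transpose m j (q i))))"
      if "q permutes {..<m}" for q j
      using permutes_not_in[OF that, of m] by (simp add: mult.commute)
    then show ?thesis
      unfolding lessThan_Suc[symmetric]
      by (simp add: sum_distrib_left sum_distrib_right mult_ac del: sum.lessThan_Suc prod.lessThan_Suc)
  qed
  \<comment> \<open>Every permutation of m + 1 points is, in a unique way, a permutation of the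
    first m followed by the transposition of m with some j.\<close>
  also have "(\<Sum>j\<in>insert m {..<m}. \<Sum>q | q permutes {..<m}. (\<Prod>i<Suc m. ?K i (b ((Transposition.transpose m j \<circ> q) i)))) =
      (\<Sum>p | p permutes insert m {..<m}. \<Prod>i<Suc m. ?K i (b (p i)))"
    by (rule sum_over_permutations_insert[symmetric]) auto
  finally show ?case by (simp only: lessThan_Suc[symmetric])
qed


section \<open>The mass of the Gaussian weight\<close>

lemma x_exp_minus_le_1: "x * exp (- x) \<le> (1::real)"
proof -
  have "x \<le> exp x" using exp_ge_add_one_self[of x] by linarith
  then have "x * exp (- x) \<le> exp x * exp (- x)" by (intro mult_right_mono) auto
  then show ?thesis by (simp add: exp_minus)
qed

text \<open>The hypothesis says that \<open>t \<mapsto> \<integral> e t\<close> satisfies the differential equation \<open>y' = - 2 \<kappa> t y\<close>.\<close>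
lemma gaussian_line:
  fixes b :: "nat \<Rightarrow> 'a \<Rightarrow> complex" and c :: "nat \<Rightarrow> complex"
  assumes M: "prob_space M" and b: "\<And>j. j < N \<Longrightarrow> b j \<in> borel_measurable M" and \<sigma>: "\<And>j. j < N \<Longrightarrow> \<sigma> j \<ge> 0"
  defines "e \<equiv> \<lambda>t x. exp (- (\<Sum>j<N. \<sigma> j * (cmod (b j x + of_real t * c j))\<^sup>2))"
  assumes grad: "\<And>t. 0 \<le> t \<Longrightarrow> t \<le> 1 \<Longrightarrow>
    (\<integral>x. (\<Sum>j<N. \<sigma> j * Re ((b j x + of_real t * c j) * cnj (c j))) * e t x \<partial>M) = \<kappa> * t * (\<integral>x. e t x \<partial>M)"
  shows "(\<integral>x. e 1 x \<partial>M) = (\<integral>x. e 0 x \<partial>M) * exp (- \<kappa>)"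
proof -
  interpret M: prob_space M by (rule M)
  interpret P: pair_sigma_finite "lborel :: real measure" M ..
  define g where "g t x = (\<Sum>j<N. \<sigma> j * Re ((b j x + of_real t * c j) * cnj (c j)))" for t x
  define D where "D t x = - 2 * (g t x * e t x)" for t x
  define \<phi> where "\<phi> t = (\<integral>x. e t x \<partial>M)" for t
  \<comment> \<open>A bound for the t-derivative uniform in t and x: with u = |b_j + t c_j|, 2u
    \<le> 1 + u^2, while the exponential keeps \<sigma>_j u^2 e below 1 and \<sigma>_j e below
    \<sigma>_j.\<close>
  define C where "C = (\<Sum>j<N. (\<sigma> j + 1) * cmod (c j))"
  have C0: "C \<ge> 0" unfolding C_def using \<sigma> by (intro sum_nonneg) (auto simp: add_nonneg_nonneg)
  have e1: "0 < e t x" "e t x \<le> 1" for t x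
  proof -
    have "0 \<le> (\<Sum>j<N. \<sigma> j * (cmod (b j x + of_real t * c j))\<^sup>2)"
      by (intro sum_nonneg mult_nonneg_nonneg) (use \<sigma> in auto)
    then show "0 < e t x" "e t x \<le> 1" by (auto simp: e_def)
  qed
  have DC: "\<bar>D t x\<bar> \<le> C" for t x
  proof -
    have "\<bar>D t x\<bar> = 2 * \<bar>g t x\<bar> * e t x" using e1(1)[of t x] by (simp add: D_def abs_mult)
    also have "\<dots> \<le> 2 * (\<Sum>j<N. \<bar>\<sigma> j * Re ((b j x + of_real t * c j) * cnj (c j))\<bar>) * e t x"
      unfolding g_def using e1(1)[of t x] by (intro mult_right_mono mult_left_mono sum_abs) auto
    also have "\<dots> = (\<Sum>j<N. 2 * \<bar>\<sigma> j * Re ((b j x + of_real t * c j) * cnj (c j))\<bar> * e t x)"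
      by (simp add: sum_distrib_left sum_distrib_right)
    also have "\<dots> \<le> C"
      unfolding C_def
    proof (rule sum_mono)
      fix j assume j: "j \<in> {..<N}"
      define u where "u = cmod (b j x + of_real t * c j)"
      have s: "\<sigma> j \<ge> 0" using \<sigma> j by simp
      have "\<bar>Re ((b j x + of_real t * c j) * cnj (c j))\<bar> \<le> u * cmod (c j)"
        unfolding u_def by (metis abs_Re_le_cmod norm_mult complex_mod_cnj)
      then have "2 * \<bar>\<sigma> j * Re ((b j x + of_real t * c j) * cnj (c j))\<bar> * e t x \<le> 2 * (\<sigma> j * (u * cmod (c j))) * e t x"
        using s e1(1)[of t x] by (intro mult_right_mono mult_left_mono) (auto simp: abs_mult intro: mult_left_mono)
      also have "\<dots> = (\<sigma> j * (2 * u)) * e t x * cmod (c j)" by simp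
      also have "\<dots> \<le> (\<sigma> j * (1 + u\<^sup>2)) * e t x * cmod (c j)"
      proof -
        have "0 \<le> (u - 1)\<^sup>2" by simp
        then have "2 * u \<le> 1 + u\<^sup>2" by (simp add: power2_diff)
        then show ?thesis using s e1(1)[of t x] by (intro mult_right_mono mult_left_mono) auto
      qed
      also have "(\<sigma> j * (1 + u\<^sup>2)) * e t x \<le> \<sigma> j + 1"
      proof -
        have "sum (\<lambda>j. \<sigma> j * (cmod (b j x + of_real t * c j))\<^sup>2) {j} \<le> (\<Sum>j<N. \<sigma> j * (cmod (b j x + of_real t * c j))\<^sup>2)"
          using j \<sigma> by (intro sum_mono2) auto
        then have "e t x \<le> exp (- (\<sigma> j * u\<^sup>2))" by (simp add: e_def u_def)
        then have "(\<sigma> j * u\<^sup>2) * e t x \<le> (\<sigma> j * u\<^sup>2) * exp (- (\<sigma> j * u\<^sup>2))" using s by (intro mult_left_mono) auto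
        also have "\<dots> \<le> 1" by (rule x_exp_minus_le_1)
        finally have "(\<sigma> j * u\<^sup>2) * e t x \<le> 1" .
        moreover have "\<sigma> j * e t x \<le> \<sigma> j" using s e1(2)[of t x] by (simp add: mult_left_le)
        ultimately show ?thesis by (simp add: algebra_simps)
      qed
      finally show "2 * \<bar>\<sigma> j * Re ((b j x + of_real t * c j) * cnj (c j))\<bar> * e t x \<le> (\<sigma> j + 1) * cmod (c j)"
        by (simp add: mult_right_mono)
    qed
    finally show ?thesis .
  qed
  have der: "((\<lambda>t. e t x) has_real_derivative D t x) (at t)" for t x
  proof -
    have eq: "e t x = exp (- (\<Sum>j<N. \<sigma> j * ((Re (b j x) + t * Re (c j))\<^sup>2 + (Im (b j x) + t * Im (c j))\<^sup>2)))" for t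
      by (simp add: e_def cmod_power2)
    have gq: "g t x = (\<Sum>j<N. \<sigma> j * ((Re (b j x) + t * Re (c j)) * Re (c j) + (Im (b j x) + t * Im (c j)) * Im (c j)))"
      by (simp add: g_def)
    show ?thesis
      unfolding D_def gq eq
      by (auto intro!: derivative_eq_intros simp: sum_distrib_left sum_negf[symmetric] algebra_simps sum.distrib[symmetric])
  qed
  have me: "e t \<in> borel_measurable M" for t
  proof -
    have "(\<lambda>x. \<Sum>j<N. \<sigma> j * (cmod (b j x + of_real t * c j))\<^sup>2) \<in> borel_measurable M"
      using b by (intro borel_measurable_sum) auto
    then show ?thesis unfolding e_def[abs_def] by simp
  qed
  have mg: "g t \<in> borel_measurable M" for t
    unfolding g_def[abs_def] using b by (intro borel_measurable_sum) auto
  have ie: "integrable M (e t)" for t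
    using e1 by (intro M.integrable_const_bound[where B = 1]) (auto simp: me abs_of_pos)
  \<comment> \<open>The first claim is the integrated differential equation. The Lipschitz bound of
    the second makes \<phi> continuous, so that the first can be differentiated.\<close>
  have incr: "\<phi> t' - \<phi> t = (\<integral>s. indicator {t..t'} s *\<^sub>R (- 2 * \<kappa> * s * \<phi> s) \<partial>lborel)"
    "\<bar>\<phi> t' - \<phi> t\<bar> \<le> C * (t' - t)"
    if t: "0 \<le> t" "t \<le> t'" "t' \<le> 1" for t t'
  proof -
    let ?f = "\<lambda>s x. indicator {t..t'} s *\<^sub>R D s x"
    have f1: "(\<integral>s. ?f s x \<partial>lborel) = e t' x - e t x" for x
    proof (rule integral_FTC_atLeastAtMost[OF t(2)])
      show "((\<lambda>t. e t x) has_vector_derivative D s x) (at s within {t..t'})" for s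
        using der[of x s] by (simp add: has_field_derivative_at_within has_real_derivative_iff_has_vector_derivative[symmetric])
      show "continuous_on {t..t'} (\<lambda>s. D s x)"
        unfolding D_def g_def e_def by (intro continuous_intros)
    qed
    have mf: "(\<lambda>(s, x). ?f s x) \<in> borel_measurable (lborel \<Otimes>\<^sub>M M)"
    proof -
      have bj: "(\<lambda>p. b j (snd p)) \<in> borel_measurable (lborel \<Otimes>\<^sub>M M)" if "j < N" for j
        by (rule measurable_compose[OF measurable_snd b[OF that]])
      have "(\<lambda>p. g (fst p) (snd p)) \<in> borel_measurable (lborel \<Otimes>\<^sub>M M)"
        unfolding g_def
      proof (rule borel_measurable_sum)
        fix j assume "j \<in> {..<N}"
        then have [measurable]: "(\<lambda>p. b j (snd p)) \<in> borel_measurable (lborel \<Otimes>\<^sub>M M)" using bj by simp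
        show "(\<lambda>p. \<sigma> j * Re ((b j (snd p) + of_real (fst p) * c j) * cnj (c j))) \<in> borel_measurable (lborel \<Otimes>\<^sub>M M)"
          by measurable
      qed
      moreover have "(\<lambda>p. e (fst p) (snd p)) \<in> borel_measurable (lborel \<Otimes>\<^sub>M M)"
      proof -
        have "(\<lambda>p. \<Sum>j<N. \<sigma> j * (cmod (b j (snd p) + of_real (fst p) * c j))\<^sup>2) \<in> borel_measurable (lborel \<Otimes>\<^sub>M M)"
        proof (rule borel_measurable_sum)
          fix j assume "j \<in> {..<N}"
          then have [measurable]: "(\<lambda>p. b j (snd p)) \<in> borel_measurable (lborel \<Otimes>\<^sub>M M)" using bj by simp
          show "(\<lambda>p. \<sigma> j * (cmod (b j (snd p) + of_real (fst p) * c j))\<^sup>2) \<in> borel_measurable (lborel \<Otimes>\<^sub>M M)"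
            by measurable
        qed
        then show ?thesis unfolding e_def by simp
      qed
      ultimately show ?thesis unfolding D_def by (simp add: case_prod_beta')
    qed
    have if': "integrable (lborel \<Otimes>\<^sub>M M) (\<lambda>(s, x). ?f s x)"
    proof (rule integrableI_bounded[OF mf])
      have "(\<integral>\<^sup>+p. ennreal (norm (case p of (s, x) \<Rightarrow> ?f s x)) \<partial>(lborel \<Otimes>\<^sub>M M)) \<le>
          (\<integral>\<^sup>+p. ennreal C * indicator {t..t'} (fst p) \<partial>(lborel \<Otimes>\<^sub>M M))"
        using DC by (intro nn_integral_mono) (auto simp: indicator_def intro!: ennreal_leI)
      also have "\<dots> = (\<integral>\<^sup>+s. (\<integral>\<^sup>+x. ennreal C * indicator {t..t'} s \<partial>M) \<partial>lborel)"
        by (subst M.nn_integral_fst[symmetric]) auto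
      also have "\<dots> = ennreal C * ennreal (t' - t)"
        using t by (simp add: M.emeasure_space_1 nn_integral_cmult)
      finally show "(\<integral>\<^sup>+p. ennreal (norm (case p of (s, x) \<Rightarrow> ?f s x)) \<partial>(lborel \<Otimes>\<^sub>M M)) < \<infinity>"
        by (simp add: ennreal_mult_less_top le_less_trans)
    qed
    have "\<phi> t' - \<phi> t = (\<integral>x. e t' x - e t x \<partial>M)"
      unfolding \<phi>_def using ie by (intro Bochner_Integration.integral_diff[symmetric])
    also have "\<dots> = (\<integral>x. (\<integral>s. ?f s x \<partial>lborel) \<partial>M)" by (simp only: f1)
    also have "\<dots> = (\<integral>s. (\<integral>x. ?f s x \<partial>M) \<partial>lborel)" by (rule P.Fubini_integral[OF if'])
    also have "\<dots> = (\<integral>s. indicator {t..t'} s *\<^sub>R (- 2 * \<kappa> * s * \<phi> s) \<partial>lborel)"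
    proof (rule Bochner_Integration.integral_cong[OF refl])
      fix s :: real
      show "(\<integral>x. ?f s x \<partial>M) = indicator {t..t'} s *\<^sub>R (- 2 * \<kappa> * s * \<phi> s)"
      proof (cases "s \<in> {t..t'}")
        case True
        then have s: "0 \<le> s" "s \<le> 1" using t by auto
        have "(\<integral>x. D s x \<partial>M) = - 2 * (\<integral>x. g s x * e s x \<partial>M)"
          unfolding D_def by (rule integral_mult_right_zero)
        also have "(\<integral>x. g s x * e s x \<partial>M) = \<kappa> * s * \<phi> s"
          unfolding g_def \<phi>_def by (rule grad[OF s])
        finally show ?thesis using True by simp
      qed simp
    qed
    finally show "\<phi> t' - \<phi> t = (\<integral>s. indicator {t..t'} s *\<^sub>R (- 2 * \<kappa> * s * \<phi> s) \<partial>lborel)" .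
    have "\<bar>e t' x - e t x\<bar> \<le> C * (t' - t)" for x
    proof -
      have "norm (e t' x - e t x) \<le> C * norm (t' - t)"
        using der DC by (intro field_differentiable_bound[where S = "{t..t'}" and f' = "\<lambda>s. D s x"])
          (use t in \<open>auto intro: has_field_derivative_at_within\<close>)
      then show ?thesis using t by simp
    qed
    then have "(\<integral>x. norm (e t' x - e t x) \<partial>M) \<le> (\<integral>x. C * (t' - t) \<partial>M)"
      by (intro integral_mono) (use ie in auto)
    moreover have "norm (\<integral>x. e t' x - e t x \<partial>M) \<le> (\<integral>x. norm (e t' x - e t x) \<partial>M)"
      by (rule integral_norm_bound)
    ultimately have "norm (\<integral>x. e t' x - e t x \<partial>M) \<le> (\<integral>x. C * (t' - t) \<partial>M)"
      by (rule order_trans[rotated])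
    then show "\<bar>\<phi> t' - \<phi> t\<bar> \<le> C * (t' - t)"
      using ie by (simp add: \<phi>_def M.prob_space)
  qed
  have cont: "continuous_on {0..1} \<phi>"
  proof (rule continuous_on_iff[THEN iffD2], intro ballI allI impI)
    fix t \<epsilon> :: real assume t: "t \<in> {0..1}" and \<epsilon>: "\<epsilon> > 0"
    show "\<exists>d>0. \<forall>t'\<in>{0..1}. dist t' t < d \<longrightarrow> dist (\<phi> t') (\<phi> t) < \<epsilon>"
    proof (intro exI[of _ "\<epsilon> / (C + 1)"] conjI ballI impI)
      show "\<epsilon> / (C + 1) > 0" using \<epsilon> C0 by simp
      fix t' assume t': "t' \<in> {0..1::real}" "dist t' t < \<epsilon> / (C + 1)"
      have "dist (\<phi> t') (\<phi> t) \<le> C * dist t' t"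
        using incr(2)[of t t'] incr(2)[of t' t] t t' by (cases "t \<le> t'") (auto simp: dist_real_def abs_minus_commute)
      also have "\<dots> \<le> (C + 1) * dist t' t" by (intro mult_right_mono) auto
      also have "\<dots> < \<epsilon>" using t'(2) C0 by (simp add: field_simps)
      finally show "dist (\<phi> t') (\<phi> t) < \<epsilon>" .
    qed
  qed
  define \<psi> where "\<psi> s = - 2 * \<kappa> * s * \<phi> s" for s
  have c\<psi>: "continuous_on {0..1} \<psi>" unfolding \<psi>_def by (intro continuous_intros cont)
  have \<phi>_int: "\<phi> t = \<phi> 0 + integral {0..t} \<psi>" if t: "0 \<le> t" "t \<le> 1" for t
  proof -
    have "set_integrable lborel {0..t} \<psi>"
      using borel_integrable_compact[OF _ continuous_on_subset[OF c\<psi>], of "{0..t}"] t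
      by (simp add: set_integrable_def)
    from set_borel_integral_eq_integral(2)[OF this]
    have "integral {0..t} \<psi> = (\<integral>s. indicator {0..t} s *\<^sub>R \<psi> s \<partial>lborel)" by (simp add: set_lebesgue_integral_def)
    then show ?thesis using incr(1)[of 0 t] t by (simp add: \<psi>_def)
  qed
  have d\<phi>: "(\<phi> has_real_derivative \<psi> t) (at t within {0..1})" if t: "t \<in> {0..1}" for t
  proof -
    have "((\<lambda>t. \<phi> 0 + integral {0..t} \<psi>) has_real_derivative 0 + \<psi> t) (at t within {0..1})"
      by (intro derivative_intros integral_has_real_derivative[OF c\<psi> t])
    then have 1: "((\<lambda>t. \<phi> 0 + integral {0..t} \<psi>) has_derivative (*) (\<psi> t)) (at t within {0..1})"
      by (simp add: has_field_derivative_def)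
    have "\<phi> s = \<phi> 0 + integral {0..s} \<psi>" if "s \<in> {0..1}" for s
      using that by (intro \<phi>_int) auto
    from has_derivative_transform[OF t this 1] show ?thesis
      by (simp add: has_field_derivative_def)
  qed
  \<comment> \<open>exp(\<kappa> t^2) is the integrating factor of the differential
    equation.\<close>
  define G where "G t = \<phi> t * exp (\<kappa> * t\<^sup>2)" for t
  have "(G has_real_derivative 0) (at t within {0..1})" if t: "t \<in> {0..1}" for t
    unfolding G_def[abs_def]
    by (auto intro!: derivative_eq_intros d\<phi>[OF t] simp: \<psi>_def algebra_simps)
  then have "\<exists>d. \<forall>t\<in>{0..1}. G t = d"
    by (intro has_field_derivative_zero_constant) auto
  then have "G 1 = G 0" by (metis atLeastAtMost_iff order_refl zero_le_one)
  then have "\<phi> 1 * exp \<kappa> = \<phi> 0" by (simp add: G_def)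
  then have "\<phi> 1 = \<phi> 0 * exp (- \<kappa>)" by (simp add: exp_minus field_simps)
  then show ?thesis by (simp add: \<phi>_def)
qed

text \<open>The diagonal of \<open>defl_kernel\<close> at w, which by \<open>wick_tilted\<close> is
  the variance of Q(w) under the normalised weight.\<close>

definition defl_var :: "real \<Rightarrow> nat \<Rightarrow> (nat \<Rightarrow> complex) \<Rightarrow> complex \<Rightarrow> real" where
  "defl_var r n z w = (1 + defl_param r n z * (cmod w)\<^sup>2) /
     ((1 + defl_param r n z) * (1 - (cmod w)\<^sup>2) * (\<Prod>i<n. (cmod (1 - z i * cnj w))\<^sup>2))"

lemma defl_var_pos:
  assumes "r \<ge> 0" "\<And>i. i < n \<Longrightarrow> cmod (z i) < 1" "cmod w < 1"
  shows "defl_var r n z w > 0"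
proof -
  have "(cmod w)\<^sup>2 < 1" using assms(3) by (simp add: abs_square_less_1)
  moreover have "(\<Prod>i<n. (cmod (1 - z i * cnj w))\<^sup>2) > 0"
  proof (rule prod_pos)
    fix i assume "i \<in> {..<n}"
    then have "1 - z i * cnj w \<noteq> 0" using assms by (intro one_minus_mult_ne_0) auto
    then show "0 < (cmod (1 - z i * cnj w))\<^sup>2" by simp
  qed
  moreover have "0 \<le> defl_param r n z * (cmod w)\<^sup>2" "0 \<le> defl_param r n z"
    using defl_param_nonneg[OF assms(1)] by auto
  ultimately show ?thesis unfolding defl_var_def by (intro divide_pos_pos mult_pos_pos add_pos_nonneg) auto
qed

lemma pseries_defl_kernel_diag:
  assumes "r \<ge> 0" "\<And>i. i < n \<Longrightarrow> cmod (z i) < \<rho>" "cmod w \<le> \<rho>" "0 < \<rho>" "\<rho> < 1"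
  shows "pseries (defl_kernel r n z w) w = of_real (defl_var r n z w)"
proof -
  let ?A = "\<Prod>i<n. 1 - z i * cnj w"
  have B: "(\<Prod>i<n. 1 - cnj (z i) * w) = cnj ?A" by simp
  have AA: "?A * cnj ?A = of_real (\<Prod>i<n. (cmod (1 - z i * cnj w))\<^sup>2)"
    by (simp only: complex_norm_square[symmetric] prod_norm[symmetric] prod_power_distrib)
  have ww: "w * cnj w = of_real ((cmod w)\<^sup>2)" by (simp only: complex_norm_square[symmetric])
  have "pseries (defl_kernel r n z w) w = 1 / ?A * (1 / (\<Prod>i<n. 1 - cnj (z i) * w)) *
      ((1 + of_real (defl_param r n z) * w * cnj w) / ((1 + of_real (defl_param r n z)) * (1 - w * cnj w)))"
    by (rule pseries_defl_kernel[OF assms(1,2,3,3,4,5)])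
  then have "pseries (defl_kernel r n z w) w = (1 + of_real (defl_param r n z) * (w * cnj w)) /
      ((1 + of_real (defl_param r n z)) * (1 - w * cnj w) * (?A * cnj ?A))"
    unfolding B by (simp add: mult_ac)
  also have "\<dots> = of_real (defl_var r n z w)"
    unfolding ww AA defl_var_def by simp
  finally show ?thesis .
qed

lemma geo_bounded_divdiff:
  assumes "geo_bounded \<rho> h" "0 < \<rho>" "\<rho> < 1" "cmod a < 1"
  shows "geo_bounded \<rho> (divdiff a h)"
proof -
  obtain C where C: "C \<ge> 0" "\<And>k. cmod (h k) \<le> C * \<rho> ^ k"
    using assms(1) unfolding geo_bounded_def by blast
  let ?\<theta> = "\<rho> * cmod a"
  have th: "0 \<le> ?\<theta>" "?\<theta> < 1"
    using assms mult_strict_mono'[of \<rho> 1 "cmod a" 1] by auto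
  have "cmod (divdiff a h k) \<le> (C * \<rho> / (1 - ?\<theta>)) * \<rho> ^ k" for k
  proof -
    have le: "norm (h (Suc (k + j)) * a ^ j) \<le> C * \<rho> ^ Suc k * ?\<theta> ^ j" for j
    proof -
      have "cmod (h (Suc (k + j))) * cmod a ^ j \<le> C * \<rho> ^ Suc (k + j) * cmod a ^ j"
        by (intro mult_right_mono C) auto
      then show ?thesis by (simp add: norm_mult norm_power power_add power_mult_distrib mult_ac)
    qed
    have s: "summable (\<lambda>j. C * \<rho> ^ Suc k * ?\<theta> ^ j)"
      using th by (intro summable_mult summable_geometric) auto
    have s': "summable (\<lambda>j. norm (h (Suc (k + j)) * a ^ j))"
      by (rule summable_comparison_test'[OF s, where N = 0]) (use le in auto)
    have "cmod (divdiff a h k) \<le> (\<Sum>j. norm (h (Suc (k + j)) * a ^ j))"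
      unfolding divdiff_def by (rule summable_norm[OF s'])
    also have "\<dots> \<le> (\<Sum>j. C * \<rho> ^ Suc k * ?\<theta> ^ j)" by (rule suminf_le[OF le s' s])
    also have "\<dots> = C * \<rho> ^ Suc k * (1 / (1 - ?\<theta>))"
      using th by (subst suminf_mult) (auto simp: suminf_geometric intro!: summable_geometric)
    finally show ?thesis by simp
  qed
  moreover have "C * \<rho> / (1 - ?\<theta>) \<ge> 0" using C(1) assms(2) th by simp
  ultimately show ?thesis unfolding geo_bounded_def by blast
qed

lemma geo_bounded_useq: "\<rho> > 0 \<Longrightarrow> geo_bounded \<rho> (useq n)"
  unfolding geo_bounded_def by (intro exI[of _ "1 / \<rho> ^ n"]) (auto simp: useq_def)

lemma lins_scale: "lins n z (\<lambda>k. c * y k) = (\<lambda>k. c * lins n z y k)"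
  using lins_lincomb[of n z "\<lambda>_. 0" c y] by (simp add: lins_zero)

lemma wpair_lincomb_right:
  assumes "wsummable \<rho> y" "geo_bounded \<rho> g" "geo_bounded \<rho> h" "\<rho> > 0"
  shows "wpair r y (\<lambda>k. c * g k - h k) = cnj c * wpair r y g - wpair r y h"
proof -
  have "(\<lambda>k. cnj c * (of_real (\<tau> r k) * y k * cnj (g k)) - of_real (\<tau> r k) * y k * cnj (h k)) sums
      (cnj c * wpair r y g - wpair r y h)"
    by (intro sums_diff sums_mult wpair_sums(1)[of \<rho>] assms)
  moreover have "of_real (\<tau> r k) * y k * cnj (c * g k - h k) =
      cnj c * (of_real (\<tau> r k) * y k * cnj (g k)) - of_real (\<tau> r k) * y k * cnj (h k)" for k
    by (simp add: algebra_simps)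
  ultimately show ?thesis unfolding wpair_def by (simp only: sums_iff)
qed

text \<open>For empty products \<open>kernel_stein\<close> says that a pairing integrates to 0
  against the weight. The direction g solves (w - z_n) g(w) = h(w) / K - 1, where h is the kernel at
  z_n and K = h(z_n), so that the right side vanishes at z_n. One part of the pairing is then an
  evaluation at z_n, giving \<theta> / K; the other is the gradient sum along m.\<close>

lemma tilt_gradient:
  assumes r: "r \<ge> 0" and z: "\<And>i. i \<le> n \<Longrightarrow> cmod (z i) < 1"
  defines "m \<equiv> lins n z (useq 0)"
  shows "(\<integral>x. (\<Sum>j<Suc n. of_real (\<tau> r j) * (interp (Suc n) z x j + \<theta> * m j) * cnj (m j)) *
        of_real (ztilt r (Suc n) z (\<lambda>j. \<theta> * m j) x) \<partial>gauss_seq r) =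
      \<theta> / of_real (defl_var r n z (z n)) * (\<integral>x. of_real (ztilt r (Suc n) z (\<lambda>j. \<theta> * m j) x) \<partial>gauss_seq r)"
proof -
  define \<sigma> where "\<sigma> = Max ((\<lambda>i. cmod (z i)) ` {..n})"
  have \<sigma>: "\<sigma> < 1" "\<And>i. i \<le> n \<Longrightarrow> cmod (z i) \<le> \<sigma>" unfolding \<sigma>_def using z by auto
  obtain \<rho>' where \<rho>': "max \<sigma> 0 < \<rho>'" "\<rho>' < 1" using dense[of "max \<sigma> 0" 1] \<sigma>(1) by auto
  obtain \<rho> where \<rho>2: "\<rho>' < \<rho>" "\<rho> < 1" using dense[OF \<rho>'(2)] by auto
  have \<rho>'0: "0 < \<rho>'" using \<rho>' by simp
  have \<rho>0: "0 < \<rho>" using \<rho>'0 \<rho>2 by simp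
  have z': "cmod (z i) < \<rho>'" if "i \<le> n" for i using \<sigma>(2)[OF that] \<rho>'(1) by simp
  have z\<rho>: "cmod (z i) < \<rho>" if "i \<le> n" for i using z'[OF that] \<rho>2(1) by simp
  let ?K = "defl_var r n z (z n)" and ?h = "defl_kernel r n z (z n)" and ?t = "\<lambda>x. complex_of_real (ztilt r (Suc n) z (\<lambda>j. \<theta> * m j) x)"
  let ?Y = "\<lambda>x k. interp (Suc n) z x k + (if k < Suc n then \<theta> * m k else 0)"
  let ?S = "\<lambda>x. \<Sum>j<Suc n. of_real (\<tau> r j) * (interp (Suc n) z x j + \<theta> * m j) * cnj (m j)"
  have K0: "?K > 0" using r z by (intro defl_var_pos) auto
  have h: "geo_bounded \<rho>' ?h" using r z' \<rho>'0 by (intro geo_bounded_defl_kernel) (auto simp: less_imp_le)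
  have hh: "pseries ?h (z n) = of_real ?K"
    using r z' \<rho>'0 \<rho>'(2) by (intro pseries_defl_kernel_diag[of _ _ _ \<rho>']) (auto simp: less_imp_le)
  define u where "u k = (1 / of_real ?K) * ?h k - useq 0 k" for k
  define g where "g = divdiff (z n) u"
  have u_eq: "u = (\<lambda>k. (1 / of_real ?K) * ?h k + (-1) * useq 0 k)" by (simp add: u_def fun_eq_iff)
  have ug: "geo_bounded \<rho>' u"
    unfolding u_eq by (intro geo_bounded_add geo_bounded_scale h geo_bounded_useq \<rho>'0)
  have uS: "wsummable \<rho>' u" by (rule geo_bounded_wsummable[OF ug \<rho>'0 \<rho>'(2)])
  have hS: "wsummable \<rho>' ?h" by (rule geo_bounded_wsummable[OF h \<rho>'0 \<rho>'(2)])
  have u0: "pseries u (z n) = 0"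
  proof -
    have "pseries u (z n) = pseries (\<lambda>k. (1 / of_real ?K) * ?h k) (z n) + (-1) * pseries (useq 0) (z n)"
      unfolding u_eq using z'[of n] by (intro pseries_lincomb[of \<rho>'] wsummable_scale hS wsummable_useq) auto
    also have "pseries (\<lambda>k. (1 / of_real ?K) * ?h k) (z n) = (1 / of_real ?K) * pseries ?h (z n)"
      using pseries_lincomb[OF _ hS less_imp_le[OF z'[of n]], of "\<lambda>_. 0" "1 / of_real ?K"] by (simp add: wsummable_def pseries_def)
    finally show ?thesis using K0 by (simp add: hh pseries_useq)
  qed
  have "lin (z n) g = u"
    unfolding g_def using lin_divdiff[OF uS less_imp_le[OF z'[of n]] \<rho>'0] u0 by simp
  then have lg: "lins (Suc n) z g = (\<lambda>k. (1 / of_real ?K) * lins n z ?h k - m k)"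
    unfolding lins.simps \<open>lin (z n) g = u\<close> unfolding u_eq lins_lincomb lins_scale m_def by (simp add: fun_eq_iff)
  have gg: "geo_bounded \<rho>' g"
    unfolding g_def using z[of n] by (intro geo_bounded_divdiff ug \<rho>'0 \<rho>'(2)) auto
  have m0: "m k = 0" if "k > n" for k using that lins_useq0(1)[of n k z] by (simp add: m_def)
  have mg: "geo_bounded \<rho> m" unfolding m_def by (intro geo_bounded_lins geo_bounded_useq \<rho>0)
  have h\<rho>: "geo_bounded \<rho> ?h" using geo_bounded_mono[OF h] \<rho>'0 \<rho>2 by simp
  have key: "wpair r (?Y x) (lins (Suc n) z g) = \<theta> / of_real ?K - ?S x" if x: "wsummable \<rho> x" for x
  proof -
    \<comment> \<open>The shifted remainder is the nodal polynomial of the first n points times q,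
      and q takes the value \<theta> at z_n because the factor w - z_n vanishes there.\<close>
    define q where "q k = lin (z n) (divdiffs (Suc n) z x) k + \<theta> * useq 0 k" for k
    have dS: "wsummable \<rho> (divdiffs (Suc n) z x)" using x z\<rho> by (intro divdiffs_wsummable) auto
    have lS: "wsummable \<rho> (lin (z n) (divdiffs (Suc n) z x))" by (rule wsummable_lin[OF dS \<rho>0])
    have qS: "wsummable \<rho> q" unfolding q_def[abs_def] by (rule wsummable_lincomb[OF lS wsummable_useq \<rho>0])
    have Y: "?Y x = lins n z q"
      unfolding q_def[abs_def] lins_lincomb m_def[symmetric] by (auto simp: interp_def fun_eq_iff m0)
    have YS: "wsummable \<rho> (?Y x)" unfolding Y by (rule lins_wsummable[OF qS \<rho>0])
    have "wpair r (?Y x) (lins n z ?h) = pseries q (z n)"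
      unfolding Y using z\<rho> by (intro wpair_defl_kernel[OF r qS _ _ \<rho>0 \<rho>2(2)]) (auto simp: less_imp_le)
    also have "\<dots> = \<theta>"
      unfolding q_def[abs_def] using pseries_lincomb[OF lS wsummable_useq less_imp_le[OF z\<rho>[of n]], of \<theta> 0]
        pseries_lin[OF dS \<rho>0 less_imp_le[OF z\<rho>[of n]], of "z n"] by (simp add: pseries_useq)
    finally have 1: "wpair r (?Y x) (lins n z ?h) = \<theta>" .
    have "(\<lambda>k. of_real (\<tau> r k) * ?Y x k * cnj (m k)) sums (\<Sum>k<Suc n. of_real (\<tau> r k) * ?Y x k * cnj (m k))"
      by (rule sums_finite) (auto simp: m0)
    then have 2: "wpair r (?Y x) m = ?S x"
      unfolding wpair_def by (simp add: sums_iff)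
    show ?thesis
      unfolding lg by (subst wpair_lincomb_right[OF YS geo_bounded_lins[OF h\<rho> \<rho>0] mg \<rho>0]) (simp add: 1 2)
  qed
  \<comment> \<open>Over empty index sets the right-hand side is an empty sum; the evaluation point
    0 is a placeholder.\<close>
  have "(\<integral>x. wpair r (?Y x) (lins (Suc n) z g) * (?t x * (\<Prod>i\<in>({}::nat set). pseries (divdiffs (Suc n) z x) 0) *
      cnj (\<Prod>j\<in>({}::nat set). pseries (divdiffs (Suc n) z x) 0)) \<partial>gauss_seq r) =
    (\<Sum>j\<in>({}::nat set). cnj (pseries g 0) * (\<integral>x. ?t x * (\<Prod>i\<in>({}::nat set). pseries (divdiffs (Suc n) z x) 0) *
      cnj (\<Prod>j\<in>{}-{j}. pseries (divdiffs (Suc n) z x) 0) \<partial>gauss_seq r))"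
    using z' by (intro kernel_stein[OF r \<rho>'0 \<rho>2 _ gg]) auto
  then have 0: "(\<integral>x. wpair r (?Y x) (lins (Suc n) z g) * ?t x \<partial>gauss_seq r) = 0" by simp
  have zz: "\<And>i. i < Suc n \<Longrightarrow> cmod (z i) < \<rho>" using z\<rho> by simp
  have pt: "poly_bounded \<rho> ?t"
    by (intro poly_bounded_tilt less_imp_le[OF \<tau>_pos[OF r]] bounded_functional_measurable[where \<rho> = \<rho>] bounded_functional_interp \<rho>0 zz)
  have pS: "poly_bounded \<rho> ?S"
    by (intro poly_bounded_sum poly_bounded_mult poly_bounded_const poly_bounded_affine bounded_functional_interp \<rho>0 zz)
  note int = poly_bounded_integrable[OF _ r \<rho>0 \<rho>2(2)]
  have it: "integrable (gauss_seq r) ?t" by (rule int[OF pt])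
  have iS: "integrable (gauss_seq r) (\<lambda>x. ?S x * ?t x)" by (rule int[OF poly_bounded_mult[OF pS pt \<rho>0]])
  have "(\<integral>x. wpair r (?Y x) (lins (Suc n) z g) * ?t x \<partial>gauss_seq r) = (\<integral>x. \<theta> / of_real ?K * ?t x - ?S x * ?t x \<partial>gauss_seq r)"
  proof (rule integral_cong_AE)
    have i: "(\<lambda>x. interp (Suc n) z x k) \<in> borel_measurable (gauss_seq r)" for k
      by (intro measurable_interp) auto
    have "(\<lambda>x. wpair r (?Y x) (lins (Suc n) z g)) \<in> borel_measurable (gauss_seq r)"
      using i by (intro measurable_wpair) auto
    then show "(\<lambda>x. wpair r (?Y x) (lins (Suc n) z g) * ?t x) \<in> borel_measurable (gauss_seq r)"
      using it by auto
    show "(\<lambda>x. \<theta> / of_real ?K * ?t x - ?S x * ?t x) \<in> borel_measurable (gauss_seq r)"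
      using it iS by (intro borel_measurable_diff borel_measurable_integrable[OF iS]) auto
    show "AE x in gauss_seq r. wpair r (?Y x) (lins (Suc n) z g) * ?t x = \<theta> / of_real ?K * ?t x - ?S x * ?t x"
      using gauss_seq_AE_wsummable[OF r \<rho>0 \<rho>2(2)]
    proof eventually_elim
      case (elim x)
      show ?case unfolding key[OF elim] by (simp add: left_diff_distrib del: sum.lessThan_Suc)
    qed
  qed
  also have "\<dots> = \<theta> / of_real ?K * (\<integral>x. ?t x \<partial>gauss_seq r) - (\<integral>x. ?S x * ?t x \<partial>gauss_seq r)"
    using it iS by (subst Bochner_Integration.integral_diff) auto
  finally show ?thesis using 0 by simp
qed


section \<open>Recursion and closed form for the mass\<close>

definition tilt_mass :: "real \<Rightarrow> nat \<Rightarrow> (nat \<Rightarrow> complex) \<Rightarrow> real" where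
  "tilt_mass r n z = (\<integral>x. ztilt r n z (\<lambda>_. 0) x \<partial>gauss_seq r)"

lemma measurable_ztilt: "ztilt r n z s \<in> borel_measurable seq_borel"
  by (intro measurable_tilt measurable_interp) auto

lemma integrable_ztilt: "r \<ge> 0 \<Longrightarrow> integrable (gauss_seq r) (ztilt r n z s)"
proof -
  assume r: "r \<ge> 0"
  interpret S: prob_space "gauss_seq r" using r by (rule prob_space_gauss_seq)
  have b: "0 < ztilt r n z s x" "ztilt r n z s x \<le> 1" for x
    using tilt_bounds[where \<sigma> = "\<tau> r" and N = n] \<tau>_pos[OF r] by (auto simp: less_imp_le)
  have "ztilt r n z s \<in> borel_measurable (gauss_seq r)" using measurable_ztilt[where r = r and n = n and z = z and s = s] by simp
  then show ?thesis
    using b by (intro S.integrable_const_bound[where B = 1]) (auto simp: abs_of_pos)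
qed

lemma ztilt_nonneg: "0 \<le> ztilt r n z s x"
  by (simp add: tilt_def)

lemma Re_of_real_mult: "Re (of_real a * w) = a * Re w" "Re (w * of_real a) = Re w * a"
  by simp_all

lemma radius_bound:
  fixes z :: "nat \<Rightarrow> complex"
  assumes "\<And>i. i < n \<Longrightarrow> cmod (z i) < 1"
  obtains \<rho> where "0 < \<rho>" "\<rho> < 1" "\<And>i. i < n \<Longrightarrow> cmod (z i) < \<rho>"
proof -
  define \<sigma> where "\<sigma> = Max (insert 0 ((\<lambda>i. cmod (z i)) ` {..<n}))"
  have "\<sigma> \<in> insert 0 ((\<lambda>i. cmod (z i)) ` {..<n})" unfolding \<sigma>_def by (rule Max_in) auto
  then have "\<sigma> < 1" using assms by auto
  moreover have "0 \<le> \<sigma>" unfolding \<sigma>_def by (rule Max_ge) auto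
  moreover have "cmod (z i) \<le> \<sigma>" if "i < n" for i unfolding \<sigma>_def using that by (intro Max_ge) auto
  moreover obtain \<rho> where "\<sigma> < \<rho>" "\<rho> < 1" using dense[OF \<open>\<sigma> < 1\<close>] by auto
  ultimately show ?thesis using that[of \<rho>] by (meson le_less_trans)
qed

text \<open>\<open>tilt_gradient\<close> is the hypothesis of \<open>gaussian_line\<close> along the
  segment from shift 0 to shift \<theta> m, with \<kappa> = |\<theta>|^2 / K.\<close>

lemma ztilt_shift_mass:
  assumes r: "r \<ge> 0" and z: "\<And>i. i \<le> n \<Longrightarrow> cmod (z i) < 1"
  shows "(\<integral>x. ztilt r (Suc n) z (\<lambda>j. \<theta> * lins n z (useq 0) j) x \<partial>gauss_seq r) =
    tilt_mass r (Suc n) z * exp (- (cmod \<theta>)\<^sup>2 / defl_var r n z (z n))"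
proof -
  let ?m = "lins n z (useq 0)" and ?K = "defl_var r n z (z n)"
  let ?e = "\<lambda>t x. exp (- (\<Sum>j<Suc n. \<tau> r j * (cmod (interp (Suc n) z x j + of_real t * (\<theta> * ?m j)))\<^sup>2))"
  have e: "?e t x = ztilt r (Suc n) z (\<lambda>j. (of_real t * \<theta>) * ?m j) x" for t x
    by (simp add: tilt_def mult.assoc)
  obtain \<rho> where \<rho>: "0 < \<rho>" "\<rho> < 1" "\<And>i. i < Suc n \<Longrightarrow> cmod (z i) < \<rho>"
    using radius_bound[of "Suc n" z] z by (auto simp: less_Suc_eq_le)
  have "(\<integral>x. ?e 1 x \<partial>gauss_seq r) = (\<integral>x. ?e 0 x \<partial>gauss_seq r) * exp (- ((cmod \<theta>)\<^sup>2 / ?K))"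
  proof (rule gaussian_line[OF prob_space_gauss_seq[OF r]])
    show "(\<lambda>x. interp (Suc n) z x j) \<in> borel_measurable (gauss_seq r)" for j
      by (intro measurable_interp) auto
    show "\<tau> r j \<ge> 0" for j using \<tau>_pos[OF r, of j] by simp
    fix t :: real
    let ?t = "\<lambda>x. ztilt r (Suc n) z (\<lambda>j. (of_real t * \<theta>) * ?m j) x"
    let ?S = "\<lambda>x. \<Sum>j<Suc n. complex_of_real (\<tau> r j) * (interp (Suc n) z x j + (of_real t * \<theta>) * ?m j) * cnj (?m j)"
    have iS: "integrable (gauss_seq r) (\<lambda>x. ?S x * of_real (?t x))"
    proof (rule poly_bounded_integrable[OF _ r \<rho>(1,2)])
      show "poly_bounded \<rho> (\<lambda>x. ?S x * of_real (?t x))"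
        by (intro poly_bounded_mult poly_bounded_sum poly_bounded_const poly_bounded_affine bounded_functional_interp \<rho>
            poly_bounded_tilt less_imp_le[OF \<tau>_pos[OF r]] bounded_functional_measurable[where \<rho> = \<rho>])
    qed
    have pt: "(\<Sum>j<Suc n. \<tau> r j * Re ((interp (Suc n) z x j + of_real t * (\<theta> * ?m j)) * cnj (\<theta> * ?m j))) * ?e t x =
        Re (cnj \<theta> * (?S x * of_real (?t x)))" for x
    proof -
      have "(\<Sum>j<Suc n. \<tau> r j * Re ((interp (Suc n) z x j + of_real t * (\<theta> * ?m j)) * cnj (\<theta> * ?m j))) = Re (cnj \<theta> * ?S x)"
        unfolding sum_distrib_left Re_sum
      proof (rule sum.cong[OF refl])
        fix j
        have "cnj \<theta> * (complex_of_real (\<tau> r j) * (interp (Suc n) z x j + of_real t * \<theta> * ?m j) * cnj (?m j)) =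
          of_real (\<tau> r j) * ((interp (Suc n) z x j + of_real t * (\<theta> * ?m j)) * cnj (\<theta> * ?m j))"
          by (simp add: mult_ac)
        then show "\<tau> r j * Re ((interp (Suc n) z x j + of_real t * (\<theta> * ?m j)) * cnj (\<theta> * ?m j)) =
          Re (cnj \<theta> * (complex_of_real (\<tau> r j) * (interp (Suc n) z x j + of_real t * \<theta> * ?m j) * cnj (?m j)))"
          by (simp only: Re_of_real_mult)
      qed
      moreover have "Re (cnj \<theta> * (?S x * of_real (?t x))) = Re (cnj \<theta> * ?S x) * ?t x"
        by (simp only: mult.assoc[symmetric] Re_of_real_mult)
      ultimately show ?thesis by (simp only: e)
    qed
    have "(\<integral>x. (\<Sum>j<Suc n. \<tau> r j * Re ((interp (Suc n) z x j + of_real t * (\<theta> * ?m j)) * cnj (\<theta> * ?m j))) * ?e t x \<partial>gauss_seq r) =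
        (\<integral>x. Re (cnj \<theta> * (?S x * of_real (?t x))) \<partial>gauss_seq r)"
      by (simp only: pt)
    also have "\<dots> = Re (\<integral>x. cnj \<theta> * (?S x * of_real (?t x)) \<partial>gauss_seq r)"
      by (intro integral_Re integrable_mult_right iS)
    also have "(\<integral>x. cnj \<theta> * (?S x * of_real (?t x)) \<partial>gauss_seq r) = cnj \<theta> * (\<integral>x. ?S x * of_real (?t x) \<partial>gauss_seq r)"
      by (rule integral_mult_right_zero)
    also have "(\<integral>x. ?S x * of_real (?t x) \<partial>gauss_seq r) = (of_real t * \<theta>) / of_real ?K * (\<integral>x. of_real (?t x) \<partial>gauss_seq r)"
      by (rule tilt_gradient[OF r z])
    also have "(\<integral>x. complex_of_real (?t x) \<partial>gauss_seq r) = of_real (\<integral>x. ?t x \<partial>gauss_seq r)"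
      by (rule integral_complex_of_real)
    also have "cnj \<theta> * (of_real t * \<theta> / of_real ?K * of_real (\<integral>x. ?t x \<partial>gauss_seq r)) =
        of_real ((cmod \<theta>)\<^sup>2 / ?K * t * (\<integral>x. ?t x \<partial>gauss_seq r))"
    proof -
      have "of_real ((cmod \<theta>)\<^sup>2) = \<theta> * cnj \<theta>" by (rule complex_norm_square)
      then have "cnj \<theta> * (of_real t * \<theta> / of_real ?K * of_real (\<integral>x. ?t x \<partial>gauss_seq r)) =
          of_real ((cmod \<theta>)\<^sup>2) / of_real ?K * of_real t * of_real (\<integral>x. ?t x \<partial>gauss_seq r)"
        by (simp add: mult_ac)
      then show ?thesis by simp
    qed
    finally show "(\<integral>x. (\<Sum>j<Suc n. \<tau> r j * Re ((interp (Suc n) z x j + of_real t * (\<theta> * ?m j)) * cnj (\<theta> * ?m j))) * ?e t x \<partial>gauss_seq r) =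
        (cmod \<theta>)\<^sup>2 / ?K * t * (\<integral>x. ?e t x \<partial>gauss_seq r)"
      by (simp only: e Re_complex_of_real)
  qed
  moreover have "ztilt r (Suc n) z (\<lambda>j. (of_real 0 * \<theta>) * ?m j) x = ztilt r (Suc n) z (\<lambda>_. 0) x" for x by simp
  ultimately show ?thesis unfolding tilt_mass_def by (simp only: e) simp
qed

text \<open>The density of coefficient n times the n-point weight is, up to
  \<open>\<tau> r n\<close> / pi, the (n + 1)-point weight shifted by \<theta> m, where \<theta> is
  the value at z_n of the n-th quotient. As coefficient n varies, \<theta> runs over the plane by
  translation, and integrating the shifted masses over \<theta> gives pi K times the unshifted
  one.\<close>

lemma tilt_mass_Suc:
  assumes r: "r \<ge> 0" and z: "\<And>i. i \<le> n \<Longrightarrow> cmod (z i) < 1"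
  shows "tilt_mass r n z = \<tau> r n * defl_var r n z (z n) * tilt_mass r (Suc n) z"
proof -
  interpret S: prob_space "gauss_seq r" using r by (rule prob_space_gauss_seq)
  interpret Q: pair_sigma_finite "gauss_seq r" "lborel :: complex measure" ..
  let ?m = "lins n z (useq 0)" and ?K = "defl_var r n z (z n)"
  let ?t = "\<lambda>\<theta>. ztilt r (Suc n) z (\<lambda>j. \<theta> * ?m j)"
  obtain \<rho> where \<rho>: "0 < \<rho>" "\<rho> < 1" "\<And>i. i < Suc n \<Longrightarrow> cmod (z i) < \<rho>"
    using radius_bound[of "Suc n" z] z by (auto simp: less_Suc_eq_le)
  have z\<rho>: "\<And>i. i < n \<Longrightarrow> cmod (z i) < \<rho>" "cmod (z n) \<le> \<rho>" using \<rho>(3) by (auto simp: less_imp_le)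
  have K0: "?K > 0" using r z by (intro defl_var_pos) auto
  have tp: "0 < \<tau> r n" by (rule \<tau>_pos[OF r])
  have mass: "ennreal (tilt_mass r k z) = (\<integral>\<^sup>+x. ennreal (ztilt r k z (\<lambda>_. 0) x) \<partial>gauss_seq r)" for k
    unfolding tilt_mass_def by (intro nn_integral_eq_integral[symmetric] integrable_ztilt r) (auto simp: ztilt_nonneg)
  have mass0: "tilt_mass r k z \<ge> 0" for k unfolding tilt_mass_def by (intro Bochner_Integration.integral_nonneg) (simp add: ztilt_nonneg)
  have mt: "(\<lambda>p. ?t (snd p) (fst p)) \<in> borel_measurable (gauss_seq r \<Otimes>\<^sub>M lborel)"
  proof -
    have i: "(\<lambda>p. interp (Suc n) z (fst p) j) \<in> borel_measurable (gauss_seq r \<Otimes>\<^sub>M lborel)" for j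
    proof -
      have "(\<lambda>x. interp (Suc n) z x j) \<in> borel_measurable (gauss_seq r)" by (intro measurable_interp) auto
      then show ?thesis by (rule measurable_compose[OF measurable_fst])
    qed
    have "(\<lambda>p. \<Sum>j<Suc n. \<tau> r j * (cmod (interp (Suc n) z (fst p) j + snd p * ?m j))\<^sup>2) \<in> borel_measurable (gauss_seq r \<Otimes>\<^sub>M lborel)"
    proof (rule borel_measurable_sum)
      fix j
      note i[measurable]
      show "(\<lambda>p. \<tau> r j * (cmod (interp (Suc n) z (fst p) j + snd p * ?m j))\<^sup>2) \<in> borel_measurable (gauss_seq r \<Otimes>\<^sub>M lborel)"
        by measurable
    qed
    then show ?thesis unfolding tilt_def by (simp del: sum.lessThan_Suc)
  qed
  have mt1: "(\<lambda>\<theta>. ?t \<theta> x) \<in> borel_measurable borel" for x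
    unfolding tilt_def by measurable
  have "ennreal (tilt_mass r n z) = (\<integral>\<^sup>+x. \<integral>\<^sup>+w. ennreal (ztilt r n z (\<lambda>_. 0) (x(n := w))) \<partial>gauss_measure (\<tau> r n) \<partial>gauss_seq r)"
    unfolding mass
  proof (rule gauss_seq_resample[OF r])
    show "(\<lambda>x. ennreal (ztilt r n z (\<lambda>_. 0) x)) \<in> borel_measurable seq_borel"
      using measurable_ztilt[where r = r and n = n and z = z and s = "\<lambda>_. 0"] by simp
  qed
  also have "\<dots> = (\<integral>\<^sup>+x. \<integral>\<^sup>+\<theta>. ennreal (\<tau> r n / pi) * ennreal (?t \<theta> x) \<partial>lborel \<partial>gauss_seq r)"
  proof (rule nn_integral_cong_AE, use gauss_seq_AE_wsummable[OF r \<rho>(1,2)] in eventually_elim)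
    case (elim x)
    define c where "c = pseries (divdiffs n z (x(n := 0))) (z n)"
    \<comment> \<open>Newton's formula writes the n-point remainder as the (n + 1)-point remainder
      plus (c + w) m. Its coefficient n is w, so the additional term of the tilt is the exponent of
      the density.\<close>
    have pt: "gauss_density (\<tau> r n) w * ztilt r n z (\<lambda>_. 0) (x(n := w)) = \<tau> r n / pi * ?t (c + w) x" for w
    proof -
      let ?x = "x(n := w)"
      have xS: "wsummable \<rho> ?x" "wsummable \<rho> (x(n := 0))" by (intro wsummable_upd elim \<rho>)+
      have q: "pseries (divdiffs n z ?x) (z n) = c + w"
      proof -
        have "divdiffs n z ?x = (\<lambda>k. divdiffs n z (x(n := 0)) k + w * useq 0 k)"
          using elim z\<rho>(1) \<rho>(1) by (rule divdiffs_upd)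
        moreover have "pseries (\<lambda>k. divdiffs n z (x(n := 0)) k + w * useq 0 k) (z n) = c + w * pseries (useq 0) (z n)"
          unfolding c_def by (rule pseries_lincomb[OF divdiffs_wsummable[OF xS(2) z\<rho>(1)] wsummable_useq z\<rho>(2)])
        ultimately show ?thesis by (simp add: pseries_useq)
      qed
      have "interp (Suc n) z x = interp (Suc n) z ?x" by (rule interp_cong) auto
      also have "\<dots> = (\<lambda>k. interp n z ?x k + (- (c + w)) * ?m k)"
        using interp_Suc[OF xS(1) _ \<rho>(1), of n z] \<rho>(3) by (simp add: q less_Suc_eq_le)
      finally have i: "interp (Suc n) z x j + (c + w) * ?m j = interp n z ?x j" for j
        by (simp add: algebra_simps)
      have "interp n z ?x n = w" using interp_ge[OF xS(1) z\<rho>(1) \<rho>(1), where k = n] by simp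
      then have "?t (c + w) x = exp (- (\<Sum>j<n. \<tau> r j * (cmod (interp n z ?x j))\<^sup>2) - \<tau> r n * (cmod w)\<^sup>2)"
        unfolding tilt_def i by simp
      then show ?thesis
        by (simp add: gauss_density_def tilt_def exp_diff exp_minus field_simps)
    qed
    have mz: "(\<lambda>w. ztilt r n z (\<lambda>_. 0) (x(n := w))) \<in> borel_measurable borel"
    proof (rule measurable_compose[OF _ measurable_ztilt], rule measurable_seqI)
      fix k show "(\<lambda>w. (x(n := w)) k) \<in> borel_measurable borel" by (cases "k = n") auto
    qed
    have "(\<integral>\<^sup>+w. ennreal (ztilt r n z (\<lambda>_. 0) (x(n := w))) \<partial>gauss_measure (\<tau> r n)) =
        (\<integral>\<^sup>+w. ennreal (gauss_density (\<tau> r n) w) * ennreal (ztilt r n z (\<lambda>_. 0) (x(n := w))) \<partial>lborel)"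
      using mz tp by (intro nn_integral_gauss_measure) auto
    also have "\<dots> = (\<integral>\<^sup>+w. ennreal (\<tau> r n / pi) * ennreal (?t (c + w) x) \<partial>lborel)"
      using tp by (intro nn_integral_cong) (simp add: ennreal_mult[symmetric] gauss_density_nonneg ztilt_nonneg pt)
    also have "\<dots> = (\<integral>\<^sup>+\<theta>. ennreal (\<tau> r n / pi) * ennreal (?t \<theta> x) \<partial>distr lborel borel ((+) c))"
      using mt1[of x] by (subst nn_integral_distr) auto
    finally show ?case by (simp add: lborel_distr_plus)
  qed
  also have "\<dots> = (\<integral>\<^sup>+\<theta>. \<integral>\<^sup>+x. ennreal (\<tau> r n / pi) * ennreal (?t \<theta> x) \<partial>gauss_seq r \<partial>lborel)"
    using mt by (intro Q.Fubini'[symmetric]) (simp add: case_prod_beta')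
  also have "\<dots> = (\<integral>\<^sup>+\<theta>. ennreal (\<tau> r n / pi * tilt_mass r (Suc n) z * exp (- (1 / ?K) * (cmod \<theta>)\<^sup>2)) \<partial>lborel)"
  proof (rule nn_integral_cong)
    fix \<theta> :: complex
    have "(\<integral>\<^sup>+x. ennreal (\<tau> r n / pi) * ennreal (?t \<theta> x) \<partial>gauss_seq r) = ennreal (\<tau> r n / pi) * (\<integral>\<^sup>+x. ennreal (?t \<theta> x) \<partial>gauss_seq r)"
      using measurable_ztilt[where r = r and n = "Suc n" and z = z and s = "\<lambda>j. \<theta> * ?m j"] by (intro nn_integral_cmult) simp
    also have "(\<integral>\<^sup>+x. ennreal (?t \<theta> x) \<partial>gauss_seq r) = ennreal (\<integral>x. ?t \<theta> x \<partial>gauss_seq r)"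
      by (intro nn_integral_eq_integral integrable_ztilt r) (auto simp: ztilt_nonneg)
    also have "(\<integral>x. ?t \<theta> x \<partial>gauss_seq r) = tilt_mass r (Suc n) z * exp (- (cmod \<theta>)\<^sup>2 / ?K)"
      by (rule ztilt_shift_mass[OF r z])
    finally show "(\<integral>\<^sup>+x. ennreal (\<tau> r n / pi) * ennreal (?t \<theta> x) \<partial>gauss_seq r) =
        ennreal (\<tau> r n / pi * tilt_mass r (Suc n) z * exp (- (1 / ?K) * (cmod \<theta>)\<^sup>2))"
      using tp mass0[of "Suc n"] by (simp add: ennreal_mult[symmetric] mult.assoc)
  qed
  also have "\<dots> = ennreal (\<integral>\<theta>. \<tau> r n / pi * tilt_mass r (Suc n) z * exp (- (1 / ?K) * (cmod \<theta>)\<^sup>2) \<partial>lborel)"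
    using tp mass0[of "Suc n"] K0 integrable_exp_norm2[of "1 / ?K"] by (intro nn_integral_eq_integral) auto
  also have "(\<integral>\<theta>. \<tau> r n / pi * tilt_mass r (Suc n) z * exp (- (1 / ?K) * (cmod \<theta>)\<^sup>2) \<partial>(lborel :: complex measure)) =
      \<tau> r n / pi * tilt_mass r (Suc n) z * (pi / (1 / ?K))"
    using K0 by (subst integral_mult_right_zero) (subst integral_exp_norm2; simp)
  also have "\<dots> = \<tau> r n * ?K * tilt_mass r (Suc n) z" by simp
  finally show ?thesis
    using mass0 tp K0 by (subst (asm) ennreal_inj) (auto intro!: mult_nonneg_nonneg)
qed

text \<open>The product of 1 - z_i conj z_l over all pairs i, l < n
  (\<open>szego_prod_complex\<close>), in real form: conjugate factors are grouped into squared
  moduli.\<close>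

definition szego_prod :: "nat \<Rightarrow> (nat \<Rightarrow> complex) \<Rightarrow> real" where
  "szego_prod n z = (\<Prod>k<n. (1 - (cmod (z k))\<^sup>2) * (\<Prod>i<k. (cmod (1 - z i * cnj (z k)))\<^sup>2))"

text \<open>The factors 1 + \<open>defl_param\<close> telescope along the recursion, because the
  numerator of \<open>defl_var r n z (z n)\<close> is the next one of them.\<close>

lemma tilt_mass_closed:
  assumes r: "r \<ge> 0" and z: "\<And>i. i < n \<Longrightarrow> cmod (z i) < 1"
  shows "(\<Prod>j<n. \<tau> r j) * tilt_mass r n z = szego_prod n z * (1 + r) / (1 + defl_param r n z)"
  using z
proof (induction n)
  case 0
  interpret S: prob_space "gauss_seq r" using r by (rule prob_space_gauss_seq)
  show ?case using r S.prob_space by (simp add: tilt_mass_def tilt_def szego_prod_def defl_param_def)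
next
  case (Suc n)
  let ?s = "defl_param r n z" and ?K = "defl_var r n z (z n)" and ?A = "1 - (cmod (z n))\<^sup>2" and ?B = "\<Prod>i<n. (cmod (1 - z i * cnj (z n)))\<^sup>2"
  have s: "?s \<ge> 0" "defl_param r (Suc n) z \<ge> 0" using defl_param_nonneg[OF r] by auto
  have s': "defl_param r (Suc n) z = ?s * (cmod (z n))\<^sup>2" by (simp add: defl_param_def)
  have A: "?A > 0" using Suc.prems[of n] by (simp add: abs_square_less_1)
  have B: "?B > 0"
  proof (rule prod_pos)
    fix i assume "i \<in> {..<n}"
    then have "1 - z i * cnj (z n) \<noteq> 0" using Suc.prems by (intro one_minus_mult_ne_0) auto
    then show "0 < (cmod (1 - z i * cnj (z n)))\<^sup>2" by simp
  qed
  have K: "?K = (1 + ?s * (cmod (z n))\<^sup>2) / ((1 + ?s) * ?A * ?B)" by (simp add: defl_var_def)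
  have K0: "?K > 0" using r Suc.prems by (intro defl_var_pos) auto
  have step: "tilt_mass r n z = \<tau> r n * ?K * tilt_mass r (Suc n) z"
    using Suc.prems by (intro tilt_mass_Suc r) simp
  have "(\<Prod>j<Suc n. \<tau> r j) * tilt_mass r (Suc n) z * ?K = (\<Prod>j<n. \<tau> r j) * tilt_mass r n z"
    unfolding step by simp
  also have "\<dots> = szego_prod n z * (1 + r) / (1 + ?s)" using Suc by simp
  finally have "(\<Prod>j<Suc n. \<tau> r j) * tilt_mass r (Suc n) z = szego_prod n z * (1 + r) / (1 + ?s) / ?K"
    using K0 nonzero_eq_divide_eq less_imp_neq by (metis (no_types, lifting))
  also have "\<dots> = szego_prod n z * (1 + r) / (1 + ?s) * ((1 + ?s) * ?A * ?B) / (1 + ?s * (cmod (z n))\<^sup>2)"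
    unfolding K by simp
  also have "\<dots> = szego_prod (Suc n) z * (1 + r) / (1 + defl_param r (Suc n) z)"
    using s by (simp add: szego_prod_def s' mult_ac)
  finally show ?case .
qed


section \<open>Determinant and permanent of the Szego kernel\<close>

definition szego_kernel :: "real \<Rightarrow> complex \<Rightarrow> complex \<Rightarrow> complex" where
  "szego_kernel s z w = (1 + of_real s * z * cnj w) / ((1 + of_real s) * (1 - z * cnj w))"

lemma det_scale_rows_cols:
  fixes D :: "nat \<Rightarrow> nat \<Rightarrow> 'a::comm_ring_1"
  shows "Determinant.det (mat n n (\<lambda>(i, j). u i * v j * D i j)) =
    (\<Prod>i<n. u i) * (\<Prod>i<n. v i) * Determinant.det (mat n n (\<lambda>(i, j). D i j))"
proof -
  have "(\<Prod>i = 0..<n. mat n n (\<lambda>(i, j). u i * v j * D i j) $$ (i, p i)) =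
      (\<Prod>i<n. u i) * (\<Prod>i<n. v i) * (\<Prod>i = 0..<n. mat n n (\<lambda>(i, j). D i j) $$ (i, p i))"
    if p: "p permutes {0..<n}" for p
  proof -
    have "(\<Prod>i = 0..<n. mat n n (\<lambda>(i, j). u i * v j * D i j) $$ (i, p i)) = (\<Prod>i = 0..<n. u i * v (p i) * D i (p i))"
      using permutes_in_image[OF p] by (intro prod.cong) auto
    also have "\<dots> = (\<Prod>i = 0..<n. u i) * (\<Prod>i = 0..<n. v (p i)) * (\<Prod>i = 0..<n. D i (p i))"
      by (simp add: prod.distrib)
    also have "(\<Prod>i = 0..<n. v (p i)) = (\<Prod>i = 0..<n. v i)"
      using prod.permute[OF p, of v] by (simp add: o_def)
    also have "(\<Prod>i = 0..<n. D i (p i)) = (\<Prod>i = 0..<n. mat n n (\<lambda>(i, j). D i j) $$ (i, p i))"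
      using permutes_in_image[OF p] by (intro prod.cong) auto
    finally show ?thesis by (simp add: atLeast0LessThan)
  qed
  then show ?thesis
    by (simp add: det_def sum_distrib_left mult_ac)
qed

text \<open>One step of Gaussian elimination with the corner entry as pivot: splitting off a unit
  lower triangular factor leaves a block triangular matrix.\<close>

lemma det_Schur_complement:
  fixes f :: "nat \<Rightarrow> nat \<Rightarrow> 'a::field"
  assumes f0: "f 0 0 \<noteq> 0"
  shows "Determinant.det (mat (Suc n) (Suc n) (\<lambda>(i, j). f i j)) =
    f 0 0 * Determinant.det (mat n n (\<lambda>(i, j). f (Suc i) (Suc j) - f (Suc i) 0 * f 0 (Suc j) / f 0 0))"
proof -
  define L where "L = mat (Suc n) (Suc n) (\<lambda>(i, j). if i = j then 1 else if j = 0 then f i 0 / f 0 0 else 0)"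
  define B where "B = mat (Suc n) (Suc n) (\<lambda>(i, j). if i = 0 then f 0 j else f i j - f i 0 * f 0 j / f 0 0)"
  have "mat (Suc n) (Suc n) (\<lambda>(i, j). f i j) = L * B"
  proof (rule eq_matI)
    fix i j assume "i < dim_row (L * B)" "j < dim_col (L * B)"
    then have ij: "i < Suc n" "j < Suc n" by (auto simp: L_def B_def)
    have "(L * B) $$ (i, j) = (\<Sum>k = 0..<Suc n. L $$ (i, k) * B $$ (k, j))"
      using ij by (simp add: L_def B_def scalar_prod_def)
    also have "\<dots> = (\<Sum>k = 0..<Suc n. (if k = i then B $$ (i, j) else 0) +
        (if k = 0 then (if i = 0 then 0 else f i 0 / f 0 0 * B $$ (0, j)) else 0))"
      using ij by (intro sum.cong) (auto simp: L_def)
    also have "\<dots> = B $$ (i, j) + (if i = 0 then 0 else f i 0 / f 0 0 * B $$ (0, j))"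
      unfolding sum.distrib using ij by (subst (1 2) sum.delta) auto
    also have "\<dots> = f i j"
      using ij by (auto simp: B_def)
    finally show "mat (Suc n) (Suc n) (\<lambda>(i, j). f i j) $$ (i, j) = (L * B) $$ (i, j)"
      using ij by simp
  qed (auto simp: L_def B_def)
  moreover have "Determinant.det (L * B) = Determinant.det L * Determinant.det B"
    by (rule det_mult[of _ "Suc n"]) (auto simp: L_def B_def)
  moreover have "Determinant.det L = 1"
  proof -
    have "Determinant.det L = prod_list (diag_mat L)"
      by (rule det_lower_triangular[of "Suc n"]) (auto simp: L_def)
    also have "\<dots> = (\<Prod>i = 0..<Suc n. L $$ (i, i))"
      by (subst prod_list_diag_prod) (simp add: L_def)
    also have "\<dots> = 1" by (rule prod.neutral) (simp add: L_def)
    finally show ?thesis .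
  qed
  moreover have "Determinant.det B = f 0 0 * Determinant.det (mat n n (\<lambda>(i, j). f (Suc i) (Suc j) - f (Suc i) 0 * f 0 (Suc j) / f 0 0))"
  proof -
    let ?C = "mat n n (\<lambda>(i, j). f (Suc i) (Suc j) - f (Suc i) 0 * f 0 (Suc j) / f 0 0)"
    have "B = four_block_mat (mat 1 1 (\<lambda>_. f 0 0)) (mat 1 n (\<lambda>(i, j). f 0 (Suc j))) (0\<^sub>m n 1) ?C"
      by (rule eq_matI) (auto simp: B_def four_block_mat_def Let_def f0)
    then have "Determinant.det B = Determinant.det (mat 1 1 (\<lambda>_. f 0 0)) * Determinant.det ?C"
      by (simp only:) (rule det_four_block_mat_lower_left_zero_col, auto)
    then show ?thesis by (simp add: det_single)
  qed
  ultimately show ?thesis by simp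
qed

text \<open>Separates the divisions from the polynomial identity, so that only the latter is
  expanded in \<open>szego_kernel_Schur_step\<close>.\<close>

lemma fraction_rearrange:
  fixes A B C D E F X Y U V W Z :: "'a::field"
  assumes "A \<noteq> 0" "B \<noteq> 0" "C \<noteq> 0" "D \<noteq> 0" "E \<noteq> 0" "F \<noteq> 0"
    and "X * B * C * F - Y * U * D * A = W * V * Z * E"
  shows "X / (E * A) - Y / (E * B) * (U / (E * C)) / (F / (E * D)) = W / B * (V / C) * (Z / (F * A))"
proof -
  have "X / (E * A) = X * B * C * F / (E * A * B * C * F)"
    "Y / (E * B) * (U / (E * C)) / (F / (E * D)) = Y * U * D * A / (E * A * B * C * F)"
    "W / B * (V / C) * (Z / (F * A)) = W * V * Z * E / (E * A * B * C * F)"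
    using assms(1-6) by (simp_all add: divide_simps)
  then show ?thesis
    by (simp only: diff_divide_distrib[symmetric] assms(7))
qed

text \<open>Subtracting the rank-one part at a leaves the reproducing kernel of the series that
  vanish at a. As for the deflated series, this is a pair of Blaschke factors times a Szego kernel
  whose parameter has been multiplied by |a|^2.\<close>

lemma szego_kernel_Schur_step:
  assumes s: "s \<ge> 0" and d: "cmod a < 1" "cmod z < 1" "cmod w < 1"
  shows "szego_kernel s z w - szego_kernel s z a * szego_kernel s a w / szego_kernel s a a =
    (z - a) / (1 - cnj a * z) * cnj ((w - a) / (1 - cnj a * w)) * szego_kernel (s * (cmod a)\<^sup>2) z w"
proof -
  let ?s = "complex_of_real s"
  have aa: "complex_of_real ((cmod a)\<^sup>2) = a * cnj a" by (rule complex_norm_square)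
  have "complex_of_real (1 + s) \<noteq> 0" using s by (subst of_real_eq_0_iff) simp
  then have s1: "1 + ?s \<noteq> 0" by simp
  have "1 + s * (cmod a)\<^sup>2 > 0" using s by (intro add_pos_nonneg) auto
  then have "complex_of_real (1 + s * (cmod a)\<^sup>2) \<noteq> 0" by (subst of_real_eq_0_iff) simp
  then have s2: "1 + ?s * (a * cnj a) \<noteq> 0" by (simp only: of_real_add of_real_mult of_real_1 aa not_False_eq_True)
  have n: "1 - z * cnj w \<noteq> 0" "1 - z * cnj a \<noteq> 0" "1 - a * cnj w \<noteq> 0" "1 - a * cnj a \<noteq> 0"
    by (rule one_minus_mult_ne_0; use d in simp)+
  have K: "szego_kernel (s * (cmod a)\<^sup>2) z w = (1 + ?s * (a * cnj a) * z * cnj w) / ((1 + ?s * (a * cnj a)) * (1 - z * cnj w))"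
    unfolding szego_kernel_def of_real_mult aa ..
  define A B C D where "A = 1 - z * cnj w" and "B = 1 - z * cnj a" and "C = 1 - a * cnj w" and "D = 1 - a * cnj a"
  define E F where "E = 1 + ?s" and "F = 1 + ?s * (a * cnj a)"
  have nz: "A \<noteq> 0" "B \<noteq> 0" "C \<noteq> 0" "D \<noteq> 0" "E \<noteq> 0" "F \<noteq> 0" using n s1 s2 by (auto simp: A_def B_def C_def D_def E_def F_def)
  have "(1 + ?s * z * cnj w) * B * C * F - (1 + ?s * z * cnj a) * (1 + ?s * a * cnj w) * D * A =
      (z - a) * (cnj w - cnj a) * (1 + ?s * (a * cnj a) * z * cnj w) * E"
    unfolding A_def B_def C_def D_def E_def F_def by (simp add: algebra_simps)
  then have "(1 + ?s * z * cnj w) / (E * A) - (1 + ?s * z * cnj a) / (E * B) * ((1 + ?s * a * cnj w) / (E * C)) / (F / (E * D)) =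
      (z - a) / B * ((cnj w - cnj a) / C) * ((1 + ?s * (a * cnj a) * z * cnj w) / (F * A))"
    by (rule fraction_rearrange[OF nz])
  then show ?thesis
    unfolding K by (simp add: szego_kernel_def A_def B_def C_def D_def E_def F_def mult_ac)
qed

lemma vandermonde2_Suc_shift:
  "vandermonde2 (Suc n) z = (\<Prod>j<n. (cmod (z (Suc j) - z 0))\<^sup>2) * vandermonde2 n (\<lambda>i. z (Suc i))"
  unfolding vandermonde2_def
  by (simp only: prod.lessThan_Suc_shift prod.distrib norm_minus_commute[of "z 0"] lessThan_0 prod.empty mult_1)

lemma szego_prod_Suc_shift:
  "szego_prod (Suc n) z = (1 - (cmod (z 0))\<^sup>2) * (\<Prod>j<n. (cmod (1 - z 0 * cnj (z (Suc j))))\<^sup>2) * szego_prod n (\<lambda>i. z (Suc i))"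
  unfolding szego_prod_def
  by (simp only: prod.lessThan_Suc_shift prod.distrib lessThan_0 prod.empty mult_1_right mult_ac)

lemma szego_prod_pos:
  assumes "\<And>i. i < n \<Longrightarrow> cmod (z i) < 1"
  shows "szego_prod n z > 0"
  unfolding szego_prod_def
proof (intro prod_pos mult_pos_pos)
  fix k assume k: "k \<in> {..<n}"
  then show "0 < 1 - (cmod (z k))\<^sup>2" using assms by (simp add: abs_square_less_1)
  fix i assume "i \<in> {..<k}"
  then have "1 - z i * cnj (z k) \<noteq> 0" using assms k by (intro one_minus_mult_ne_0) auto
  then show "0 < (cmod (1 - z i * cnj (z k)))\<^sup>2" by simp
qed

text \<open>Points are removed from the front, each multiplying s by its squared modulus, so that
  the factors 1 + s telescope. The Blaschke factors, together with 1 - |z_0|^2 from the pivot, build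
  up the Vandermonde product over \<open>szego_prod\<close>.\<close>

lemma det_szego_kernel:
  assumes "s \<ge> 0" "\<And>i. i < n \<Longrightarrow> cmod (z i) < 1"
  shows "Determinant.det (mat n n (\<lambda>(i, j). szego_kernel s (z i) (z j))) =
    of_real ((1 + s * (\<Prod>i<n. (cmod (z i))\<^sup>2)) / (1 + s) * (vandermonde2 n z / szego_prod n z))"
  using assms
proof (induction n arbitrary: s z)
  case 0
  have "1 + s \<noteq> 0" using 0 by simp
  then show ?case by (simp add: vandermonde2_def szego_prod_def det_dim_zero)
next
  case (Suc n)
  let ?a = "z 0" and ?z = "\<lambda>i. z (Suc i)" and ?s = "s * (cmod (z 0))\<^sup>2"
  let ?b = "\<lambda>w. (w - ?a) / (1 - cnj ?a * w)"
  have a: "cmod ?a < 1" using Suc.prems by simp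
  have s': "?s \<ge> 0" using Suc.prems by simp
  have aa: "?a * cnj ?a = of_real ((cmod ?a)\<^sup>2)" by (simp only: complex_norm_square[symmetric])
  have D: "1 - (cmod ?a)\<^sup>2 > 0" using a by (simp add: abs_square_less_1)
  have K0: "szego_kernel s ?a ?a = of_real ((1 + ?s) / ((1 + s) * (1 - (cmod ?a)\<^sup>2)))"
    by (simp add: szego_kernel_def mult.assoc aa)
  moreover have "(1 + ?s) / ((1 + s) * (1 - (cmod ?a)\<^sup>2)) > 0"
    using s' D Suc.prems(1) by (intro divide_pos_pos mult_pos_pos add_pos_nonneg) auto
  ultimately have K1: "szego_kernel s ?a ?a \<noteq> 0" by (simp only: of_real_eq_0_iff)
  have "Determinant.det (mat (Suc n) (Suc n) (\<lambda>(i, j). szego_kernel s (z i) (z j))) = szego_kernel s ?a ?a *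
      Determinant.det (mat n n (\<lambda>(i, j). szego_kernel s (?z i) (?z j) - szego_kernel s (?z i) ?a * szego_kernel s ?a (?z j) / szego_kernel s ?a ?a))"
    by (rule det_Schur_complement[where f = "\<lambda>i j. szego_kernel s (z i) (z j)"]) (rule K1)
  also have "mat n n (\<lambda>(i, j). szego_kernel s (?z i) (?z j) - szego_kernel s (?z i) ?a * szego_kernel s ?a (?z j) / szego_kernel s ?a ?a) =
      mat n n (\<lambda>(i, j). ?b (?z i) * cnj (?b (?z j)) * szego_kernel ?s (?z i) (?z j))"
    by (intro cong_mat refl, unfold prod.case, rule szego_kernel_Schur_step) (use Suc.prems in auto)
  also have "Determinant.det \<dots> = (\<Prod>i<n. ?b (?z i)) * (\<Prod>i<n. cnj (?b (?z i))) * Determinant.det (mat n n (\<lambda>(i, j). szego_kernel ?s (?z i) (?z j)))"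
    by (rule det_scale_rows_cols)
  also have "Determinant.det (mat n n (\<lambda>(i, j). szego_kernel ?s (?z i) (?z j))) =
      of_real ((1 + ?s * (\<Prod>i<n. (cmod (?z i))\<^sup>2)) / (1 + ?s) * (vandermonde2 n ?z / szego_prod n ?z))"
    using s' Suc.prems by (intro Suc.IH) auto
  also have "(\<Prod>i<n. ?b (?z i)) * (\<Prod>i<n. cnj (?b (?z i))) =
      of_real ((\<Prod>j<n. (cmod (?z j - ?a))\<^sup>2) / (\<Prod>j<n. (cmod (1 - ?a * cnj (?z j)))\<^sup>2))"
  proof -
    have "cmod (1 - cnj ?a * w) = cmod (1 - ?a * cnj w)" for w
      using complex_mod_cnj[of "1 - cnj ?a * w"] by simp
    then have "?b w * cnj (?b w) = of_real ((cmod (w - ?a))\<^sup>2 / (cmod (1 - ?a * cnj w))\<^sup>2)" for w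
      by (simp only: complex_norm_square[symmetric] norm_divide power_divide)
    then show ?thesis by (simp only: prod.distrib[symmetric] of_real_prod[symmetric] prod_dividef[symmetric])
  qed
  also have "szego_kernel s ?a ?a * (of_real ((\<Prod>j<n. (cmod (?z j - ?a))\<^sup>2) / (\<Prod>j<n. (cmod (1 - ?a * cnj (?z j)))\<^sup>2)) *
      of_real ((1 + ?s * (\<Prod>i<n. (cmod (?z i))\<^sup>2)) / (1 + ?s) * (vandermonde2 n ?z / szego_prod n ?z))) =
      of_real ((1 + s * (\<Prod>i<Suc n. (cmod (z i))\<^sup>2)) / (1 + s) * (vandermonde2 (Suc n) z / szego_prod (Suc n) z))"
  proof -
    have "1 + ?s \<noteq> 0" using s' by simp
    then have "(1 + ?s) / ((1 + s) * (1 - (cmod ?a)\<^sup>2)) * ((\<Prod>j<n. (cmod (?z j - ?a))\<^sup>2) / (\<Prod>j<n. (cmod (1 - ?a * cnj (?z j)))\<^sup>2) *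
      ((1 + ?s * (\<Prod>i<n. (cmod (?z i))\<^sup>2)) / (1 + ?s) * (vandermonde2 n ?z / szego_prod n ?z))) =
      (1 + s * (\<Prod>i<Suc n. (cmod (z i))\<^sup>2)) / (1 + s) * (vandermonde2 (Suc n) z / szego_prod (Suc n) z)"
      unfolding vandermonde2_Suc_shift szego_prod_Suc_shift prod.lessThan_Suc_shift[of "\<lambda>i. (cmod (z i))\<^sup>2"]
      by (simp add: mult_ac)
    then show ?thesis unfolding K0 of_real_mult[symmetric] by (simp only:)
  qed
  finally show ?case .
qed

lemma szego_prod_complex:
  "of_real (szego_prod n z) = (\<Prod>i<n. \<Prod>l<n. 1 - z i * cnj (z l))"
proof (induction n)
  case 0
  then show ?case by (simp add: szego_prod_def)
next
  case (Suc n)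
  have B: "complex_of_real (\<Prod>i<n. (cmod (1 - z i * cnj (z n)))\<^sup>2) = (\<Prod>i<n. 1 - z i * cnj (z n)) * (\<Prod>i<n. 1 - z n * cnj (z i))"
  proof -
    have "complex_of_real ((cmod (1 - z i * cnj (z n)))\<^sup>2) = (1 - z i * cnj (z n)) * (1 - z n * cnj (z i))" for i
      unfolding complex_norm_square by (simp add: mult.commute)
    then show ?thesis by (simp only: of_real_prod prod.distrib)
  qed
  have A: "complex_of_real (1 - (cmod (z n))\<^sup>2) = 1 - z n * cnj (z n)"
    by (simp only: of_real_diff of_real_1 complex_norm_square)
  have "szego_prod (Suc n) z = szego_prod n z * ((1 - (cmod (z n))\<^sup>2) * (\<Prod>i<n. (cmod (1 - z i * cnj (z n)))\<^sup>2))"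
    by (simp add: szego_prod_def)
  then have "complex_of_real (szego_prod (Suc n) z) = (\<Prod>i<n. \<Prod>l<n. 1 - z i * cnj (z l)) *
     ((1 - z n * cnj (z n)) * ((\<Prod>i<n. 1 - z i * cnj (z n)) * (\<Prod>i<n. 1 - z n * cnj (z i))))"
    by (simp only: of_real_mult A B Suc)
  then show ?case by (simp add: prod.distrib mult_ac)
qed


lemma permanent_mat:
  "permanent (mat n n (\<lambda>(i, j). f i j)) = (\<Sum>p | p permutes {..<n}. \<Prod>i<n. f i (p i))"
proof -
  have "(\<Prod>i = 0..<n. mat n n (\<lambda>(i, j). f i j) $$ (i, p i)) = (\<Prod>i<n. f i (p i))" if p: "p permutes {..<n}" for p
  proof (rule prod.cong)
    fix i assume i: "i \<in> {..<n}"
    then have "p i \<in> {..<n}" using permutes_in_image[OF p] by metis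
    then show "mat n n (\<lambda>(i, j). f i j) $$ (i, p i) = f i (p i)" using i by simp
  qed (simp add: atLeast0LessThan)
  then show ?thesis
    unfolding permanent_def dim_row_mat atLeast0LessThan by (intro sum.cong refl) blast
qed

text \<open>Each of the two products in the denominator of the kernel depends on the row alone or on
  the column alone. A permutation leaves their total product unchanged, and each contributes one
  \<open>szego_prod n z\<close>.\<close>

lemma sum_prod_defl_kernel:
  assumes r: "r \<ge> 0" and z: "\<And>i. i < n \<Longrightarrow> cmod (z i) < 1"
  shows "(\<Sum>p | p permutes {..<n}. \<Prod>i<n. cnj (pseries (defl_kernel r n z (z i)) (z (p i)))) =
    permanent (mat n n (\<lambda>(i, j). szego_kernel (defl_param r n z) (z i) (z j))) / (of_real (szego_prod n z))\<^sup>2"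
proof -
  let ?P = "complex_of_real (szego_prod n z)" and ?S = "szego_kernel (defl_param r n z)"
  obtain \<rho> where \<rho>: "0 < \<rho>" "\<rho> < 1" "\<And>i. i < n \<Longrightarrow> cmod (z i) < \<rho>"
    using radius_bound[of n z] z by auto
  have "(\<Prod>i<n. cnj (pseries (defl_kernel r n z (z i)) (z (p i)))) = (\<Prod>i<n. ?S (z i) (z (p i))) / ?P\<^sup>2"
    if p: "p permutes {..<n}" for p
  proof -
    have pn: "p i < n" if "i < n" for i using permutes_in_image[OF p, of i] that by simp
    have "cnj (pseries (defl_kernel r n z (z i)) (z (p i))) =
        ?S (z i) (z (p i)) / ((\<Prod>l<n. 1 - z i * cnj (z l)) * (\<Prod>l<n. 1 - z l * cnj (z (p i))))" if "i < n" for i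
    proof -
      have "pseries (defl_kernel r n z (z i)) (z (p i)) =
          1 / (\<Prod>l<n. 1 - z l * cnj (z i)) * (1 / (\<Prod>l<n. 1 - cnj (z l) * z (p i))) *
          ((1 + of_real (defl_param r n z) * z (p i) * cnj (z i)) / ((1 + of_real (defl_param r n z)) * (1 - z (p i) * cnj (z i))))"
        using \<rho> pn that less_imp_le by (intro pseries_defl_kernel[OF r _ _ _ \<rho>(1,2)]) auto
      then show ?thesis by (simp add: szego_kernel_def mult_ac)
    qed
    then have "(\<Prod>i<n. cnj (pseries (defl_kernel r n z (z i)) (z (p i)))) =
        (\<Prod>i<n. ?S (z i) (z (p i)) / ((\<Prod>l<n. 1 - z i * cnj (z l)) * (\<Prod>l<n. 1 - z l * cnj (z (p i)))))"
      by (intro prod.cong) auto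
    also have "\<dots> = (\<Prod>i<n. ?S (z i) (z (p i))) / ((\<Prod>i<n. \<Prod>l<n. 1 - z i * cnj (z l)) * (\<Prod>i<n. \<Prod>l<n. 1 - z l * cnj (z (p i))))"
      by (simp only: prod_dividef prod.distrib)
    also have "(\<Prod>i<n. \<Prod>l<n. 1 - z l * cnj (z (p i))) = (\<Prod>i<n. \<Prod>l<n. 1 - z l * cnj (z i))"
      using prod.permute[OF p, of "\<lambda>i. \<Prod>l<n. 1 - z l * cnj (z i)"] by (simp add: o_def)
    also have "\<dots> = (\<Prod>l<n. \<Prod>i<n. 1 - z l * cnj (z i))" by (rule prod.swap)
    finally show ?thesis by (simp only: szego_prod_complex power2_eq_square)
  qed
  then show ?thesis by (simp add: permanent_mat sum_divide_distrib)
qed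

text \<open>Up to positive factors the permanent is the integral of a nonnegative function, hence
  real and nonnegative. The \<open>szego_prod\<close> in the mass cancels one of the two in the
  denominator of \<open>sum_prod_defl_kernel\<close>.\<close>

lemma nn_integral_kac_rice:
  assumes r: "r \<ge> 0" and z: "\<And>i. i < n \<Longrightarrow> cmod (z i) < 1"
  defines "p \<equiv> permanent (mat n n (\<lambda>(i, j). szego_kernel (defl_param r n z) (z i) (z j)))"
  shows "p = of_real (Re p)" "0 \<le> Re p"
    "(\<integral>\<^sup>+x. ennreal (kac_rice r n z x) \<partial>gauss_seq r) =
       ennreal ((1 + r) / (1 + defl_param r n z) * (vandermonde2 n z / szego_prod n z) * Re p / pi ^ n)"
proof -
  let ?P = "szego_prod n z" and ?s = "defl_param r n z"
  let ?Q = "\<lambda>x. pseries (divdiffs n z x)"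
  define G where "G = (\<lambda>x. ztilt r n z (\<lambda>_. 0) x * (\<Prod>i<n. (cmod (?Q x (z i)))\<^sup>2))"
  define I where "I = (\<integral>x. G x \<partial>gauss_seq r)"
  obtain \<rho> where \<rho>: "0 < \<rho>" "\<rho> < 1" "\<And>i. i < n \<Longrightarrow> cmod (z i) < \<rho>"
    using radius_bound[of n z] z by auto
  have \<rho>': "cmod (z i) \<le> \<rho>" if "i < n" for i using \<rho>(3)[OF that] by simp
  have P: "?P > 0" using z by (rule szego_prod_pos)
  have s: "?s \<ge> 0" by (rule defl_param_nonneg[OF r])
  have T: "(\<Prod>j<n. \<tau> r j) > 0" by (intro prod_pos \<tau>_pos[OF r] ballI)
  have closed: "(\<Prod>j<n. \<tau> r j) * tilt_mass r n z = ?P * (1 + r) / (1 + ?s)"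
    using z by (intro tilt_mass_closed r)
  have "?P * (1 + r) / (1 + ?s) > 0" using P r s by (intro divide_pos_pos mult_pos_pos) auto
  then have mass: "tilt_mass r n z > 0"
    unfolding closed[symmetric] using T by (rule zero_less_mult_pos)
  have cG: "complex_of_real (G x) = of_real (ztilt r n z (\<lambda>_. 0) x) * (\<Prod>i<n. ?Q x (z i)) * cnj (\<Prod>j<n. ?Q x (z j))" for x
    by (simp only: G_def of_real_mult of_real_prod complex_norm_square prod.distrib cnj_prod mult.assoc)
  have iG: "integrable (gauss_seq r) (\<lambda>x. complex_of_real (G x))"
  proof (rule poly_bounded_integrable[OF _ r \<rho>(1,2)])
    show "poly_bounded \<rho> (\<lambda>x. complex_of_real (G x))"
      unfolding cG
      by (intro poly_bounded_monomial bounded_functional_interp bounded_functional_eval \<rho> \<rho>' less_imp_le[OF \<tau>_pos[OF r]]) auto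
  qed
  have iG': "integrable (gauss_seq r) G"
    using integrable_Re[OF iG] by simp
  have G0: "G x \<ge> 0" for x
    unfolding G_def by (intro mult_nonneg_nonneg prod_nonneg ztilt_nonneg) auto
  then have I0: "I \<ge> 0" unfolding I_def by (intro Bochner_Integration.integral_nonneg)
  have "complex_of_real I = (\<integral>x. complex_of_real (G x) \<partial>gauss_seq r)"
    unfolding I_def by (rule integral_complex_of_real[symmetric])
  also have "\<dots> = (\<integral>x. of_real (ztilt r n z (\<lambda>_. 0) x) \<partial>gauss_seq r) *
      (\<Sum>p | p permutes {..<n}. \<Prod>i<n. cnj (pseries (defl_kernel r n z (z i)) (z (p i))))"
    unfolding cG by (rule wick_tilted[OF r \<rho>]) (auto intro: \<rho>')
  also have "\<dots> = of_real (tilt_mass r n z) * (p / (of_real ?P)\<^sup>2)"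
    using sum_prod_defl_kernel[of r n z] r z unfolding p_def tilt_mass_def by (simp only: integral_complex_of_real)
  finally have "p = of_real (I * ?P\<^sup>2 / tilt_mass r n z)"
    using P mass by (simp add: field_simps)
  moreover from this have Rep: "Re p = I * ?P\<^sup>2 / tilt_mass r n z" by (simp only: Re_complex_of_real)
  ultimately show "p = of_real (Re p)" by (simp only:)
  show "0 \<le> Re p" unfolding Rep using I0 mass by simp
  have kr: "kac_rice r n z x = vandermonde2 n z * ((\<Prod>j<n. \<tau> r j) / pi ^ n) * G x" for x
  proof -
    have "(\<Prod>j<n. gauss_density (\<tau> r j) (interp n z x j)) = (\<Prod>j<n. \<tau> r j) / pi ^ n * ztilt r n z (\<lambda>_. 0) x"
      by (simp add: gauss_density_def tilt_def prod.distrib prod_dividef exp_sum sum_negf[symmetric])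
    then show ?thesis unfolding kac_rice_def G_def by (simp add: mult_ac)
  qed
  have V: "0 \<le> vandermonde2 n z * ((\<Prod>j<n. \<tau> r j) / pi ^ n)"
    using T by (auto simp: vandermonde2_def intro!: mult_nonneg_nonneg prod_nonneg divide_nonneg_nonneg less_imp_le[OF \<tau>_pos[OF r]])
  have "(\<integral>\<^sup>+x. ennreal (kac_rice r n z x) \<partial>gauss_seq r) =
      ennreal (\<integral>x. vandermonde2 n z * ((\<Prod>j<n. \<tau> r j) / pi ^ n) * G x \<partial>gauss_seq r)"
    unfolding kr by (intro nn_integral_eq_integral integrable_mult_right iG' AE_I2 mult_nonneg_nonneg[OF V G0])
  also have "(\<integral>x. vandermonde2 n z * ((\<Prod>j<n. \<tau> r j) / pi ^ n) * G x \<partial>gauss_seq r) =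
      vandermonde2 n z * ((\<Prod>j<n. \<tau> r j) / pi ^ n) * I"
    unfolding I_def by (rule integral_mult_right_zero)
  also have "\<dots> = (1 + r) / (1 + ?s) * (vandermonde2 n z / ?P) * Re p / pi ^ n"
  proof -
    have "I = Re p * tilt_mass r n z / ?P\<^sup>2" unfolding Rep using P mass by simp
    then have "vandermonde2 n z * ((\<Prod>j<n. \<tau> r j) / pi ^ n) * I =
      ((\<Prod>j<n. \<tau> r j) * tilt_mass r n z) * (vandermonde2 n z * Re p / (pi ^ n * ?P\<^sup>2))"
      by simp
    also have "\<dots> = (1 + r) / (1 + ?s) * (vandermonde2 n z / ?P) * Re p / pi ^ n"
      unfolding closed using P by (simp add: power2_eq_square mult_ac)
    finally show ?thesis .
  qed
  finally show "(\<integral>\<^sup>+x. ennreal (kac_rice r n z x) \<partial>gauss_seq r) =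
       ennreal ((1 + r) / (1 + ?s) * (vandermonde2 n z / ?P) * Re p / pi ^ n)" .
qed


section \<open>Correlation functions\<close>

lemma szego_disk_closed:
  assumes "s \<ge> 0" "cmod z < 1" "cmod w < 1"
  shows "szego_disk s z w = szego_kernel s z w"
proof -
  let ?q = "z * cnj w"
  have q: "cmod ?q < 1"
    using assms mult_strict_mono'[of "cmod z" 1 "cmod w" 1] by (simp add: norm_mult)
  have "1 - ?q \<noteq> 0" using assms by (intro one_minus_mult_ne_0) auto
  have "complex_of_real (1 + s) \<noteq> 0" using assms by (subst of_real_eq_0_iff) simp
  then have s: "1 + complex_of_real s \<noteq> 0" by simp
  have "(\<Sum>n. ?q ^ Suc n) = ?q * (1 / (1 - ?q))"
    using suminf_mult[OF summable_geometric[OF q], of ?q] suminf_geometric[OF q] by simp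
  then have "szego_disk s z w = 1 / (1 + of_real s) + ?q / (1 - ?q)"
    by (simp add: szego_disk_def)
  also have "\<dots> = szego_kernel s z w"
    using s \<open>1 - ?q \<noteq> 0\<close> by (simp add: szego_kernel_def add_frac_eq) (simp add: algebra_simps)
  finally show ?thesis .
qed

text \<open>The correlation function before the Vandermonde quotient is recognised as a determinant.
  Taking \<open>Re\<close> makes it real-valued by definition; on the disk the permanent is real
  anyway.\<close>

definition disk_density :: "real \<Rightarrow> nat \<Rightarrow> (nat \<Rightarrow> complex) \<Rightarrow> real" where
  "disk_density r n z = (1 + r) / (1 + defl_param r n z) * (vandermonde2 n z / szego_prod n z) *
     Re (permanent (mat n n (\<lambda>(i, j). szego_kernel (defl_param r n z) (z i) (z j))))"

lemma disk_density_perdet: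
  assumes r: "r \<ge> 0" and z: "\<And>i. i < n \<Longrightarrow> cmod (z i) < 1"
  shows "complex_of_real (disk_density r n z) =
    complex_of_real ((1 + r) / (1 + r * (\<Prod>k<n. cmod (z k) ^ 4))) *
    perdet (mat n n (\<lambda>(i, j). szego_disk (r * (\<Prod>l<n. (cmod (z l))\<^sup>2)) (z i) (z j)))"
proof -
  let ?s = "defl_param r n z" and ?V = "vandermonde2 n z / szego_prod n z"
  define p where "p = permanent (mat n n (\<lambda>(i, j). szego_kernel ?s (z i) (z j)))"
  have s: "?s \<ge> 0" by (rule defl_param_nonneg[OF r])
  have m: "mat n n (\<lambda>(i, j). szego_disk (r * (\<Prod>l<n. (cmod (z l))\<^sup>2)) (z i) (z j)) =
      mat n n (\<lambda>(i, j). szego_kernel ?s (z i) (z j))"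
    unfolding defl_param_def[symmetric]
    by (intro cong_mat refl, unfold prod.case, rule szego_disk_closed) (use s z in auto)
  have "(\<Prod>k<n. (cmod (z k))\<^sup>2) * (\<Prod>k<n. (cmod (z k))\<^sup>2) = (\<Prod>k<n. cmod (z k) ^ 4)"
    by (simp add: prod.distrib[symmetric] power_add[symmetric])
  then have s4: "?s * (\<Prod>i<n. (cmod (z i))\<^sup>2) = r * (\<Prod>k<n. cmod (z k) ^ 4)"
    by (simp add: defl_param_def)
  have r4: "1 + r * (\<Prod>k<n. cmod (z k) ^ 4) > 0"
    using r by (intro add_pos_nonneg mult_nonneg_nonneg prod_nonneg) auto
  have p: "p = of_real (Re p)"
    unfolding p_def using r z by (rule nn_integral_kac_rice(1))
  have det: "Determinant.det (mat n n (\<lambda>(i, j). szego_kernel ?s (z i) (z j))) =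
    of_real ((1 + r * (\<Prod>k<n. cmod (z k) ^ 4)) / (1 + ?s) * ?V)"
    using det_szego_kernel[of ?s n z] s z unfolding s4 by simp
  have "disk_density r n z = (1 + r) / (1 + r * (\<Prod>k<n. cmod (z k) ^ 4)) *
      (Re p * ((1 + r * (\<Prod>k<n. cmod (z k) ^ 4)) / (1 + ?s) * ?V))"
    unfolding disk_density_def p_def[symmetric] using r4 by simp
  then have "complex_of_real (disk_density r n z) = of_real ((1 + r) / (1 + r * (\<Prod>k<n. cmod (z k) ^ 4))) *
      (of_real (Re p) * of_real ((1 + r * (\<Prod>k<n. cmod (z k) ^ 4)) / (1 + ?s) * ?V))"
    by (simp only: of_real_mult)
  then show ?thesis
    unfolding m perdet_def p_def[symmetric] det p[symmetric] .
qed

lemma disk_density_nonneg: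
  assumes r: "r \<ge> 0" and z: "\<And>i. i < n \<Longrightarrow> cmod (z i) < 1"
  shows "0 \<le> disk_density r n z"
proof -
  have "0 \<le> vandermonde2 n z" unfolding vandermonde2_def by (intro prod_nonneg) auto
  moreover have "0 < szego_prod n z" using z by (rule szego_prod_pos)
  moreover have "0 \<le> Re (permanent (mat n n (\<lambda>(i, j). szego_kernel (defl_param r n z) (z i) (z j))))"
    using r z by (rule nn_integral_kac_rice(2))
  ultimately show ?thesis
    unfolding disk_density_def using r defl_param_nonneg[OF r, of n z]
    by (intro mult_nonneg_nonneg divide_nonneg_nonneg) auto
qed

lemma measurable_disk_density:
  assumes [measurable]: "\<And>i. i < n \<Longrightarrow> (\<lambda>u. z u i) \<in> borel_measurable M"
  shows "(\<lambda>u. disk_density r n (z u)) \<in> borel_measurable M"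
proof -
  have 1: "(\<lambda>u. defl_param r n (z u)) \<in> borel_measurable M"
    unfolding defl_param_def by (intro borel_measurable_times borel_measurable_prod borel_measurable_const) simp
  have 2: "(\<lambda>u. vandermonde2 n (z u)) \<in> borel_measurable M"
    unfolding vandermonde2_def by (intro borel_measurable_prod) simp
  have 3: "(\<lambda>u. szego_prod n (z u)) \<in> borel_measurable M"
    unfolding szego_prod_def
    by (intro borel_measurable_prod borel_measurable_times) (auto intro!: borel_measurable_prod borel_measurable_power borel_measurable_norm
        borel_measurable_diff borel_measurable_times measurable_compose[OF _ measurable_cnj])
  have 4: "(\<lambda>u. szego_kernel (defl_param r n (z u)) (z u i) (z u j)) \<in> borel_measurable M" if "i < n" "j < n" for i j
    using that 1 unfolding szego_kernel_def
    by (intro borel_measurable_divide borel_measurable_add borel_measurable_times borel_measurable_diff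
        measurable_compose[OF _ measurable_cnj]) (auto simp: borel_measurable_of_real)
  have 5: "(\<lambda>u. permanent (mat n n (\<lambda>(i, j). szego_kernel (defl_param r n (z u)) (z u i) (z u j)))) \<in> borel_measurable M"
    unfolding permanent_mat
  proof (intro borel_measurable_sum borel_measurable_prod 4)
    fix p i assume "p \<in> {p. p permutes {..<n}}" "i \<in> {..<n}"
    then show "i < n" "p i < n" using permutes_in_image[of p "{..<n}" i] by auto
  qed
  show ?thesis
    unfolding disk_density_def
    by (intro borel_measurable_times borel_measurable_divide borel_measurable_add borel_measurable_const 1 2 3
        measurable_compose[OF 5 borel_measurable_Re])
qed

lemma disk_density_1:
  assumes r: "r \<ge> 0" and z: "cmod z < 1"
  shows "disk_density r 1 (\<lambda>_. z) = (1 + r) * (1 + r * cmod z ^ 4) / ((1 + r * (cmod z)\<^sup>2)\<^sup>2 * (1 - (cmod z)\<^sup>2)\<^sup>2)"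
proof -
  let ?c = "(cmod z)\<^sup>2"
  have zz: "z * cnj z = of_real ?c" by (simp only: complex_norm_square)
  have P: "{p. p permutes {..<Suc 0}} = {id}" by (auto simp: lessThan_Suc)
  have "permanent (mat (Suc 0) (Suc 0) (\<lambda>(i, j). szego_kernel (r * ?c) z z)) = szego_kernel (r * ?c) z z"
    unfolding permanent_mat[where f = "\<lambda>i j. szego_kernel (r * ?c) z z"] P by simp
  also have "\<dots> = of_real ((1 + r * ?c * ?c) / ((1 + r * ?c) * (1 - ?c)))"
    unfolding szego_kernel_def mult.assoc zz by simp
  finally have "Re (permanent (mat (Suc 0) (Suc 0) (\<lambda>(i, j). szego_kernel (r * ?c) z z))) = (1 + r * ?c * ?c) / ((1 + r * ?c) * (1 - ?c))"
    by (simp only: Re_complex_of_real)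
  moreover have "?c * ?c = cmod z ^ 4" by (simp add: power_add[symmetric])
  ultimately show ?thesis
    by (simp add: disk_density_def defl_param_def vandermonde2_def szego_prod_def power2_eq_square[of "1 + r * ?c"] power2_eq_square[of "1 - ?c"] mult.assoc)
qed

section \<open>The reference measure on the disk and its powers\<close>

lemma unit_disk_borel [measurable, simp]: "unit_disk \<in> sets borel"
proof -
  have "unit_disk = ball 0 1" by (auto simp: unit_disk_def dist_norm)
  then show ?thesis by (metis borel_open open_ball)
qed

lemma space_disk_ref_measure: "space disk_ref_measure = unit_disk"
  by (simp add: disk_ref_measure_def space_scale_measure space_restrict_space)

lemma sets_disk_ref_measure: "sets disk_ref_measure = sets (restrict_space borel unit_disk)"
  by (simp add: disk_ref_measure_def sets_restrict_space)

lemma measurable_disk_ref_borel: "(\<lambda>x. x) \<in> disk_ref_measure \<rightarrow>\<^sub>M borel"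
  unfolding measurable_cong_sets[OF sets_disk_ref_measure refl]
  by (rule measurable_restrict_space1) simp

lemma emeasure_disk_ref_measure:
  assumes "A \<in> sets borel"
  shows "emeasure disk_ref_measure (A \<inter> unit_disk) = (\<integral>\<^sup>+w. ennreal (1 / pi) * indicator unit_disk w * indicator A w \<partial>lborel)"
proof -
  have "emeasure disk_ref_measure (A \<inter> unit_disk) = ennreal (1 / pi) * emeasure lborel (A \<inter> unit_disk)"
    by (simp add: disk_ref_measure_def emeasure_restrict_space)
  also have "\<dots> = (\<integral>\<^sup>+w. ennreal (1 / pi) * indicator (A \<inter> unit_disk) w \<partial>lborel)"
    using assms by (simp add: nn_integral_cmult_indicator)
  also have "\<dots> = (\<integral>\<^sup>+w. ennreal (1 / pi) * indicator unit_disk w * indicator A w \<partial>lborel)"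
    by (intro nn_integral_cong) (simp add: indicator_def)
  finally show ?thesis .
qed

lemma finite_measure_disk_ref: "finite_measure disk_ref_measure"
proof
  have "emeasure disk_ref_measure (space disk_ref_measure) = ennreal (1 / pi) * emeasure lborel unit_disk"
    by (simp add: disk_ref_measure_def space_scale_measure space_restrict_space emeasure_restrict_space)
  moreover have "emeasure lborel unit_disk < \<infinity>"
    by (rule emeasure_bounded_finite) (auto simp: bounded_iff unit_disk_def intro!: exI[of _ 1] less_imp_le)
  ultimately show "emeasure disk_ref_measure (space disk_ref_measure) \<noteq> \<infinity>"
    by (simp add: ennreal_mult_eq_top_iff)
qed

text \<open>The image of the product measure on the disk and the density on the plane both agree
  with the product of the measures E on product sets, hence coincide. This carries integrals over
  tuples in the disk to Lebesgue measure, where the Kac-Rice formula is stated.\<close>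

lemma nn_integral_disk_ref_PiM:
  fixes f :: "(nat \<Rightarrow> complex) \<Rightarrow> ennreal"
  assumes f: "f \<in> borel_measurable (PiM {..<n} (\<lambda>_. borel))"
  shows "(\<integral>\<^sup>+z. f z \<partial>PiM {..<n} (\<lambda>_. disk_ref_measure)) =
    (\<integral>\<^sup>+z. (\<Prod>i<n. ennreal (1 / pi) * indicator unit_disk (z i)) * f z \<partial>PiM {..<n} (\<lambda>_. lborel))"
proof -
  let ?D = "PiM {..<n} (\<lambda>_. disk_ref_measure)" and ?B = "PiM {..<n} (\<lambda>_::nat. borel :: complex measure)"
    and ?L = "PiM {..<n} (\<lambda>_::nat. lborel :: complex measure)" and ?h = "\<lambda>z. \<Prod>i<n. ennreal (1 / pi) * indicator unit_disk (z i :: complex)"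
  define E :: "nat \<Rightarrow> complex measure" where "E = (\<lambda>_. distr disk_ref_measure borel (\<lambda>x. x))"
  have sE: "sets (E i) = sets borel" for i by (simp add: E_def)
  interpret D: finite_measure disk_ref_measure by (rule finite_measure_disk_ref)
  interpret DD: product_sigma_finite "\<lambda>_::nat. disk_ref_measure" ..
  interpret LL: product_sigma_finite "\<lambda>_::nat. lborel :: complex measure" ..
  have "sigma_finite_measure (E i)" for i
    unfolding E_def by (intro finite_measure.axioms(1) D.finite_measure_distr measurable_disk_ref_borel)
  then interpret EE: product_sigma_finite E by (rule product_sigma_finite.intro)
  have setsE: "sets (PiM {..<n} E) = sets ?B" by (intro sets_PiM_cong refl sE)
  have eE: "emeasure (E i) A = emeasure disk_ref_measure (A \<inter> unit_disk)" if "A \<in> sets borel" for A i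
    unfolding E_def using that measurable_disk_ref_borel by (simp add: emeasure_distr space_disk_ref_measure)
  have mid: "(\<lambda>x. x) \<in> ?D \<rightarrow>\<^sub>M ?B"
  proof (rule measurable_PiM_single')
    fix i assume i: "i \<in> {..<n}"
    show "(\<lambda>x. x i) \<in> ?D \<rightarrow>\<^sub>M borel"
      by (rule measurable_compose[OF measurable_component_singleton[OF i] measurable_disk_ref_borel])
  qed (auto simp: space_PiM)
  have mh: "?h \<in> borel_measurable ?L" by measurable
  have "distr ?D ?B (\<lambda>x. x) = PiM {..<n} E"
  proof (rule EE.PiM_eqI)
    fix A assume "\<And>i. i \<in> {..<n} \<Longrightarrow> A i \<in> sets (E i)"
    then have A: "\<And>i. i < n \<Longrightarrow> A i \<in> sets borel" using sE by auto
    have "emeasure (distr ?D ?B (\<lambda>x. x)) (PiE {..<n} A) = emeasure ?D (PiE {..<n} A \<inter> space ?D)"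
      using mid A by (subst emeasure_distr) (auto intro!: sets_PiM_I_finite)
    also have "PiE {..<n} A \<inter> space ?D = PiE {..<n} (\<lambda>i. A i \<inter> unit_disk)"
      by (auto simp: space_PiM space_disk_ref_measure PiE_iff)
    also have "emeasure ?D \<dots> = (\<Prod>i<n. emeasure disk_ref_measure (A i \<inter> unit_disk))"
      using A by (intro DD.emeasure_PiM) (auto simp: sets_disk_ref_measure sets_restrict_space)
    also have "\<dots> = (\<Prod>i<n. emeasure (E i) (A i))" using A by (intro prod.cong) (auto simp: eE)
    finally show "emeasure (distr ?D ?B (\<lambda>x. x)) (PiE {..<n} A) = (\<Prod>i<n. emeasure (E i) (A i))" .
  qed (auto simp: setsE)
  moreover have "density ?L ?h = PiM {..<n} E"
  proof (rule EE.PiM_eqI)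
    fix A assume "\<And>i. i \<in> {..<n} \<Longrightarrow> A i \<in> sets (E i)"
    then have A: "\<And>i. i < n \<Longrightarrow> A i \<in> sets borel" using sE by auto
    have "PiE {..<n} A \<in> sets ?L" using A by (intro sets_PiM_I_finite) auto
    then have "emeasure (density ?L ?h) (PiE {..<n} A) = (\<integral>\<^sup>+z. ?h z * indicator (PiE {..<n} A) z \<partial>?L)"
      using mh by (intro emeasure_density)
    also have "\<dots> = (\<integral>\<^sup>+z. (\<Prod>i<n. ennreal (1 / pi) * indicator unit_disk (z i) * indicator (A i) (z i)) \<partial>?L)"
    proof (intro nn_integral_cong)
      fix z assume "z \<in> space ?L"
      then have "indicator (PiE {..<n} A) z = (\<Prod>i<n. indicator (A i) (z i) :: ennreal)"
        by (auto simp: indicator_def space_PiM PiE_iff prod_zero_iff)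
      then show "?h z * indicator (PiE {..<n} A) z = (\<Prod>i<n. ennreal (1 / pi) * indicator unit_disk (z i) * indicator (A i) (z i))"
        by (simp add: prod.distrib)
    qed
    also have "\<dots> = (\<Prod>i<n. \<integral>\<^sup>+w. ennreal (1 / pi) * indicator unit_disk w * indicator (A i) w \<partial>lborel)"
      using A by (intro LL.product_nn_integral_prod) auto
    also have "\<dots> = (\<Prod>i<n. emeasure (E i) (A i))"
      using A by (intro prod.cong) (auto simp: eE emeasure_disk_ref_measure)
    finally show "emeasure (density ?L ?h) (PiE {..<n} A) = (\<Prod>i<n. emeasure (E i) (A i))" .
  next
    show "sets (density ?L ?h) = sets (PiM {..<n} E)"
      unfolding sets_density setsE by (intro sets_PiM_cong refl) simp
  qed simp
  ultimately have eq: "distr ?D ?B (\<lambda>x. x) = density ?L ?h" by simp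
  have fL: "f \<in> borel_measurable ?L"
    using f by (simp cong: measurable_cong_sets sets_PiM_cong)
  have "(\<integral>\<^sup>+z. f z \<partial>?D) = (\<integral>\<^sup>+z. f z \<partial>distr ?D ?B (\<lambda>x. x))"
    using mid f by (subst nn_integral_distr) auto
  also have "\<dots> = (\<integral>\<^sup>+z. ?h z * f z \<partial>?L)"
    unfolding eq using mh fL by (rule nn_integral_density)
  finally show ?thesis .
qed

text \<open>The factor pi^(-n) from the Gaussian densities is absorbed by the reference measure; on
  the product set all points lie in the disk, so the indicators of the disk equal 1.\<close>

lemma factorial_moment_disk_density:
  assumes r: "r \<ge> 0" and jm: "\<And>i. i < length js \<Longrightarrow> js ! i < m"
    and L: "\<And>i. i < m \<Longrightarrow> L i \<in> sets borel" "\<And>i. i < m \<Longrightarrow> L i \<subseteq> cball 0 \<rho>" and \<rho>: "\<rho> < 1"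
    and disj: "disjoint_family_on L {..<m}"
  shows "(\<integral>\<^sup>+x. ennreal (real (fact_moment m L js x)) \<partial>gauss_seq r) =
    (\<integral>\<^sup>+z. ennreal (disk_density r (length js) z) * indicator (PiE {..<length js} (\<lambda>i. L (js ! i))) z
      \<partial>PiM {..<length js} (\<lambda>_. disk_ref_measure))"
proof -
  let ?n = "length js"
  let ?A = "PiE {..<length js} (\<lambda>i. L (js ! i))"
  have A: "?A \<in> sets (PiM {..<?n} (\<lambda>_. borel))" using L(1) jm by (intro sets_PiM_I_finite) auto
  have "(\<lambda>z. disk_density r ?n z) \<in> borel_measurable (PiM {..<?n} (\<lambda>_. borel))"
    by (rule measurable_disk_density) (auto intro: measurable_component_singleton)
  then have m: "(\<lambda>z. ennreal (disk_density r ?n z) * indicator ?A z) \<in> borel_measurable (PiM {..<?n} (\<lambda>_. borel))"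
    using A by (intro borel_measurable_times_ennreal borel_measurable_indicator) auto
  have "(\<integral>\<^sup>+x. ennreal (real (fact_moment m L js x)) \<partial>gauss_seq r) =
    (\<integral>\<^sup>+z. (\<integral>\<^sup>+x. ennreal (kac_rice r ?n z x) \<partial>gauss_seq r) * indicator ?A z \<partial>PiM {..<?n} (\<lambda>_. lborel))"
    by (rule factorial_moment_formula[OF r jm L \<rho> disj])
  also have "\<dots> = (\<integral>\<^sup>+z. (\<Prod>i<?n. ennreal (1 / pi) * indicator unit_disk (z i)) *
      (ennreal (disk_density r ?n z) * indicator ?A z) \<partial>PiM {..<?n} (\<lambda>_. lborel))"
  proof (intro nn_integral_cong)
    fix z
    show "(\<integral>\<^sup>+x. ennreal (kac_rice r ?n z x) \<partial>gauss_seq r) * indicator ?A z =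
      (\<Prod>i<?n. ennreal (1 / pi) * indicator unit_disk (z i)) * (ennreal (disk_density r ?n z) * indicator ?A z)"
    proof (cases "z \<in> ?A")
      case True
      have z: "cmod (z i) < 1" if "i < ?n" for i
      proof -
        have "z i \<in> L (js ! i)" using True that by auto
        then have "z i \<in> cball 0 \<rho>" using L(2)[OF jm[OF that]] by blast
        then show ?thesis using \<rho> by simp
      qed
      then have "(\<Prod>i<?n. ennreal (1 / pi) * indicator unit_disk (z i)) = ennreal (1 / pi) ^ ?n"
        by (simp add: unit_disk_def)
      also have "\<dots> = ennreal ((1 / pi) ^ ?n)" by (simp add: ennreal_power)
      finally have "(\<Prod>i<?n. ennreal (1 / pi) * indicator unit_disk (z i)) * ennreal (disk_density r ?n z) =
          ennreal ((1 / pi) ^ ?n * disk_density r ?n z)"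
        using disk_density_nonneg[of r ?n z] r z by (simp add: ennreal_mult)
      moreover have "(\<integral>\<^sup>+x. ennreal (kac_rice r ?n z x) \<partial>gauss_seq r) = ennreal ((1 / pi) ^ ?n * disk_density r ?n z)"
        using nn_integral_kac_rice(3)[of r ?n z] r z by (simp add: disk_density_def power_one_over mult_ac)
      ultimately show ?thesis using True by simp
    qed simp
  qed
  also have "\<dots> = (\<integral>\<^sup>+z. ennreal (disk_density r ?n z) * indicator ?A z \<partial>PiM {..<?n} (\<lambda>_. disk_ref_measure))"
    by (rule nn_integral_disk_ref_PiM[OF m, symmetric])
  finally show ?thesis .
qed


section \<open>The zero process of the Gaussian analytic function\<close>

lemma gauss_measure_scale:
  assumes t: "t > 0"
  shows "distr (gauss_measure 1) borel (\<lambda>w. w / of_real (sqrt t)) = gauss_measure t"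
proof (rule measure_eqI)
  fix A assume "A \<in> sets (distr (gauss_measure 1) borel (\<lambda>w. w / of_real (sqrt t)))"
  then have A[measurable]: "A \<in> sets borel" by simp
  let ?c = "1 / sqrt t"
  have c: "?c \<noteq> 0" "?c\<^sup>2 = 1 / t" using t by (auto simp: power_divide)
  have d: "\<bar>?c\<bar> ^ DIM(complex) = ?c\<^sup>2" by (simp add: power_divide)
  have sc: "0 + ?c *\<^sub>R w = w / of_real (sqrt t)" for w :: complex
    by (simp add: scaleR_conv_of_real)
  have "emeasure (gauss_measure t) A = (\<integral>\<^sup>+w. ennreal (gauss_density t w) * indicator A w \<partial>lborel)"
    unfolding gauss_measure_def by (intro emeasure_density) auto
  also have "\<dots> = (\<integral>\<^sup>+w. ennreal (gauss_density t w) * indicator A w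
      \<partial>density (distr lborel borel (\<lambda>w. 0 + ?c *\<^sub>R w)) (\<lambda>_. ennreal (\<bar>?c\<bar> ^ DIM(complex))))"
    by (subst lborel_affine[OF c(1), of 0]) (rule refl)
  also have "\<dots> = (\<integral>\<^sup>+w. ennreal (?c\<^sup>2) * (ennreal (gauss_density t (w / of_real (sqrt t))) * indicator A (w / of_real (sqrt t))) \<partial>lborel)"
    unfolding sc d by (subst nn_integral_density, simp, simp, subst nn_integral_distr) simp_all
  also have "\<dots> = (\<integral>\<^sup>+w. ennreal (gauss_density 1 w) * indicator ((\<lambda>w. w / of_real (sqrt t)) -` A) w \<partial>lborel)"
  proof (rule nn_integral_cong)
    fix w :: complex
    have "(cmod (w / of_real (sqrt t)))\<^sup>2 = (cmod w)\<^sup>2 / t"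
      using t by (simp add: norm_divide power_divide)
    then have "?c\<^sup>2 * gauss_density t (w / of_real (sqrt t)) = gauss_density 1 w"
      using t unfolding c(2) gauss_density_def by simp
    then show "ennreal (?c\<^sup>2) * (ennreal (gauss_density t (w / of_real (sqrt t))) * indicator A (w / of_real (sqrt t))) =
        ennreal (gauss_density 1 w) * indicator ((\<lambda>w. w / of_real (sqrt t)) -` A) w"
      using gauss_density_nonneg[OF t] by (auto simp: ennreal_mult[symmetric] indicator_def)
  qed
  also have "\<dots> = emeasure (gauss_measure 1) ((\<lambda>w. w / of_real (sqrt t)) -` A)"
  proof -
    have "(\<lambda>w::complex. w / of_real (sqrt t)) -` A \<inter> space borel \<in> sets borel" by measurable
    then show ?thesis
      unfolding gauss_measure_def by (intro emeasure_density[symmetric]) auto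
  qed
  also have "\<dots> = emeasure (distr (gauss_measure 1) borel (\<lambda>w. w / of_real (sqrt t))) A"
    by (subst emeasure_distr) (auto simp: gauss_measure_def)
  finally show "emeasure (distr (gauss_measure 1) borel (\<lambda>w. w / of_real (sqrt t))) A = emeasure (gauss_measure t) A" ..
qed simp

text \<open>Rescaled so that coefficient k has inverse variance \<open>\<tau> r k\<close>; the
  constant coefficient is the one that changes.\<close>

definition gaf_coeffs :: "(nat \<Rightarrow> 'a \<Rightarrow> complex) \<Rightarrow> real \<Rightarrow> 'a \<Rightarrow> nat \<Rightarrow> complex" where
  "gaf_coeffs \<zeta> r \<omega> k = \<zeta> k \<omega> / of_real (sqrt (\<tau> r k))"

lemma distr_gaf_coeffs:
  assumes M: "prob_space M" and indep: "prob_space.indep_vars M (\<lambda>_. borel) \<zeta> UNIV"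
    and gauss: "\<And>n. std_complex_gaussian M (\<zeta> n)" and r: "r \<ge> 0"
  shows "gaf_coeffs \<zeta> r \<in> M \<rightarrow>\<^sub>M seq_borel" "distr M seq_borel (gaf_coeffs \<zeta> r) = gauss_seq r"
proof -
  interpret prob_space M by (rule M)
  have \<zeta>: "\<zeta> n \<in> borel_measurable M" "distr M borel (\<zeta> n) = gauss_measure 1" for n
  proof -
    have d: "distributed M lborel (\<zeta> n) (\<lambda>z. ennreal (exp (- (cmod z)\<^sup>2) / pi))"
      using gauss[of n] by (simp add: std_complex_gaussian_def)
    show "\<zeta> n \<in> borel_measurable M" using distributed_measurable[OF d] by simp
    have "distr M borel (\<zeta> n) = distr M lborel (\<zeta> n)" by (intro distr_cong) auto
    also have "\<dots> = density lborel (\<lambda>z. ennreal (exp (- (cmod z)\<^sup>2) / pi))" using d by (rule distributed_distr_eq_density)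
    finally show "distr M borel (\<zeta> n) = gauss_measure 1"
      by (simp add: gauss_measure_def gauss_density_def)
  qed
  have X: "(\<lambda>\<omega>. gaf_coeffs \<zeta> r \<omega> k) \<in> borel_measurable M" for k
    unfolding gaf_coeffs_def using \<zeta>(1) by simp
  then show "gaf_coeffs \<zeta> r \<in> M \<rightarrow>\<^sub>M seq_borel" by (rule measurable_seqI)
  have "indep_vars (\<lambda>_. borel) (\<lambda>k \<omega>. gaf_coeffs \<zeta> r \<omega> k) UNIV"
    unfolding gaf_coeffs_def by (rule indep_vars_compose2[OF indep]) simp
  then have "distr M seq_borel (\<lambda>\<omega>. \<lambda>k\<in>UNIV. gaf_coeffs \<zeta> r \<omega> k) = PiM UNIV (\<lambda>k. distr M borel (\<lambda>\<omega>. gaf_coeffs \<zeta> r \<omega> k))"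
    using X by (subst (asm) indep_vars_iff_distr_eq_PiM) auto
  moreover have "distr M borel (\<lambda>\<omega>. gaf_coeffs \<zeta> r \<omega> k) = gauss_measure (\<tau> r k)" for k
  proof -
    have "distr M borel (\<lambda>\<omega>. gaf_coeffs \<zeta> r \<omega> k) = distr (distr M borel (\<zeta> k)) borel (\<lambda>w. w / of_real (sqrt (\<tau> r k)))"
      unfolding gaf_coeffs_def using \<zeta>(1) by (subst distr_distr) (auto simp: o_def)
    then show ?thesis unfolding \<zeta>(2) gauss_measure_scale[OF \<tau>_pos[OF r]] .
  qed
  ultimately show "distr M seq_borel (gaf_coeffs \<zeta> r) = gauss_seq r"
    by (simp add: gauss_seq_def restrict_UNIV)
qed

lemma gaf_disk_pseries:
  assumes x: "wsummable_all (gaf_coeffs \<zeta> r \<omega>)" and z: "cmod z < 1"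
  shows "gaf_disk \<zeta> r \<omega> z = pseries (gaf_coeffs \<zeta> r \<omega>) z"
proof -
  obtain \<rho> where \<rho>: "cmod z < \<rho>" "\<rho> < 1" using dense[OF z] by auto
  have "0 < \<rho>" using \<rho>(1) norm_ge_zero[of z] by linarith
  then have "wsummable \<rho> (gaf_coeffs \<zeta> r \<omega>)" using x \<rho>(2) by (simp add: wsummable_all_iff)
  then have "summable (\<lambda>k. gaf_coeffs \<zeta> r \<omega> k * z ^ k)" using \<rho>(1) by (intro pseries_summable) auto
  then have "pseries (gaf_coeffs \<zeta> r \<omega>) z = (\<Sum>k. gaf_coeffs \<zeta> r \<omega> (Suc k) * z ^ Suc k) + gaf_coeffs \<zeta> r \<omega> 0"
    unfolding pseries_def by (subst suminf_split_head) auto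
  then show ?thesis by (simp add: gaf_disk_def gaf_coeffs_def \<tau>_def)
qed

lemma emeasure_zero_measure_card:
  assumes \<Lambda>: "\<Lambda> \<in> sets (restrict_space borel S)" and fin: "finite {z \<in> \<Lambda>. f z = 0}"
  shows "emeasure (zero_measure S f) \<Lambda> = of_nat (card {z \<in> \<Lambda>. f z = 0})"
proof -
  have "\<Lambda> \<subseteq> S" using \<Lambda> sets.sets_into_space[OF \<Lambda>] by (simp add: space_restrict_space)
  then have eq: "(\<lambda>z. z) -` \<Lambda> \<inter> space (count_space {z \<in> S. f z = 0}) = {z \<in> \<Lambda>. f z = 0}" by auto
  have m: "(\<lambda>z. z) \<in> count_space {z \<in> S. f z = 0} \<rightarrow>\<^sub>M restrict_space borel S"
    by (auto simp: space_restrict_space)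
  have "emeasure (zero_measure S f) \<Lambda> = emeasure (count_space {z \<in> S. f z = 0}) {z \<in> \<Lambda>. f z = 0}"
    unfolding zero_measure_def emeasure_distr[OF m \<Lambda>] eq ..
  also have "\<dots> = of_nat (card {z \<in> \<Lambda>. f z = 0})"
    using fin \<open>\<Lambda> \<subseteq> S\<close> by (subst emeasure_count_space_finite) auto
  finally show ?thesis .
qed

lemma rel_compact_borel_unit_disk:
  assumes "rel_compact_borel unit_disk \<Lambda>"
  shows "\<Lambda> \<in> sets (restrict_space borel unit_disk)" "\<Lambda> \<in> sets borel" "\<exists>\<rho><1. \<Lambda> \<subseteq> cball 0 \<rho>"
proof -
  show 1: "\<Lambda> \<in> sets (restrict_space borel unit_disk)" using assms by (simp add: rel_compact_borel_def)
  then show "\<Lambda> \<in> sets borel" by (auto simp: sets_restrict_space)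
  obtain K where K: "compact K" "K \<subseteq> unit_disk" "\<Lambda> \<subseteq> K" using assms by (auto simp: rel_compact_borel_def)
  show "\<exists>\<rho><1. \<Lambda> \<subseteq> cball 0 \<rho>"
  proof (cases "K = {}")
    case True
    then show ?thesis using K by (intro exI[of _ 0]) auto
  next
    case False
    have "continuous_on K cmod" by (intro continuous_intros)
    then obtain w where w: "w \<in> K" "\<And>v. v \<in> K \<Longrightarrow> cmod v \<le> cmod w"
      using continuous_attains_sup[OF K(1) False] by blast
    then show ?thesis using K by (intro exI[of _ "cmod w"]) (auto simp: unit_disk_def)
  qed
qed

lemma zero_measure_gaf_disk:
  assumes reg: "gaf_coeffs \<zeta> r \<omega> \<in> regular_seqs" and \<Lambda>: "rel_compact_borel unit_disk \<Lambda>"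
  shows "emeasure (zero_measure unit_disk (gaf_disk \<zeta> r \<omega>)) \<Lambda> = of_nat (zero_count \<Lambda> (gaf_coeffs \<zeta> r \<omega>))"
    "point_count (zero_measure unit_disk (gaf_disk \<zeta> r \<omega>)) \<Lambda> = zero_count \<Lambda> (gaf_coeffs \<zeta> r \<omega>)"
proof -
  let ?x = "gaf_coeffs \<zeta> r \<omega>"
  note L = rel_compact_borel_unit_disk[OF \<Lambda>]
  obtain \<rho> where \<rho>: "\<rho> < 1" "\<Lambda> \<subseteq> cball 0 \<rho>" using L(3) by blast
  have "{v \<in> \<Lambda>. gaf_disk \<zeta> r \<omega> v = 0} = {v \<in> \<Lambda>. pseries ?x v = 0}"
  proof -
    have "gaf_disk \<zeta> r \<omega> v = pseries ?x v" if "v \<in> \<Lambda>" for v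
      using reg \<rho> that by (intro gaf_disk_pseries) (auto simp: regular_seqs_def)
    then show ?thesis by auto
  qed
  moreover have "finite {v \<in> \<Lambda>. pseries ?x v = 0}" using reg \<rho> by (rule finite_zeros)
  ultimately show e: "emeasure (zero_measure unit_disk (gaf_disk \<zeta> r \<omega>)) \<Lambda> = of_nat (zero_count \<Lambda> ?x)"
    using emeasure_zero_measure_card[OF L(1), of "gaf_disk \<zeta> r \<omega>"] reg by (simp add: zero_count_def)
  then show "point_count (zero_measure unit_disk (gaf_disk \<zeta> r \<omega>)) \<Lambda> = zero_count \<Lambda> ?x"
    by (simp add: point_count_def measure_def enn2real_of_nat)
qed

section \<open>Index lists, measurability up to null sets, and assembly\<close>

lemma length_concat_replicate:
  "length ks = length xs \<Longrightarrow> length (concat (map2 replicate ks xs)) = sum_list ks"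
  by (induction ks xs rule: list_induct2) auto

lemma map_concat_replicate:
  "length ks = length xs \<Longrightarrow> map f (concat (map2 replicate ks xs)) = concat (map2 replicate ks (map f xs))"
  by (induction ks xs rule: list_induct2) auto

lemma set_concat_replicate:
  "length ks = length xs \<Longrightarrow> set (concat (map2 replicate ks xs)) \<subseteq> set xs"
  by (induction ks xs rule: list_induct2) auto

lemma count_list_replicate: "count_list (replicate k x) y = (if x = y then k else 0)"
  by (induction k) auto

lemma count_list_concat_replicate:
  assumes "length ks = length xs" "distinct xs" "i < length xs"
  shows "count_list (concat (map2 replicate ks xs)) (xs ! i) = ks ! i"
  using assms
proof (induction ks xs arbitrary: i rule: list_induct2)
  case (Cons k ks x xs)
  show ?case
  proof (cases i)
    case 0
    have "x \<notin> set xs" using Cons.prems by simp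
    then have "x \<notin> set (concat (map2 replicate ks xs))" using set_concat_replicate[OF Cons.hyps] by blast
    then show ?thesis using 0 by (simp add: count_list_replicate count_notin del: set_concat)
  next
    case (Suc j)
    then show ?thesis using Cons by (auto simp: count_list_replicate)
  qed
qed simp


text \<open>The counts are compared with a Borel function of the coefficients on the event that the
  series is regular, hence almost surely; this yields measurability for the completed
  measure.\<close>

lemma borel_measurable_completion_AE:
  fixes f g :: "'a \<Rightarrow> 'b::topological_space"
  assumes g: "g \<in> borel_measurable M" and ae: "AE x in M. f x = g x"
  shows "f \<in> borel_measurable (completion M)"
proof (rule measurableI)
  fix A :: "'b set" assume A: "A \<in> sets borel"
  have a: "g -` A \<inter> space M \<in> sets (completion M)" using measurable_sets[OF g A] by auto
  have e: "AE x in completion M. x \<in> g -` A \<inter> space M \<longleftrightarrow> x \<in> f -` A \<inter> space M"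
    using AE_completion[OF ae] by eventually_elim auto
  have "f -` A \<inter> space M \<in> sets (completion M)"
    by (rule completion.in_sets_AE[OF e a]) simp
  then show "f -` A \<inter> space (completion M) \<in> sets (completion M)" by simp
qed simp

lemma common_radius:
  fixes m :: nat
  assumes "\<And>i. i < m \<Longrightarrow> \<exists>\<rho><1. L i \<subseteq> cball (0::complex) \<rho>"
  shows "\<exists>\<rho><1. \<forall>i<m. L i \<subseteq> cball 0 \<rho>"
  using assms
proof (induction m)
  case 0
  then show ?case by (auto intro: exI[of _ 0])
next
  case (Suc m)
  obtain \<rho> where \<rho>: "\<rho> < 1" "\<forall>i<m. L i \<subseteq> cball 0 \<rho>" using Suc.IH Suc.prems by (meson less_SucI)
  obtain \<sigma> where \<sigma>: "\<sigma> < 1" "L m \<subseteq> cball 0 \<sigma>" using Suc.prems[of m] by auto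
  have "\<forall>i<Suc m. L i \<subseteq> cball 0 (max \<rho> \<sigma>)"
    using \<rho>(2) \<sigma>(2) by (fastforce simp: less_Suc_eq subset_iff)
  then show ?case using \<rho>(1) \<sigma>(1) by (intro exI[of _ "max \<rho> \<sigma>"]) simp
qed

lemma gaf_coeffs_AE_regular:
  assumes "gaf_coeffs \<zeta> r \<in> M \<rightarrow>\<^sub>M seq_borel" "distr M seq_borel (gaf_coeffs \<zeta> r) = gauss_seq r" "r \<ge> 0"
  shows "AE \<omega> in M. gaf_coeffs \<zeta> r \<omega> \<in> regular_seqs"
proof -
  have "AE x in gauss_seq r. x \<in> regular_seqs"
    using gauss_seq_AE_wsummable_all[OF assms(3)] gauss_seq_AE_nonzero[OF assms(3)]
    by eventually_elim (auto simp: regular_seqs_def)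
  then have "AE x in distr M seq_borel (gaf_coeffs \<zeta> r). x \<in> regular_seqs"
    by (simp only: assms(2))
  then show ?thesis by (rule AE_distrD[OF assms(1)])
qed

lemma correlation_integral_gaf_disk:
  assumes X: "gaf_coeffs \<zeta> r \<in> M \<rightarrow>\<^sub>M seq_borel" "distr M seq_borel (gaf_coeffs \<zeta> r) = gauss_seq r" and r: "r \<ge> 0"
    and len: "length ks = length Ls" and n: "sum_list ks = n"
    and Ls: "\<And>i. i < length Ls \<Longrightarrow> rel_compact_borel unit_disk (Ls ! i)"
    and disj: "\<And>i j. i < length Ls \<Longrightarrow> j < length Ls \<Longrightarrow> i \<noteq> j \<Longrightarrow> Ls ! i \<inter> Ls ! j = {}"
  shows "(\<integral>\<^sup>+\<omega>. of_nat (\<Prod>i<length Ls. falling_factorial (point_count (zero_measure unit_disk (gaf_disk \<zeta> r \<omega>)) (Ls ! i)) (ks ! i)) \<partial>M) =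
    (\<integral>\<^sup>+z \<in> (PiE {..<n} (\<lambda>j. concat (map2 replicate ks Ls) ! j)). ennreal (disk_density r n z) \<partial>PiM {..<n} (\<lambda>_. disk_ref_measure))"
proof -
  let ?m = "length Ls" and ?L = "\<lambda>i. Ls ! i"
  \<comment> \<open>Index i is repeated \<open>ks ! i\<close> times, so that a falling factorial of
    order \<open>ks ! i\<close> for each set becomes a list of distinct zeros labelled by their
    sets.\<close>
  define js where "js = concat (map2 replicate ks [0..<length Ls])"
  have jn: "length js = n" unfolding js_def using n len by (subst length_concat_replicate) auto
  have jm: "js ! i < ?m" if "i < length js" for i
    using set_concat_replicate[of ks "[0..<length Ls]"] len nth_mem[OF that] unfolding js_def[symmetric] by auto
  have jL: "concat (map2 replicate ks Ls) = map ?L js"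
    unfolding js_def using len by (subst map_concat_replicate) (auto simp: map_nth)
  have jc: "count_list js i = ks ! i" if "i < ?m" for i
    using count_list_concat_replicate[of ks "[0..<length Ls]" i] len that by (simp add: js_def)
  note L = rel_compact_borel_unit_disk[OF Ls]
  obtain \<rho> where \<rho>: "\<rho> < 1" "\<And>i. i < ?m \<Longrightarrow> ?L i \<subseteq> cball 0 \<rho>"
    using common_radius[of ?m ?L] L(3) by blast
  have d: "disjoint_family_on ?L {..<?m}" using disj by (auto simp: disjoint_family_on_def)
  have "AE \<omega> in M. of_nat (\<Prod>i<?m. falling_factorial (point_count (zero_measure unit_disk (gaf_disk \<zeta> r \<omega>)) (Ls ! i)) (ks ! i)) =
      ennreal (real (fact_moment ?m ?L js (gaf_coeffs \<zeta> r \<omega>)))"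
    using gaf_coeffs_AE_regular[OF X r]
  proof eventually_elim
    case (elim \<omega>)
    have "(\<Prod>i<?m. falling_factorial (point_count (zero_measure unit_disk (gaf_disk \<zeta> r \<omega>)) (Ls ! i)) (ks ! i)) =
        fact_moment ?m ?L js (gaf_coeffs \<zeta> r \<omega>)"
      unfolding fact_moment_def by (intro prod.cong refl) (simp add: zero_measure_gaf_disk(2)[OF elim Ls] jc)
    then show ?case by (simp only: ennreal_of_nat_eq_real_of_nat)
  qed
  then have "(\<integral>\<^sup>+\<omega>. of_nat (\<Prod>i<?m. falling_factorial (point_count (zero_measure unit_disk (gaf_disk \<zeta> r \<omega>)) (Ls ! i)) (ks ! i)) \<partial>M) =
      (\<integral>\<^sup>+\<omega>. ennreal (real (fact_moment ?m ?L js (gaf_coeffs \<zeta> r \<omega>))) \<partial>M)"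
    by (rule nn_integral_cong_AE)
  also have "\<dots> = (\<integral>\<^sup>+x. ennreal (real (fact_moment ?m ?L js x)) \<partial>gauss_seq r)"
    unfolding X(2)[symmetric]
    by (rule nn_integral_distr[OF X(1), symmetric])
      (simp only: measurable_distr_eq1, rule measurable_fact_moment[OF L(2) \<rho>(2,1)])
  also have "\<dots> = (\<integral>\<^sup>+z. ennreal (disk_density r (length js) z) * indicator (PiE {..<length js} (\<lambda>i. ?L (js ! i))) z
      \<partial>PiM {..<length js} (\<lambda>_. disk_ref_measure))"
    by (rule factorial_moment_disk_density[OF r jm L(2) \<rho>(2,1) d])
  also have "PiE {..<length js} (\<lambda>i. ?L (js ! i)) = PiE {..<n} (\<lambda>j. concat (map2 replicate ks Ls) ! j)"
    unfolding jL jn by (intro PiE_cong) (simp add: jn)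
  finally show ?thesis unfolding jn .
qed

lemma point_process_gaf_disk:
  assumes X: "gaf_coeffs \<zeta> r \<in> M \<rightarrow>\<^sub>M seq_borel" "distr M seq_borel (gaf_coeffs \<zeta> r) = gauss_seq r" and r: "r \<ge> 0"
  shows "point_process M unit_disk (\<lambda>\<omega>. zero_measure unit_disk (gaf_disk \<zeta> r \<omega>))"
  unfolding point_process_def
proof (intro conjI allI impI)
  note reg = gaf_coeffs_AE_regular[OF X r]
  show "AE \<omega> in M. zero_measure unit_disk (gaf_disk \<zeta> r \<omega>) \<in> configurations unit_disk"
    using reg
  proof eventually_elim
    case (elim \<omega>)
    show ?case
      unfolding configurations_def using zero_measure_gaf_disk(1)[OF elim]
      by (auto simp: zero_measure_def)
  qed
  fix \<Lambda> assume \<Lambda>: "rel_compact_borel unit_disk \<Lambda>"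
  obtain \<rho> where \<rho>: "\<rho> < 1" "\<Lambda> \<subseteq> cball 0 \<rho>" using rel_compact_borel_unit_disk(3)[OF \<Lambda>] by blast
  show "(\<lambda>\<omega>. emeasure (zero_measure unit_disk (gaf_disk \<zeta> r \<omega>)) \<Lambda>) \<in> borel_measurable (completion M)"
  proof (rule borel_measurable_completion_AE)
    have "(\<lambda>\<omega>. zero_count \<Lambda> (gaf_coeffs \<zeta> r \<omega>)) \<in> M \<rightarrow>\<^sub>M count_space UNIV"
      by (rule measurable_compose[OF X(1) measurable_zero_count[OF rel_compact_borel_unit_disk(2)[OF \<Lambda>] \<rho>(2,1)]])
    then show "(\<lambda>\<omega>. of_nat (zero_count \<Lambda> (gaf_coeffs \<zeta> r \<omega>)) :: ennreal) \<in> borel_measurable M"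
      by (rule measurable_compose) simp
    show "AE \<omega> in M. emeasure (zero_measure unit_disk (gaf_disk \<zeta> r \<omega>)) \<Lambda> = of_nat (zero_count \<Lambda> (gaf_coeffs \<zeta> r \<omega>))"
      using reg by eventually_elim (rule zero_measure_gaf_disk(1)[OF _ \<Lambda>])
  qed
qed

theorem corollary1p4:
  fixes M :: "'a measure" and \<zeta> :: "nat \<Rightarrow> 'a \<Rightarrow> complex" and r :: real
  assumes "prob_space M"
    and "prob_space.indep_vars M (\<lambda>_. borel) \<zeta> UNIV"
    and "\<And>n. std_complex_gaussian M (\<zeta> n)"
    and "r > 0"
  shows "\<exists>\<rho>.
    permanental_determinantal_process M unit_disk disk_ref_measure
      (\<lambda>\<omega>. zero_measure unit_disk (gaf_disk \<zeta> r \<omega>)) \<rho>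
      (\<lambda>n z. (1 + r) / (1 + r * (\<Prod>k<n. cmod (z k) ^ 4)))
      (\<lambda>n z. szego_disk (r * (\<Prod>l<n. (cmod (z l))\<^sup>2))) \<and>
    (\<forall>z\<in>unit_disk.
       \<rho> 1 (\<lambda>_. z) =
         (1 + r) * (1 + r * cmod z ^ 4) / ((1 + r * (cmod z)\<^sup>2)\<^sup>2 * (1 - (cmod z)\<^sup>2)\<^sup>2))"
proof -
  have r: "r \<ge> 0" using assms(4) by simp
  note X = distr_gaf_coeffs[OF assms(1-3) r]
  have "has_correlation_function M unit_disk disk_ref_measure
      (\<lambda>\<omega>. zero_measure unit_disk (gaf_disk \<zeta> r \<omega>)) n (disk_density r n)" for n
    unfolding has_correlation_function_def
  proof (intro conjI allI impI ballI)
    show "disk_density r n \<in> borel_measurable (PiM {..<n} (\<lambda>_. disk_ref_measure))"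
    proof (rule measurable_disk_density)
      fix i assume "i < n"
      then have "(\<lambda>z. z i) \<in> PiM {..<n} (\<lambda>_. disk_ref_measure) \<rightarrow>\<^sub>M disk_ref_measure"
        by (intro measurable_component_singleton) simp
      then show "(\<lambda>z. z i) \<in> borel_measurable (PiM {..<n} (\<lambda>_. disk_ref_measure))"
        by (rule measurable_compose[OF _ measurable_disk_ref_borel])
    qed
    show "0 \<le> disk_density r n z" if "z \<in> space (PiM {..<n} (\<lambda>_. disk_ref_measure))" for z
      using that r by (intro disk_density_nonneg) (auto simp: space_PiM space_disk_ref_measure unit_disk_def)
  next
    fix Ls :: "complex set list" and ks
    assume "length ks = length Ls" "sum_list ks = n" "\<forall>i<length Ls. rel_compact_borel unit_disk (Ls ! i)"
      "\<forall>i<length Ls. \<forall>j<length Ls. i \<noteq> j \<longrightarrow> Ls ! i \<inter> Ls ! j = {}"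
    then show "(\<integral>\<^sup>+\<omega>. of_nat (\<Prod>i<length Ls. falling_factorial (point_count (zero_measure unit_disk (gaf_disk \<zeta> r \<omega>)) (Ls ! i)) (ks ! i)) \<partial>M) =
      (\<integral>\<^sup>+z \<in> (PiE {..<n} (\<lambda>j. concat (map2 replicate ks Ls) ! j)). ennreal (disk_density r n z) \<partial>PiM {..<n} (\<lambda>_. disk_ref_measure))"
      by (intro correlation_integral_gaf_disk[OF X r]) auto
  qed
  then have "permanental_determinantal_process M unit_disk disk_ref_measure
      (\<lambda>\<omega>. zero_measure unit_disk (gaf_disk \<zeta> r \<omega>)) (disk_density r)
      (\<lambda>n z. (1 + r) / (1 + r * (\<Prod>k<n. cmod (z k) ^ 4)))
      (\<lambda>n z. szego_disk (r * (\<Prod>l<n. (cmod (z l))\<^sup>2)))"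
    unfolding permanental_determinantal_process_def
    using point_process_gaf_disk[OF X r] disk_density_perdet[OF r] by (auto simp: unit_disk_def)
  then show ?thesis
    using disk_density_1[OF r] by (intro exI[of _ "disk_density r"]) (auto simp: unit_disk_def)
qed

end
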